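(* Given $p\in\{1,\ldots,n-1\}$ and $\mathbf d=(d_1,\ldots,d_p)$, a $p$-tuple of integers with $d_1\ge\cdots\ge d_p\ge1$, there exists a Zariski open dense subset $\mathfrak U(\mathbf d,n)$ of $\mathbf H(\mathbf d,n)=H(d_1,n)\times\cdots\times H(d_p,n)$ such that for each $\mathbf f=(f_1,\ldots,f_p)\in\mathfrak m(\mathbf d,n)$, with each $f_i$ of multiplicity exactly $d_i$, such that $\mathrm{in}_0(\mathbf f)\in\mathfrak U(\mathbf d,n)$, the following properties are satisfied: (i) $(Z(\mathbf f),0)$ is an ICIS germ; (ii) the origin is a conic singular point of $Z(\mathbf f)$. Therefore there exists a positive radius $r_{\mathbf f}$ such that for every positive $r\le r_{\mathbf f}$, the subset $Z(\mathbf f)_{\le r}=Z(\mathbf f)\cap\{|x|\le r\}$ is Lipschitz normally embedded (LNE) in $\mathbb C^n$.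
   Context: Smooth means $C^\infty$. $H(d,n)$ is the $\mathbb C$-vector space of homogeneous polynomials of degree $d$ in $\mathbb C[x_1,\ldots,x_n]$. $\mathcal O_n$ is the local $\mathbb C$-algebra of complex analytic function germs $(\mathbb C^n,0)\to\mathbb C$, with maximal ideal $\mathfrak m_n$, and $\mathfrak m(\mathbf d,n)=\mathfrak m_n^{d_1}\times\cdots\times\mathfrak m_n^{d_p}$. The multiplicity of $f=\sum_{k\ge0}f_k\neq 0$ ($f_k\in H(k,n)$) is the integer $d$ with $f\in\mathfrak m_n^d\setminus\mathfrak m_n^{d+1}$, and then $\mathrm{in}_0(f)=f_d$; put $\mathrm{in}_0(\mathbf f)=(\mathrm{in}_0(f_1),\ldots,\mathrm{in}_0(f_p))$. $(Z(\mathbf f),0)$ is the germ at $0$ of the common zero locus of the $f_i$ (a representative near $0$ is used in the last sentence of the claim). **ICIS.** A germ $(X,0)\subset(\mathbb C^n,0)$ is an ICIS germ (isolated complete intersection singularity) of codimension $p$ if there are $f_1,\ldots,f_p\in\mathfrak m_n$ generating the ideal $I(X)\subset \mathcal O_n$ of germs vanishing on $X$ and such that $D_xf_1\wedge\cdots\wedge D_xf_p\ne0$ for every $x\in X\setminus 0$ close to $0$. **Conic singular points.** Identify $\mathbb C^n$ with $\mathbb R^m$, $m=2n$. A subset $N$ of a smooth manifold with boundary $(P,\partial P)$ is a p-sub-manifold of $P$ if it is a smooth embedded sub-manifold with (possibly empty) boundary $\partial N$, with $\partial N=N\cap\partial P$, and $T_xN+T_x\partial P=T_xP$ for every $x\in\partial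 N$. Let $\mathrm{bl}_0:[0,\infty)\times\mathbb S^{m-1}\to\mathbb R^m$, $(r,u)\mapsto ru$. For $X\subset\mathbb R^m$ with non-empty closed germ at $0$, the origin is a conic point of $X$ if there is $r>0$ such that the closure in $[0,r)\times\mathbb S^{m-1}$ of $\mathrm{bl}_0^{-1}(X\cap\{0<|x|<r\})$ is a p-sub-manifold of $[0,r)\times\mathbb S^{m-1}$. A point of $X$ is singular if the germ of $X$ there is not that of a smooth sub-manifold. A conic singular point is a conic point that is a singular point. **LNE.** For $S\subset\mathbb R^m$, $d^S_{\rm in}(x,x')$ is the infimum of the lengths of rectifiable paths lying in $S$ joining $x$ and $x'$; $S$ is LNE if there is $L>0$ with $d^S_{\rm in}(x,x')\le L|x-x'|$ for all $x,x'\in S$.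
   Formalization: In (ii), the origin is claimed to be singular only if some d_i ≥ 2; if all d_i = 1, it is claimed only to be a conic point, since for independent linear parts (e.g. f_i = x_i) Z(f) is smooth at the origin and (ii) fails. (i) and the LNE claim are stated for all d. *)

theory Defs
  imports "HOL-Analysis.Analysis" "HOL-Library.Poly_Mapping" "HOL-Library.Extended_Nonnegative_Real"
begin

section \<open>Polynomials\<close>

type_synonym ('v, 'c) mpoly = "('v \<Rightarrow>\<^sub>0 nat) \<Rightarrow>\<^sub>0 'c"

definition monom_eval :: "('v \<Rightarrow> 'c::comm_semiring_1) \<Rightarrow> ('v \<Rightarrow>\<^sub>0 nat) \<Rightarrow> 'c" where
  "monom_eval s \<alpha> = (\<Prod>v\<in>Poly_Mapping.keys \<alpha>. s v ^ Poly_Mapping.lookup \<alpha> v)"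

definition mpoly_eval :: "('v \<Rightarrow> 'c::comm_semiring_1) \<Rightarrow> ('v, 'c) mpoly \<Rightarrow> 'c" where
  "mpoly_eval s P = (\<Sum>\<alpha>\<in>Poly_Mapping.keys P. Poly_Mapping.lookup P \<alpha> * monom_eval s \<alpha>)"

definition monom_degree :: "('n::finite \<Rightarrow>\<^sub>0 nat) \<Rightarrow> nat" where
  "monom_degree \<alpha> = (\<Sum>i\<in>UNIV. Poly_Mapping.lookup \<alpha> i)"

definition hom_polys :: "nat \<Rightarrow> ('n::finite, complex) mpoly set" where
  "hom_polys d = {F. \<forall>\<alpha>\<in>Poly_Mapping.keys F. monom_degree \<alpha> = d}"

text \<open>Tuples are lists; indices run from 0 to \<open>length d - 1\<close>.\<close>

definition hom_tuples :: "nat list \<Rightarrow> ('n::finite, complex) mpoly list set" where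
  "hom_tuples d = {F. length F = length d \<and> (\<forall>i<length d. F ! i \<in> hom_polys (d ! i))}"

lemma monom_eval_superset:
  assumes "finite A" "Poly_Mapping.keys \<alpha> \<subseteq> A"
  shows "monom_eval s \<alpha> = (\<Prod>v\<in>A. s v ^ Poly_Mapping.lookup \<alpha> v)"
  unfolding monom_eval_def
  by (rule prod.mono_neutral_left) (use assms in \<open>auto simp: in_keys_iff\<close>)

lemma monom_eval_add: "monom_eval s (\<alpha> + \<beta>) = monom_eval s \<alpha> * monom_eval s \<beta>"
proof -
  let ?A = "Poly_Mapping.keys \<alpha> \<union> Poly_Mapping.keys \<beta>"
  have "monom_eval s (\<alpha> + \<beta>) = (\<Prod>v\<in>?A. s v ^ Poly_Mapping.lookup (\<alpha> + \<beta>) v)"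
    by (rule monom_eval_superset) (auto dest: subsetD[OF Poly_Mapping.keys_add])
  also have "\<dots> = (\<Prod>v\<in>?A. s v ^ Poly_Mapping.lookup \<alpha> v) * (\<Prod>v\<in>?A. s v ^ Poly_Mapping.lookup \<beta> v)"
    by (simp add: lookup_add power_add prod.distrib)
  finally show ?thesis
    by (simp add: monom_eval_superset[of ?A])
qed

lemma mpoly_eval_superset:
  assumes "finite A" "Poly_Mapping.keys P \<subseteq> A"
  shows "mpoly_eval s P = (\<Sum>\<alpha>\<in>A. Poly_Mapping.lookup P \<alpha> * monom_eval s \<alpha>)"
  unfolding mpoly_eval_def
  by (rule sum.mono_neutral_left) (use assms in \<open>auto simp: in_keys_iff\<close>)

lemma mpoly_eval_zero [simp]: "mpoly_eval s 0 = 0"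
  by (simp add: mpoly_eval_def)

lemma mpoly_eval_single [simp]: "mpoly_eval s (Poly_Mapping.single \<alpha> c) = c * monom_eval s \<alpha>"
  by (simp add: mpoly_eval_def)

lemma mpoly_eval_one [simp]: "mpoly_eval s 1 = 1"
  by (simp flip: single_one add: monom_eval_def)

lemma mpoly_eval_add: "mpoly_eval s (P + Q) = mpoly_eval s P + mpoly_eval s Q"
proof -
  let ?A = "Poly_Mapping.keys P \<union> Poly_Mapping.keys Q"
  have "mpoly_eval s (P + Q) = (\<Sum>\<alpha>\<in>?A. Poly_Mapping.lookup (P + Q) \<alpha> * monom_eval s \<alpha>)"
    by (rule mpoly_eval_superset) (auto dest: subsetD[OF Poly_Mapping.keys_add])
  then show ?thesis
    by (simp add: mpoly_eval_superset[of ?A] lookup_add algebra_simps sum.distrib)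
qed

lemma update_eq_add_single: "a \<notin> Poly_Mapping.keys P \<Longrightarrow> Poly_Mapping.update a c P = P + Poly_Mapping.single a c"
  by (rule poly_mapping_eqI)
     (auto simp: lookup_update lookup_add lookup_single in_keys_iff when_def)

lemma mpoly_eval_mult: "mpoly_eval s (P * Q) = mpoly_eval s P * mpoly_eval s Q"
proof -
  have single: "mpoly_eval s (P * Poly_Mapping.single a c) = mpoly_eval s P * (c * monom_eval s a)"
    for P a c
  proof (induction P rule: update_induct)
    case const
    then show ?case by simp
  next
    case (update P b e)
    then show ?case
      by (simp add: update_eq_add_single distrib_right mpoly_eval_add mult_single monom_eval_add)
         (simp add: mult_ac)
  qed
  show ?thesis
  proof (induction Q rule: update_induct)
    case const
    then show ?case by simp
  next
    case (update Q b e)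
    then show ?case
      by (simp only: update_eq_add_single distrib_left mpoly_eval_add single mpoly_eval_single
          not_False_eq_True)
  qed
qed

section \<open>The Zariski topology on the space of tuples of homogeneous polynomials\<close>

text \<open>The variable \<open>(i, \<alpha>)\<close> of the coordinate ring is the coefficient of the monomial \<open>\<alpha>\<close> in the
  \<open>i\<close>-th component.\<close>

definition coeff_coords :: "('n, complex) mpoly list \<Rightarrow> nat \<times> ('n \<Rightarrow>\<^sub>0 nat) \<Rightarrow> complex" where
  "coeff_coords F = (\<lambda>(i, \<alpha>). if i < length F then Poly_Mapping.lookup (F ! i) \<alpha> else 0)"

definition zariski_topology :: "nat list \<Rightarrow> ('n::finite, complex) mpoly list topology" where
  "zariski_topology d = topology (\<lambda>U. \<exists>\<P> :: (nat \<times> ('n \<Rightarrow>\<^sub>0 nat), complex) mpoly set.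
     U \<subseteq> hom_tuples d \<and>
     hom_tuples d - U = {F \<in> hom_tuples d. \<forall>P\<in>\<P>. mpoly_eval (coeff_coords F) P = 0})"

lemma openin_zariski_topology:
  "openin (zariski_topology d) U \<longleftrightarrow> (\<exists>\<P> :: (nat \<times> ('n::finite \<Rightarrow>\<^sub>0 nat), complex) mpoly set.
     U \<subseteq> hom_tuples d \<and>
     hom_tuples d - U = {F \<in> hom_tuples d. \<forall>P\<in>\<P>. mpoly_eval (coeff_coords F) P = 0})" (is "_ \<longleftrightarrow> ?op U")
proof -
  define N :: "(nat \<times> ('n \<Rightarrow>\<^sub>0 nat), complex) mpoly set \<Rightarrow> ('n, complex) mpoly list set" where
    "N \<P> = {F \<in> hom_tuples d. \<exists>P\<in>\<P>. mpoly_eval (coeff_coords F) P \<noteq> 0}" for \<P>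
  have char: "?op = (\<lambda>U. \<exists>\<P>. U = N \<P>)"
    unfolding N_def by (intro ext ex_cong1) auto
  have "istopology (\<lambda>U. \<exists>\<P>. U = N \<P>)"
    unfolding istopology_def
  proof (intro conjI allI impI)
    fix S T assume "\<exists>\<P>. S = N \<P>" and "\<exists>\<P>. T = N \<P>"
    then obtain \<P> \<Q> where ST: "S = N \<P>" "T = N \<Q>" by auto
    have "F \<in> N \<P> \<inter> N \<Q> \<longleftrightarrow> F \<in> N ((\<lambda>(P, Q). P * Q) ` (\<P> \<times> \<Q>))" for F
      by (simp add: N_def mpoly_eval_mult) blast
    then show "\<exists>\<R>. S \<inter> T = N \<R>"
      unfolding ST by blast
  next
    fix \<K> assume "\<forall>K\<in>\<K>. \<exists>\<P>. K = N \<P>"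
    then obtain \<P> where \<P>: "\<And>K. K \<in> \<K> \<Longrightarrow> K = N (\<P> K)"
      by metis
    have "\<Union>\<K> = \<Union>((\<lambda>K. N (\<P> K)) ` \<K>)"
      using \<P> by auto
    also have "\<dots> = N (\<Union>(\<P> ` \<K>))"
      by (auto simp: N_def)
    finally show "\<exists>\<P>. \<Union>\<K> = N \<P>" by blast
  qed
  then have "istopology ?op"
    by (simp only: char)
  then have "openin (zariski_topology d) = ?op"
    unfolding zariski_topology_def by (rule topology_inverse')
  then show ?thesis
    by (rule fun_cong)
qed

lemma topspace_zariski_topology: "topspace (zariski_topology d) = hom_tuples d"
proof -
  have "openin (zariski_topology d) (hom_tuples d)"
    unfolding openin_zariski_topology by (rule exI[of _ "{1}"]) auto
  moreover have "topspace (zariski_topology d) \<subseteq> hom_tuples d"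
    using openin_topspace[of "zariski_topology d"] unfolding openin_zariski_topology by blast
  ultimately show ?thesis
    using openin_subset by (intro subset_antisym)
qed

section \<open>Germs of analytic functions\<close>

text \<open>A germ at the origin is given by any of its representatives, a function on the whole space
  whose values away from the origin play no role.\<close>

definition power_series_at_0 :: "(('n::finite \<Rightarrow>\<^sub>0 nat) \<Rightarrow> complex) \<Rightarrow> (complex^'n \<Rightarrow> complex) \<Rightarrow> bool" where
  "power_series_at_0 a f \<longleftrightarrow>
     (\<forall>\<^sub>F x in nhds 0. ((\<lambda>\<alpha>. a \<alpha> * monom_eval (($) x) \<alpha>) has_sum f x) UNIV)"

definition analytic_germs :: "(complex^'n::finite \<Rightarrow> complex) set" where
  "analytic_germs = {f. \<exists>a. power_series_at_0 a f}"

definition germ_ideal :: "(complex^'n::finite \<Rightarrow> complex) set \<Rightarrow> (complex^'n \<Rightarrow> complex) set" where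
  "germ_ideal S = {g \<in> analytic_germs. \<exists>T h. finite T \<and> T \<subseteq> S \<and> (\<forall>t\<in>T. h t \<in> analytic_germs) \<and>
     (\<forall>\<^sub>F x in nhds 0. g x = (\<Sum>t\<in>T. h t x * t x))}"

definition max_ideal :: "(complex^'n::finite \<Rightarrow> complex) set" where
  "max_ideal = {f \<in> analytic_germs. f 0 = 0}"

primrec max_ideal_power :: "nat \<Rightarrow> (complex^'n::finite \<Rightarrow> complex) set" where
  "max_ideal_power 0 = analytic_germs"
| "max_ideal_power (Suc k) =
     germ_ideal {\<lambda>x. g x * h x |g h. g \<in> max_ideal \<and> h \<in> max_ideal_power k}"

definition max_ideal_tuples :: "nat list \<Rightarrow> (complex^'n::finite \<Rightarrow> complex) list set" where
  "max_ideal_tuples d =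
     {f. length f = length d \<and> (\<forall>i<length d. f ! i \<in> max_ideal_power (d ! i))}"

definition has_multiplicity :: "(complex^'n::finite \<Rightarrow> complex) \<Rightarrow> nat \<Rightarrow> bool" where
  "has_multiplicity f d \<longleftrightarrow> f \<in> max_ideal_power d - max_ideal_power (Suc d)"

definition taylor_coeff :: "(complex^'n::finite \<Rightarrow> complex) \<Rightarrow> ('n \<Rightarrow>\<^sub>0 nat) \<Rightarrow> complex" where
  "taylor_coeff f = (THE a. power_series_at_0 a f)"

lemma finite_monoms_of_degree: "finite {\<alpha> :: 'n::finite \<Rightarrow>\<^sub>0 nat. monom_degree \<alpha> = k}"
proof (rule finite_imageD)
  have "Poly_Mapping.lookup ` {\<alpha> :: 'n \<Rightarrow>\<^sub>0 nat. monom_degree \<alpha> = k} \<subseteq> (UNIV :: 'n set) \<rightarrow>\<^sub>E {..k}"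
  proof (rule image_subsetI)
    fix \<alpha> :: "'n \<Rightarrow>\<^sub>0 nat"
    assume "\<alpha> \<in> {\<alpha>. monom_degree \<alpha> = k}"
    moreover have "Poly_Mapping.lookup \<alpha> i \<le> monom_degree \<alpha>" for i
      unfolding monom_degree_def by (rule member_le_sum) simp_all
    ultimately show "Poly_Mapping.lookup \<alpha> \<in> (UNIV :: 'n set) \<rightarrow>\<^sub>E {..k}"
      by auto
  qed
  then show "finite (Poly_Mapping.lookup ` {\<alpha> :: 'n \<Rightarrow>\<^sub>0 nat. monom_degree \<alpha> = k})"
    by (rule finite_subset) (simp add: finite_PiE)
qed (simp add: inj_on_def poly_mapping.lookup_inject)

definition hom_component :: "nat \<Rightarrow> (complex^'n::finite \<Rightarrow> complex) \<Rightarrow> ('n, complex) mpoly" where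
  "hom_component k f = (\<Sum>\<alpha> | monom_degree \<alpha> = k. Poly_Mapping.single \<alpha> (taylor_coeff f \<alpha>))"

definition initial_form :: "(complex^'n::finite \<Rightarrow> complex) \<Rightarrow> ('n, complex) mpoly" where
  "initial_form f = hom_component (THE d. has_multiplicity f d) f"

definition zero_locus :: "(complex^'n::finite \<Rightarrow> complex) list \<Rightarrow> (complex^'n) set" where
  "zero_locus f = {x. \<forall>g\<in>set f. g x = 0}"

section \<open>Isolated complete intersection singularities\<close>

definition vanishing_ideal :: "(complex^'n::finite) set \<Rightarrow> (complex^'n \<Rightarrow> complex) set" where
  "vanishing_ideal X = {g \<in> analytic_germs. \<forall>\<^sub>F x in nhds 0. x \<in> X \<longrightarrow> g x = 0}"

text \<open>The exterior product of linear forms, as an alternating form in the vectors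
  \<open>v 0, \<dots>, v (length \<phi> - 1)\<close>.\<close>

definition wedge :: "('a \<Rightarrow> complex) list \<Rightarrow> (nat \<Rightarrow> 'a) \<Rightarrow> complex" where
  "wedge \<phi> v = (\<Sum>\<sigma> | \<sigma> permutes {..<length \<phi>}.
     of_int (sign \<sigma>) * (\<Prod>i<length \<phi>. (\<phi> ! i) (v (\<sigma> i))))"

text \<open>The real Frechet derivative of an analytic function is complex linear, hence is its complex
  derivative.\<close>

definition icis_germ :: "nat \<Rightarrow> (complex^'n::finite) set \<Rightarrow> bool" where
  "icis_germ p X \<longleftrightarrow> (\<exists>f. length f = p \<and> set f \<subseteq> max_ideal \<and>
     vanishing_ideal X = germ_ideal (set f) \<and>
     (\<forall>\<^sub>F x in at 0 within X. wedge (map (\<lambda>g. frechet_derivative g (at x)) f) \<noteq> (\<lambda>v. 0)))"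

section \<open>Smooth submanifolds with boundary of Euclidean spaces\<close>

primrec Ck_on :: "nat \<Rightarrow> 'a::euclidean_space set \<Rightarrow> ('a \<Rightarrow> 'b::euclidean_space) \<Rightarrow> bool" where
  "Ck_on 0 U f \<longleftrightarrow> continuous_on U f"
| "Ck_on (Suc k) U f \<longleftrightarrow>
     f differentiable_on U \<and> (\<forall>v. Ck_on k U (\<lambda>x. frechet_derivative f (at x) v))"

definition diffeomorphism ::
  "'a::euclidean_space set \<Rightarrow> 'b::euclidean_space set \<Rightarrow> ('a \<Rightarrow> 'b) \<Rightarrow> ('b \<Rightarrow> 'a) \<Rightarrow> bool" where
  "diffeomorphism V W \<Phi> \<Psi> \<longleftrightarrow> open V \<and> open W \<and> homeomorphism V W \<Phi> \<Psi> \<and>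
     (\<forall>k. Ck_on k V \<Phi>) \<and> (\<forall>k. Ck_on k W \<Psi>)"

text \<open>\<open>\<Phi>\<close> straightens \<open>N\<close> near \<open>x\<close> to the linear subspace \<open>L\<close> if \<open>e = 0\<close>, and to a closed
  half-space of \<open>L\<close> if \<open>e \<noteq> 0\<close>.\<close>

definition slice_chart :: "'a::euclidean_space set \<Rightarrow> 'a \<Rightarrow> ('a \<Rightarrow> 'a) \<Rightarrow> 'a set \<Rightarrow> 'a \<Rightarrow> bool" where
  "slice_chart N x \<Phi> L e \<longleftrightarrow> subspace L \<and> e \<in> L \<and> x \<in> N \<and>
     (\<exists>V W \<Psi>. x \<in> V \<and> diffeomorphism V W \<Phi> \<Psi> \<and> \<Phi> ` (N \<inter> V) = {y \<in> L. 0 \<le> e \<bullet> y} \<inter> W)"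

definition submanifold_with_boundary :: "'a::euclidean_space set \<Rightarrow> bool" where
  "submanifold_with_boundary N \<longleftrightarrow> (\<exists>k. \<forall>x\<in>N. \<exists>\<Phi> L e. slice_chart N x \<Phi> L e \<and> dim L = k)"

definition manifold_boundary :: "'a::euclidean_space set \<Rightarrow> 'a set" where
  "manifold_boundary N = {x. \<exists>\<Phi> L e. slice_chart N x \<Phi> L e \<and> e \<noteq> 0 \<and> e \<bullet> \<Phi> x = 0}"

definition tangent_space :: "'a::euclidean_space set \<Rightarrow> 'a \<Rightarrow> 'a set" where
  "tangent_space N x = {v. \<exists>\<Phi> L e. slice_chart N x \<Phi> L e \<and> frechet_derivative \<Phi> (at x) v \<in> L}"

text \<open>Here \<open>P\<close> is itself a submanifold with boundary of the ambient Euclidean space, so that the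
  submanifolds of \<open>P\<close> are the submanifolds of the ambient space contained in \<open>P\<close>.\<close>

definition p_submanifold :: "'a::euclidean_space set \<Rightarrow> 'a set \<Rightarrow> bool" where
  "p_submanifold P N \<longleftrightarrow> N \<subseteq> P \<and> submanifold_with_boundary N \<and>
     manifold_boundary N = N \<inter> manifold_boundary P \<and>
     (\<forall>x\<in>manifold_boundary N.
        {v + w |v w. v \<in> tangent_space N x \<and> w \<in> tangent_space (manifold_boundary P) x}
          = tangent_space P x)"

section \<open>Conic singular points\<close>

definition bl0 :: "real \<times> 'a::euclidean_space \<Rightarrow> 'a" where
  "bl0 = (\<lambda>(r, u). r *\<^sub>R u)"

definition conic_point :: "'a::euclidean_space set \<Rightarrow> bool" where
  "conic_point X \<longleftrightarrow>
     0 \<in> closure X \<and> (\<exists>\<rho>>0. closedin (top_of_set (ball 0 \<rho>)) (X \<inter> ball 0 \<rho>)) \<and>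
     (\<exists>r>0. p_submanifold ({0..<r} \<times> sphere 0 1)
        (top_of_set ({0..<r} \<times> sphere 0 1) closure_of
          (bl0 -` (X \<inter> {x. 0 < norm x \<and> norm x < r}) \<inter> {0..} \<times> sphere 0 1)))"

definition singular_point :: "'a::euclidean_space set \<Rightarrow> 'a \<Rightarrow> bool" where
  "singular_point X x \<longleftrightarrow> x \<in> X \<and>
     \<not> (\<exists>V. open V \<and> x \<in> V \<and> submanifold_with_boundary (X \<inter> V) \<and> manifold_boundary (X \<inter> V) = {})"

definition conic_singular_point :: "'a::euclidean_space set \<Rightarrow> bool" where
  "conic_singular_point X \<longleftrightarrow> conic_point X \<and> singular_point X 0"

section \<open>Lipschitz normal embedding\<close>

definition path_length :: "(real \<Rightarrow> 'a::metric_space) \<Rightarrow> ennreal" where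
  "path_length \<gamma> = (SUP (k, t) \<in> {(k :: nat, t :: nat \<Rightarrow> real). mono t \<and> range t \<subseteq> {0..1}}.
     \<Sum>i<k. ennreal (dist (\<gamma> (t i)) (\<gamma> (t (Suc i)))))"

text \<open>The value is infinite if no rectifiable path in \<open>S\<close> joins the two points.\<close>

definition inner_dist :: "'a::metric_space set \<Rightarrow> 'a \<Rightarrow> 'a \<Rightarrow> ennreal" where
  "inner_dist S x y = (INF \<gamma> \<in> {\<gamma>. path \<gamma> \<and> path_image \<gamma> \<subseteq> S \<and> pathstart \<gamma> = x \<and> pathfinish \<gamma> = y \<and>
     path_length \<gamma> < \<infinity>}. path_length \<gamma>)"

definition LNE :: "'a::metric_space set \<Rightarrow> bool" where
  "LNE S \<longleftrightarrow> (\<exists>L>0. \<forall>x\<in>S. \<forall>y\<in>S. inner_dist S x y \<le> ennreal (L * dist x y))"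

end

theory Submission
  imports Defs "HOL-Computational_Algebra.Polynomial"
begin

text \<open>
  Write \<open>F\<^sub>i\<close> for the initial form of \<open>f\<^sub>i\<close>, and split the variables into \<open>x\<close>, those in the image \<open>X\<close> of
  \<open>{..<p}\<close> under \<open>\<iota>\<close>, and the remaining ones \<open>y\<close>, among them the one called \<open>j0\<close>. Three conditions on
  the coefficients of the forms are generic, each being implied by the nonvanishing of a nonzero
  polynomial. First, the forms \<open>F\<^sub>i (x, 0)\<close> behave like the powers \<open>x\<^sub>i ^ d\<^sub>i\<close>: modulo them, every
  monomial in \<open>x\<close> is a combination of the monomials with exponents below \<open>d\<^sub>i\<close>
  (\<open>generic_reduction\<close>). Secondly, the fibre of \<open>{F = 0}\<close> over the point of the \<open>y\<close>-space with \<open>j0\<close>-th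
  coordinate one and all others zero is simple, and thirdly, the differentials of the \<open>F\<^sub>i\<close> are
  independent at all points of \<open>{F = 0}\<close> except the origin. The last two conditions are obtained by
  counting parameters (\<open>generic_independent_at\<close>, \<open>generic_independent\<close>): the coefficients that
  violate them are in the image of a polynomial map from a space of smaller dimension, which lies in
  a hypersurface by \<open>algebraic_dependence\<close>.

  The geometry takes place on the blow-up of the origin. The functions \<open>f\<^sub>i (t u) / t ^ d\<^sub>i\<close> are smooth
  in \<open>(t, u)\<close> near \<open>t = 0\<close>, where they are equal to \<open>F\<^sub>i u\<close> (\<open>Ck_on_blowup\<close>). By the third condition
  and Euler's identity they define, together with the equation of the unit sphere, a submersion
  along the slices \<open>t = const\<close>, at all of their zeros with \<open>t = 0\<close>. The inverse function theorem
  straightens the zero set by charts that preserve \<open>t\<close> (\<open>submersion_straight\<close>), so for small \<open>t \<ge> 0\<close>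
  it is a p-submanifold: the origin is a conic point, and the differentials of the \<open>f\<^sub>i\<close> are
  independent near it. If the germ were smooth, then its tangent cone, which is \<open>{F = 0}\<close>, would be
  linear; but the difference of two points of the fibre is a point with \<open>y = 0\<close>, where the \<open>F\<^sub>i\<close> have
  no common zero except the origin. In the charts, points of the link that are close to each other
  are joined by short paths, other points are joined through the origin; this gives the Lipschitz
  estimate (\<open>LNE_X\<close>).

  It remains to see that the \<open>f\<^sub>i\<close> generate the ideal of their zero set. Following the fibre along an
  arc of coefficients from the forms \<open>x\<^sub>i ^ d\<^sub>i - y\<^sub>0 ^ d\<^sub>i\<close>, with \<open>y\<^sub>0\<close> the variable \<open>j0\<close>, shows that it has \<open>\<Prod> d\<^sub>i\<close> points
  (\<open>many_points_in_fibre\<close>), as many as there are monomials in \<open>x\<close> with exponents below \<open>d\<^sub>i\<close>. The first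
  condition gives a division with remainder of convergent power series by the \<open>f\<^sub>i\<close>, where the
  remainder is a combination of these monomials with coefficients depending on \<open>y\<close> (\<open>division\<close>). If
  the dividend vanishes on the zero set, then so does the remainder; its values at the points over \<open>y\<close>
  that come from the points of the fibre determine its coefficients at \<open>y\<close>, as the matrix of the
  values of the monomials is invertible (\<open>interpolation_matrix\<close>), so the remainder is zero
  (\<open>remainder_zero\<close>).
\<close>

type_synonym 'v mon = "'v \<Rightarrow>\<^sub>0 nat"

abbreviation lkp where "lkp == Poly_Mapping.lookup"
abbreviation sgl where "sgl == Poly_Mapping.single"
abbreviation mdeg where "mdeg == monom_degree"
abbreviation FD :: "('a::real_normed_vector => 'b::real_normed_vector) => 'a filter => 'a => 'b"
 where "FD == frechet_derivative"

section \<open>Polynomial functions\<close>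

text \<open>A function of infinitely many variables that is a polynomial in the variables of \<open>J\<close>, of
 degree at most \<open>B\<close> in each of them.\<close>

definition polydeg :: "'v set => nat => (('v => complex) => complex) => bool" where
 "polydeg J B \<phi> \<longleftrightarrow> (\<exists>P :: ('v, complex) mpoly.
   (\<forall>al\<in>Poly_Mapping.keys P. Poly_Mapping.keys al \<subseteq> J & (\<forall>a. lkp al a \<le> B)) &
   (\<forall>v. \<phi> v = mpoly_eval v P))"

definition polyon :: "'v set => (('v => complex) => complex) => bool" where
 "polyon J \<phi> \<longleftrightarrow> (\<exists>B. polydeg J B \<phi>)"

lemma polydegI:
 assumes "!!al a. al \<in> Poly_Mapping.keys P ==> a \<in> Poly_Mapping.keys al ==> a \<in> J"
  and "!!al a. al \<in> Poly_Mapping.keys P ==> lkp al a \<le> B"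
  and "!!v. \<phi> v = mpoly_eval v P"
 shows "polydeg J B \<phi>"
 unfolding polydeg_def using assms by blast

lemma polydeg_weaken: "polydeg J B \<phi> ==> B \<le> B' ==> J \<subseteq> J' ==> polydeg J' B' \<phi>"
 unfolding polydeg_def by (meson order_trans)

lemma polydeg_const: "polydeg J B (%v. k)"
 by (rule polydegI[where P = "sgl 0 k"]) (auto split: if_splits simp: monom_eval_def)

lemma polydeg_var:
 assumes "a \<in> J" shows "polydeg J 1 (%v. v a)"
 by (rule polydegI[where P = "sgl (sgl a 1) 1"])
   (use assms in \<open>auto simp: monom_eval_def lookup_single when_def\<close>)

lemma polydeg_add:
 assumes "polydeg J B \<phi>" "polydeg J B \<psi>"
 shows "polydeg J B (%v. \<phi> v + \<psi> v)"
proof -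
 from assms obtain P Q where
  P: "!!al. al \<in> Poly_Mapping.keys P ==> Poly_Mapping.keys al \<subseteq> J & (\<forall>a. lkp al a \<le> B)"
   "!!v. \<phi> v = mpoly_eval v P"
  and Q: "!!al. al \<in> Poly_Mapping.keys Q ==> Poly_Mapping.keys al \<subseteq> J & (\<forall>a. lkp al a \<le> B)"
   "!!v. \<psi> v = mpoly_eval v Q"
  unfolding polydeg_def by blast
 have "Poly_Mapping.keys ga \<subseteq> J & (\<forall>a. lkp ga a \<le> B)"
  if "ga \<in> Poly_Mapping.keys (P + Q)" for ga
  using that Poly_Mapping.keys_add[of P Q] P(1)[of ga] Q(1)[of ga] by blast
 then show ?thesis
  unfolding polydeg_def using P(2) Q(2) by (intro exI[of _ "P + Q"]) (simp add: mpoly_eval_add)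
qed

lemma polydeg_mult:
 assumes "polydeg J B \<phi>" "polydeg J B' \<psi>"
 shows "polydeg J (B + B') (%v. \<phi> v * \<psi> v)"
proof -
 from assms obtain P Q where
  P: "!!al. al \<in> Poly_Mapping.keys P ==> Poly_Mapping.keys al \<subseteq> J & (\<forall>a. lkp al a \<le> B)"
   "!!v. \<phi> v = mpoly_eval v P"
  and Q: "!!al. al \<in> Poly_Mapping.keys Q ==> Poly_Mapping.keys al \<subseteq> J & (\<forall>a. lkp al a \<le> B')"
   "!!v. \<psi> v = mpoly_eval v Q"
  unfolding polydeg_def by blast
 have "Poly_Mapping.keys ga \<subseteq> J & (\<forall>a. lkp ga a \<le> B + B')"
  if "ga \<in> Poly_Mapping.keys (P * Q)" for ga
 proof -
  from that Poly_Mapping.keys_mult[of P Q] obtain al be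
   where "ga = al + be" "al \<in> Poly_Mapping.keys P" "be \<in> Poly_Mapping.keys Q" by blast
  then show ?thesis
   using P(1)[of al] Q(1)[of be] Poly_Mapping.keys_add[of al be] by (auto simp: lookup_add intro!: add_mono)
 qed
 then show ?thesis
  unfolding polydeg_def using P(2) Q(2) by (intro exI[of _ "P * Q"]) (simp add: mpoly_eval_mult)
qed

lemma polydeg_power:
 assumes "polydeg J B \<phi>" "k \<le> s"
 shows "polydeg J (B * s) (%v. \<phi> v ^ k)"
proof -
 have "polydeg J (k * B) (%v. \<phi> v ^ k)"
 proof (induction k)
  case 0 then show ?case by (simp add: polydeg_const)
 next
  case (Suc k) then show ?case using polydeg_mult[OF assms(1) Suc] by simp
 qed
 then show ?thesis using assms(2) by (elim polydeg_weaken) (auto simp: mult.commute)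
qed

lemma polydeg_prod:
 assumes "finite A" "!!a. a \<in> A ==> polydeg J B (\<phi> a)"
 shows "polydeg J (card A * B) (%v. \<Prod>a\<in>A. \<phi> a v)"
 using assms
proof (induction A rule: finite_induct)
 case empty then show ?case by (simp add: polydeg_const)
next
 case (insert a A)
 then show ?case using polydeg_mult[of J B "\<phi> a" "card A * B" "%v. \<Prod>a\<in>A. \<phi> a v"] by simp
qed

lemma polyon_const: "polyon J (%v. k)"
 unfolding polyon_def by (rule exI, rule polydeg_const)

lemma polyon_var: "a \<in> J ==> polyon J (%v. v a)"
 unfolding polyon_def by (rule exI, erule polydeg_var)

lemma polyon_add: "polyon J \<phi> ==> polyon J \<psi> ==> polyon J (%v. \<phi> v + \<psi> v)"
 unfolding polyon_def using polydeg_add polydeg_weaken[OF _ max.cobounded1 order_refl]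
  polydeg_weaken[OF _ max.cobounded2 order_refl] by metis

lemma polyon_mult: "polyon J \<phi> ==> polyon J \<psi> ==> polyon J (%v. \<phi> v * \<psi> v)"
 unfolding polyon_def by (elim exE) (rule exI, erule polydeg_mult, assumption)

lemma polyon_uminus: "polyon J \<phi> ==> polyon J (%v. - \<phi> v)"
 using polyon_mult[OF polyon_const[of J "-1"]] by simp

lemma polyon_diff: "polyon J \<phi> ==> polyon J \<psi> ==> polyon J (%v. \<phi> v - \<psi> v)"
 using polyon_add[of J \<phi> "%v. - \<psi> v"] polyon_uminus[of J \<psi>] by simp

lemma polyon_sum: "(!!a. a \<in> A ==> polyon J (\<phi> a)) ==> polyon J (%v. \<Sum>a\<in>A. \<phi> a v)"
 by (induction A rule: infinite_finite_induct) (simp_all add: polyon_const polyon_add)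

lemma polyon_prod: "(!!a. a \<in> A ==> polyon J (\<phi> a)) ==> polyon J (%v. \<Prod>a\<in>A. \<phi> a v)"
 by (induction A rule: infinite_finite_induct) (simp_all add: polyon_const polyon_mult)

lemma polyon_power: "polyon J \<phi> ==> polyon J (%v. \<phi> v ^ k)"
 by (induction k) (simp_all add: polyon_const polyon_mult)

lemmas polyon_intros = polyon_const polyon_add polyon_mult polyon_uminus polyon_diff polyon_sum
 polyon_prod polyon_power

lemma polyon_cong_vars:
 assumes "polyon J \<phi>" "!!a. a \<in> J ==> v a = w a"
 shows "\<phi> v = \<phi> w"
proof -
 from assms(1) obtain P where P: "!!al. al \<in> Poly_Mapping.keys P ==> Poly_Mapping.keys al \<subseteq> J"
   "!!v. \<phi> v = mpoly_eval v P"
  unfolding polyon_def polydeg_def by blast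
 have "monom_eval v al = monom_eval w al" if "al \<in> Poly_Mapping.keys P" for al
  unfolding monom_eval_def using P(1)[OF that] assms(2) by (intro prod.cong) auto
 then show ?thesis unfolding P(2) mpoly_eval_def by (intro sum.cong) auto
qed

lemma polyon_line:
 assumes "polyon J \<phi>"
 obtains q where "!!s. \<phi> (%a. A a + s * B a) = poly q s"
proof -
 from assms obtain P where P: "!!v. \<phi> v = mpoly_eval v P"
  unfolding polyon_def polydeg_def by blast
 let ?q = "\<Sum>al\<in>Poly_Mapping.keys P. [:lkp P al:] *
   (\<Prod>a\<in>Poly_Mapping.keys al. [:A a, B a:] ^ lkp al a)"
 have "\<phi> (%a. A a + s * B a) = poly ?q s" for s
  unfolding P mpoly_eval_def monom_eval_def by (simp add: poly_sum poly_prod)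
 then show ?thesis by (rule that)
qed

text \<open>Restricted to the line through the two points, both functions are nonzero polynomials in one
 variable.\<close>

lemma polyon_common_nonzero:
 assumes "polyon J \<phi>" "polyon J \<psi>" "\<phi> v ~= 0" "\<psi> w ~= 0"
 obtains u where "\<phi> u ~= 0" "\<psi> u ~= 0"
proof -
 obtain q r where q: "!!s. \<phi> (%a. v a + s * (w a - v a)) = poly q s"
  and r: "!!s. \<psi> (%a. v a + s * (w a - v a)) = poly r s"
  using polyon_line[OF assms(1), of v "%a. w a - v a"] polyon_line[OF assms(2), of v "%a. w a - v a"] by metis
 have "poly q 0 ~= 0" "poly r 1 ~= 0"
  using q[of 0] r[of 1] assms(3,4) by auto
 then have "q * r ~= 0" by auto
 then have "finite {s. poly (q * r) s = 0}" by (rule poly_roots_finite)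
 then obtain s where "poly (q * r) s ~= 0"
  by (metis (mono_tags, lifting) UNIV_eq_I infinite_UNIV_char_0 mem_Collect_eq)
 then show ?thesis using that[of "%a. v a + s * (w a - v a)"] q r by auto
qed

lemma polyon_common_nonzero_family:
 assumes "finite A" "!!a. a \<in> A ==> polyon J (\<phi> a)" "!!a. a \<in> A ==> \<exists>v. \<phi> a v ~= 0"
 shows "\<exists>v. (\<Prod>a\<in>A. \<phi> a v) ~= 0"
 using assms
proof (induction A rule: finite_induct)
 case empty then show ?case by simp
next
 case (insert a A)
 then obtain v w where "\<phi> a v ~= 0" "(\<Prod>a\<in>A. \<phi> a w) ~= 0" by (metis insertCI)
 then obtain u where "\<phi> a u ~= 0" "(\<Prod>a\<in>A. \<phi> a u) ~= 0"
  using polyon_common_nonzero[of J "\<phi> a" "%v. \<Prod>a\<in>A. \<phi> a v" v w] insert.prems polyon_prod[of A J \<phi>]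
  by (metis insertCI)
 then show ?case using insert.hyps by (intro exI[of _ u]) simp
qed

lemma polynomial_vanishing_on_box:
 fixes T :: "'i => complex set"
 assumes "finite I" "!!i. i \<in> I ==> infinite (T i)"
  and "!!v. (!!i. i \<in> I ==> v i \<in> T i) ==>
   (\<Sum>ga\<in>PiE I (%_. {..s}). b ga * (\<Prod>i\<in>I. v i ^ ga i)) = 0"
  and "ga \<in> PiE I (%_. {..s})"
 shows "b ga = (0 :: complex)"
 using assms
proof (induction I arbitrary: b ga rule: finite_induct)
 case empty
 then show ?case using empty(2)[of undefined] by simp
next
 case (insert i I)
 have inj: "inj_on (%(y, g). g(i := y)) ({..s} \<times> PiE I (%_. {..s}))"
  using insert.hyps by (auto simp: inj_on_def fun_eq_iff PiE_def extensional_def split: if_splits)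
 have split: "(\<Sum>ga\<in>PiE (insert i I) (%_. {..s}). b ga * (\<Prod>i\<in>insert i I. v i ^ ga i)) =
   (\<Sum>y\<le>s. (\<Sum>g\<in>PiE I (%_. {..s}). b (g(i := y)) * (\<Prod>i\<in>I. v i ^ g i)) * v i ^ y)" for v
 proof -
  have *: "(\<Prod>j\<in>I. v j ^ (g(i := y)) j) = (\<Prod>j\<in>I. v j ^ g j)" for g y
   using insert.hyps by (intro prod.cong) auto
  have "(\<Sum>ga\<in>PiE (insert i I) (%_. {..s}). b ga * (\<Prod>i\<in>insert i I. v i ^ ga i)) =
    (\<Sum>(y, g)\<in>{..s} \<times> PiE I (%_. {..s}). b (g(i := y)) * (v i ^ y * (\<Prod>j\<in>I. v j ^ g j)))"
   unfolding PiE_insert_eq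
   by (subst sum.reindex[OF inj]) (use insert.hyps * in \<open>auto simp: case_prod_unfold intro!: sum.cong\<close>)
  also have "\<dots> = (\<Sum>y\<le>s. \<Sum>g\<in>PiE I (%_. {..s}). b (g(i := y)) * (v i ^ y * (\<Prod>j\<in>I. v j ^ g j)))"
   by (subst sum.cartesian_product) simp
  finally show ?thesis by (simp add: sum_distrib_left sum_distrib_right mult_ac)
 qed
 have "(\<Sum>g\<in>PiE I (%_. {..s}). b (g(i := y)) * (\<Prod>i\<in>I. v i ^ g i)) = 0"
  if v: "!!i. i \<in> I ==> v i \<in> T i" and "y \<le> s" for v y
 proof (rule ccontr)
  define k where "k y = (\<Sum>g\<in>PiE I (%_. {..s}). b (g(i := y)) * (\<Prod>i\<in>I. v i ^ g i))" for y
  assume "\<not> ?thesis"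
  then have "finite {z. (\<Sum>y\<le>s. k y * z ^ y) = 0}"
   using \<open>y \<le> s\<close> by (intro polyfun_roots_finite[of k y]) (auto simp: k_def)
  moreover have "T i \<subseteq> {z. (\<Sum>y\<le>s. k y * z ^ y) = 0}"
  proof clarify
   fix z assume z: "z \<in> T i"
   have "(\<Sum>y\<le>s. (\<Sum>g\<in>PiE I (%_. {..s}). b (g(i := y)) * (\<Prod>j\<in>I. (v(i := z)) j ^ g j)) * (v(i := z)) i ^ y) = 0"
    unfolding split[symmetric] using v z by (intro insert.prems(2)) auto
   moreover have "(\<Prod>j\<in>I. (v(i := z)) j ^ g j) = (\<Prod>j\<in>I. v j ^ g j)" for g
    using insert.hyps by (intro prod.cong) auto
   ultimately show "(\<Sum>y\<le>s. k y * z ^ y) = 0" by (simp add: k_def)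
  qed
  ultimately show False using insert.prems(1)[of i] finite_subset by auto
 qed
 then have "b (g(i := y)) = 0" if "g \<in> PiE I (%_. {..s})" "y \<le> s" for g y
  using insert.IH[of "%g. b (g(i := y))" g] insert.prems(1) that by auto
 then show ?case using insert.prems(3) unfolding PiE_insert_eq by auto
qed

section \<open>Linear systems\<close>

lemma underdetermined_system:
 fixes a :: "'e => 'v => 'c::field"
 assumes "finite E" "finite V" "card E < card V"
 shows "\<exists>x. (\<exists>v\<in>V. x v ~= 0) & (\<forall>e\<in>E. (\<Sum>v\<in>V. a e v * x v) = 0)"
 using assms
proof (induction E arbitrary: V a rule: finite_induct)
 case empty
 then have "V ~= {}" by auto
 then show ?case by (intro exI[of _ "%_. 1"]) auto
next
 case (insert e E)
 show ?case
 proof (cases "\<forall>v\<in>V. a e v = 0")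
  case True
  then show ?thesis using insert.IH[of V a] insert.prems insert.hyps by auto
 next
  case False
  then obtain u where u: "u \<in> V" "a e u ~= 0" by auto
  have V: "V = insert u (V - {u})" using u by auto
  have "card E < card (V - {u})" using insert u by auto
  then obtain x where x: "\<exists>v\<in>V - {u}. x v ~= 0"
   "!!e'. e' \<in> E ==> (\<Sum>v\<in>V - {u}. (a e' v - a e' u * a e v / a e u) * x v) = 0"
   using insert.IH[of "V - {u}" "%e' v. a e' v - a e' u * a e v / a e u"] insert.prems by auto
  define y where "y v = (if v = u then - (\<Sum>v\<in>V - {u}. a e v * x v) / a e u else x v)" for v
  have yu: "y u = - (\<Sum>v\<in>V - {u}. a e v * x v) / a e u" by (simp add: y_def)
  have y: "(\<Sum>v\<in>V. k v * y v) = k u * y u + (\<Sum>v\<in>V - {u}. k v * x v)" for k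
   by (subst V, subst sum.insert) (use insert.prems in \<open>auto simp: y_def intro!: sum.cong\<close>)
  have "(\<Sum>v\<in>V. a e' v * y v) = 0" if "e' \<in> E" for e'
   using x(2)[OF that] u(2) unfolding y[of "a e'"] yu
   by (simp add: algebra_simps sum_subtractf sum_distrib_left sum_divide_distrib)
  moreover have "(\<Sum>v\<in>V. a e v * y v) = 0" using u(2) unfolding y[of "a e"] yu by simp
  moreover have "\<exists>v\<in>V. y v ~= 0" using x(1) by (auto simp: y_def)
  ultimately show ?thesis by blast
 qed
qed

text \<open>The polynomial \<open>\<phi>\<close> is the product of the pivots of Gaussian elimination without division; it
 replaces the determinant.\<close>

lemma generically_solvable_system:
 assumes "finite A" "!!al be. al \<in> A ==> be \<in> A ==> polyon J (m al be)"
  and "!!al be. al \<in> A ==> be \<in> A ==> m al be v0 = (if al = be then 1 else 0)"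
 shows "\<exists>\<phi>. polyon J \<phi> & \<phi> v0 = 1 &
  (\<forall>v. \<phi> v ~= 0 --> (\<forall>b. \<exists>n. \<forall>al\<in>A. (\<Sum>be\<in>A. m al be v * n be) = b al))"
 using assms
proof (induction A arbitrary: m rule: finite_induct)
 case empty
 then show ?case by (intro exI[of _ "%_. 1"]) (simp add: polyon_const)
next
 case (insert e A)
 define m' where "m' al be v = m e e v * m al be v - m al e v * m e be v" for al be v
 have "polyon J (m' al be)" if "al \<in> A" "be \<in> A" for al be
  unfolding m'_def using that insert.prems(1) by (intro polyon_intros) auto
 moreover have "m' al be v0 = (if al = be then 1 else 0)" if "al \<in> A" "be \<in> A" for al be
  unfolding m'_def using that insert.prems(2) insert.hyps by auto
 ultimately obtain \<phi> where \<phi>: "polyon J \<phi>" "\<phi> v0 = 1"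
  "!!v b. \<phi> v ~= 0 ==> \<exists>n. \<forall>al\<in>A. (\<Sum>be\<in>A. m' al be v * n be) = b al"
  using insert.IH[of m'] by blast
 have "\<exists>n. \<forall>al\<in>insert e A. (\<Sum>be\<in>insert e A. m al be v * n be) = b al"
  if nz: "m e e v * \<phi> v ~= 0" for v b
 proof -
  obtain n where n: "!!al. al \<in> A ==> (\<Sum>be\<in>A. m' al be v * n be) = m e e v * b al - m al e v * b e"
   using \<phi>(3)[of v "%al. m e e v * b al - m al e v * b e"] nz by auto
  define l where "l be = (if be = e then (b e - (\<Sum>be\<in>A. m e be v * n be)) / m e e v else n be)" for be
  have le: "m e e v * l e = b e - (\<Sum>be\<in>A. m e be v * n be)" using nz by (simp add: l_def)
  have l: "(\<Sum>be\<in>insert e A. k be * l be) = k e * l e + (\<Sum>be\<in>A. k be * n be)" for k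
   using insert.hyps by (auto simp: l_def intro!: sum.cong)
  have "(\<Sum>be\<in>insert e A. m al be v * l be) = b al" if "al \<in> A" for al
  proof -
   have "m e e v * (\<Sum>be\<in>insert e A. m al be v * l be) =
     m al e v * (m e e v * l e) + (\<Sum>be\<in>A. m e e v * m al be v * n be)"
    by (simp only: l) (simp add: algebra_simps sum_distrib_left)
   also have "\<dots> = m al e v * b e + (\<Sum>be\<in>A. m' al be v * n be)"
    unfolding le m'_def by (simp add: algebra_simps sum_subtractf sum_distrib_left)
   also have "\<dots> = m e e v * b al" by (simp add: n[OF that])
   finally show ?thesis using nz by simp
  qed
  moreover have "(\<Sum>be\<in>insert e A. m e be v * l be) = b e" unfolding l le by simp
  ultimately show ?thesis by blast
 qed
 moreover have "polyon J (%v. m e e v * \<phi> v)" using \<phi>(1) insert.prems(1) by (intro polyon_intros) auto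
 moreover have "m e e v0 * \<phi> v0 = 1" using \<phi>(2) insert.prems(2) by simp
 ultimately show ?case by blast
qed

section \<open>Algebraic dependence\<close>

lemma finite_bounded_monoms:
 assumes "finite (J :: 'v set)"
 shows "finite {al :: 'v mon. Poly_Mapping.keys al \<subseteq> J & (\<forall>a. lkp al a \<le> M)}" (is "finite ?E")
  and "card {al :: 'v mon. Poly_Mapping.keys al \<subseteq> J & (\<forall>a. lkp al a \<le> M)} \<le> (M + 1) ^ card J"
proof -
 let ?f = "%al :: 'v mon. restrict (lkp al) J"
 have inj: "inj_on ?f ?E"
 proof (rule inj_onI, rule poly_mapping_eqI)
  fix al be k assume "al \<in> ?E" "be \<in> ?E" "?f al = ?f be"
  then have "k \<in> J ==> lkp al k = lkp be k"
   "k \<notin> J ==> k \<notin> Poly_Mapping.keys al & k \<notin> Poly_Mapping.keys be"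
   using restrict_apply'[of k J] by (metis, blast)
  then show "lkp al k = lkp be k"
   unfolding in_keys_iff by metis
 qed
 have sub: "?f ` ?E \<subseteq> PiE J (%_. {..M})" by auto
 have fin: "finite (PiE J (%_. {..M}))" using assms by (intro finite_PiE) auto
 show "finite ?E" using finite_imageD[OF finite_subset[OF sub fin] inj] .
 have "card ?E = card (?f ` ?E)" by (simp add: card_image[OF inj])
 also have "\<dots> \<le> card (PiE J (%_. {..M}))" by (rule card_mono[OF fin sub])
 also have "\<dots> = (M + 1) ^ card J" using assms by (simp add: card_PiE)
 finally show "card ?E \<le> (M + 1) ^ card J" .
qed

text \<open>Counting dimensions: the monomials of degree at most \<open>s\<close> in each of \<open>card I\<close> variables outnumber,
 for large \<open>s\<close>, the monomials that can occur when the polynomials \<open>\<Phi> a\<close>, which have fewer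
 variables, are substituted into them.\<close>

lemma algebraic_dependence:
 fixes \<Phi> :: "'i => ('v => complex) => complex"
 assumes "finite I" "finite J" "card J < card I" "!!a. a \<in> I ==> polyon J (\<Phi> a)"
 shows "\<exists>\<phi>. polyon I \<phi> & (\<exists>v. \<phi> v ~= 0) & (\<forall>w. \<phi> (%a. \<Phi> a w) = 0)"
proof -
 obtain Bf where Bf: "!!a. a \<in> I ==> polydeg J (Bf a) (\<Phi> a)"
  using assms(4) unfolding polyon_def by metis
 define B where "B = (\<Sum>a\<in>I. Bf a)"
 have B: "polydeg J B (\<Phi> a)" if "a \<in> I" for a
  using Bf[OF that] by (rule polydeg_weaken) (use assms(1) that in \<open>auto simp: B_def intro: member_le_sum\<close>)
 define N where "N = card I"
 define s where "s = (B * N + 1) ^ card J"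
 define M where "M = N * (B * s)"
 define E where "E = {al :: 'v mon. Poly_Mapping.keys al \<subseteq> J & (\<forall>a. lkp al a \<le> M)}"
 define V where "V = PiE I (%_. {..s})"
 have "card E \<le> (M + 1) ^ card J" unfolding E_def by (rule finite_bounded_monoms(2)[OF assms(2)])
 also have "\<dots> \<le> ((s + 1) * (B * N + 1)) ^ card J"
  by (rule power_mono) (simp_all add: M_def algebra_simps)
 also have "\<dots> = (s + 1) ^ card J * s" by (simp only: s_def power_mult_distrib)
 also have "\<dots> < (s + 1) ^ Suc (card J)" by simp
 also have "\<dots> \<le> (s + 1) ^ N" unfolding N_def using assms(3) by (intro power_increasing) auto
 also have "\<dots> = card V" unfolding V_def N_def using assms(1) by (simp add: card_PiE)
 finally have card: "card E < card V" .
 have finE: "finite E" unfolding E_def by (rule finite_bounded_monoms(1)[OF assms(2)])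
 have finV: "finite V" unfolding V_def using assms(1) by (intro finite_PiE) auto
 have keyE: "(\<forall>al\<in>Poly_Mapping.keys P. Poly_Mapping.keys al \<subseteq> J & (\<forall>a. lkp al a \<le> M))
   \<longleftrightarrow> Poly_Mapping.keys P \<subseteq> E" for P :: "('v, complex) mpoly"
  unfolding E_def subset_eq by simp
 have "polydeg J M (%w. \<Prod>a\<in>I. \<Phi> a w ^ ga a)" if "ga \<in> V" for ga
  unfolding M_def N_def using that B assms(1) unfolding V_def by (intro polydeg_prod polydeg_power) auto
 then have "\<forall>ga\<in>V. \<exists>P. Poly_Mapping.keys P \<subseteq> E & (\<forall>w. (\<Prod>a\<in>I. \<Phi> a w ^ ga a) = mpoly_eval w P)"
  unfolding polydeg_def keyE by blast
 then obtain P where P: "!!ga. ga \<in> V ==> Poly_Mapping.keys (P ga) \<subseteq> E"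
  "!!ga w. ga \<in> V ==> (\<Prod>a\<in>I. \<Phi> a w ^ ga a) = mpoly_eval w (P ga)"
  by metis
 obtain x where x: "\<exists>ga\<in>V. x ga ~= 0"
  "!!al. al \<in> E ==> (\<Sum>ga\<in>V. lkp (P ga) al * x ga) = (0 :: complex)"
  using underdetermined_system[OF finE finV card, of "%al ga. lkp (P ga) al"] by blast
 define \<phi> where "\<phi> v = (\<Sum>ga\<in>V. x ga * (\<Prod>a\<in>I. v a ^ ga a))" for v
 have "polyon I \<phi>" unfolding \<phi>_def by (intro polyon_intros polyon_var) auto
 moreover have "\<exists>v. \<phi> v ~= 0"
 proof (rule ccontr)
  assume "\<not> ?thesis"
  then have "x ga = 0" if "ga \<in> V" for ga
   using polynomial_vanishing_on_box[OF assms(1), where T = "%_. UNIV" and s = s and b = x and ga = ga] that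
   by (simp add: \<phi>_def V_def infinite_UNIV_char_0)
  then show False using x(1) by auto
 qed
 moreover have "\<phi> (%a. \<Phi> a w) = 0" for w
 proof -
  have "\<phi> (%a. \<Phi> a w) = (\<Sum>ga\<in>V. x ga * (\<Sum>al\<in>E. lkp (P ga) al * monom_eval w al))"
   unfolding \<phi>_def by (intro sum.cong refl) (simp add: P(2) mpoly_eval_superset[OF finE P(1)])
  also have "\<dots> = (\<Sum>al\<in>E. (\<Sum>ga\<in>V. lkp (P ga) al * x ga) * monom_eval w al)"
   by (simp add: sum_distrib_left sum_distrib_right sum.swap[of _ V] mult_ac)
  finally show ?thesis using x(2) by simp
 qed
 ultimately show ?thesis by blast
qed

section \<open>Homogeneous forms and their partial derivatives\<close>

definition zmon :: "complex^'n => (('n::finite) mon) => complex" where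
 "zmon z al = (\<Prod>m\<in>UNIV. z $ m ^ lkp al m)"

definition dmono :: "'n => complex^'n => (('n::finite) mon) => complex" where
 "dmono m z al = of_nat (lkp al m) * zmon z (al - sgl m 1)"

text \<open>The tuple of forms with coefficients \<open>c\<close>, and their partial derivatives.\<close>

definition hform :: "(nat \<times> (('n::finite) mon) => complex) => nat => nat => complex^'n => complex" where
 "hform c i k z = (\<Sum>al | mdeg al = k. c (i, al) * zmon z al)"

definition dform ::
 "(nat \<times> (('n::finite) mon) => complex) => nat => nat => 'n => complex^'n => complex" where
 "dform c i k m z = (\<Sum>al | mdeg al = k. c (i, al) * dmono m z al)"

definition idx :: "nat list => (nat \<times> (('n::finite) mon)) set" where
 "idx d = {(i, al). i < length d & mdeg al = d ! i}"

lemma finite_idx: "finite (idx d :: (nat \<times> (('n::finite) mon)) set)"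
proof -
 have "idx d = (SIGMA i : {..<length d}. {al :: 'n mon. mdeg al = d ! i})"
  by (auto simp: idx_def)
 then show ?thesis using finite_monoms_of_degree by auto
qed

lemma monom_eval_eq_zmon: "monom_eval (($) z) al = zmon z al"
 by (simp add: zmon_def monom_eval_superset[of UNIV])

lemma zmon_zero [simp]: "zmon z 0 = 1"
 by (simp add: zmon_def)

lemma zmon_add: "zmon z (al + be) = zmon z al * zmon z be"
 by (simp add: zmon_def lookup_add power_add prod.distrib)

lemma zmon_single [simp]: "zmon z (sgl m k) = z $ m ^ k"
proof -
 have "zmon z (sgl m k) = (\<Prod>l\<in>UNIV. if l = m then z $ m ^ k else 1)"
  unfolding zmon_def by (intro prod.cong) (auto simp: lookup_single when_def)
 then show ?thesis by simp
qed

lemma monom_degree_zero [simp]: "mdeg 0 = 0"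
 by (simp add: monom_degree_def)

lemma monom_degree_add: "mdeg (al + be) = mdeg al + mdeg be"
 by (simp add: monom_degree_def lookup_add sum.distrib)

lemma monom_degree_single [simp]: "mdeg (sgl m k) = k"
 by (simp add: monom_degree_def lookup_single when_def)

lemma lookup_le_monom_degree: "lkp al m \<le> mdeg al"
 unfolding monom_degree_def by (rule member_le_sum) simp_all

lemma monom_degree_eq_0_iff: "mdeg al = 0 \<longleftrightarrow> al = 0"
 using lookup_le_monom_degree[of al] by (auto intro!: poly_mapping_eqI)

text \<open>Subtraction of monomials is truncated in every exponent.\<close>

lemma monom_diff_add:
 assumes "!!m. lkp be m \<le> lkp al m"
 shows "al - be + be = (al :: 'n mon)"
 by (rule poly_mapping_eqI) (simp add: lookup_add lookup_minus assms)

lemma monom_diff_single_add: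
 assumes "k \<le> lkp al m"
 shows "al - sgl m k + sgl m k = (al :: 'n mon)"
 by (rule monom_diff_add) (use assms in \<open>auto simp: lookup_single when_def\<close>)

lemma monom_degree_diff_single:
 assumes "k \<le> lkp al m"
 shows "mdeg (al - sgl m k) + k = mdeg al"
 using arg_cong[OF monom_diff_single_add[OF assms], of mdeg] by (simp add: monom_degree_add)

lemma zmon_scale: "zmon (k *s z) al = k ^ mdeg al * zmon z al"
 by (simp add: zmon_def monom_degree_def power_mult_distrib prod.distrib power_sum)

lemma scaleR_eq_scalar_mult: "r *\<^sub>R (z :: complex^'n) = of_real r *s z"
 unfolding vec_eq_iff vector_scaleR_component vector_smult_component by (simp add: scaleR_conv_of_real)

lemma dmono_scale: "dmono m (k *s z) al = k ^ (mdeg al - 1) * dmono m z al"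
proof (cases "lkp al m = 0")
 case False
 then have "mdeg al - 1 = mdeg (al - sgl m 1)"
  using monom_degree_diff_single[of 1 al m] by simp
 then show ?thesis by (simp add: dmono_def zmon_scale)
qed (simp add: dmono_def)

lemma euler_zmon: "(\<Sum>m\<in>UNIV. z $ m * dmono m z al) = of_nat (mdeg al) * zmon z al"
proof -
 have "z $ m * dmono m z al = of_nat (lkp al m) * zmon z al" for m
 proof (cases "lkp al m = 0")
  case False
  then have "zmon z al = zmon z (al - sgl m 1) * z $ m"
   using monom_diff_single_add[of 1 al m] zmon_add[of z "al - sgl m 1" "sgl m 1"]
   by simp
  then show ?thesis by (simp add: dmono_def)
 qed (simp add: dmono_def)
 then show ?thesis by (simp add: monom_degree_def sum_distrib_right)
qed

lemma hform_scale: "hform c i k (s *s z) = s ^ k * hform c i k z"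
 by (simp add: hform_def zmon_scale sum_distrib_left mult_ac)

lemma dform_scale: "dform c i k m (s *s z) = s ^ (k - 1) * dform c i k m z"
 by (simp add: dform_def dmono_scale sum_distrib_left mult_ac)

lemma euler_hform: "(\<Sum>m\<in>UNIV. z $ m * dform c i k m z) = of_nat k * hform c i k z"
proof -
 have "(\<Sum>m\<in>UNIV. z $ m * dform c i k m z) =
   (\<Sum>al | mdeg al = k. c (i, al) * (\<Sum>m\<in>UNIV. z $ m * dmono m z al))"
  by (simp add: dform_def sum_distrib_left mult_ac sum.swap[of _ _ UNIV])
 then show ?thesis by (simp add: euler_zmon hform_def sum_distrib_left mult_ac)
qed

section \<open>The space of tuples of forms\<close>

lemma coeff_coords_surj:
 assumes "!!a. a \<notin> idx d ==> v a = 0"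
 obtains F :: "('n::finite, complex) mpoly list" where "F \<in> hom_tuples d" "coeff_coords F = v"
proof
 let ?P = "%i. \<Sum>al | mdeg al = d ! i. sgl al (v (i, al))"
 have look: "lkp (?P i) be = (if mdeg be = d ! i then v (i, be) else 0)" for i be
  by (simp add: lookup_sum lookup_single when_def finite_monoms_of_degree)
 show "map ?P [0..<length d] \<in> hom_tuples d"
  by (auto simp: hom_tuples_def hom_polys_def in_keys_iff look split: if_splits)
 show "coeff_coords (map ?P [0..<length d]) = v"
  using assms by (auto simp: coeff_coords_def fun_eq_iff look idx_def)
qed

lemma coeff_coords_outside:
 assumes "F \<in> hom_tuples d" "a \<notin> idx d" shows "coeff_coords F a = 0"
proof (cases a)
 case (Pair i al)
 then show ?thesis
  using assms by (force simp: hom_tuples_def hom_polys_def coeff_coords_def idx_def in_keys_iff)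
qed

lemma zariski_open_dense:
 fixes \<phi> :: "(nat \<times> (('n::finite) mon) => complex) => complex"
 assumes "polyon (idx d) \<phi>" "\<phi> v ~= 0"
 defines "U \<equiv> {F \<in> hom_tuples d. \<phi> (coeff_coords F) ~= 0}"
 shows "openin (zariski_topology d) U" "zariski_topology d closure_of U = hom_tuples d"
proof -
 obtain P where P: "!!v. \<phi> v = mpoly_eval v P"
  using assms(1) unfolding polyon_def polydeg_def by blast
 show "openin (zariski_topology d) U"
  unfolding openin_zariski_topology U_def by (rule exI[of _ "{P}"]) (auto simp: P)
 have "\<exists>F\<in>U. F \<in> T" if T: "openin (zariski_topology d) T" "G \<in> T" for G T
 proof -
  obtain \<P> :: "(nat \<times> ('n mon), complex) mpoly set" where
   \<P>: "T \<subseteq> hom_tuples d" "hom_tuples d - T = {F \<in> hom_tuples d. \<forall>P\<in>\<P>. mpoly_eval (coeff_coords F) P = 0}"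
   using T(1) unfolding openin_zariski_topology by blast
  then obtain Q where Q: "Q \<in> \<P>" "mpoly_eval (coeff_coords G) Q ~= 0" using T(2) by blast
  let ?w = "coeff_coords G"
  let ?v = "%a. if a \<in> idx d then v a else 0"
  have nz: "\<phi> ?v ~= 0" using polyon_cong_vars[OF assms(1), of v ?v] assms(2) by simp
  obtain q where q: "!!s. \<phi> (%a. ?w a + s * (?v a - ?w a)) = poly q s"
   using polyon_line[OF assms(1), of ?w "%a. ?v a - ?w a"] by blast
  have "finite (\<Union>(Poly_Mapping.keys ` Poly_Mapping.keys Q))" by auto
  moreover have "polyon UNIV (%v. mpoly_eval v Q)"
   unfolding mpoly_eval_def monom_eval_def by (intro polyon_intros polyon_var) auto
  ultimately obtain r where r: "!!s. mpoly_eval (%a. ?w a + s * (?v a - ?w a)) Q = poly r s"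
   using polyon_line[of UNIV "%v. mpoly_eval v Q" ?w "%a. ?v a - ?w a"] by blast
  have "poly q 1 ~= 0" "poly r 0 ~= 0" using q[of 1] r[of 0] nz Q(2) by auto
  then have "q * r ~= 0" by auto
  then have "finite {s. poly (q * r) s = 0}" by (rule poly_roots_finite)
  then obtain s where s: "poly (q * r) s ~= 0"
   by (metis (mono_tags, lifting) UNIV_eq_I infinite_UNIV_char_0 mem_Collect_eq)
  have "?w a + s * (?v a - ?w a) = 0" if "a \<notin> idx d" for a
   using that coeff_coords_outside[of G d a] T(2) \<P>(1) by auto
  then obtain F :: "('n, complex) mpoly list" where
   F: "F \<in> hom_tuples d" "coeff_coords F = (%a. ?w a + s * (?v a - ?w a))"
   by (rule coeff_coords_surj[of d "%a. ?w a + s * (?v a - ?w a)"]) blast+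
  have "F \<in> U" using F s q by (auto simp: U_def)
  moreover have "mpoly_eval (coeff_coords F) Q ~= 0" using F s r by auto
  then have "F \<in> T" using F(1) Q(1) \<P>(2) by blast
  ultimately have "F \<in> U" "F \<in> T" by auto
  then show ?thesis by blast
 qed
 then show "zariski_topology d closure_of U = hom_tuples d"
  unfolding closure_of_def topspace_zariski_topology by blast
qed

section \<open>Generic tuples have no singular zeros\<close>

text \<open>The idea is a count of dimensions. Fix \<open>j\<close> and \<open>i0\<close>. The data of a zero \<open>x\<close> in the coordinate
 subspace \<open>S\<close> with \<open>x $ j = 1\<close>, and of a linear dependence with \<open>i0\<close>-th coefficient 1 between the
 differentials at \<open>x\<close>, amount to \<open>card S - 1 + (p - 1)\<close> parameters. Being a zero determines the
 coefficient of \<open>x\<^sub>j\<^bsup>d\<^esup>\<close> in each of the \<open>p\<close> forms, and the linear dependence determines the coefficient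
 of \<open>x\<^sub>j\<^bsup>d-1\<^esup> x\<^sub>m\<close> in the \<open>i0\<close>-th form, for each \<open>m\<close> in \<open>S - {j}\<close>. So the tuples with such a
 zero form the image of a polynomial map from a space of dimension one less than that of the space of
 all tuples, and they satisfy an algebraic equation. The parameters are stored in the slots of the
 coefficients that they determine, and the slot of \<open>x\<^sub>j\<^bsup>d\<^esup>\<close> in the \<open>i0\<close>-th form stays unused.\<close>

lemma generic_no_dependence_normalized:
 fixes S :: "'n::finite set"
 assumes "j \<in> S" "i0 < length d" and d: "!!i. i < length d ==> 1 \<le> d ! i"
 shows "\<exists>\<phi>. polyon (idx d) \<phi> & (\<exists>v. \<phi> v ~= 0) &
  (\<forall>c x l. x $ j = 1 & (\<forall>m. m \<notin> S --> x $ m = 0) & (\<forall>i<length d. hform c i (d ! i) x = 0) &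
    l i0 = 1 & (\<forall>m\<in>S - {j}. (\<Sum>i<length d. l i * dform c i (d ! i) m x) = 0) --> \<phi> c = 0)"
proof -
 define piv where "piv i = (i, sgl j (d ! i))" for i
 define sl where "sl m = (i0, sgl j (d ! i0 - 1) + sgl m 1)" for m
 define J where "J = idx d - {piv i0}"
 define xv :: "(nat \<times> ('n mon) => complex) => complex^'n" where
  "xv v = (\<chi> m. if m = j then 1 else if m \<in> S then v (sl m) else 0)" for v
 define lv where "lv v i = (if i = i0 then 1 else v (piv i))" for v :: "nat \<times> ('n mon) => complex" and i
 define \<Psi> where "\<Psi> m v = - ((\<Sum>i\<in>{..<length d} - {i0}. lv v i *
     (\<Sum>al\<in>{al. mdeg al = d ! i} - {sgl j (d ! i)}. v (i, al) * dmono m (xv v) al)) +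
    (\<Sum>al | mdeg al = d ! i0 & (i0, al) \<notin> sl ` S. v (i0, al) * dmono m (xv v) al))" for m v
 define \<Phi>1 where "\<Phi>1 a v = (if a \<in> sl ` (S - {j}) then \<Psi> (inv_into UNIV sl a) v else v a)" for a v
 define \<Phi> where "\<Phi> a v = (if a \<in> piv ` {..<length d} then
    - (\<Sum>al\<in>{al. mdeg al = d ! fst a} - {sgl j (d ! fst a)}. \<Phi>1 (fst a, al) v * zmon (xv v) al)
   else \<Phi>1 a v)" for a v
 have d0: "1 \<le> d ! i0" using d assms(2) by simp
 have slj: "sl j = piv i0"
  unfolding sl_def piv_def using d0 by (simp flip: single_add)
 have "m = m'" if "sgl m (1 :: nat) = sgl m' 1" for m m' :: 'n
  using arg_cong[OF that, of "%f. lkp f m"] by (simp add: lookup_single when_def split: if_splits)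
 then have inj_sl: "inj sl"
  by (auto simp: inj_def sl_def)
 have inv_sl: "inv_into UNIV sl (sl m) = m" for m using inj_sl by simp
 have sl_idx: "sl m \<in> idx d" for m
  using assms(2) d0 by (simp add: sl_def idx_def monom_degree_add)
 have piv_idx: "piv i \<in> idx d" if "i < length d" for i using that by (simp add: piv_def idx_def)
 have slJ: "sl m \<in> J" if "m ~= j" for m
  using sl_idx[of m] that injD[OF inj_sl, of m j] slj by (auto simp: J_def)
 have pivJ: "piv i \<in> J" if "i < length d" "i ~= i0" for i
  using piv_idx[of i] that by (auto simp: J_def piv_def)
 have polyxv: "polyon J (%v. xv v $ m)" for m
  by (cases "m = j"; cases "m \<in> S") (auto simp: xv_def intro!: polyon_const polyon_var slJ)
 have polymono: "polyon J (%v. zmon (xv v) al)" for al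
  unfolding zmon_def by (intro polyon_intros polyxv)
 have polydmono: "polyon J (%v. dmono m (xv v) al)" for al m
  unfolding dmono_def by (intro polyon_intros polymono)
 have polylv: "polyon J (%v. lv v i)" if "i < length d" for i
  using that by (cases "i = i0") (auto simp: lv_def intro!: polyon_const polyon_var pivJ)
 have poly\<Psi>: "polyon J (\<Psi> m)" for m
  unfolding \<Psi>_def
 proof (intro polyon_intros polylv polydmono)
  show "polyon J (%v. v (i, al))" if "i \<in> {..<length d} - {i0}"
   "al \<in> {al. mdeg al = d ! i} - {sgl j (d ! i)}" for i al
   using that by (intro polyon_var) (auto simp: J_def idx_def piv_def)
  show "polyon J (%v. v (i0, al))" if "al \<in> {al. mdeg al = d ! i0 & (i0, al) \<notin> sl ` S}" for al
  proof -
   have "piv i0 \<in> sl ` S" using slj assms(1) by (metis imageI)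
   then show ?thesis using that assms(2) by (intro polyon_var) (auto simp: J_def idx_def)
  qed
 qed auto
 have poly\<Phi>1: "polyon J (\<Phi>1 a)" if "a \<in> J" for a
  unfolding \<Phi>1_def using poly\<Psi> polyon_var[OF that]
  by (cases "a \<in> sl ` (S - {j})") (simp_all add: poly\<Psi> polyon_var[OF that])
 have poly\<Phi>: "polyon J (\<Phi> a)" if "a \<in> idx d" for a
 proof (cases "a \<in> piv ` {..<length d}")
  case True
  then have "fst a < length d" by (auto simp: piv_def)
  then have "(fst a, al) \<in> J" if "al \<in> {al. mdeg al = d ! fst a} - {sgl j (d ! fst a)}" for al
   using that by (auto simp: J_def idx_def piv_def)
  then show ?thesis
   using True unfolding \<Phi>_def by (simp del: Diff_iff) (intro polyon_intros polymono poly\<Phi>1, simp)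
 next
  case False
  then have "a \<in> J" using that assms(2) by (auto simp: J_def)
  then show ?thesis using False poly\<Phi>1 unfolding \<Phi>_def by simp
 qed
 have fin: "finite (idx d :: (nat \<times> ('n mon)) set)" by (rule finite_idx)
 have "finite J" "card J < card (idx d :: (nat \<times> ('n mon)) set)"
  unfolding J_def using fin piv_idx[OF assms(2)] by (auto intro: card_Diff1_less simp del: card_Diff_insert card_Diff_singleton)
 then obtain \<phi> where \<phi>: "polyon (idx d) \<phi>" "\<exists>v. \<phi> v ~= 0" "!!v. \<phi> (%a. \<Phi> a v) = 0"
  using algebraic_dependence[OF fin, of J \<Phi>] poly\<Phi> by blast
 have "\<phi> c = 0"
  if xj: "x $ j = 1" and xS: "!!m. m \<notin> S ==> x $ m = 0" and zero: "!!i. i < length d ==> hform c i (d ! i) x = 0"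
   and l0: "l i0 = 1" and dep: "!!m. m \<in> S - {j} ==> (\<Sum>i<length d. l i * dform c i (d ! i) m x) = 0" for c x l
 proof -
  define v where "v a = (if a \<in> piv ` {..<length d} then l (fst a)
    else if a \<in> sl ` (S - {j}) then x $ (inv_into UNIV sl a) else c a)" for a
  have npiv: "sl m \<notin> piv ` {..<length d}" if "m ~= j" for m
  proof
   assume "sl m \<in> piv ` {..<length d}"
   then have "sl m = sl j" unfolding slj by (auto simp: sl_def piv_def)
   then show False using that injD[OF inj_sl] by blast
  qed
  have xv: "xv v = x"
   using xj xS npiv by (auto simp: vec_eq_iff xv_def v_def inv_sl)
  have lv: "lv v i = l i" if "i < length d" for i
   using that l0 by (auto simp: lv_def v_def) (auto simp: piv_def)
  have v1: "v (i, al) = c (i, al)" if "i < length d" "i ~= i0" "al ~= sgl j (d ! i)" for i al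
   using that by (auto simp: v_def piv_def sl_def)
  have v2: "v (i0, al) = c (i0, al)" if "(i0, al) \<notin> sl ` S" for al
  proof -
   have "(i0, al) ~= piv i0" using that slj assms(1) by (metis image_eqI)
   then show ?thesis using that by (auto simp: v_def piv_def)
  qed
  have \<Psi>: "\<Psi> m v = c (sl m)" if m: "m \<in> S - {j}" for m
  proof -
   let ?s = "sgl j (d ! i0 - 1) + sgl m 1"
   have A: "lv v i * (\<Sum>al\<in>{al. mdeg al = d ! i} - {sgl j (d ! i)}. v (i, al) * dmono m (xv v) al)
      = l i * dform c i (d ! i) m x" if i: "i \<in> {..<length d} - {i0}" for i
   proof -
    have "dmono m x (sgl j (d ! i)) = 0"
     using m by (auto simp: dmono_def lookup_single when_def)
    then have "dform c i (d ! i) m x = (\<Sum>al\<in>{al. mdeg al = d ! i} - {sgl j (d ! i)}. c (i, al) * dmono m x al)"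
     unfolding dform_def using finite_monoms_of_degree by (intro sum.mono_neutral_right) auto
    then show ?thesis using i v1 lv xv by (auto intro!: sum.cong)
   qed
   have "{al. mdeg al = d ! i0} =
     {al. mdeg al = d ! i0 & (i0, al) \<notin> sl ` S} \<union> (snd \<circ> sl) ` S"
    using sl_idx by (auto simp: idx_def sl_def image_iff)
   moreover have "(\<Sum>al\<in>(snd \<circ> sl) ` S. c (i0, al) * dmono m x al) = c (sl m)"
   proof -
    have "dmono m x (snd (sl m')) = 0" if "m' ~= m" for m'
     using that m by (auto simp: dmono_def sl_def lookup_add lookup_single when_def)
    moreover have "dmono m x (snd (sl m)) = 1"
     using m xj by (auto simp: dmono_def sl_def lookup_add lookup_single when_def)
    moreover have "(i0, snd (sl m)) = sl m" by (simp add: sl_def)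
    moreover have "(\<Sum>al\<in>(snd \<circ> sl) ` S. c (i0, al) * dmono m x al) = c (i0, snd (sl m)) * dmono m x (snd (sl m))"
    proof (subst sum.remove[of _ "snd (sl m)"])
     have "c (i0, al) * dmono m x al = 0" if "al \<in> (snd \<circ> sl) ` S - {snd (sl m)}" for al
      using that calculation(1) by fastforce
     then show "c (i0, snd (sl m)) * dmono m x (snd (sl m)) +
       (\<Sum>al\<in>(snd \<circ> sl) ` S - {snd (sl m)}. c (i0, al) * dmono m x al) =
       c (i0, snd (sl m)) * dmono m x (snd (sl m))"
      by (simp add: sum.neutral)
    qed (use m in auto)
    ultimately show ?thesis by simp
   qed
   ultimately have B: "dform c i0 (d ! i0) m x = (\<Sum>al | mdeg al = d ! i0 & (i0, al) \<notin> sl ` S. v (i0, al) * dmono m (xv v) al) + c (sl m)"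
   proof -
    assume *: "{al. mdeg al = d ! i0} =
      {al. mdeg al = d ! i0 & (i0, al) \<notin> sl ` S} \<union> (snd \<circ> sl) ` S"
     and **: "(\<Sum>al\<in>(snd \<circ> sl) ` S. c (i0, al) * dmono m x al) = c (sl m)"
    have "dform c i0 (d ! i0) m x =
      (\<Sum>al | mdeg al = d ! i0 & (i0, al) \<notin> sl ` S. c (i0, al) * dmono m x al) +
      (\<Sum>al\<in>(snd \<circ> sl) ` S. c (i0, al) * dmono m x al)"
     unfolding dform_def *
    proof (rule sum.union_disjoint)
     show "finite {al. mdeg al = d ! i0 & (i0, al) \<notin> sl ` S}"
      by (rule finite_subset[OF _ finite_monoms_of_degree[of "d ! i0"]]) auto
    qed (auto simp: sl_def)
    then show ?thesis using v2 xv ** by simp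
   qed
   have "(\<Sum>i<length d. l i * dform c i (d ! i) m x) =
     (\<Sum>i\<in>{..<length d} - {i0}. l i * dform c i (d ! i) m x) + l i0 * dform c i0 (d ! i0) m x"
    using assms(2) by (subst sum.remove[of _ i0]) auto
   then have "(\<Sum>i\<in>{..<length d} - {i0}. l i * dform c i (d ! i) m x) = - dform c i0 (d ! i0) m x"
    using dep[OF m] l0 by (simp add: eq_neg_iff_add_eq_0)
   then show ?thesis
    unfolding \<Psi>_def using A B by simp
  qed
  have \<Phi>1: "\<Phi>1 a v = c a" if "a \<in> idx d" "a \<notin> piv ` {..<length d}" for a
   using that \<Psi> by (auto simp: \<Phi>1_def inv_sl v_def)
  have "\<Phi> a v = c a" if a: "a \<in> idx d" for a
  proof (cases "a \<in> piv ` {..<length d}")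
   case True
   then obtain i where i: "i < length d" "a = piv i" by auto
   let ?A = "{al. mdeg al = d ! i} - {sgl j (d ! i)}"
   have "0 = hform c i (d ! i) x" using zero i by simp
   also have "\<dots> = c (piv i) * zmon x (sgl j (d ! i)) + (\<Sum>al\<in>?A. c (i, al) * zmon x al)"
    unfolding hform_def piv_def using finite_monoms_of_degree by (subst sum.remove[of _ "sgl j (d ! i)"]) auto
   finally have "c (piv i) = - (\<Sum>al\<in>?A. c (i, al) * zmon x al)"
    using xj by (simp add: eq_neg_iff_add_eq_0)
   moreover have "\<Phi>1 (i, al) v = c (i, al)" if "al \<in> ?A" for al
    using that i by (intro \<Phi>1) (auto simp: idx_def piv_def)
   ultimately show ?thesis using i xv by (auto simp: \<Phi>_def piv_def)
  next
   case False
   then show ?thesis using \<Phi>1[OF a] by (simp add: \<Phi>_def)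
  qed
  then show ?thesis using polyon_cong_vars[OF \<phi>(1), of c "%a. \<Phi> a v"] \<phi>(3)[of v] by simp
 qed
 then show ?thesis using \<phi>(1,2) by blast
qed

text \<open>By homogeneity in the linear dependence, its nonzero coefficient can be normalized.\<close>

lemma generic_independent_at:
 fixes S :: "'n::finite set"
 assumes "j \<in> S" and d: "!!i. i < length d ==> 1 \<le> d ! i"
 shows "\<exists>\<phi>. polyon (idx d) \<phi> & (\<exists>v. \<phi> v ~= 0) &
  (\<forall>c x l. \<phi> c ~= 0 & x $ j = 1 & (\<forall>m. m \<notin> S --> x $ m = 0) & (\<forall>i<length d. hform c i (d ! i) x = 0) &
    (\<forall>m\<in>S - {j}. (\<Sum>i<length d. l i * dform c i (d ! i) m x) = 0) --> (\<forall>i<length d. l i = 0))"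
proof -
 define Q where "Q i0 \<phi> \<longleftrightarrow> polyon (idx d) \<phi> & (\<exists>v. \<phi> v ~= 0) &
  (\<forall>c x l. x $ j = 1 & (\<forall>m. m \<notin> S --> x $ m = 0) & (\<forall>i<length d. hform c i (d ! i) x = 0) &
    l i0 = 1 & (\<forall>m\<in>S - {j}. (\<Sum>i<length d. l i * dform c i (d ! i) m x) = 0) --> \<phi> c = 0)" for i0 \<phi>
 have "\<exists>\<phi>. Q i0 \<phi>" if "i0 < length d" for i0
  unfolding Q_def by (rule generic_no_dependence_normalized[OF assms(1) that d])
 then obtain \<phi> where "!!i0. i0 < length d ==> Q i0 (\<phi> i0)" by metis
 then have \<phi>: "!!i0. i0 < length d ==> polyon (idx d) (\<phi> i0)" "!!i0. i0 < length d ==> \<exists>v. \<phi> i0 v ~= 0"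
  and \<phi>0: "!!i0 c x l. i0 < length d ==> x $ j = 1 ==> (\<forall>m. m \<notin> S --> x $ m = 0) ==>
    (\<forall>i<length d. hform c i (d ! i) x = 0) ==> l i0 = 1 ==>
    (\<forall>m\<in>S - {j}. (\<Sum>i<length d. l i * dform c i (d ! i) m x) = 0) ==> \<phi> i0 c = 0"
  unfolding Q_def by blast+
 have "l i0 = 0" if nz: "(\<Prod>i0<length d. \<phi> i0 c) ~= 0" and x: "x $ j = 1" "\<forall>m. m \<notin> S --> x $ m = 0"
   "\<forall>i<length d. hform c i (d ! i) x = 0"
   and l: "\<forall>m\<in>S - {j}. (\<Sum>i<length d. l i * dform c i (d ! i) m x) = 0" and i0: "i0 < length d" for c x l i0
 proof (rule ccontr)
  assume l0: "l i0 ~= 0"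
  have "(\<Sum>i<length d. l i / l i0 * dform c i (d ! i) m x) = (\<Sum>i<length d. l i * dform c i (d ! i) m x) / l i0" for m
   by (simp add: sum_divide_distrib)
  then have "\<phi> i0 c = 0" using \<phi>0[OF i0 x, of "%i. l i / l i0"] l0 l by simp
  then show False using nz i0 by simp
 qed
 moreover have "polyon (idx d) (%c. \<Prod>i0<length d. \<phi> i0 c)" using \<phi>(1) by (intro polyon_intros) auto
 moreover have "\<exists>v. (\<Prod>i0<length d. \<phi> i0 v) ~= 0"
  using \<phi> by (intro polyon_common_nonzero_family[of _ "idx d"]) auto
 ultimately show ?thesis by blast
qed

text \<open>By homogeneity in \<open>x\<close>, any nonzero coordinate of \<open>x\<close> can be normalized.\<close>

lemma generic_independent:
 assumes d: "!!i. i < length d ==> 1 \<le> d ! i"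
 shows "\<exists>\<phi>. polyon (idx d) \<phi> & (\<exists>v. \<phi> v ~= 0) &
  (\<forall>c (x :: complex^'n::finite) l. \<phi> c ~= 0 & x ~= 0 & (\<forall>i<length d. hform c i (d ! i) x = 0) &
    (\<forall>m. (\<Sum>i<length d. l i * dform c i (d ! i) m x) = 0) --> (\<forall>i<length d. l i = 0))"
proof -
 define Q where "Q j \<phi> \<longleftrightarrow> polyon (idx d) \<phi> & (\<exists>v. \<phi> v ~= 0) &
  (\<forall>c x l. \<phi> c ~= 0 & x $ j = 1 & (\<forall>m. m \<notin> UNIV --> x $ m = 0) & (\<forall>i<length d. hform c i (d ! i) x = 0) &
    (\<forall>m\<in>UNIV - {j}. (\<Sum>i<length d. l i * dform c i (d ! i) m x) = 0) --> (\<forall>i<length d. l i = 0))"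
  for j :: 'n and \<phi>
 have "\<exists>\<phi>. Q j \<phi>" for j
  unfolding Q_def by (rule generic_independent_at[OF UNIV_I d])
 then obtain \<phi> where "!!j. Q j (\<phi> j)" by metis
 then have \<phi>: "!!j :: 'n. polyon (idx d) (\<phi> j)" "!!j. \<exists>v. \<phi> j v ~= 0"
  and \<phi>0: "!!j c x l. \<phi> j c ~= 0 ==> x $ j = 1 ==> (\<forall>i<length d. hform c i (d ! i) x = 0) ==>
    (\<forall>m\<in>UNIV - {j}. (\<Sum>i<length d. l i * dform c i (d ! i) m x) = 0) ==> (\<forall>i<length d. l i = 0)"
  unfolding Q_def by blast+
 have "\<forall>i<length d. l i = 0"
  if nz: "(\<Prod>j\<in>UNIV. \<phi> j c) ~= 0" and x: "x ~= 0" "\<forall>i<length d. hform c i (d ! i) x = 0"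
   and l: "\<forall>m. (\<Sum>i<length d. l i * dform c i (d ! i) m x) = 0" for c and x :: "complex^'n" and l
 proof -
  obtain j where j: "x $ j ~= 0" using x(1) by (auto simp: vec_eq_iff)
  define y where "y = (1 / x $ j) *s x"
  define l' where "l' i = l i * (x $ j) ^ (d ! i - 1)" for i
  have "dform c i (d ! i) m y = (1 / x $ j) ^ (d ! i - 1) * dform c i (d ! i) m x" for i m
   unfolding y_def by (rule dform_scale)
  then have "l' i * dform c i (d ! i) m y = l i * dform c i (d ! i) m x" for i m
   using j by (simp add: l'_def power_one_over)
  then have "\<forall>i<length d. l' i = 0"
   using \<phi>0[of j c y l'] nz x(2) j l by (simp add: y_def hform_scale)
  then show ?thesis using j by (simp add: l'_def)
 qed
 moreover have "polyon (idx d) (%c. \<Prod>j\<in>UNIV. \<phi> j c)" using \<phi>(1) by (intro polyon_intros) auto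
 moreover have "\<exists>v. (\<Prod>j\<in>UNIV. \<phi> j v) ~= 0"
  using \<phi> by (intro polyon_common_nonzero_family[of _ "idx d"]) auto
 ultimately show ?thesis by blast
qed

section \<open>Reduction of monomials modulo generic forms\<close>

text \<open>The variables \<open>\<iota> 0, \<dots>, \<iota> (p - 1)\<close> are the ones to be eliminated, called \<open>x\<close>-variables below;
 \<open>j0\<close> is one of the other variables, called \<open>y\<close>-variables.\<close>

locale elimination =
 fixes d :: "nat list" and \<iota> :: "nat => 'n::finite" and j0 :: 'n
 assumes inj_\<iota>: "inj_on \<iota> {..<length d}"
  and j0: "j0 \<notin> \<iota> ` {..<length d}"
  and d_pos: "!!i. i < length d ==> 1 \<le> d ! i"
begin

definition X :: "'n set" where "X = \<iota> ` {..<length d}"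

definition xmon :: "('n mon) => bool" where "xmon al \<longleftrightarrow> Poly_Mapping.keys al \<subseteq> X"

text \<open>The least degree in which every \<open>x\<close>-monomial has an exponent \<open>\<ge> d ! i\<close> at \<open>\<iota> i\<close> for some \<open>i\<close>.\<close>

definition topdeg :: nat where "topdeg = (\<Sum>i<length d. d ! i - 1) + 1"

definition red :: "('n mon) => bool" where
 "red al \<longleftrightarrow> (\<exists>i<length d. d ! i \<le> lkp al (\<iota> i))"

definition rix :: "('n mon) => nat" where
 "rix al = (LEAST i. i < length d & d ! i \<le> lkp al (\<iota> i))"

definition rest :: "('n mon) => ('n mon)" where
 "rest al = al - sgl (\<iota> (rix al)) (d ! rix al)"

text \<open>The part of the \<open>i\<close>-th form without \<open>y\<close>-variables.\<close>

definition F0 :: "(nat \<times> ('n mon) => complex) => nat => complex^'n => complex" where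
 "F0 c i x = (\<Sum>al | mdeg al = d ! i & xmon al. c (i, al) * zmon x al)"

definition bas :: "(nat \<times> ('n mon) => complex) => ('n mon) => complex^'n => complex" where
 "bas c al x = (if red al then zmon x (rest al) * F0 c (rix al) x else zmon x al)"

lemma rix:
 assumes "red al"
 shows "rix al < length d" "d ! rix al \<le> lkp al (\<iota> (rix al))"
proof -
 obtain i where "i < length d & d ! i \<le> lkp al (\<iota> i)"
  using assms unfolding red_def by blast
 then have "rix al < length d & d ! rix al \<le> lkp al (\<iota> (rix al))"
  unfolding rix_def by (rule LeastI)
 then show "rix al < length d" "d ! rix al \<le> lkp al (\<iota> (rix al))" by auto
qed

lemma rest_add:
 assumes "red al"
 shows "rest al + sgl (\<iota> (rix al)) (d ! rix al) = al"
 unfolding rest_def by (rule monom_diff_single_add[OF rix(2)[OF assms]])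

lemma \<iota>_in_X: "i < length d ==> \<iota> i \<in> X"
 by (simp add: X_def)

lemma xmon_add: "xmon (al + be) \<longleftrightarrow> xmon al & xmon be"
 unfolding xmon_def subset_iff in_keys_iff lookup_add by auto

lemma xmon_single: "m \<in> X ==> xmon (sgl m k)"
 by (simp add: xmon_def)

lemma xmon_rest: "xmon al ==> red al ==> xmon (rest al)"
 using rest_add xmon_add by metis

lemma degree_rest: "red al ==> mdeg (rest al) + d ! rix al = mdeg al"
 using arg_cong[OF rest_add, of al mdeg] by (simp add: monom_degree_add)

lemma xmon_degree:
 assumes "xmon al"
 shows "mdeg al = (\<Sum>i<length d. lkp al (\<iota> i))"
proof -
 have "mdeg al = (\<Sum>m\<in>X. lkp al m)"
  unfolding monom_degree_def using assms
  by (intro sum.mono_neutral_right) (auto simp: xmon_def in_keys_iff)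
 then show ?thesis unfolding X_def by (simp add: sum.reindex[OF inj_\<iota>])
qed

lemma red_if_large:
 assumes "xmon al" "topdeg \<le> mdeg al"
 shows "red al"
proof (rule ccontr)
 assume "\<not> red al"
 then have "lkp al (\<iota> i) \<le> d ! i - 1" if "i < length d" for i
  using that d_pos[of i] unfolding red_def by (metis One_nat_def Suc_pred le_simps(2) less_le_trans not_le zero_less_one)
 then have "mdeg al \<le> (\<Sum>i<length d. d ! i - 1)"
  unfolding xmon_degree[OF assms(1)] by (intro sum_mono) auto
 then show False using assms(2) by (simp add: topdeg_def)
qed

lemma finite_xmons: "finite {al. mdeg al = k & xmon al}"
 by (rule finite_subset[OF _ finite_monoms_of_degree[of k]]) auto

lemma bas_expansion:
 fixes A :: "('n mon) set"
 assumes A: "finite A" "!!ga. xmon ga ==> mdeg ga = mdeg al ==> ga \<in> A" and "xmon al"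
 shows "bas c al x = (\<Sum>ga\<in>A. (if red al then
   (if \<exists>de. ga = rest al + de & xmon de & mdeg de = d ! rix al then c (rix al, ga - rest al) else 0)
   else if ga = al then 1 else 0) * zmon x ga)"
proof (cases "red al")
 case False
 have "(\<Sum>ga\<in>A. (if ga = al then 1 else 0) * zmon x ga) = (\<Sum>ga\<in>A. if ga = al then zmon x ga else 0)"
  by (intro sum.cong) auto
 then show ?thesis using False A assms(3) by (simp add: bas_def)
next
 case True
 let ?D = "{de. mdeg de = d ! rix al & xmon de}"
 let ?h = "%ga. if \<exists>de. ga = rest al + de & xmon de & mdeg de = d ! rix al then c (rix al, ga - rest al) else 0"
 have inj: "inj_on ((+) (rest al)) ?D" by (auto simp: inj_on_def)
 have sub: "(+) (rest al) ` ?D \<subseteq> A"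
  using A(2) xmon_rest[OF assms(3) True] degree_rest[OF True] by (auto simp: xmon_add monom_degree_add)
 have "(\<Sum>ga\<in>A. ?h ga * zmon x ga) = (\<Sum>ga\<in>(+) (rest al) ` ?D. ?h ga * zmon x ga)"
  using A(1) sub by (intro sum.mono_neutral_right) auto
 also have "\<dots> = (\<Sum>de\<in>?D. ?h (rest al + de) * zmon x (rest al + de))"
  by (simp add: sum.reindex[OF inj] o_def)
 also have "\<dots> = (\<Sum>de\<in>?D. c (rix al, de) * (zmon x (rest al) * zmon x de))"
  by (intro sum.cong) (auto simp: zmon_add)
 also have "\<dots> = bas c al x"
  using True by (simp add: bas_def F0_def sum_distrib_left mult_ac)
 finally show ?thesis using True by simp
qed

text \<open>For \<open>F\<^sub>i = x\<^sub>i\<^bsup>d i\<^esup>\<close> the functions \<open>bas c al\<close> are the monomials themselves, so they span for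
 generic coefficients. Since the span is homogeneous, the representation can be chosen homogeneous.\<close>

lemma generic_reduction:
 "\<exists>\<phi>. polyon (idx d) \<phi> & (\<exists>v. \<phi> v ~= 0) &
  (\<forall>c al. \<phi> c ~= 0 & xmon al & mdeg al \<le> topdeg -->
   (\<exists>n. \<forall>x. zmon x al = (\<Sum>al' | mdeg al' = mdeg al & xmon al'. n al' * bas c al' x)))"
proof -
 define A where "A = {al. xmon al & mdeg al \<le> topdeg}"
 have "A = (\<Union>k\<le>topdeg. {al. mdeg al = k & xmon al})" by (auto simp: A_def)
 then have finA: "finite A" using finite_xmons by simp
 define m where "m ga al v = (if red al then
   (if \<exists>de. ga = rest al + de & xmon de & mdeg de = d ! rix al then v (rix al, ga - rest al) else 0)
   else if ga = al then 1 else 0)" for ga al and v :: "nat \<times> ('n mon) => complex"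
 define v0 where "v0 = (%(i, de). if de = sgl (\<iota> i) (d ! i) then 1 else 0 :: complex)"
 have "polyon (idx d) (m ga al)" for ga al
 proof (cases "red al")
  case True
  show ?thesis
  proof (cases "\<exists>de. ga = rest al + de & xmon de & mdeg de = d ! rix al")
   case t: True
   then obtain de where de: "ga = rest al + de" "mdeg de = d ! rix al" by blast
   have "m ga al = (%v. v (rix al, de))" using True t de(1) by (simp add: m_def fun_eq_iff)
   then show ?thesis using de(2) rix(1)[OF True] by (simp add: polyon_var idx_def)
  next
   case False
   have "m ga al = (%v. 0)" unfolding m_def by (simp only: True False if_True if_False)
   then show ?thesis by (simp add: polyon_const)
  qed
 next
  case False
  then have "m ga al = (%v. if ga = al then 1 else 0)" by (simp add: m_def fun_eq_iff)
  then show ?thesis by (simp add: polyon_const)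
 qed
 moreover have "m ga al v0 = (if ga = al then 1 else 0)" if "al \<in> A" for ga al
 proof (cases "red al")
  case True
  let ?s = "sgl (\<iota> (rix al)) (d ! rix al)"
  have s: "xmon ?s" "rest al + ?s = al" using rix(1)[OF True] rest_add[OF True] by (auto simp: xmon_single \<iota>_in_X)
  show ?thesis
  proof (cases "\<exists>de. ga = rest al + de & xmon de & mdeg de = d ! rix al")
   case t: True
   then obtain de where de: "ga = rest al + de" by blast
   have "de = ?s \<longleftrightarrow> ga = al" using s(2) de by (metis add_left_cancel)
   then show ?thesis using True t de by (simp add: m_def v0_def)
  next
   case False
   then have "ga ~= al" using s by (metis monom_degree_single)
   moreover have "m ga al v0 = 0" unfolding m_def by (simp only: True False if_True if_False)
   ultimately show ?thesis by simp
  qed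
 qed (simp add: m_def)
 ultimately obtain \<phi> where \<phi>: "polyon (idx d) \<phi>" "\<phi> v0 = 1"
  "!!v b. \<phi> v ~= 0 ==> \<exists>n. \<forall>al\<in>A. (\<Sum>be\<in>A. m al be v * n be) = b al"
  using generically_solvable_system[OF finA, of "idx d" m v0] by blast
 have "\<exists>n. \<forall>x. zmon x al = (\<Sum>al' | mdeg al' = mdeg al & xmon al'. n al' * bas c al' x)"
  if c: "\<phi> c ~= 0" and al: "xmon al" "mdeg al \<le> topdeg" for c al
 proof -
  obtain n where n: "!!ga. ga \<in> A ==> (\<Sum>be\<in>A. m ga be c * n be) = (if ga = al then 1 else 0)"
   using \<phi>(3)[OF c, of "%ga. if ga = al then 1 else 0"] by blast
  let ?B = "{al'. mdeg al' = mdeg al & xmon al'}"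
  have BA: "?B \<subseteq> A" using al(2) by (auto simp: A_def)
  have finB: "finite ?B" by (rule finite_xmons)
  have mdeg: "mdeg ga = mdeg be" if "m ga be c ~= 0" for ga be
   using that degree_rest[of be] by (auto simp: m_def monom_degree_add split: if_splits)
  have "zmon x al = (\<Sum>al'\<in>?B. n al' * bas c al' x)" for x
  proof -
   have "bas c be x = (\<Sum>ga\<in>?B. m ga be c * zmon x ga)" if "be \<in> ?B" for be
    unfolding m_def using that finB by (intro bas_expansion) auto
   then have "(\<Sum>be\<in>?B. n be * bas c be x) = (\<Sum>be\<in>?B. \<Sum>ga\<in>?B. n be * (m ga be c * zmon x ga))"
    by (simp add: sum_distrib_left)
   also have "\<dots> = (\<Sum>ga\<in>?B. (\<Sum>be\<in>?B. m ga be c * n be) * zmon x ga)"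
    by (subst sum.swap) (simp add: sum_distrib_left sum_distrib_right mult_ac)
   also have "\<dots> = (\<Sum>ga\<in>?B. (if ga = al then 1 else 0) * zmon x ga)"
   proof (intro sum.cong refl, goal_cases)
    case (1 ga)
    have "m ga be c = 0" if "be \<in> A - ?B" for be
     by (rule ccontr, drule mdeg) (use that 1 in \<open>auto simp: A_def\<close>)
    then have "(\<Sum>be\<in>?B. m ga be c * n be) = (\<Sum>be\<in>A. m ga be c * n be)"
     using BA finA by (intro sum.mono_neutral_left) auto
    then show ?case using n[of ga] 1 BA by auto
   qed
   also have "\<dots> = (\<Sum>ga\<in>?B. if ga = al then zmon x ga else 0)" by (intro sum.cong) auto
   also have "\<dots> = zmon x al" using finB al by simp
   finally show ?thesis ..
  qed
  then show ?thesis by blast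
 qed
 moreover have "\<exists>v. \<phi> v ~= 0" using \<phi>(2) by (intro exI[of _ v0]) simp
 ultimately show ?thesis using \<phi>(1) by blast
qed

end

section \<open>Calculus of smooth maps\<close>

lemma frechet_derivative_cong_open:
 assumes "open U" "x \<in> U" "!!y. y \<in> U ==> f y = g y"
 shows "FD f (at x) = FD g (at x)"
proof -
 have "(f has_derivative D) (at x) \<longleftrightarrow> (g has_derivative D) (at x)" for D
  using has_derivative_transform_within_open[OF _ assms(1,2), of f D UNIV g]
   has_derivative_transform_within_open[OF _ assms(1,2), of g D UNIV f] assms(3) by auto
 then show ?thesis by (simp add: frechet_derivative_def)
qed

lemma Ck_on_cong:
 assumes "open U" "!!x. x \<in> U ==> f x = g x" "Ck_on k U f"
 shows "Ck_on k U g"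
 using assms(2,3)
proof (induction k arbitrary: f g)
 case 0
 then have "continuous_on U f" by simp
 then have "continuous_on U g" by (rule continuous_on_eq) (rule 0(1))
 then show ?case by simp
next
 case (Suc k)
 have Df: "FD f (at x) = FD g (at x)" if "x \<in> U" for x
  using assms(1) that Suc.prems(1) by (rule frechet_derivative_cong_open)
 have f: "f differentiable_on U" "Ck_on k U (%x. FD f (at x) v)" for v
  using Suc.prems(2) by simp_all
 have "g differentiable_on U"
  unfolding differentiable_on_def
 proof
  fix x assume x: "x \<in> U"
  have "f differentiable (at x within U)" using f(1) x unfolding differentiable_on_def by blast
  then show "g differentiable (at x within U)"
   by (rule differentiable_transform_within[OF _ zero_less_one x]) (rule Suc.prems(1))
 qed
 moreover have "Ck_on k U (%x. FD g (at x) v)" for v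
  by (rule Suc.IH[OF _ f(2)]) (rule fun_cong[OF Df])
 ultimately show ?case by simp
qed

lemma Ck_on_has_derivative:
 assumes "Ck_on (Suc k) U f" "open U" "x \<in> U"
 shows "(f has_derivative FD f (at x)) (at x)"
proof -
 have "f differentiable (at x)"
  using assms by (simp add: differentiable_on_eq_differentiable_at)
 then show ?thesis by (simp add: frechet_derivative_works)
qed

lemma Ck_on_SucI:
 assumes "open U" "!!x. x \<in> U ==> (f has_derivative D x) (at x)"
  and "!!v. Ck_on k U (%x. D x v)"
 shows "Ck_on (Suc k) U f"
proof -
 have "f differentiable_on U"
  using assms(1,2) by (auto simp: differentiable_on_eq_differentiable_at differentiable_def)
 moreover have "FD f (at x) = D x" if "x \<in> U" for x
  using frechet_derivative_at[OF assms(2)[OF that]] by simp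
 then have "Ck_on k U (%x. FD f (at x) v)" for v
  by (intro Ck_on_cong[OF assms(1) _ assms(3)[of v]]) auto
 ultimately show ?thesis by simp
qed

lemma Ck_on_Suc_imp: "Ck_on (Suc k) U f ==> Ck_on k U f"
proof (induction k arbitrary: f)
 case 0
 then show ?case by (simp add: differentiable_imp_continuous_on)
next
 case (Suc k)
 then have "f differentiable_on U" "!!v. Ck_on (Suc k) U (%x. FD f (at x) v)"
  by (auto simp only: Ck_on.simps(2)[of "Suc k"])
 then show ?case using Suc.IH by (simp only: Ck_on.simps(2)[of k]) blast
qed

lemma Ck_on_subset: "Ck_on k U f ==> V \<subseteq> U ==> Ck_on k V f"
proof (induction k arbitrary: f)
 case 0 then show ?case using continuous_on_subset by simp
next
 case (Suc k)
 then have "f differentiable_on V" "!!v. Ck_on k V (%x. FD f (at x) v)"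
  using differentiable_on_subset by auto
 then show ?case by simp
qed

lemma Ck_on_const: "open U ==> Ck_on k U (%x. c)"
proof (induction k arbitrary: c)
 case (Suc k)
 show ?case by (rule Ck_on_SucI[OF \<open>open U\<close> has_derivative_const Suc.IH[OF \<open>open U\<close>]])
qed simp

lemma Ck_on_bounded_linear:
 assumes "bounded_linear f" "open U"
 shows "Ck_on k U f"
proof (cases k)
 case 0
 then show ?thesis using linear_continuous_on[OF assms(1)] by simp
next
 case (Suc l)
 show ?thesis
  unfolding Suc by (rule Ck_on_SucI[OF assms(2) bounded_linear_imp_has_derivative[OF assms(1)] Ck_on_const[OF assms(2)]])
qed

lemma Ck_on_add:
 assumes "open U" "Ck_on k U f" "Ck_on k U g"
 shows "Ck_on k U (%x. f x + g x)"
 using assms(2,3)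
proof (induction k arbitrary: f g)
 case 0 then show ?case by (simp add: continuous_on_add)
next
 case (Suc k)
 show ?case
 proof (rule Ck_on_SucI[OF assms(1)])
  show "((%x. f x + g x) has_derivative (%v. FD f (at x) v + FD g (at x) v)) (at x)"
   if "x \<in> U" for x
   using Ck_on_has_derivative[OF Suc.prems(1) assms(1) that] Ck_on_has_derivative[OF Suc.prems(2) assms(1) that]
   by (rule has_derivative_add)
  show "Ck_on k U (%x. FD f (at x) v + FD g (at x) v)" for v
   using Suc.prems by (intro Suc.IH) auto
 qed
qed

lemma Ck_on_sum:
 assumes "open U" "!!a. a \<in> A ==> Ck_on k U (f a)"
 shows "Ck_on k U (%x. \<Sum>a\<in>A. f a x)"
 using assms(2)
proof (induction A rule: infinite_finite_induct)
 case (insert a A)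
 then show ?case
  using Ck_on_add[OF assms(1), of k "f a" "%x. \<Sum>a\<in>A. f a x"] by simp
qed (simp_all add: Ck_on_const assms(1))

lemma Ck_on_bilinear:
 assumes "bounded_bilinear prd" "open U" "Ck_on k U f" "Ck_on k U g"
 shows "Ck_on k U (%x. prd (f x) (g x))"
 using assms(3,4)
proof (induction k arbitrary: f g)
 case 0 then show ?case by (simp add: bounded_bilinear.continuous_on[OF assms(1)])
next
 case (Suc k)
 show ?case
 proof (rule Ck_on_SucI[OF assms(2)])
  show "((%x. prd (f x) (g x)) has_derivative
    (%v. prd (f x) (FD g (at x) v) + prd (FD f (at x) v) (g x))) (at x)"
   if "x \<in> U" for x
   using bounded_bilinear.FDERIV[OF assms(1) Ck_on_has_derivative[OF Suc.prems(1) assms(2) that]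
     Ck_on_has_derivative[OF Suc.prems(2) assms(2) that]] .
  show "Ck_on k U (%x. prd (f x) (FD g (at x) v) + prd (FD f (at x) v) (g x))" for v
   by (intro Ck_on_add[OF assms(2)] Suc.IH Ck_on_Suc_imp[OF Suc.prems(1)] Ck_on_Suc_imp[OF Suc.prems(2)])
    (use Suc.prems in simp_all)
 qed
qed

lemma linear_basis_expansion:
 fixes v :: "'a::euclidean_space"
 assumes "linear D"
 shows "D v = (\<Sum>b\<in>Basis. (v \<bullet> b) *\<^sub>R D b)"
proof -
 have "D (\<Sum>b\<in>Basis. (v \<bullet> b) *\<^sub>R b) = (\<Sum>b\<in>Basis. (v \<bullet> b) *\<^sub>R D b)"
  using assms by (simp add: linear_sum linear_cmul o_def)
 then show ?thesis by (simp add: euclidean_representation)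
qed

lemma derivative_basis_expansion:
 fixes v :: "'a::euclidean_space"
 assumes "(f has_derivative D) F"
 shows "D v = (\<Sum>b\<in>Basis. (v \<bullet> b) *\<^sub>R D b)"
 using linear_basis_expansion[OF has_derivative_linear[OF assms]] .

lemma Ck_on_compose:
 fixes f :: "'b::euclidean_space => 'c::euclidean_space" and g :: "'a::euclidean_space => 'b"
 assumes "open U" "open V" "g ` U \<subseteq> V" "Ck_on k V f" "Ck_on k U g"
 shows "Ck_on k U (%x. f (g x))"
 using assms(4,5)
proof (induction k arbitrary: f)
 case 0
 then have "continuous_on V f" "continuous_on U g" by simp_all
 then have "continuous_on U (%x. f (g x))" using assms(3) by (rule continuous_on_compose2)
 then show ?case by simp
next
 case (Suc k)
 let ?Df = "%y. FD f (at y)" and ?Dg = "%y. FD g (at y)"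
 show ?case
 proof (rule Ck_on_SucI[OF assms(1)])
  fix x assume x: "x \<in> U"
  have f: "(f has_derivative ?Df (g x)) (at (g x))"
   using x assms(3) by (intro Ck_on_has_derivative[OF Suc.prems(1) assms(2)]) auto
  have "((%x. f (g x)) has_derivative (%v. ?Df (g x) (?Dg x v))) (at x)"
   using has_derivative_compose[OF Ck_on_has_derivative[OF Suc.prems(2) assms(1) x] f] .
  moreover have "(%v. ?Df (g x) (?Dg x v)) = (%v. \<Sum>b\<in>Basis. (?Dg x v \<bullet> b) *\<^sub>R ?Df (g x) b)"
   by (rule ext) (rule derivative_basis_expansion[OF f])
  ultimately show "((%x. f (g x)) has_derivative (%v. \<Sum>b\<in>Basis. (?Dg x v \<bullet> b) *\<^sub>R ?Df (g x) b)) (at x)"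
   by (simp only:)
 next
  fix v
  have "Ck_on k U (%x. ?Dg x v \<bullet> b)" for b
   using Suc.prems(2) by (intro Ck_on_bilinear[OF bounded_bilinear_inner assms(1)] Ck_on_const[OF assms(1)]) auto
  moreover have "Ck_on k U (%x. ?Df (g x) b)" for b
   by (intro Suc.IH Ck_on_Suc_imp[OF Suc.prems(2)]) (use Suc.prems(1) in simp)
  ultimately show "Ck_on k U (%x. \<Sum>b\<in>Basis. (?Dg x v \<bullet> b) *\<^sub>R ?Df (g x) b)"
   by (intro Ck_on_sum[OF assms(1)] Ck_on_bilinear[OF bounded_bilinear_scaleR assms(1)])
 qed
qed

lemma Ck_on_linear_compose:
 assumes "bounded_linear L" "open U" "Ck_on k U f"
 shows "Ck_on k U (%x. L (f x))"
 using Ck_on_compose[OF assms(2) open_UNIV _ Ck_on_bounded_linear[OF assms(1) open_UNIV] assms(3)] by simp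

subsection \<open>Inverses\<close>

lemma has_derivative_vanishing_scaleR:
 fixes f :: "'a::real_normed_vector => real" and g :: "'a => 'b::real_normed_vector"
 assumes f: "(f has_derivative D) (at x)" "f x = 0" and g: "isCont g x"
 shows "((%y. f y *\<^sub>R g y) has_derivative (%h. D h *\<^sub>R g x)) (at x)"
proof -
 interpret D: bounded_linear D using f(1) by (rule has_derivative_bounded_linear)
 obtain K where K: "!!h. norm (D h) \<le> norm h * K" "K > 0" using D.pos_bounded by blast
 define q where "q h = norm (f (x + h) - f x - D h) / norm h" for h
 have lim: "(q \<longlongrightarrow> 0) (at 0)"
  using f(1) unfolding has_derivative_at q_def by blast
 have gl: "((%h. g (x + h)) \<longlongrightarrow> g x) (at 0)"
  using g unfolding isCont_iff .
 have "((%h. q h * norm (g (x + h)) + K * norm (g (x + h) - g x)) \<longlongrightarrow> 0 * norm (g x) + K * norm (g x - g x)) (at 0)"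
  by (intro tendsto_add tendsto_mult tendsto_norm tendsto_diff tendsto_const lim gl)
 then have bnd: "((%h. q h * norm (g (x + h)) + K * norm (g (x + h) - g x)) \<longlongrightarrow> 0) (at 0)"
  by simp
 have le: "norm (f (x + h) *\<^sub>R g (x + h) - f x *\<^sub>R g x - D h *\<^sub>R g x) / norm h \<le>
    q h * norm (g (x + h)) + K * norm (g (x + h) - g x)" if h: "h ~= 0" for h
 proof -
  have "f (x + h) *\<^sub>R g (x + h) - f x *\<^sub>R g x - D h *\<^sub>R g x =
    (f (x + h) - f x - D h) *\<^sub>R g (x + h) + D h *\<^sub>R (g (x + h) - g x)"
   using f(2) by (simp add: scaleR_left_diff_distrib scaleR_right_diff_distrib)
  also have "norm \<dots> \<le> norm (f (x + h) - f x - D h) * norm (g (x + h)) + norm (D h) * norm (g (x + h) - g x)"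
   by (metis norm_scaleR norm_triangle_ineq real_norm_def)
  also have "\<dots> \<le> norm (f (x + h) - f x - D h) * norm (g (x + h)) + (norm h * K) * norm (g (x + h) - g x)"
   using K(1)[of h] by (intro add_left_mono mult_right_mono) auto
  also have "\<dots> = norm h * (q h * norm (g (x + h)) + K * norm (g (x + h) - g x))"
   using h by (simp add: q_def distrib_left)
  finally show ?thesis using h by (simp add: pos_divide_le_eq mult.commute)
 qed
 have "((%h. norm (f (x + h) *\<^sub>R g (x + h) - f x *\<^sub>R g x - D h *\<^sub>R g x) / norm h) \<longlongrightarrow> 0) (at 0)"
  by (rule Lim_null_comparison[OF _ bnd]) (auto simp: eventually_at_filter intro!: always_eventually le)
 moreover have "bounded_linear (%h. D h *\<^sub>R g x)"
  by (rule bounded_linear_compose[OF bounded_linear_scaleR_left D.bounded_linear_axioms])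
 ultimately show ?thesis unfolding has_derivative_at by blast
qed

lemma linear_inv_bij:
 fixes A :: "'a::euclidean_space => 'a"
 assumes "linear A" "bij A"
 shows "linear (inv A)" "A (inv A b) = b" "inv A (A b) = b"
proof -
 show 1: "A (inv A b) = b" for b using assms(2) by (simp add: bij_is_surj surj_f_inv_f)
 show 2: "inv A (A b) = b" for b using assms(2) by (simp add: bij_is_inj)
 have "inv A (b + c) = inv A b + inv A c" for b c
  using 2[of "inv A b + inv A c"] linear_add[OF assms(1), of "inv A b" "inv A c"] by (simp add: 1)
 moreover have "inv A (r *\<^sub>R b) = r *\<^sub>R inv A b" for r b
  using 2[of "r *\<^sub>R inv A b"] linear_cmul[OF assms(1), of r "inv A b"] by (simp add: 1)
 ultimately show "linear (inv A)" by (intro linearI) auto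
qed

lemma isCont_inverse_linear:
 fixes A :: "'w::euclidean_space => 'a::euclidean_space => 'a"
 assumes "open W" "x0 \<in> W" and A: "!!x. x \<in> W ==> linear (A x)" "!!x. x \<in> W ==> bij (A x)"
  and cont: "!!c. continuous_on W (%x. A x c)"
 shows "isCont (%x. inv (A x) b) x0"
proof -
 obtain B where B: "B > 0" "!!w. norm (A x0 w) \<ge> B * norm w"
  using linear_inj_bounded_below_pos[OF A(1)[OF assms(2)] bij_is_inj[OF A(2)[OF assms(2)]]] by (metis mult.commute)
 have cA: "((%x. A x c) \<longlongrightarrow> A x0 c) (at x0)" for c
  using cont[of c] assms(1,2) by (simp add: continuous_on_eq_continuous_at isCont_def)
 let ?e = "%x. \<Sum>c\<in>Basis. norm (A x c - A x0 c)"
 have "(?e \<longlongrightarrow> (\<Sum>c\<in>(Basis :: 'a set). 0)) (at x0)"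
  using cA by (intro tendsto_sum tendsto_norm_zero) (simp add: LIM_zero_iff)
 then have "\<forall>\<^sub>F x in at x0. ?e x < B / 2" using B(1) by (intro order_tendstoD(2)[of _ 0]) auto
 moreover have "\<forall>\<^sub>F x in at x0. x \<in> W" using assms(1,2) by (rule eventually_at_in_open')
 ultimately have ev: "\<forall>\<^sub>F x in at x0. norm (inv (A x) b - inv (A x0) b) \<le> 2 / B * norm (A x (inv (A x0) b) - b)"
 proof eventually_elim
  case (elim x)
  have op: "norm (A x w - A x0 w) \<le> norm w * (B / 2)" for w
  proof -
   have "linear (%w. A x w - A x0 w)" using A(1) elim assms(2) by (intro linear_compose_sub) auto
   then have "A x w - A x0 w = (\<Sum>c\<in>Basis. (w \<bullet> c) *\<^sub>R (A x c - A x0 c))"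
    by (rule linear_basis_expansion)
   also have "norm \<dots> \<le> (\<Sum>c\<in>Basis. norm w * norm (A x c - A x0 c))"
    by (intro sum_norm_le) (auto intro!: mult_right_mono Basis_le_norm)
   also have "\<dots> = norm w * ?e x" by (simp add: sum_distrib_left)
   also have "\<dots> \<le> norm w * (B / 2)" using elim(1) by (intro mult_left_mono) auto
   finally show ?thesis .
  qed
  let ?w = "inv (A x) b - inv (A x0) b"
  have lin: "A x ?w = b - A x (inv (A x0) b)"
   using A[OF elim(2)] by (simp add: linear_diff linear_inv_bij)
  have "B * norm ?w \<le> norm (A x0 ?w)" by (rule B(2))
  also have "\<dots> \<le> norm (A x ?w) + norm (A x ?w - A x0 ?w)"
   by (metis add.commute norm_minus_commute norm_triangle_sub)
  also have "\<dots> \<le> norm (A x ?w) + norm ?w * (B / 2)" using op by simp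
  finally have "B / 2 * norm ?w \<le> norm (A x ?w)" by (simp add: algebra_simps)
  then show ?case unfolding lin using B(1) by (simp add: field_simps norm_minus_commute)
 qed
 have "((%x. A x (inv (A x0) b) - b) \<longlongrightarrow> 0) (at x0)"
  using cA[of "inv (A x0) b"] linear_inv_bij(2)[OF A(1,2), OF assms(2) assms(2)] by (simp add: LIM_zero_iff)
 then have "((%x. 2 / B * norm (A x (inv (A x0) b) - b)) \<longlongrightarrow> 0) (at x0)"
  using tendsto_mult_left[OF tendsto_norm_zero, of _ _ "2 / B"] by fastforce
 then have "((%x. norm (inv (A x) b - inv (A x0) b)) \<longlongrightarrow> 0) (at x0)"
  by (rule Lim_null_comparison[rotated]) (use ev in simp)
 then show ?thesis by (simp add: isCont_def LIM_zero_iff tendsto_norm_zero_iff)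
qed

lemma Ck_on_inverse_linear:
 fixes A :: "'w::euclidean_space => 'a::euclidean_space => 'a"
 assumes "open W" and A: "!!x. x \<in> W ==> linear (A x)" "!!x. x \<in> W ==> bij (A x)"
  and Ck: "!!c. Ck_on k W (%x. A x c)"
 shows "Ck_on k W (%x. inv (A x) b)"
 using Ck
proof (induction k arbitrary: b)
 case 0
 then show ?case
  using isCont_inverse_linear[OF assms(1) _ A] by (simp add: continuous_on_eq_continuous_at[OF assms(1)])
next
 case (Suc k)
 let ?D = "%x v c. FD (%x. A x c) (at x) v"
 have cont: "continuous_on W (%x. A x c)" for c
  using Suc.prems[of c] by (auto intro: differentiable_imp_continuous_on)
 show ?case
 proof (rule Ck_on_SucI[OF assms(1)])
  fix x assume x: "x \<in> W"
  let ?u = "inv (A x) b"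
  have der: "((%y. A y c) has_derivative (%v. ?D x v c)) (at x)" for c
   using Ck_on_has_derivative[OF Suc.prems[of c] assms(1) x] .
  have f: "((%y. (A y ?u - b) \<bullet> c2) has_derivative (%v. ?D x v ?u \<bullet> c2)) (at x)" for c2
   by (auto intro!: derivative_eq_intros der)
  have "((%y. ?u - (\<Sum>c2\<in>Basis. ((A y ?u - b) \<bullet> c2) *\<^sub>R inv (A y) c2)) has_derivative
    (%v. 0 - (\<Sum>c2\<in>Basis. (?D x v ?u \<bullet> c2) *\<^sub>R inv (A x) c2))) (at x)"
   using x A by (intro has_derivative_diff has_derivative_const has_derivative_sum
     has_derivative_vanishing_scaleR[OF f] isCont_inverse_linear[OF assms(1) x A cont])
    (auto simp: linear_inv_bij)
  moreover have "?u - (\<Sum>c2\<in>Basis. ((A y ?u - b) \<bullet> c2) *\<^sub>R inv (A y) c2) = inv (A y) b" if "y \<in> W" for y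
  proof -
   have lin: "linear (inv (A y))" using A that by (simp add: linear_inv_bij)
   have "(\<Sum>c2\<in>Basis. ((A y ?u - b) \<bullet> c2) *\<^sub>R inv (A y) c2) = inv (A y) (A y ?u - b)"
    by (rule linear_basis_expansion[OF lin, symmetric])
   also have "\<dots> = ?u - inv (A y) b" using lin A that by (simp add: linear_diff linear_inv_bij)
   finally show ?thesis by simp
  qed
  ultimately have D1: "((%y. inv (A y) b) has_derivative (%v. 0 - (\<Sum>c2\<in>Basis. (?D x v ?u \<bullet> c2) *\<^sub>R inv (A x) c2))) (at x)"
   by (rule has_derivative_transform_within_open[OF _ assms(1) x])
  have D2: "?D x v ?u = (\<Sum>c1\<in>Basis. (?u \<bullet> c1) *\<^sub>R ?D x v c1)" for v
  proof -
   have "((%y. \<Sum>c1\<in>Basis. (?u \<bullet> c1) *\<^sub>R A y c1) has_derivative (%v. \<Sum>c1\<in>Basis. (?u \<bullet> c1) *\<^sub>R ?D x v c1)) (at x)"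
    by (intro has_derivative_sum has_derivative_scaleR_right der)
   moreover have "(\<Sum>c1\<in>Basis. (?u \<bullet> c1) *\<^sub>R A y c1) = A y ?u" if "y \<in> W" for y
    by (rule linear_basis_expansion[OF A(1)[OF that], symmetric])
   ultimately have "((%y. A y ?u) has_derivative (%v. \<Sum>c1\<in>Basis. (?u \<bullet> c1) *\<^sub>R ?D x v c1)) (at x)"
    by (rule has_derivative_transform_within_open[OF _ assms(1) x])
   then have "(%v. ?D x v ?u) = (%v. \<Sum>c1\<in>Basis. (?u \<bullet> c1) *\<^sub>R ?D x v c1)"
    by (rule has_derivative_unique[OF der])
   then show ?thesis by (rule fun_cong)
  qed
  show "((%y. inv (A y) b) has_derivative
    (%v. - (\<Sum>c2\<in>Basis. ((\<Sum>c1\<in>Basis. (inv (A x) b \<bullet> c1) *\<^sub>R ?D x v c1) \<bullet> c2) *\<^sub>R inv (A x) c2))) (at x)"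
   using D1 unfolding D2 diff_0 .
 next
  fix v
  have inv: "Ck_on k W (%x. inv (A x) c)" for c
   by (intro Suc.IH Ck_on_Suc_imp[OF Suc.prems])
  have D: "Ck_on k W (%x. ?D x v c)" for c using Suc.prems[of c] by simp
  have "Ck_on k W (%x. (\<Sum>c2\<in>Basis. ((\<Sum>c1\<in>Basis. (inv (A x) b \<bullet> c1) *\<^sub>R ?D x v c1) \<bullet> c2) *\<^sub>R inv (A x) c2))"
   by (intro Ck_on_sum[OF assms(1)] Ck_on_bilinear[OF bounded_bilinear_scaleR assms(1)]
     Ck_on_bilinear[OF bounded_bilinear_inner assms(1)] Ck_on_const[OF assms(1)] inv D)
  then show "Ck_on k W (%x. - (\<Sum>c2\<in>Basis. ((\<Sum>c1\<in>Basis. (inv (A x) b \<bullet> c1) *\<^sub>R ?D x v c1) \<bullet> c2) *\<^sub>R inv (A x) c2))"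
   by (rule Ck_on_linear_compose[OF bounded_linear_minus[OF bounded_linear_ident] assms(1)])
 qed
qed

lemma diffeomorphism_restrict:
 assumes "diffeomorphism V W \<Phi> \<Psi>" "open V'" "V' \<subseteq> V"
 shows "diffeomorphism V' (\<Phi> ` V') \<Phi> \<Psi>" "open (\<Phi> ` V')"
proof -
 have hom: "homeomorphism V W \<Phi> \<Psi>" and op: "open V" "open W" using assms(1) by (auto simp: diffeomorphism_def)
 have sub: "\<Phi> ` V' \<subseteq> W" using assms(3) hom by (auto simp: homeomorphism_def)
 have "openin (top_of_set W) (\<Phi> ` V')"
  by (rule homeomorphism_imp_open_map[OF hom]) (use assms(2,3) op in \<open>simp add: openin_open_eq\<close>)
 then show op': "open (\<Phi> ` V')" using op by (simp add: openin_open_eq)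
 have "homeomorphism V' (\<Phi> ` V') \<Phi> \<Psi>"
  by (rule homeomorphism_of_subsets[OF hom assms(3) order_refl refl])
 then show "diffeomorphism V' (\<Phi> ` V') \<Phi> \<Psi>"
  unfolding diffeomorphism_def
 proof (intro conjI allI)
  show "Ck_on k V' \<Phi>" "Ck_on k (\<Phi> ` V') \<Psi>" for k
   using assms(1) by (auto simp: diffeomorphism_def intro: Ck_on_subset[OF _ assms(3)] Ck_on_subset[OF _ sub])
 qed (use assms(2) op' in auto)
qed

lemma diffeomorphism_derivatives:
 assumes "diffeomorphism V W \<Phi> \<Psi>" "x \<in> V"
 defines "D \<equiv> FD \<Phi> (at x)" and "E \<equiv> FD \<Psi> (at (\<Phi> x))"
 shows "(\<Phi> has_derivative D) (at x)" "(\<Psi> has_derivative E) (at (\<Phi> x))"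
  "!!v. E (D v) = v" "!!v. D (E v) = v" "linear D" "linear E"
proof -
 have hom: "homeomorphism V W \<Phi> \<Psi>" and op: "open V" "open W"
  and Ck: "Ck_on (Suc 0) V \<Phi>" "Ck_on (Suc 0) W \<Psi>"
  using assms(1) by (auto simp: diffeomorphism_def simp del: Ck_on.simps)
 have y: "\<Phi> x \<in> W" "\<Psi> (\<Phi> x) = x" using hom assms(2) by (auto simp: homeomorphism_def)
 show D: "(\<Phi> has_derivative D) (at x)" unfolding D_def using Ck_on_has_derivative[OF Ck(1) op(1) assms(2)] .
 show E: "(\<Psi> has_derivative E) (at (\<Phi> x))" unfolding E_def using Ck_on_has_derivative[OF Ck(2) op(2) y(1)] .
 have "((%z. \<Psi> (\<Phi> z)) has_derivative (%v. E (D v))) (at x)" by (rule has_derivative_compose[OF D E])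
 then have "((%z. z) has_derivative (%v. E (D v))) (at x)"
  by (rule has_derivative_transform_within_open[OF _ op(1) assms(2)]) (use hom in \<open>auto simp: homeomorphism_def\<close>)
 then have "(%v. E (D v)) = (%v. v)" using has_derivative_unique has_derivative_ident by blast
 then show "E (D v) = v" for v by (rule fun_cong)
 have D': "(\<Phi> has_derivative D) (at (\<Psi> (\<Phi> x)))" using D y by simp
 have "((%z. \<Phi> (\<Psi> z)) has_derivative (%v. D (E v))) (at (\<Phi> x))" by (rule has_derivative_compose[OF E D'])
 then have "((%z. z) has_derivative (%v. D (E v))) (at (\<Phi> x))"
  by (rule has_derivative_transform_within_open[OF _ op(2) y(1)]) (use hom in \<open>auto simp: homeomorphism_def\<close>)
 then have "(%v. D (E v)) = (%v. v)" using has_derivative_unique has_derivative_ident by blast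
 then show "D (E v) = v" for v by (rule fun_cong)
 show "linear D" "linear E" using D E has_derivative_linear by auto
qed

text \<open>The inverse function theorem gives a differentiable inverse. Its derivative is the inverse of the derivative at the preimage, so its smoothness follows by induction from that of matrix inversion.\<close>

lemma smooth_inverse_function:
 fixes f :: "'a::euclidean_space => 'a"
 assumes "open U" "x0 \<in> U" and smooth: "!!k. Ck_on k U f"
  and inj: "!!v. FD f (at x0) v = 0 ==> v = 0"
 obtains V W g where "V \<subseteq> U" "x0 \<in> V" "diffeomorphism V W f g"
proof -
 have der: "(f has_derivative FD f (at x)) (at x)" if "x \<in> U" for x
  using Ck_on_has_derivative[OF smooth assms(1) that] .
 define f' where "f' x = Blinfun (FD f (at x))" for x
 have f': "blinfun_apply (f' x) = FD f (at x)" if "x \<in> U" for x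
  unfolding f'_def by (rule bounded_linear_Blinfun_apply[OF has_derivative_bounded_linear[OF der[OF that]]])
 have "continuous_on U (%x. FD f (at x) v)" for v using smooth[of "Suc 0"] by simp
 then have "continuous_on U (%x. blinfun_apply (f' x) v)" for v
  using continuous_on_cong[of U U "%x. FD f (at x) v" "%x. blinfun_apply (f' x) v"] f' by simp
 then have contf: "continuous_on U f'" by (intro continuous_on_blinfun_componentwise)
 have lin: "linear (FD f (at x0))" using der[OF assms(2)] has_derivative_linear by blast
 have "inj (FD f (at x0))" using lin inj by (simp add: linear_injective_0)
 then obtain h where h: "linear h" "!!x. h (FD f (at x0) x) = x"
  using linear_injective_left_inverse[OF lin] by (metis comp_apply id_apply)
 have "Blinfun h o\<^sub>L f' x0 = id_blinfun"
  by (rule blinfun_eqI) (use h f'[OF assms(2)] in \<open>simp add: bounded_linear_Blinfun_apply linear_conv_bounded_linear\<close>)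
 then obtain V W g g' where VW: "open V" "V \<subseteq> U" "x0 \<in> V" "open W" "homeomorphism V W f g"
  and g': "!!y. y \<in> W ==> (g has_derivative (g' y)) (at y)"
   "!!y. y \<in> W ==> g' y = inv (blinfun_apply (f' (g y)))" "!!y. y \<in> W ==> bij (blinfun_apply (f' (g y)))"
  using inverse_function_theorem[OF assms(1) _ contf assms(2), of f "Blinfun h"] der f' by metis
 have gW: "g y \<in> V" if "y \<in> W" for y using VW(5) that by (auto simp: homeomorphism_def)
 have "Ck_on k W g" for k
 proof (induction k)
  case 0 then show ?case using VW(5) by (simp add: homeomorphism_def)
 next
  case (Suc k)
  let ?A = "%y. FD f (at (g y))"
  show ?case
  proof (rule Ck_on_SucI[OF VW(4)])
   show "(g has_derivative inv (?A y)) (at y)" if "y \<in> W" for y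
    using g'(1,2)[OF that] f'[of "g y"] gW[OF that] VW(2) by auto
   show "Ck_on k W (%y. inv (?A y) v)" for v
   proof (rule Ck_on_inverse_linear[OF VW(4)])
    show "linear (?A y)" if "y \<in> W" for y
     using der[of "g y"] gW[OF that] VW(2) has_derivative_linear by blast
    show "bij (?A y)" if "y \<in> W" for y
     using g'(3)[OF that] f'[of "g y"] gW[OF that] VW(2) by auto
    have "Ck_on k U (%x. FD f (at x) c)" for c using smooth[of "Suc k"] by simp
    then show "Ck_on k W (%y. ?A y c)" for c
     using gW VW(2) Suc
     by (intro Ck_on_compose[OF VW(4) assms(1), where f = "%x. FD f (at x) c" and g = g]) auto
   qed
  qed
 qed
 then have "diffeomorphism V W f g"
  using VW Ck_on_subset[OF smooth VW(2)] by (simp add: diffeomorphism_def)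
 then show ?thesis using that VW by blast
qed

section \<open>Power series and their blow-ups\<close>

definition hcomp :: "((('n::finite) mon) => complex) => nat => complex^'n => complex" where
 "hcomp a k u = (\<Sum>al | mdeg al = k. a al * zmon u al)"

definition dcomp :: "((('n::finite) mon) => complex) => nat => 'n => complex^'n => complex" where
 "dcomp a k m u = (\<Sum>al | mdeg al = k. a al * dmono m u al)"

definition hnorm :: "((('n::finite) mon) => complex) => nat => real" where
 "hnorm a k = (\<Sum>al | mdeg al = k. cmod (a al))"

definition converges :: "real => ((('n::finite) mon) => complex) => bool" where
 "converges R a \<longleftrightarrow> (\<forall>\<rho>. 0 \<le> \<rho> & \<rho> < R --> summable (%k. hnorm a k * \<rho> ^ k))"

definition order_ge :: "int => ((('n::finite) mon) => complex) => bool" where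
 "order_ge e a \<longleftrightarrow> (\<forall>al. int (mdeg al) < e --> a al = 0)"

text \<open>If \<open>a\<close> are the Taylor coefficients of \<open>f\<close> and vanish in degrees below \<open>e\<close>, then
 \<open>blowup e a (t, u) = f (t u) / t^e\<close>, extended to \<open>t = 0\<close>. Negative \<open>e\<close> are allowed so that the
 functions of this form are closed under partial derivatives.\<close>

definition blowup :: "int => ((('n::finite) mon) => complex) => real \<times> (complex^'n) => complex" where
 "blowup e a = (%(t, u). suminf (%k. of_real t ^ nat (int k - e) * hcomp a k u))"

definition box2 :: "real => (real \<times> (complex^'n)) set" where
 "box2 ep = {(t, u). \<bar>t\<bar> < ep & (\<forall>m. cmod (u $ m) < 2)}"

definition radial_coeffs :: "int => ((('n::finite) mon) => complex) => ('n mon) => complex" where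
 "radial_coeffs e a al = of_int (int (mdeg al) - e) * a al"

definition directional_coeffs ::
 "complex^'n => ((('n::finite) mon) => complex) => ('n mon) => complex" where
 "directional_coeffs v a be =
   (\<Sum>m\<in>UNIV. v $ m * (of_nat (Suc (lkp be m)) * a (be + sgl m 1)))"

lemma open_box2: "open (box2 ep :: (real \<times> (complex^'n::finite)) set)"
proof -
 have "box2 ep = {x :: real \<times> (complex^'n). \<bar>fst x\<bar> < ep} \<inter> (\<Inter>m. {x. cmod (snd x $ m) < 2})"
  by (auto simp: box2_def)
 also have "open \<dots>"
  by (intro open_Int open_INT ballI open_Collect_less continuous_intros) auto
 finally show ?thesis .
qed

lemma convex_box2: "convex (box2 ep :: (real \<times> (complex^'n::finite)) set)"
proof (rule convexI)
 fix x y :: "real \<times> (complex^'n)" and r s :: real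
 assume xy: "x \<in> box2 ep" "y \<in> box2 ep" and rs: "0 \<le> r" "0 \<le> s" "r + s = 1"
 have "r *\<^sub>R fst x + s *\<^sub>R fst y \<in> ball 0 ep"
  using xy by (intro convexD[OF convex_ball _ _ rs]) (auto simp: box2_def)
 moreover have "r *\<^sub>R (snd x $ m) + s *\<^sub>R (snd y $ m) \<in> ball 0 2" for m
  using xy by (intro convexD[OF convex_ball _ _ rs]) (auto simp: box2_def)
 ultimately show "r *\<^sub>R x + s *\<^sub>R y \<in> box2 ep" unfolding box2_def mem_Collect_eq case_prod_beta by simp
qed

lemma hnorm_nonneg: "0 \<le> hnorm a k"
 by (simp add: hnorm_def sum_nonneg)

lemma hcomp_order: "order_ge e a ==> int k < e ==> hcomp a k u = 0"
 by (auto simp: hcomp_def order_ge_def intro: sum.neutral)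

lemma dcomp_order: "order_ge e a ==> int k < e ==> dcomp a k m u = 0"
 by (auto simp: dcomp_def order_ge_def intro: sum.neutral)

lemma norm_zmon_le:
 fixes s :: real
 assumes "!!m. cmod (u $ m) \<le> s"
 shows "cmod (zmon u al) \<le> s ^ mdeg al"
proof -
 have "cmod (zmon u al) = (\<Prod>m\<in>UNIV. cmod (u $ m) ^ lkp al m)"
  by (simp add: zmon_def norm_power flip: prod_norm)
 also have "\<dots> \<le> (\<Prod>m\<in>UNIV. s ^ lkp al m)"
  using assms by (intro prod_mono) (auto intro: power_mono)
 finally show ?thesis by (simp add: monom_degree_def power_sum)
qed

lemma norm_dmono_le:
 fixes s :: real
 assumes "!!m. cmod (u $ m) \<le> s" "1 \<le> s"
 shows "cmod (dmono m u al) \<le> mdeg al * s ^ mdeg al"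
proof -
 have "cmod (zmon u (al - sgl m 1)) \<le> s ^ mdeg (al - sgl m 1)"
  by (rule norm_zmon_le[OF assms(1)])
 also have "\<dots> \<le> s ^ mdeg al"
  using assms(2) by (intro power_increasing) (auto simp: monom_degree_def lookup_minus intro: sum_mono)
 finally show ?thesis
  using lookup_le_monom_degree[of al m] assms(2)
  unfolding dmono_def norm_mult norm_of_nat by (intro mult_mono) auto
qed

lemma norm_hcomp_le:
 assumes "!!m. cmod (u $ m) \<le> s"
 shows "cmod (hcomp a k u) \<le> hnorm a k * s ^ k"
proof -
 have "cmod (hcomp a k u) \<le> (\<Sum>al | mdeg al = k. cmod (a al) * s ^ k)"
  unfolding hcomp_def using norm_zmon_le[OF assms]
  by (intro sum_norm_le) (auto simp: norm_mult intro!: mult_left_mono)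
 then show ?thesis by (simp add: hnorm_def sum_distrib_right)
qed

lemma norm_dcomp_le:
 assumes "!!m. cmod (u $ m) \<le> s" "1 \<le> s"
 shows "cmod (dcomp a k m u) \<le> k * (hnorm a k * s ^ k)"
proof -
 have "cmod (dcomp a k m u) \<le> (\<Sum>al | mdeg al = k. cmod (a al) * (k * s ^ k))"
  unfolding dcomp_def using norm_dmono_le[OF assms]
  by (intro sum_norm_le) (auto simp: norm_mult intro!: mult_left_mono)
 then show ?thesis by (simp add: hnorm_def sum_distrib_left sum_distrib_right mult_ac)
qed

lemma hcomp_radial: "hcomp (radial_coeffs e a) k u = of_int (int k - e) * hcomp a k u"
 by (simp add: hcomp_def radial_coeffs_def sum_distrib_left mult_ac)

lemma dcomp_zero: "dcomp a 0 m u = 0"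
 by (simp add: dcomp_def dmono_def monom_degree_eq_0_iff)

lemma hcomp_directional:
 "hcomp (directional_coeffs v a) k u = (\<Sum>m\<in>UNIV. v $ m * dcomp a (Suc k) m u)"
proof -
 have "dcomp a (Suc k) m u =
   (\<Sum>be | mdeg be = k. of_nat (Suc (lkp be m)) * a (be + sgl m 1) * zmon u be)" for m
 proof -
  let ?h = "%be :: 'a mon. be + sgl m 1"
  have "{al. mdeg al = Suc k & lkp al m ~= 0} = ?h ` {be. mdeg be = k}"
  proof (intro subset_antisym subsetI)
   fix al assume "al \<in> {al. mdeg al = Suc k & lkp al m ~= 0}"
   then have "?h (al - sgl m 1) = al" "mdeg (al - sgl m 1) = k"
    using monom_diff_single_add[of 1 al m] monom_degree_diff_single[of 1 al m] by auto
   then show "al \<in> ?h ` {be. mdeg be = k}" by (intro image_eqI[of _ _ "al - sgl m 1"]) auto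
  qed (auto simp: monom_degree_add lookup_add)
  moreover have "inj_on ?h {be. mdeg be = k}" by (auto simp: inj_on_def)
  moreover have "dcomp a (Suc k) m u =
    (\<Sum>al | mdeg al = Suc k & lkp al m ~= 0. a al * dmono m u al)"
   unfolding dcomp_def using finite_monoms_of_degree
   by (intro sum.mono_neutral_right) (auto simp: dmono_def)
  ultimately show ?thesis
   by (simp add: sum.reindex dmono_def lookup_add mult_ac)
 qed
 then show ?thesis
  by (simp add: hcomp_def directional_coeffs_def sum_distrib_left sum_distrib_right sum.swap[of _ UNIV] mult_ac)
qed

lemma hnorm_directional_le:
 "hnorm (directional_coeffs v a) k \<le> (\<Sum>m\<in>UNIV. cmod (v $ m)) * (Suc k * hnorm a (Suc k))"
proof -
 have "hnorm (directional_coeffs v a) k \<le> (\<Sum>be | mdeg be = k. \<Sum>m\<in>UNIV. cmod (v $ m) * (Suc k * cmod (a (be + sgl m 1))))"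
  unfolding hnorm_def
 proof (rule sum_mono)
  fix be :: "'a mon" assume "be \<in> {be. mdeg be = k}"
  then have "lkp be m \<le> k" for m using lookup_le_monom_degree[of be m] by simp
  then show "cmod (directional_coeffs v a be) \<le> (\<Sum>m\<in>UNIV. cmod (v $ m) * (Suc k * cmod (a (be + sgl m 1))))"
   unfolding directional_coeffs_def
   by (intro sum_norm_le) (auto simp: norm_mult simp del: of_nat_Suc intro!: mult_left_mono mult_right_mono)
 qed
 also have "\<dots> = (\<Sum>m\<in>UNIV. cmod (v $ m) * (Suc k * (\<Sum>be | mdeg be = k. cmod (a (be + sgl m 1)))))"
  by (simp add: sum.swap[of _ UNIV] sum_distrib_left)
 also have "\<dots> \<le> (\<Sum>m\<in>UNIV. cmod (v $ m) * (Suc k * hnorm a (Suc k)))"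
 proof (intro sum_mono mult_left_mono)
  fix m
  have "(\<Sum>be | mdeg be = k. cmod (a (be + sgl m 1))) =
    (\<Sum>al\<in>(%be. be + sgl m 1) ` {be. mdeg be = k}. cmod (a al))"
   by (subst sum.reindex) (auto simp: inj_on_def)
  also have "\<dots> \<le> hnorm a (Suc k)"
   unfolding hnorm_def using finite_monoms_of_degree by (intro sum_mono2) (auto simp: monom_degree_add)
  finally show "(\<Sum>be | mdeg be = k. cmod (a (be + sgl m 1))) \<le> hnorm a (Suc k)" .
 qed auto
 finally show ?thesis by (simp add: sum_distrib_right)
qed

lemma converges_times_index:
 assumes "converges R a" "0 \<le> \<rho>" "\<rho> < R"
 shows "summable (%k. real (Suc k) * hnorm a (Suc k) * \<rho> ^ k)" "summable (%k. real k * hnorm a k * \<rho> ^ k)"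
proof -
 have "summable (%n. diffs (hnorm a) n * \<rho> ^ n)"
 proof (rule termdiff_converges[of \<rho> R])
  show "norm \<rho> < R" using assms by simp
  fix x :: real assume x: "norm x < R"
  then have "summable (%k. hnorm a k * \<bar>x\<bar> ^ k)" using assms(1) by (simp add: converges_def)
  then have "summable (%n. norm (hnorm a n * x ^ n))"
   by (simp add: abs_mult power_abs hnorm_nonneg)
  then show "summable (%n. hnorm a n * x ^ n)" by (rule summable_norm_cancel)
 qed
 then show *: "summable (%k. real (Suc k) * hnorm a (Suc k) * \<rho> ^ k)" by (simp add: diffs_def)
 have "summable (%k. real (Suc k) * hnorm a (Suc k) * \<rho> ^ Suc k)"
  using summable_mult[OF *, of \<rho>] by (simp add: mult_ac)
 then show "summable (%k. real k * hnorm a k * \<rho> ^ k)"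
  by (rule summable_Suc_iff[THEN iffD1])
qed

lemma converges_radial:
 assumes "converges R a" shows "converges R (radial_coeffs e a)"
 unfolding converges_def
proof clarify
 fix \<rho> :: real assume \<rho>: "0 \<le> \<rho>" "\<rho> < R"
 have "hnorm (radial_coeffs e a) k \<le> (real k + \<bar>of_int e\<bar>) * hnorm a k" for k
  unfolding hnorm_def sum_distrib_left
  by (rule sum_mono) (auto simp: radial_coeffs_def norm_mult intro!: mult_right_mono norm_triangle_le_diff)
 then have le: "hnorm (radial_coeffs e a) k * \<rho> ^ k \<le> real k * hnorm a k * \<rho> ^ k + \<bar>of_int e\<bar> * (hnorm a k * \<rho> ^ k)" for k
  using mult_right_mono[of _ _ "\<rho> ^ k"] \<rho>(1) by (fastforce simp: algebra_simps)
 show "summable (%k. hnorm (radial_coeffs e a) k * \<rho> ^ k)"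
 proof (rule summable_comparison_test')
  show "summable (%k. real k * hnorm a k * \<rho> ^ k + \<bar>of_int e\<bar> * (hnorm a k * \<rho> ^ k))"
   using converges_times_index(2)[OF assms \<rho>] assms \<rho> by (intro summable_add summable_mult) (auto simp: converges_def)
  show "norm (hnorm (radial_coeffs e a) k * \<rho> ^ k) \<le> real k * hnorm a k * \<rho> ^ k + \<bar>of_int e\<bar> * (hnorm a k * \<rho> ^ k)" for k
   using le[of k] \<rho>(1) hnorm_nonneg[of "radial_coeffs e a" k] by (simp add: abs_mult)
 qed
qed

lemma converges_directional:
 assumes "converges R a" shows "converges R (directional_coeffs v a)"
 unfolding converges_def
proof clarify
 fix \<rho> :: real assume \<rho>: "0 \<le> \<rho>" "\<rho> < R"
 let ?V = "\<Sum>m\<in>UNIV. cmod (v $ m)"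
 show "summable (%k. hnorm (directional_coeffs v a) k * \<rho> ^ k)"
 proof (rule summable_comparison_test')
  show "summable (%k. ?V * (real (Suc k) * hnorm a (Suc k) * \<rho> ^ k))"
   using converges_times_index(1)[OF assms \<rho>] by (intro summable_mult)
  show "norm (hnorm (directional_coeffs v a) k * \<rho> ^ k) \<le> ?V * (real (Suc k) * hnorm a (Suc k) * \<rho> ^ k)" for k
   using mult_right_mono[OF hnorm_directional_le[of v a k], of "\<rho> ^ k"] \<rho>(1) hnorm_nonneg[of "directional_coeffs v a" k]
   by (simp add: mult_ac del: of_nat_Suc)
 qed
qed

lemma order_radial: "order_ge e a ==> order_ge (e + 1) (radial_coeffs e a)"
 unfolding order_ge_def radial_coeffs_def
proof (intro allI impI)
 fix al :: "'a mon"
 assume a: "\<forall>al. int (mdeg al) < e --> a al = 0" "int (mdeg al) < e + 1"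
 then show "of_int (int (mdeg al) - e) * a al = 0"
  by (cases "int (mdeg al) = e") auto
qed

lemma order_directional: "order_ge e a ==> order_ge (e - 1) (directional_coeffs v a)"
 by (auto simp: order_ge_def directional_coeffs_def monom_degree_add intro!: sum.neutral)

lemma has_derivative_suminf:
 fixes f :: "nat => 'a::real_normed_vector => 'b::banach"
 assumes "convex S" "open S" "x \<in> S" and f: "!!n x. x \<in> S ==> (f n has_derivative f' n x) (at x)"
  and bound: "!!n x h. x \<in> S ==> norm (f' n x h) \<le> B n * norm h" and "summable B"
  and sums: "!!x. x \<in> S ==> summable (%n. f n x)"
 shows "((%x. suminf (%n. f n x)) has_derivative (%h. suminf (%n. f' n x h))) (at x)"
proof -
 have sumf': "summable (%n. norm (f' n x h))" if "x \<in> S" for x h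
  by (rule summable_comparison_test'[OF summable_mult2[OF \<open>summable B\<close>, of "norm h"]])
    (use bound[OF that] in simp)
 have "\<exists>g. \<forall>x\<in>S. (%n. f n x) sums (g x) & (g has_derivative (%h. suminf (%n. f' n x h))) (at x within S)"
 proof (rule has_derivative_series[OF assms(1) has_derivative_at_withinI[OF f] _ \<open>x \<in> S\<close> summable_sums[OF sums[OF \<open>x \<in> S\<close>]]])
  fix e :: real assume "e > 0"
  have "(%n. suminf (%i. B (i + n))) \<longlonglongrightarrow> 0"
   using suminf_exist_split[of _ B] assms(6) suminf_split_head tendsto_diff[OF tendsto_const summable_LIMSEQ[OF assms(6)], of "suminf B"]
   by (simp add: suminf_minus_initial_segment)
  then have "\<forall>\<^sub>F n in sequentially. (suminf (%i. B (i + n))) < e" using \<open>e > 0\<close> by (rule order_tendstoD)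
  then show "\<forall>\<^sub>F n in sequentially. \<forall>x\<in>S. \<forall>h. norm ((\<Sum>i<n. f' i x h) - (suminf (%n. f' n x h))) \<le> e * norm h"
  proof eventually_elim
   case (elim n)
   show ?case
   proof (intro ballI allI)
    fix x h assume x: "x \<in> S"
    have s: "summable (%n. f' n x h)" using sumf'[OF x] by (rule summable_norm_cancel)
    have s2: "summable (%i. B (i + n) * norm h)" using summable_ignore_initial_segment[OF assms(6)] by (intro summable_mult2)
    have s3: "summable (%i. norm (f' (i + n) x h))" using sumf'[OF x, of h] by (subst summable_iff_shift)
    have "norm ((\<Sum>i<n. f' i x h) - (suminf (%n. f' n x h))) = norm (suminf (%i. f' (i + n) x h))"
     using suminf_minus_initial_segment[OF s, of n] by (simp add: norm_minus_commute)
    also have "\<dots> \<le> (suminf (%i. norm (f' (i + n) x h)))" using s3 by (rule summable_norm)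
    also have "\<dots> \<le> (suminf (%i. B (i + n) * norm h))" using bound[OF x] s2 s3 by (intro suminf_le) auto
    also have "\<dots> = (suminf (%i. B (i + n))) * norm h"
     using summable_ignore_initial_segment[OF assms(6)] by (rule suminf_mult2[symmetric])
    also have "\<dots> \<le> e * norm h" using elim by (intro mult_right_mono) auto
    finally show "norm ((\<Sum>i<n. f' i x h) - (suminf (%n. f' n x h))) \<le> e * norm h" .
   qed
  qed
 qed
 then obtain g where g: "!!x. x \<in> S ==> (%n. f n x) sums (g x)" "!!x. x \<in> S ==> (g has_derivative (%h. suminf (%n. f' n x h))) (at x within S)"
  by blast
 have "(g has_derivative (%h. suminf (%n. f' n x h))) (at x)" using g(2)[OF assms(3)] unfolding at_within_open[OF assms(3,2)] .
 then show ?thesis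
  by (rule has_derivative_transform_within_open[OF _ assms(2,3)]) (rule sums_unique[OF g(1)])
qed

lemma zmon_has_derivative:
 "((%u. zmon u al) has_derivative (%v. \<Sum>m\<in>UNIV. v $ m * dmono m u al)) (at u)"
proof -
 have "((%u. u $ m ^ lkp al m) has_derivative
   (%v. of_nat (lkp al m) * v $ m * u $ m ^ (lkp al m - 1))) (at u)" for m
  by (rule has_derivative_power) (rule bounded_linear_imp_has_derivative[OF bounded_linear_vec_nth])
 then have "((%u. \<Prod>m\<in>UNIV. u $ m ^ lkp al m) has_derivative
   (%v. \<Sum>m\<in>UNIV. of_nat (lkp al m) * v $ m * u $ m ^ (lkp al m - 1) *
    (\<Prod>l\<in>UNIV - {m}. u $ l ^ lkp al l))) (at u)"
  by (intro has_derivative_prod)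
 moreover have "of_nat (lkp al m) * v $ m * u $ m ^ (lkp al m - 1) *
    (\<Prod>l\<in>UNIV - {m}. u $ l ^ lkp al l) = v $ m * dmono m u al" for m v
 proof -
  have "zmon u (al - sgl m 1) = u $ m ^ (lkp al m - 1) *
    (\<Prod>l\<in>UNIV - {m}. u $ l ^ lkp al l)"
   unfolding zmon_def by (subst prod.remove[of _ m]) (auto simp: lookup_minus lookup_single when_def intro!: prod.cong)
  then show ?thesis by (simp add: dmono_def)
 qed
 ultimately show ?thesis unfolding zmon_def by (simp only:)
qed

lemma hcomp_has_derivative:
 "(hcomp a k has_derivative (%v. \<Sum>m\<in>UNIV. v $ m * dcomp a k m u)) (at u)"
proof -
 have "((%u. \<Sum>al | mdeg al = k. a al * zmon u al) has_derivative
   (%v. \<Sum>al | mdeg al = k. a al * (\<Sum>m\<in>UNIV. v $ m * dmono m u al))) (at u)"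
  by (intro has_derivative_sum has_derivative_mult_right zmon_has_derivative)
 moreover have "(\<Sum>al | mdeg al = k. a al * (\<Sum>m\<in>UNIV. v $ m * dmono m u al)) = (\<Sum>m\<in>UNIV. v $ m * dcomp a k m u)" for v
  by (simp add: dcomp_def sum_distrib_left sum.swap[of _ UNIV] mult_ac)
 ultimately show ?thesis unfolding hcomp_def by simp
qed

lemma pow_shift_bound:
 fixes ep :: real
 assumes "0 < ep" "e \<le> int k"
 shows "ep ^ nat (int k - e) = ep powi (- e) * ep ^ k"
proof -
 have "ep ^ nat (int k - e) = ep powi (- e + int k)" using assms(2) by (simp add: power_int_def)
 also have "\<dots> = ep powi (- e) * ep powi int k" using assms(1) by (subst power_int_add) auto
 finally show ?thesis by simp
qed

lemma blowup_summable:
 assumes "converges R a" "order_ge e a" "2 * ep \<le> R" "(t, u) \<in> box2 ep"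
 shows "summable (%k. of_real t ^ nat (int k - e) * hcomp a k u)"
proof -
 obtain ep' where ep': "0 < ep'" "ep' < ep" "\<bar>t\<bar> < ep'"
  using dense[of "\<bar>t\<bar>" ep] assms(4) by (auto simp: box2_def) (metis abs_ge_zero le_less_trans)
 have "summable (%k. ep' powi (- e) * (hnorm a k * (2 * ep') ^ k))"
  by (rule summable_mult, rule assms(1)[unfolded converges_def, rule_format]) (use assms(3) ep' in auto)
 then show ?thesis
 proof (rule summable_comparison_test')
  fix k :: nat
  show "norm (of_real t ^ nat (int k - e) * hcomp a k u) \<le> ep' powi (- e) * (hnorm a k * (2 * ep') ^ k)"
  proof (cases "int k < e")
   case True
   have "0 \<le> ep' powi (- e) * (hnorm a k * (2 * ep') ^ k)"
    using ep' by (intro mult_nonneg_nonneg hnorm_nonneg zero_le_power zero_le_power_int) auto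
   then show ?thesis using hcomp_order[OF assms(2) True] by simp
  next
   case False
   have "cmod (of_real t ^ nat (int k - e)) \<le> ep' ^ nat (int k - e)"
    using ep' by (simp add: norm_power power_mono)
   moreover have "cmod (hcomp a k u) \<le> hnorm a k * 2 ^ k"
    using assms(4) by (intro norm_hcomp_le) (auto simp: box2_def intro: less_imp_le)
   ultimately have "cmod (of_real t ^ nat (int k - e)) * cmod (hcomp a k u) \<le> ep' ^ nat (int k - e) * (hnorm a k * 2 ^ k)"
    by (intro mult_mono) (use ep' in auto)
   then show ?thesis
    using False ep' by (simp add: norm_mult pow_shift_bound power_mult_distrib mult_ac)
  qed
 qed
qed

lemma blowup_has_derivative:
 fixes a :: "(('n::finite) mon) => complex"
 assumes "converges R a" "order_ge e a" "2 * ep \<le> R" "x \<in> box2 ep"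
 shows "(blowup e a has_derivative (%(\<tau>, v). of_real \<tau> * blowup (e + 1) (radial_coeffs e a) x +
   blowup (e - 1) (directional_coeffs v a) x)) (at x)"
proof -
 obtain t u where x: "x = (t, u)" by (cases x)
 obtain ep' where ep': "0 < ep'" "ep' < ep" "\<bar>t\<bar> < ep'"
  using dense[of "\<bar>t\<bar>" ep] assms(4) x by (auto simp: box2_def) (metis abs_ge_zero le_less_trans)
 define f where "f k = (%(t, u). of_real t ^ nat (int k - e) * hcomp a k u)" for k
 define D1 where "D1 k = (%(t :: real, u :: complex^'n). of_nat (nat (int k - e)) * of_real t ^ (nat (int k - e) - 1) * hcomp a k u)" for k
 define D2 where "D2 k = (%(t :: real, u :: complex^'n) v. of_real t ^ nat (int k - e) * (\<Sum>m\<in>UNIV. v $ m * dcomp a k m u))" for k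
 define f' where "f' k x h = of_real (fst h) * D1 k x + D2 k x (snd h)" for k x h
 have xS: "x \<in> box2 ep'" using assms(4) ep' x by (auto simp: box2_def)
 have der: "(f k has_derivative f' k x) (at x)" for k x
 proof -
  have A: "((%x :: real \<times> (complex^'n). of_real (fst x) ^ nat (int k - e) :: complex) has_derivative
    (%h. of_nat (nat (int k - e)) * of_real (fst h) * of_real (fst x) ^ (nat (int k - e) - 1))) (at x)"
   by (rule has_derivative_power) (auto intro!: derivative_eq_intros has_derivative_of_real)
  have B: "((%x. hcomp a k (snd x)) has_derivative (%h. \<Sum>m\<in>UNIV. snd h $ m * dcomp a k m (snd x))) (at x)"
   using has_derivative_compose[OF has_derivative_snd[OF has_derivative_ident] hcomp_has_derivative] .
  show ?thesis
   using has_derivative_mult[OF A B] unfolding f_def f'_def D1_def D2_def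
   by (simp add: split_beta' mult_ac add.commute)
 qed
 have split: "f' k x (\<tau>, v) = of_real \<tau> * D1 k x + D2 k x v" for k x \<tau> v by (simp add: f'_def)
 define M where "M = (1 + inverse ep') * ep' powi (- e)"
 have Mpos: "0 \<le> ep' powi (- e)" "0 \<le> M" using ep' by (auto simp: M_def)
 define B where "B k = (real CARD('n) + 1) * M * ((real k + \<bar>of_int e\<bar>) * (hnorm a k * (2 * ep') ^ k))" for k
 have "norm (f' k y h) \<le> B k * norm h" if y: "y \<in> box2 ep'" for k y h
 proof (cases "int k < e")
  case True
  then have "f' k y h = 0"
   using hcomp_order[OF assms(2)] dcomp_order[OF assms(2)] by (simp add: f'_def D1_def D2_def case_prod_beta)
  moreover have "0 \<le> B k" using Mpos ep' hnorm_nonneg[of a k] by (simp add: B_def)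
  ultimately show ?thesis by simp
 next
  case False
  obtain s w where sw: "y = (s, w)" by (cases y)
  have s: "\<bar>s\<bar> \<le> ep'" and w: "!!m. cmod (w $ m) \<le> 2" using y sw by (auto simp: box2_def intro: less_imp_le)
  let ?q = "nat (int k - e)" and ?H = "hnorm a k * 2 ^ k"
  have H0: "0 \<le> ?H" using hnorm_nonneg[of a k] by simp
  have kq: "real ?q \<le> real k + \<bar>of_int e\<bar>" using False by linarith
  have pe: "ep' ^ ?q * ?H = ep' powi (- e) * (hnorm a k * (2 * ep') ^ k)"
   using False ep' by (simp add: pow_shift_bound power_mult_distrib mult_ac)
  have H1: "0 \<le> ep' ^ ?q * ?H" using ep' H0 by simp
  have D1: "cmod (D1 k y) \<le> (real k + \<bar>of_int e\<bar>) * (inverse ep' * (ep' ^ ?q * ?H))"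
  proof (cases "?q = 0")
   case True then show ?thesis using ep' H0 by (simp add: D1_def sw)
  next
   case False
   have "ep' ^ (?q - 1) = inverse ep' * ep' ^ ?q"
    using False ep' by (cases ?q) (auto simp: field_simps)
   moreover have "\<bar>s\<bar> ^ (?q - 1) \<le> ep' ^ (?q - 1)" using s by (intro power_mono) auto
   moreover have "cmod (hcomp a k w) \<le> ?H" using w by (rule norm_hcomp_le)
   ultimately have "\<bar>s\<bar> ^ (?q - 1) * cmod (hcomp a k w) \<le> inverse ep' * ep' ^ ?q * ?H"
    using ep' by (intro mult_mono) auto
   then have "real ?q * (\<bar>s\<bar> ^ (?q - 1) * cmod (hcomp a k w)) \<le> (real k + \<bar>of_int e\<bar>) * (inverse ep' * ep' ^ ?q * ?H)"
    by (rule mult_mono[OF kq]) auto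
   then show ?thesis by (simp add: D1_def sw norm_mult norm_power mult_ac)
  qed
  have D2: "cmod (D2 k y v) \<le> real CARD('n) * norm v * ((real k + \<bar>of_int e\<bar>) * (ep' ^ ?q * ?H))" for v
  proof -
   have "cmod (\<Sum>m\<in>UNIV. v $ m * dcomp a k m w) \<le> (\<Sum>m\<in>(UNIV :: 'n set). norm v * (real k * ?H))"
   proof (rule sum_norm_le)
    fix m
    show "cmod (v $ m * dcomp a k m w) \<le> norm v * (real k * ?H)"
     unfolding norm_mult using norm_dcomp_le[OF w, of a k m] Finite_Cartesian_Product.norm_nth_le[of v m] by (intro mult_mono) auto
   qed
   then have "cmod (\<Sum>m\<in>UNIV. v $ m * dcomp a k m w) \<le> real CARD('n) * (norm v * (real k * ?H))" by simp
   also have "\<dots> \<le> real CARD('n) * (norm v * ((real k + \<bar>of_int e\<bar>) * ?H))"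
    using H0 by (intro mult_left_mono mult_right_mono) auto
   finally have "\<bar>s\<bar> ^ ?q * cmod (\<Sum>m\<in>UNIV. v $ m * dcomp a k m w) \<le> ep' ^ ?q * (real CARD('n) * (norm v * ((real k + \<bar>of_int e\<bar>) * ?H)))"
    using s ep' by (intro mult_mono power_mono) auto
   then show ?thesis by (simp add: D2_def sw norm_mult norm_power mult_ac)
  qed
  let ?Z = "(real k + \<bar>of_int e\<bar>) * (ep' ^ ?q * ?H)"
  have Z0: "0 \<le> ?Z" using H1 by simp
  have "norm (f' k y h) \<le> \<bar>fst h\<bar> * cmod (D1 k y) + cmod (D2 k y (snd h))"
   unfolding f'_def by (rule norm_triangle_le) (simp add: norm_mult)
  also have "\<dots> \<le> norm h * (inverse ep' * ?Z) + real CARD('n) * norm h * ?Z"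
  proof (intro add_mono)
   show "\<bar>fst h\<bar> * cmod (D1 k y) \<le> norm h * (inverse ep' * ?Z)"
    using D1 norm_fst_le[of "fst h" "snd h"] ep' Z0 by (intro mult_mono) (auto simp: mult_ac)
   have "cmod (D2 k y (snd h)) \<le> real CARD('n) * norm (snd h) * ?Z" by (rule D2)
   also have "\<dots> \<le> real CARD('n) * norm h * ?Z"
    using norm_snd_le[of "snd h" "fst h"] Z0 by (intro mult_right_mono mult_left_mono) auto
   finally show "cmod (D2 k y (snd h)) \<le> real CARD('n) * norm h * ?Z" .
  qed
  also have "\<dots> = (inverse ep' + real CARD('n)) * (?Z * norm h)" by (simp add: algebra_simps)
  also have "\<dots> \<le> ((real CARD('n) + 1) * (1 + inverse ep')) * (?Z * norm h)"
   by (rule mult_right_mono[OF _ mult_nonneg_nonneg[OF Z0 norm_ge_zero]]) (use ep' in \<open>simp add: algebra_simps\<close>)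
  also have "\<dots> = B k * norm h"
   unfolding B_def M_def pe by (simp add: mult_ac)
  finally show ?thesis .
 qed
 moreover have "summable B"
 proof -
  have "2 * ep' < R" "0 \<le> 2 * ep'" using ep' assms(3) by auto
  then have "summable (%k. hnorm a k * (2 * ep') ^ k)" "summable (%k. real k * hnorm a k * (2 * ep') ^ k)"
   using converges_times_index(2)[OF assms(1), of "2 * ep'"] assms(1) unfolding converges_def by blast+
  then have "summable (%k. real k * hnorm a k * (2 * ep') ^ k + \<bar>of_int e\<bar> * (hnorm a k * (2 * ep') ^ k))"
   by (intro summable_add summable_mult)
  then have "summable (%k. (real k + \<bar>of_int e\<bar>) * (hnorm a k * (2 * ep') ^ k))" by (simp add: algebra_simps)
  then show ?thesis unfolding B_def by (rule summable_mult)
 qed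
 moreover have "summable (%k. f k y)" if "y \<in> box2 ep'" for y
  using that ep' blowup_summable[OF assms(1,2), of ep' "fst y" "snd y"] assms(3) by (simp add: f_def case_prod_beta)
 ultimately have main: "((%x. suminf (%k. f k x)) has_derivative (%h. suminf (%k. f' k x h))) (at x)"
  by (intro has_derivative_suminf[OF convex_box2 open_box2 xS der])
 have "(suminf (%k. f' k x (\<tau>, v))) = of_real \<tau> * blowup (e + 1) (radial_coeffs e a) x + blowup (e - 1) (directional_coeffs v a) x" for \<tau> v
 proof -
  have D1: "D1 k x = of_real t ^ nat (int k - (e + 1)) * hcomp (radial_coeffs e a) k u" for k
  proof (cases "int k \<le> e")
   case True
   then show ?thesis using hcomp_order[OF assms(2), of k] by (cases "int k = e") (auto simp: D1_def x hcomp_radial)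
  next
   case False
   then have "nat (int k - e) - 1 = nat (int k - (e + 1))" "of_nat (nat (int k - e)) = (of_int (int k - e) :: complex)"
    by (auto simp: of_nat_nat)
   then show ?thesis by (simp add: D1_def x hcomp_radial mult_ac)
  qed
  have D2: "D2 (Suc k) x v = of_real t ^ nat (int k - (e - 1)) * hcomp (directional_coeffs v a) k u" for k
   by (simp add: D2_def x hcomp_directional algebra_simps)
  have D20: "D2 0 x v = 0" by (simp add: D2_def x dcomp_zero)
  have s1: "summable (%k. D1 k x)"
   unfolding D1 using blowup_summable[OF converges_radial[OF assms(1)] order_radial[OF assms(2)] assms(3)] assms(4) x by blast
  have s2: "summable (%k. D2 (Suc k) x v)"
   unfolding D2 using blowup_summable[OF converges_directional[OF assms(1)] order_directional[OF assms(2)] assms(3)] assms(4) x by blast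
  then have s2': "summable (%k. D2 k x v)" by (rule summable_Suc_iff[THEN iffD1])
  have "(suminf (%k. f' k x (\<tau>, v))) = of_real \<tau> * (suminf (%k. D1 k x)) + (suminf (%k. D2 k x v))"
   unfolding split using s1 s2' by (simp add: suminf_add[symmetric] suminf_mult[symmetric] summable_mult)
  also have "(suminf (%k. D2 k x v)) = (suminf (%k. D2 (Suc k) x v))"
   using suminf_split_head[OF s2'] D20 by simp
  finally show ?thesis unfolding D1 D2 by (simp add: blowup_def x)
 qed
 then have "(%h. suminf (%k. f' k x h)) = (%(\<tau>, v). of_real \<tau> * blowup (e + 1) (radial_coeffs e a) x +
   blowup (e - 1) (directional_coeffs v a) x)" by (intro ext) (simp only: split_paired_all prod.case)
 moreover have "(%x. suminf (%k. f k x)) = blowup e a" by (simp add: f_def blowup_def fun_eq_iff)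
 ultimately show ?thesis using main by (simp only:)
qed

text \<open>Derivatives of blow-ups are sums of blow-ups, so smoothness follows by induction.\<close>

lemma Ck_on_blowup:
 fixes a :: "(('n::finite) mon) => complex"
 assumes "converges R a" "order_ge e a" "2 * ep \<le> R"
 shows "Ck_on k (box2 ep) (blowup e a)"
 using assms(1,2)
proof (induction k arbitrary: e a)
 case 0
 have "isCont (blowup e a) x" if "x \<in> box2 ep" for x
  by (rule has_derivative_continuous[OF blowup_has_derivative[OF 0 assms(3) that]])
 then show ?case by (simp add: continuous_on_eq_continuous_at[OF open_box2])
next
 case (Suc k)
 show ?case
 proof (rule Ck_on_SucI[OF open_box2 blowup_has_derivative[OF Suc.prems assms(3)]])
  fix h :: "real \<times> (complex^'n)"
  have 1: "Ck_on k (box2 ep) (%x. of_real (fst h) * blowup (e + 1) (radial_coeffs e a) x)"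
   by (rule Ck_on_linear_compose[OF bounded_linear_mult_right open_box2])
     (rule Suc.IH[OF converges_radial[OF Suc.prems(1)] order_radial[OF Suc.prems(2)]])
  have 2: "Ck_on k (box2 ep) (%x. blowup (e - 1) (directional_coeffs (snd h) a) x)"
   by (rule Suc.IH[OF converges_directional[OF Suc.prems(1)] order_directional[OF Suc.prems(2)]])
  show "Ck_on k (box2 ep) (%x. (case h of (\<tau>, v) => of_real \<tau> * blowup (e + 1) (radial_coeffs e a) x +
    blowup (e - 1) (directional_coeffs v a) x))"
   using Ck_on_add[OF open_box2 1 2] by (simp add: case_prod_beta)
 qed
qed

lemma blowup_zero:
 assumes "order_ge (int e) a"
 shows "blowup (int e) a (0, u) = hcomp a e u"
proof -
 have "(%k. of_real 0 ^ nat (int k - int e) * hcomp a k u) = (%k. if k = e then hcomp a e u else 0)"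
  using hcomp_order[OF assms] by (auto simp: fun_eq_iff power_0_left)
 then show ?thesis
  using sums_unique[OF sums_single[of e "%_. hcomp a e u"]] by (simp add: blowup_def)
qed

section \<open>Tangent cones and boundaries of submanifolds\<close>

definition tcone :: "'a::euclidean_space set => 'a => 'a set" where
 "tcone N x = {v. \<exists>ga. ga 0 = x & (ga has_vector_derivative v) (at 0 within {0..}) &
   (\<exists>de>0. \<forall>s. 0 \<le> s & s < de --> ga s \<in> N)}"

lemma tcone_mono: "N \<subseteq> N' ==> tcone N x \<subseteq> tcone N' x"
 unfolding tcone_def by blast

lemma tcone_limit:
 assumes "ga 0 = x" "(ga has_vector_derivative v) (at 0 within {0..})"
 shows "((%s. (1 / s) *\<^sub>R (ga s - x)) \<longlongrightarrow> v) (at_right 0)"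
proof -
 have "((%s. (1 / norm (s - 0)) *\<^sub>R (ga s - (ga 0 + (s - 0) *\<^sub>R v))) \<longlongrightarrow> 0) (at 0 within {0..})"
  using assms(2) unfolding has_vector_derivative_def has_derivative_within by blast
 then have "((%s. (1 / norm (s - 0)) *\<^sub>R (ga s - (ga 0 + (s - 0) *\<^sub>R v))) \<longlongrightarrow> 0) (at_right 0)"
  by (rule tendsto_within_subset) auto
 then have "((%s. (1 / s) *\<^sub>R (ga s - x) - v) \<longlongrightarrow> 0) (at_right 0)"
 proof (rule Lim_transform_eventually)
  show "\<forall>\<^sub>F s in at_right 0. (1 / norm (s - 0)) *\<^sub>R (ga s - (ga 0 + (s - 0) *\<^sub>R v)) = (1 / s) *\<^sub>R (ga s - x) - v"
   using eventually_at_right_less[of "0 :: real"]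
   by eventually_elim (simp add: assms(1) scaleR_right_diff_distrib scaleR_right_distrib)
 qed
 then show ?thesis by (rule LIM_zero_cancel)
qed

lemma slice_chart_unfold:
 assumes "slice_chart N x \<Phi> L e"
 obtains V W \<Psi> where "subspace L" "e \<in> L" "x \<in> N" "x \<in> V" "open V" "open W" "diffeomorphism V W \<Phi> \<Psi>"
  "\<forall>y\<in>V. \<Psi> (\<Phi> y) = y" "\<forall>z\<in>W. \<Phi> (\<Psi> z) = z" "\<forall>y\<in>V. \<Phi> y \<in> W" "\<forall>z\<in>W. \<Psi> z \<in> V"
  "\<forall>y\<in>V. y \<in> N \<longleftrightarrow> \<Phi> y \<in> L & 0 \<le> e \<bullet> \<Phi> y"
proof -
 obtain V W \<Psi> where *: "subspace L" "e \<in> L" "x \<in> N" "x \<in> V" and d: "diffeomorphism V W \<Phi> \<Psi>"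
  and im: "\<Phi> ` (N \<inter> V) = {y \<in> L. 0 \<le> e \<bullet> y} \<inter> W"
  using assms unfolding slice_chart_def by blast
 have op: "open V" "open W" and hom: "homeomorphism V W \<Phi> \<Psi>" using d by (auto simp: diffeomorphism_def)
 have 1: "!!y. y \<in> V ==> \<Psi> (\<Phi> y) = y" "!!z. z \<in> W ==> \<Phi> (\<Psi> z) = z" "!!y. y \<in> V ==> \<Phi> y \<in> W" "!!z. z \<in> W ==> \<Psi> z \<in> V"
  using hom by (auto simp: homeomorphism_def)
 have "y \<in> N \<longleftrightarrow> \<Phi> y \<in> L & 0 \<le> e \<bullet> \<Phi> y" if "y \<in> V" for y
 proof
  assume "y \<in> N" then have "\<Phi> y \<in> \<Phi> ` (N \<inter> V)" using that by blast
  then show "\<Phi> y \<in> L & 0 \<le> e \<bullet> \<Phi> y" unfolding im by blast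
 next
  assume "\<Phi> y \<in> L & 0 \<le> e \<bullet> \<Phi> y"
  then have "\<Phi> y \<in> \<Phi> ` (N \<inter> V)" unfolding im using 1(3)[OF that] by blast
  then obtain y' where "y' \<in> N" "y' \<in> V" "\<Phi> y = \<Phi> y'" by blast
  then show "y \<in> N" using 1(1)[OF that] 1(1)[of y'] by metis
 qed
 then show ?thesis using that[OF * op d] 1 by simp
qed

text \<open>Tangent cones are defined by curves and hence do not depend on a chart; in a chart they are read off from the linear model.\<close>

lemma tcone_in_slice:
 assumes c: "slice_chart N x \<Phi> L e" and v: "v \<in> tcone N x"
 shows "FD \<Phi> (at x) v \<in> L" "e \<bullet> \<Phi> x = 0 ==> 0 \<le> e \<bullet> FD \<Phi> (at x) v"
proof -
 let ?D = "FD \<Phi> (at x)"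
 obtain V W \<Psi> where L: "subspace L" "x \<in> N" and V: "x \<in> V" "open V" and d: "diffeomorphism V W \<Phi> \<Psi>"
  and N: "\<forall>y\<in>V. y \<in> N \<longleftrightarrow> \<Phi> y \<in> L & 0 \<le> e \<bullet> \<Phi> y"
  by (rule slice_chart_unfold[OF c]) (rule that; assumption)
 note N = N[rule_format]
 obtain ga de where ga: "ga 0 = x" "(ga has_vector_derivative v) (at 0 within {0..})"
  and de: "de > 0" "!!s. 0 \<le> s ==> s < de ==> ga s \<in> N"
  using v unfolding tcone_def by blast
 have "(\<Phi> has_derivative ?D) (at (ga 0))" using diffeomorphism_derivatives(1)[OF d V(1)] ga(1) by simp
 then have "(\<Phi> has_derivative ?D) (at (ga 0) within ga ` {0..})" by (rule has_derivative_at_withinI)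
 then have "((\<Phi> \<circ> ga) has_vector_derivative ?D v) (at 0 within {0..})"
  by (rule vector_derivative_diff_chain_within[OF ga(2)])
 then have lim: "((%s. (1 / s) *\<^sub>R ((\<Phi> \<circ> ga) s - \<Phi> x)) \<longlongrightarrow> ?D v) (at_right 0)"
  by (rule tcone_limit[rotated]) (simp add: ga(1))
 have "(ga \<longlongrightarrow> ga 0) (at 0 within {0..})"
  using has_vector_derivative_continuous[OF ga(2)] by (simp add: continuous_within)
 then have "(ga \<longlongrightarrow> x) (at_right 0)" unfolding ga(1) by (rule tendsto_within_subset) auto
 then have "\<forall>\<^sub>F s in at_right 0. ga s \<in> V" using V topological_tendstoD by blast
 moreover have "\<forall>\<^sub>F s in at_right 0. s < de" using de(1) by (rule eventually_at_right_real[THEN eventually_mono]) auto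
 ultimately have ev: "\<forall>\<^sub>F s in at_right 0. 0 < s & \<Phi> (ga s) \<in> L & 0 \<le> e \<bullet> \<Phi> (ga s)"
  using eventually_at_right_less[of "0 :: real"]
 proof eventually_elim
  case (elim s)
  then show ?case using N[OF elim(1)] de(2)[of s] by simp
 qed
 have xL: "\<Phi> x \<in> L" using N[OF V(1)] L(2) by simp
 have "\<forall>\<^sub>F s in at_right 0. (1 / s) *\<^sub>R ((\<Phi> \<circ> ga) s - \<Phi> x) \<in> L"
  using ev by eventually_elim (use L(1) xL in \<open>auto intro: subspace_scale subspace_diff\<close>)
 then show "?D v \<in> L"
  by (rule Lim_in_closed_set[OF closed_subspace[OF L(1)] _ _ lim]) simp
 show "0 \<le> e \<bullet> ?D v" if "e \<bullet> \<Phi> x = 0"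
 proof -
  have "\<forall>\<^sub>F s in at_right 0. (1 / s) *\<^sub>R ((\<Phi> \<circ> ga) s - \<Phi> x) \<in> {y. 0 \<le> e \<bullet> y}"
   using ev by eventually_elim (use that in \<open>auto simp: inner_diff_right\<close>)
  then have "?D v \<in> {y. 0 \<le> e \<bullet> y}"
   by (rule Lim_in_closed_set[OF closed_halfspace_ge _ _ lim]) simp
  then show ?thesis by simp
 qed
qed

lemma slice_in_tcone:
 assumes c: "slice_chart N x \<Phi> L e" and v: "FD \<Phi> (at x) v \<in> L"
  and e: "e = 0 \<or> e \<bullet> \<Phi> x > 0 \<or> 0 \<le> e \<bullet> FD \<Phi> (at x) v"
 shows "v \<in> tcone N x"
proof -
 let ?D = "FD \<Phi> (at x)" and ?E = "%\<Psi>. FD \<Psi> (at (\<Phi> x))"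
 obtain V W \<Psi> where L: "subspace L" and "e \<in> L" and xN: "x \<in> N" and V: "x \<in> V" "open V" "open W"
  and d: "diffeomorphism V W \<Phi> \<Psi>"
  and 1: "\<forall>y\<in>V. \<Psi> (\<Phi> y) = y" "\<forall>z\<in>W. \<Phi> (\<Psi> z) = z" "\<forall>y\<in>V. \<Phi> y \<in> W" "\<forall>z\<in>W. \<Psi> z \<in> V"
  and N: "\<forall>y\<in>V. y \<in> N \<longleftrightarrow> \<Phi> y \<in> L & 0 \<le> e \<bullet> \<Phi> y"
  by (rule slice_chart_unfold[OF c]) (rule that; assumption)
 note 1 = 1[rule_format] and N = N[rule_format]
 define k where "k s = \<Phi> x + s *\<^sub>R ?D v" for s
 have kder: "(k has_vector_derivative ?D v) (at 0 within {0..})"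
  unfolding k_def by (auto intro!: derivative_eq_intros)
 have lim: "(k \<longlongrightarrow> \<Phi> x) (at 0)"
  unfolding k_def by (rule tendsto_eq_intros refl | simp)+
 have "\<forall>\<^sub>F s in at 0. k s \<in> W" using topological_tendstoD[OF lim V(3) 1(3)[OF V(1)]] .
 moreover have "\<forall>\<^sub>F s in at 0. 0 \<le> s --> 0 \<le> e \<bullet> k s"
  using e
 proof (elim disjE)
  assume "e \<bullet> \<Phi> x > 0"
  moreover have "((%s. e \<bullet> k s) \<longlongrightarrow> e \<bullet> \<Phi> x) (at 0)" using lim by (intro tendsto_intros)
  ultimately have "\<forall>\<^sub>F s in at 0. 0 < e \<bullet> k s" using order_tendstoD(1) by blast
  then show ?thesis by eventually_elim auto
 next
  assume "0 \<le> e \<bullet> ?D v"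
  moreover have "0 \<le> e \<bullet> \<Phi> x" using N[OF V(1)] xN by simp
  ultimately show ?thesis by (intro always_eventually) (simp add: k_def inner_add_right)
 qed simp
 ultimately have "\<forall>\<^sub>F s in at 0. k s \<in> W & (0 \<le> s --> 0 \<le> e \<bullet> k s)" by eventually_elim auto
 then obtain de where de: "de > 0" "!!s. s ~= 0 ==> \<bar>s\<bar> < de ==> k s \<in> W & (0 \<le> s --> 0 \<le> e \<bullet> k s)"
  unfolding eventually_at by (auto simp: dist_real_def)
 have xL: "\<Phi> x \<in> L" "0 \<le> e \<bullet> \<Phi> x" using N[OF V(1)] xN by auto
 have "\<Psi> (k s) \<in> N" if "0 \<le> s" "s < de" for s
 proof -
  have W: "k s \<in> W" "0 \<le> e \<bullet> k s"
  proof -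
   have "k s \<in> W & 0 \<le> e \<bullet> k s"
   proof (cases "s = 0")
    case True
    then show ?thesis using xL 1(3)[OF V(1)] by (simp add: k_def)
   next
    case False
    then show ?thesis using de(2)[OF False] that by simp
   qed
   then show "k s \<in> W" "0 \<le> e \<bullet> k s" by auto
  qed
  moreover have "k s \<in> L" using L xL v unfolding k_def by (intro subspace_add subspace_scale) auto
  ultimately show ?thesis using N[OF 1(4)[OF W(1)]] 1(2)[OF W(1)] by simp
 qed
 moreover have "\<Psi> (k 0) = x" using 1(1)[OF V(1)] by (simp add: k_def)
 moreover have "((\<Psi> \<circ> k) has_vector_derivative v) (at 0 within {0..})"
 proof -
  have "(\<Psi> has_derivative ?E \<Psi>) (at (k 0))" using diffeomorphism_derivatives(2)[OF d V(1)] by (simp add: k_def)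
  then have "(\<Psi> has_derivative ?E \<Psi>) (at (k 0) within k ` {0..})" by (rule has_derivative_at_withinI)
  then have "((\<Psi> \<circ> k) has_vector_derivative ?E \<Psi> (?D v)) (at 0 within {0..})"
   by (rule vector_derivative_diff_chain_within[OF kder])
  then show ?thesis using diffeomorphism_derivatives(3)[OF d V(1)] by simp
 qed
 ultimately show ?thesis unfolding tcone_def using de(1) by (intro CollectI exI[of _ "\<Psi> \<circ> k"]) auto
qed

lemma slice_tangent_iff:
 assumes c: "slice_chart N x \<Phi> L e"
 shows "FD \<Phi> (at x) v \<in> L \<longleftrightarrow> (\<exists>a\<in>tcone N x. \<exists>b\<in>tcone N x. v = a - b)"
proof -
 let ?D = "FD \<Phi> (at x)"
 obtain V W \<Psi> where L: "subspace L" "e \<in> L" and V: "x \<in> V" and d: "diffeomorphism V W \<Phi> \<Psi>"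
  by (rule slice_chart_unfold[OF c]) (rule that; assumption)
 note D = diffeomorphism_derivatives[OF d V]
 define f where "f = FD \<Psi> (at (\<Phi> x)) e"
 have f: "?D f = e" using D(4) by (simp add: f_def)
 show ?thesis
 proof
  assume v: "?D v \<in> L"
  define \<kappa> where "\<kappa> = (if e = 0 then 0 else \<bar>e \<bullet> ?D v\<bar> / (e \<bullet> e))"
  have D\<kappa>: "?D (\<kappa> *\<^sub>R f) = \<kappa> *\<^sub>R e" "?D (v + \<kappa> *\<^sub>R f) = ?D v + \<kappa> *\<^sub>R e"
   using D(5) f by (simp_all add: linear_add linear_cmul)
  have k: "\<kappa> * (e \<bullet> e) = \<bar>e \<bullet> ?D v\<bar>" "0 \<le> \<kappa>" by (auto simp: \<kappa>_def)
  have "\<kappa> *\<^sub>R f \<in> tcone N x"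
   using L k by (intro slice_in_tcone[OF c]) (auto simp: D\<kappa> subspace_scale)
  moreover have "v + \<kappa> *\<^sub>R f \<in> tcone N x"
   using L k v by (intro slice_in_tcone[OF c]) (auto simp: D\<kappa> subspace_scale subspace_add inner_add_right)
  ultimately show "\<exists>a\<in>tcone N x. \<exists>b\<in>tcone N x. v = a - b"
   by (intro bexI[of _ "v + \<kappa> *\<^sub>R f"] bexI[of _ "\<kappa> *\<^sub>R f"]) auto
 next
  assume "\<exists>a\<in>tcone N x. \<exists>b\<in>tcone N x. v = a - b"
  then obtain a b where "a \<in> tcone N x" "b \<in> tcone N x" "v = a - b" by blast
  then show "?D v \<in> L"
   using tcone_in_slice(1)[OF c] L(1) D(5) by (simp add: linear_diff subspace_diff)
 qed
qed

text \<open>Comparison with the tangent cone shows that the tangent space is the same in all charts.\<close>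

lemma tangent_space_slice:
 assumes c: "slice_chart N x \<Phi> L e"
 shows "v \<in> tangent_space N x \<longleftrightarrow> FD \<Phi> (at x) v \<in> L"
 unfolding tangent_space_def using slice_tangent_iff assms by blast

lemma tangent_space_mono:
 assumes "slice_chart N x \<Phi> L e" "slice_chart N' x \<Phi>' L' e'" "N \<subseteq> N'"
 shows "tangent_space N x \<subseteq> tangent_space N' x"
proof
 fix v assume "v \<in> tangent_space N x"
 then obtain a b where "a \<in> tcone N x" "b \<in> tcone N x" "v = a - b"
  unfolding tangent_space_slice[OF assms(1)] slice_tangent_iff[OF assms(1)] by blast
 then show "v \<in> tangent_space N' x"
  unfolding tangent_space_slice[OF assms(2)] slice_tangent_iff[OF assms(2)]
  using tcone_mono[OF assms(3), of x] by blast
qed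

lemma tcone_interior_subspace:
 assumes c: "slice_chart N x \<Phi> L e" and e: "e = 0 \<or> e \<bullet> \<Phi> x > 0"
 shows "subspace (tcone N x)"
proof -
 obtain V W \<Psi> where L: "subspace L" and V: "x \<in> V" and d: "diffeomorphism V W \<Phi> \<Psi>"
  by (rule slice_chart_unfold[OF c]) (rule that; assumption)
 have "tcone N x = {v. FD \<Phi> (at x) v \<in> L}"
  using tcone_in_slice(1)[OF c] slice_in_tcone[OF c] e by blast
 then show ?thesis
  using linear_subspace_vimage[OF diffeomorphism_derivatives(5)[OF d V] L] by (simp add: vimage_def)
qed

text \<open>At an interior point the tangent cone is a linear subspace, at a boundary point it is not.\<close>

lemma interior_not_boundary:
 assumes c: "slice_chart N x \<Phi> L e" and e: "e = 0 \<or> e \<bullet> \<Phi> x > 0"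
 shows "x \<notin> manifold_boundary N"
proof
 assume "x \<in> manifold_boundary N"
 then obtain \<Phi>' L' e' where c': "slice_chart N x \<Phi>' L' e'" and e': "e' ~= 0" "e' \<bullet> \<Phi>' x = 0"
  unfolding manifold_boundary_def by blast
 obtain V W \<Psi> where L: "subspace L'" "e' \<in> L'" and V: "x \<in> V" and d: "diffeomorphism V W \<Phi>' \<Psi>"
  by (rule slice_chart_unfold[OF c']) (rule that; assumption)
 note D = diffeomorphism_derivatives[OF d V]
 define f where "f = FD \<Psi> (at (\<Phi>' x)) e'"
 have f: "FD \<Phi>' (at x) f = e'" using D(4) by (simp add: f_def)
 have "f \<in> tcone N x" using L f by (intro slice_in_tcone[OF c']) auto
 then have "- f \<in> tcone N x" using tcone_interior_subspace[OF c e] subspace_neg by blast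
 then have "0 \<le> e' \<bullet> FD \<Phi>' (at x) (- f)" using tcone_in_slice(2)[OF c'] e' by blast
 also have "\<dots> = - (e' \<bullet> e')" using D(5) f by (simp add: linear_neg)
 finally show False using e'(1) inner_gt_zero_iff[of e'] by linarith
qed

section \<open>Submanifolds of a product that are transversal to the slices of the first factor\<close>

text \<open>Near \<open>x\<close> the set \<open>M\<close> is straightened to a product by a diffeomorphism that preserves the first
 coordinate.\<close>

definition straight :: "(real \<times> 'a::euclidean_space) set => real \<times> 'a => nat => bool" where
 "straight M x k \<longleftrightarrow> (\<exists>V W \<Phi> \<Psi> (K :: 'a set). x \<in> V & diffeomorphism V W \<Phi> \<Psi> & (\<forall>y\<in>V. fst (\<Phi> y) = fst y) &
   subspace K & dim K = k & (\<forall>y\<in>V. y \<in> M \<longleftrightarrow> snd (\<Phi> y) \<in> K))"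

definition collar :: "(real \<times> 'a) set => real => (real \<times> 'a) set" where
 "collar M r = {x \<in> M. 0 \<le> fst x & fst x < r}"

lemma straight_charts:
 fixes M :: "(real \<times> 'a::euclidean_space) set"
 assumes "straight M x k" "x \<in> M" "0 \<le> fst x" "fst x < r"
 obtains \<Phi> K where "subspace K" "dim K = k" "fst (\<Phi> x) = fst x" "slice_chart (collar M r) x \<Phi> (UNIV \<times> K) (1, 0)"
  "fst x = 0 ==> slice_chart {y \<in> M. fst y = 0} x \<Phi> ({0} \<times> K) 0"
  "!!v. fst (FD \<Phi> (at x) v) = fst v" "!!w. \<exists>v. FD \<Phi> (at x) v = w"
  "linear (FD \<Phi> (at x))"
proof -
 obtain V' W' \<Phi> \<Psi> and K :: "'a set" where *: "x \<in> V' & diffeomorphism V' W' \<Phi> \<Psi> & (\<forall>y\<in>V'. fst (\<Phi> y) = fst y) &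
   subspace K & dim K = k & (\<forall>y\<in>V'. y \<in> M \<longleftrightarrow> snd (\<Phi> y) \<in> K)"
  using assms(1) unfolding straight_def by (elim exE) (rule that, assumption)
 from * have V': "x \<in> V'" "diffeomorphism V' W' \<Phi> \<Psi>" and K: "subspace K" "dim K = k" by simp_all
 from * have fst': "!!y. y \<in> V' ==> fst (\<Phi> y) = fst y" and M': "!!y. y \<in> V' ==> y \<in> M \<longleftrightarrow> snd (\<Phi> y) \<in> K" by simp_all
 define V where "V = V' \<inter> {y. fst y < r}"
 have opV: "open V" using V'(2) unfolding V_def diffeomorphism_def
  by (intro open_Int open_Collect_less continuous_intros) auto
 have d: "diffeomorphism V (\<Phi> ` V) \<Phi> \<Psi>" using diffeomorphism_restrict(1)[OF V'(2) opV] by (simp add: V_def)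
 have xV: "x \<in> V" using V'(1) assms(4) by (simp add: V_def)
 have hom: "homeomorphism V' W' \<Phi> \<Psi>" using V'(2) by (simp add: diffeomorphism_def)
 have im1: "\<Phi> ` (collar M r \<inter> V) = {y \<in> UNIV \<times> K. 0 \<le> (1, 0) \<bullet> y} \<inter> \<Phi> ` V"
  using M' fst' by (auto simp: V_def collar_def mem_Times_iff inner_prod_def)
 have im2: "\<Phi> ` ({y \<in> M. fst y = 0} \<inter> V) = {y \<in> {0} \<times> K. 0 \<le> 0 \<bullet> y} \<inter> \<Phi> ` V"
  using M' fst' by (auto simp: V_def mem_Times_iff)
 have "slice_chart (collar M r) x \<Phi> (UNIV \<times> K) (1, 0)"
  unfolding slice_chart_def
  using K(1) assms(2-4) xV d im1 subspace_Times[OF subspace_UNIV K(1)] by (auto simp: subspace_0 collar_def)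
 moreover have "slice_chart {y \<in> M. fst y = 0} x \<Phi> ({0} \<times> K) 0" if "fst x = 0"
  unfolding slice_chart_def
  using K(1) assms(2) that xV d im2 subspace_Times[OF subspace_single_0 K(1)] by (auto simp: subspace_0 zero_prod_def)
 moreover note D = diffeomorphism_derivatives[OF d xV]
 have "fst (FD \<Phi> (at x) v) = fst v" for v
 proof -
  have "((%y. fst (\<Phi> y)) has_derivative (%v. fst (FD \<Phi> (at x) v))) (at x)"
   by (rule has_derivative_fst[OF D(1)])
  then have "(fst has_derivative (%v. fst (FD \<Phi> (at x) v))) (at x)"
   by (rule has_derivative_transform_within_open[OF _ opV xV]) (use fst' in \<open>auto simp: V_def\<close>)
  moreover have "(fst has_derivative fst) (at x)" by (rule has_derivative_fst[OF has_derivative_ident])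
  ultimately have "(%v. fst (FD \<Phi> (at x) v)) = fst" by (rule has_derivative_unique)
  then show ?thesis by (rule fun_cong)
 qed
 moreover have "\<exists>v. FD \<Phi> (at x) v = w" for w using D(4) by blast
 moreover have "fst (\<Phi> x) = fst x" using fst'[OF V'(1)] .
 ultimately show ?thesis using that K D(5) by blast
qed

lemma dim_UNIV_Times:
 assumes "subspace (K :: 'a::euclidean_space set)"
 shows "dim ((UNIV :: real set) \<times> K) = Suc (dim K)"
 using dim_Times[OF subspace_UNIV[where 'a = real] assms] by simp

lemma collar_submanifold:
 fixes M :: "(real \<times> 'a::euclidean_space) set"
 assumes st: "!!x. x \<in> collar M r ==> straight M x k" and "0 < r"
 shows "submanifold_with_boundary (collar M r)" "manifold_boundary (collar M r) = {x \<in> M. fst x = 0}"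
proof -
 have ch: "\<exists>\<Phi> K. subspace K & dim K = k & fst (\<Phi> x) = fst x & slice_chart (collar M r) x \<Phi> (UNIV \<times> K) (1, 0)"
  if "x \<in> collar M r" for x
 proof -
  have x: "x \<in> M" "0 \<le> fst x" "fst x < r" using that by (auto simp: collar_def)
  show ?thesis by (rule straight_charts[OF st[OF that] x]) blast
 qed
 have "\<exists>\<Phi> L e. slice_chart (collar M r) x \<Phi> L e & dim L = Suc k" if "x \<in> collar M r" for x
  using ch[OF that] dim_UNIV_Times by metis
 then show "submanifold_with_boundary (collar M r)" unfolding submanifold_with_boundary_def by blast
 show "manifold_boundary (collar M r) = {x \<in> M. fst x = 0}"
 proof (intro subset_antisym subsetI)
  fix x assume b: "x \<in> manifold_boundary (collar M r)"
  then have x: "x \<in> collar M r" by (auto simp: manifold_boundary_def slice_chart_def)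
  then obtain \<Phi> K where "fst (\<Phi> x) = fst x" "slice_chart (collar M r) x \<Phi> (UNIV \<times> K) (1, 0)" using ch by blast
  then have "\<not> 0 < fst x" using interior_not_boundary b by (fastforce simp: inner_prod_def)
  then show "x \<in> {x \<in> M. fst x = 0}" using x by (auto simp: collar_def)
 next
  fix x assume "x \<in> {x \<in> M. fst x = 0}"
  then have x: "x \<in> collar M r" "fst x = 0" using \<open>0 < r\<close> by (auto simp: collar_def)
  then obtain \<Phi> K where "fst (\<Phi> x) = fst x" "slice_chart (collar M r) x \<Phi> (UNIV \<times> K) (1, 0)" using ch by blast
  then show "x \<in> manifold_boundary (collar M r)"
   unfolding manifold_boundary_def using x(2)
   by (intro CollectI exI[of _ \<Phi>] exI[of _ "UNIV \<times> K"] exI[of _ "(1, 0)"]) (auto simp: inner_prod_def zero_prod_def)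
 qed
qed

text \<open>At the boundary the charts preserve the first coordinate, so the tangent space of \<open>M\<close> contains a vector that is transversal to the slice.\<close>

lemma collar_p_submanifold:
 fixes M S :: "(real \<times> 'a::euclidean_space) set"
 assumes stM: "!!x. x \<in> collar M r ==> straight M x k" and stS: "!!x. x \<in> collar S r ==> straight S x l"
  and "0 < r" "M \<subseteq> S"
 shows "p_submanifold (collar S r) (collar M r)"
 unfolding p_submanifold_def
proof (intro conjI ballI)
 have M: "submanifold_with_boundary (collar M r)" "manifold_boundary (collar M r) = {x \<in> M. fst x = 0}"
  using collar_submanifold[OF stM \<open>0 < r\<close>] by simp_all
 have S: "manifold_boundary (collar S r) = {x \<in> S. fst x = 0}"
  using collar_submanifold(2)[OF stS \<open>0 < r\<close>] by simp
 show "collar M r \<subseteq> collar S r" using assms(4) by (auto simp: collar_def)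
 show "submanifold_with_boundary (collar M r)" by (rule M(1))
 show "manifold_boundary (collar M r) = collar M r \<inter> manifold_boundary (collar S r)"
 proof -
  have "{x \<in> M. fst x = 0} = collar M r \<inter> {x \<in> S. fst x = 0}" using assms(3,4) by (auto simp: collar_def)
  then show ?thesis unfolding M(2) S .
 qed
 fix x assume "x \<in> manifold_boundary (collar M r)"
 then have x: "x \<in> M" "x \<in> S" "fst x = 0" using M(2) assms(4) by auto
 then have xc: "x \<in> collar M r" "x \<in> collar S r" using assms(3) by (auto simp: collar_def)
 obtain \<Phi> K where \<Phi>: "subspace K" "slice_chart (collar M r) x \<Phi> (UNIV \<times> K) (1, 0)"
  "!!v. fst (FD \<Phi> (at x) v) = fst v" "!!w. \<exists>v. FD \<Phi> (at x) v = w"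
  "linear (FD \<Phi> (at x))"
  by (rule straight_charts[OF stM[OF xc(1)] x(1), of r]) (use x assms(3) in auto)
 obtain \<Phi>' K' where \<Phi>': "subspace K'" "slice_chart (collar S r) x \<Phi>' (UNIV \<times> K') (1, 0)"
  "slice_chart {y \<in> S. fst y = 0} x \<Phi>' ({0} \<times> K') 0"
  "!!v. fst (FD \<Phi>' (at x) v) = fst v" "linear (FD \<Phi>' (at x))"
  by (rule straight_charts[OF stS[OF xc(2)] x(2), of r]) (use x assms(3) in auto)
 have TM: "v \<in> tangent_space (collar M r) x \<longleftrightarrow> snd (FD \<Phi> (at x) v) \<in> K" for v
  unfolding tangent_space_slice[OF \<Phi>(2)] by (auto simp: mem_Times_iff)
 have TS: "v \<in> tangent_space (collar S r) x \<longleftrightarrow> snd (FD \<Phi>' (at x) v) \<in> K'" for v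
  unfolding tangent_space_slice[OF \<Phi>'(2)] by (auto simp: mem_Times_iff)
 have TS0: "v \<in> tangent_space {y \<in> S. fst y = 0} x \<longleftrightarrow> fst v = 0 & v \<in> tangent_space (collar S r) x" for v
  unfolding tangent_space_slice[OF \<Phi>'(3)] TS using \<Phi>'(4) by (auto simp: mem_Times_iff)
 have subMS: "tangent_space (collar M r) x \<subseteq> tangent_space (collar S r) x"
  by (rule tangent_space_mono[OF \<Phi>(2) \<Phi>'(2)]) (use assms(4) in \<open>auto simp: collar_def\<close>)
 have add: "v + w \<in> tangent_space (collar S r) x"
  if "v \<in> tangent_space (collar S r) x" "w \<in> tangent_space (collar S r) x" for v w
  using that unfolding TS linear_add[OF \<Phi>'(5)] by (simp add: subspace_add[OF \<Phi>'(1)])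
 have scaleM: "k *\<^sub>R v \<in> tangent_space (collar M r) x" if "v \<in> tangent_space (collar M r) x" for v k
  using that unfolding TM linear_cmul[OF \<Phi>(5)] by (simp add: subspace_scale[OF \<Phi>(1)])
 have negS: "- v \<in> tangent_space (collar S r) x" if "v \<in> tangent_space (collar S r) x" for v
  using that unfolding TS linear_neg[OF \<Phi>'(5)] by (simp add: subspace_neg[OF \<Phi>'(1)])
 obtain v0 where v0: "FD \<Phi> (at x) v0 = (1, 0)" using \<Phi>(4) by blast
 then have v0': "fst v0 = 1" "v0 \<in> tangent_space (collar M r) x"
  using \<Phi>(3)[of v0] TM subspace_0[OF \<Phi>(1)] by auto
 show "{v + w |v w. v \<in> tangent_space (collar M r) x & w \<in> tangent_space (manifold_boundary (collar S r)) x} = tangent_space (collar S r) x"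
  unfolding S
 proof (intro subset_antisym subsetI)
  fix z assume z: "z \<in> tangent_space (collar S r) x"
  have zM: "fst z *\<^sub>R v0 \<in> tangent_space (collar M r) x" using scaleM v0' by blast
  have "z + - (fst z *\<^sub>R v0) \<in> tangent_space (collar S r) x"
   by (rule add[OF z negS[OF subsetD[OF subMS zM]]])
  moreover have "fst (z + - (fst z *\<^sub>R v0)) = 0" using v0'(1) by simp
  ultimately have "z + - (fst z *\<^sub>R v0) \<in> tangent_space {y \<in> S. fst y = 0} x" using TS0 by blast
  then show "z \<in> {v + w |v w. v \<in> tangent_space (collar M r) x & w \<in> tangent_space {y \<in> S. fst y = 0} x}"
   using zM by (intro CollectI exI[of _ "fst z *\<^sub>R v0"] exI[of _ "z + - (fst z *\<^sub>R v0)"]) auto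
 qed (use subMS add TS0 in blast)
qed

text \<open>A submersion along the second factor straightens its zero set. With \<open>A\<close> the partial derivative
 at the point and \<open>B\<close> a right inverse of \<open>A\<close> on its range, the chart is
 \<open>(t, u) \<mapsto> (t, u - B (A u) + B (q (t, u)))\<close>: its partial derivative at the point is the identity, and
 its second component lies in the kernel of \<open>A\<close> if and only if \<open>q\<close> vanishes.\<close>

lemma submersion_straight:
 fixes q :: "real \<times> 'a::euclidean_space => 'b::euclidean_space"
 assumes "open Om" "x0 \<in> Om" and smooth: "!!k. Ck_on k Om q"
  and range: "!!x. x \<in> Om ==> q x \<in> R" and R: "range (%v. FD q (at x0) (0, v)) = R"
 shows "straight {x. q x = 0} x0 (DIM('a) - dim R)"
  and "\<exists>V. open V & x0 \<in> V & V \<subseteq> Om & (\<forall>x\<in>V. \<forall>w\<in>R. \<exists>v. FD q (at x) (0, v) = w)"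
proof -
 have der: "(q has_derivative FD q (at x)) (at x)" if "x \<in> Om" for x
  using Ck_on_has_derivative[OF smooth assms(1) that] .
 define A where "A v = FD q (at x0) (0, v)" for v
 have linD: "linear (FD q (at x))" if "x \<in> Om" for x
  using der[OF that] has_derivative_linear by blast
 have linA: "linear A"
  unfolding A_def using linear_compose[OF _ linD[OF assms(2)], of "%v. (0, v)"]
  by (simp add: o_def linear_iff)
 have RA: "R = range A" using R by (simp add: A_def)
 have subR: "subspace R" unfolding RA using linear_subspace_image[OF linA subspace_UNIV] .
 obtain B where B: "linear B" "!!w. w \<in> R ==> A (B w) = w"
  using linear_exists_right_inverse_on[OF linA subspace_UNIV] unfolding RA by auto
 define K where "K = {v. A v = 0}"
 have K: "subspace K" unfolding K_def using linear_subspace_kernel[OF linA] .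
 have dimK: "dim K = DIM('a) - dim R"
 proof -
  have inj: "inj_on B R" using B(2) by (metis inj_onI)
  have dimBR: "dim (B ` R) = dim R" using inj subR by (intro dim_image_eq[OF B(1)]) (simp add: span_eq_iff[THEN iffD2])
  have "K \<inter> B ` R = {0}"
  proof (intro subset_antisym subsetI)
   fix v assume "v \<in> K \<inter> B ` R"
   then obtain w where "w \<in> R" "v = B w" "A (B w) = 0" by (auto simp: K_def)
   then show "v \<in> {0}" using B(2)[of w] linear_0[OF B(1)] by simp
  qed (use K subspace_0[OF K] subspace_0[OF subR] linear_0[OF B(1)] in \<open>auto intro!: image_eqI[of _ _ 0]\<close>)
  moreover have "{x + y |x y. x \<in> K & y \<in> B ` R} = UNIV"
  proof -
   have "v \<in> {x + y |x y. x \<in> K & y \<in> B ` R}" for v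
    by (rule CollectI, rule exI[of _ "v - B (A v)"], rule exI[of _ "B (A v)"])
      (use B(2)[of "A v"] in \<open>auto simp: K_def RA linear_diff[OF linA]\<close>)
   then show ?thesis by blast
  qed
  ultimately show ?thesis
   using dim_sums_Int[OF K linear_subspace_image[OF B(1) subR]] dimBR by (simp add: dim_UNIV)
 qed
 define \<Phi> where "\<Phi> x = (fst x, snd x - B (A (snd x)) + B (q x))" for x
 define D where "D x h = (fst h, snd h - B (A (snd h)) + B (FD q (at x) h))" for x h
 have blB: "bounded_linear B" and blA: "bounded_linear A" using B(1) linA by (simp_all add: linear_conv_bounded_linear)
 have BA: "bounded_linear (%x :: real \<times> 'a. B (A (snd x)))"
  by (rule bounded_linear_compose[OF blB bounded_linear_compose[OF blA bounded_linear_snd]])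
 have der\<Phi>: "(\<Phi> has_derivative D x) (at x)" if "x \<in> Om" for x
  unfolding \<Phi>_def D_def
  by (intro has_derivative_Pair has_derivative_add has_derivative_diff has_derivative_fst has_derivative_snd
    has_derivative_ident bounded_linear.has_derivative[OF blB der[OF that]] bounded_linear_imp_has_derivative[OF BA])
 have FD: "FD \<Phi> (at x) = D x" if "x \<in> Om" for x
  using frechet_derivative_at[OF der\<Phi>[OF that]] by simp
 have Ck: "Ck_on k Om \<Phi>" for k
 proof -
  have lin: "bounded_linear (%x :: real \<times> 'a. (fst x, snd x - B (A (snd x))))"
   by (intro bounded_linear_Pair bounded_linear_fst bounded_linear_sub bounded_linear_snd BA)
  have lin2: "bounded_linear (%w. (0 :: real, B w))" by (intro bounded_linear_Pair bounded_linear_zero blB)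
  have "Ck_on k Om (%x. (fst x, snd x - B (A (snd x))) + (0, B (q x)))"
   by (intro Ck_on_add[OF assms(1)] Ck_on_bounded_linear[OF lin assms(1)] Ck_on_linear_compose[OF lin2 assms(1) smooth])
  then show ?thesis by (simp add: \<Phi>_def[abs_def])
 qed
 have inR: "FD q (at x) h \<in> R" if x: "x \<in> Om" for x h
 proof (rule ccontr)
  assume n: "FD q (at x) h \<notin> R"
  obtain z where z: "!!y. y \<in> R ==> z \<bullet> y = 0" "z \<bullet> FD q (at x) h ~= 0"
  proof -
   obtain y z where yz: "y \<in> span R" "!!w. w \<in> span R ==> orthogonal z w" "FD q (at x) h = y + z"
    using orthogonal_subspace_decomp_exists by blast
   have "z ~= 0" using n yz subR by (auto simp: span_eq_iff[THEN iffD2])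
   then have "z \<bullet> FD q (at x) h ~= 0" using yz by (auto simp: inner_add_right orthogonal_def)
   then show ?thesis using that[of z] yz(2) span_base by (metis orthogonal_def)
  qed
  have "((%y. z \<bullet> q y) has_derivative (%h. z \<bullet> FD q (at x) h)) (at x)"
   by (intro has_derivative_inner_right der x)
  then have "((%y. 0) has_derivative (%h. z \<bullet> FD q (at x) h)) (at x)"
   by (rule has_derivative_transform_within_open[OF _ assms(1) x]) (use z(1) range in auto)
  then have "(%h. z \<bullet> FD q (at x) h) = (%h. 0)"
   using has_derivative_unique has_derivative_const by blast
  then show False using z(2) by metis
 qed
 have "v = 0" if "FD \<Phi> (at x0) v = 0" for v
 proof -
  have v: "fst v = 0" "snd v - B (A (snd v)) + B (FD q (at x0) v) = 0"
   using that unfolding FD[OF assms(2)] D_def zero_prod_def by auto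
  then have "v = (0, snd v)" by (simp add: prod_eq_iff)
  then have "FD q (at x0) v = A (snd v)" unfolding A_def by metis
  then show ?thesis using v by (simp add: prod_eq_iff)
 qed
 then obtain V W \<Psi> where V: "V \<subseteq> Om" "x0 \<in> V" "diffeomorphism V W \<Phi> \<Psi>"
  using smooth_inverse_function[OF assms(1,2) Ck] by blast
 have "q y = 0 \<longleftrightarrow> snd (\<Phi> y) \<in> K" if "y \<in> Om" for y
 proof -
  have "A (snd (\<Phi> y)) = A (snd y) - A (B (A (snd y))) + A (B (q y))"
   by (simp add: \<Phi>_def linear_add[OF linA] linear_diff[OF linA])
  also have "\<dots> = q y" using B(2)[OF range[OF that]] B(2)[of "A (snd y)"] by (simp add: RA)
  finally show ?thesis by (simp add: K_def)
 qed
 then show "straight {x. q x = 0} x0 (DIM('a) - dim R)"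
  unfolding straight_def using V K dimK
  by (intro exI[of _ V] exI[of _ W] exI[of _ \<Phi>] exI[of _ \<Psi>] exI[of _ K]) (auto simp: \<Phi>_def)
 have "\<exists>v. FD q (at x) (0, v) = w" if x: "x \<in> V" and w: "w \<in> R" for x w
 proof -
  have xO: "x \<in> Om" using x V by blast
  obtain h where h: "D x h = (0, B w)" using diffeomorphism_derivatives(4)[OF V(3) x] FD[OF xO] by metis
  then have h1: "h = (0, snd h)" and h2: "snd h - B (A (snd h)) + B (FD q (at x) h) = B w"
   by (auto simp: D_def prod_eq_iff)
  have "A (snd h - B (A (snd h)) + B (FD q (at x) h)) = FD q (at x) h"
   using B(2)[OF inR[OF xO]] B(2)[of "A (snd h)"] by (simp add: RA linear_add[OF linA] linear_diff[OF linA])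
  then have "FD q (at x) h = w" unfolding h2 B(2)[OF w] by simp
  then show ?thesis using h1 by metis
 qed
 then show "\<exists>V. open V & x0 \<in> V & V \<subseteq> Om & (\<forall>x\<in>V. \<forall>w\<in>R. \<exists>v. FD q (at x) (0, v) = w)"
  using V by (intro exI[of _ V]) (auto simp: diffeomorphism_def)
qed

section \<open>Taylor series of germs\<close>

lemma sums_by_degree:
 fixes g :: "(('n::finite) mon) => 'a::real_normed_vector"
 assumes "(g has_sum S) UNIV"
 shows "(%k. \<Sum>al | mdeg al = k. g al) sums S"
proof -
 let ?A = "SIGMA k:UNIV. {al :: 'n mon. mdeg al = k}"
 have bij: "bij_betw snd ?A UNIV"
  by (rule bij_betwI[of _ _ _ "%al. (mdeg al, al)"]) auto
 have "((%x. g (snd x)) has_sum S) ?A"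
  using assms has_sum_reindex_bij_betw[OF bij, of g S] by simp
 then have "((%k. \<Sum>al | mdeg al = k. g al) has_sum S) UNIV"
  by (rule has_sum_SigmaD) (simp add: has_sum_finite finite_monoms_of_degree)
 then show ?thesis by (rule has_sum_imp_sums)
qed

lemma norm_vec_le_card:
 fixes z :: "complex^'n::finite"
 assumes "!!m. cmod (z $ m) \<le> r"
 shows "norm z \<le> real CARD('n) * r"
proof -
 have "norm z \<le> (\<Sum>m\<in>UNIV. cmod (z $ m))" unfolding norm_vec_def by (rule L2_set_le_sum) auto
 also have "\<dots> \<le> (\<Sum>m\<in>(UNIV :: 'n set). r)" using assms by (intro sum_mono)
 finally show ?thesis by simp
qed

lemma component_le_norm: "cmod (z $ m) \<le> norm (z :: complex^'n::finite)"
 by (rule Finite_Cartesian_Product.norm_nth_le)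

lemma power_series_local:
 fixes f :: "complex^'n::finite => complex"
 assumes "power_series_at_0 a f"
 obtains \<rho> where "0 < \<rho>" "(%al. cmod (a al) * \<rho> ^ mdeg al) summable_on UNIV" "summable (%k. hnorm a k * \<rho> ^ k)"
  "!!z. (!!m. cmod (z $ m) \<le> \<rho>) ==> ((%al. a al * zmon z al) has_sum f z) UNIV"
  "!!z. (!!m. cmod (z $ m) \<le> \<rho>) ==> (%k. hcomp a k z) sums f z"
proof -
 obtain e where e: "e > 0" "!!z. dist z 0 < e ==> ((%al. a al * monom_eval (($) z) al) has_sum f z) UNIV"
  using assms unfolding power_series_at_0_def eventually_nhds_metric by blast
 define \<rho> where "\<rho> = e / (real CARD('n) + 1)"
 have \<rho>: "0 < \<rho>" using e(1) by (simp add: \<rho>_def)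
 have small: "real CARD('n) * \<rho> < e"
  using e(1) by (simp add: \<rho>_def pos_divide_less_eq algebra_simps)
 have hs: "((%al. a al * zmon z al) has_sum f z) UNIV" if "!!m. cmod (z $ m) \<le> \<rho>" for z
 proof -
  have "dist z 0 < e" using norm_vec_le_card[OF that] small by simp
  from e(2)[OF this] show ?thesis by (simp add: monom_eval_eq_zmon)
 qed
 have s: "(%k. hcomp a k z) sums f z" if "!!m. cmod (z $ m) \<le> \<rho>" for z
  unfolding hcomp_def by (rule sums_by_degree[OF hs[OF that]])
 define z0 :: "complex^'n" where "z0 = (\<chi> m. of_real \<rho>)"
 have z0: "cmod (zmon z0 al) = \<rho> ^ mdeg al" for al
  using \<rho> by (simp add: zmon_def z0_def monom_degree_def norm_power power_sum flip: prod_norm)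
 have "(%al. a al * zmon z0 al) summable_on UNIV"
  using hs[of z0] \<rho> by (auto simp: z0_def summable_on_def)
 then have "(%al. norm (a al * zmon z0 al)) summable_on UNIV" by (simp only: summable_on_iff_abs_summable_on_complex)
 then have abs: "(%al. cmod (a al) * \<rho> ^ mdeg al) summable_on UNIV" by (simp add: norm_mult z0)
 then obtain S where "((%al. cmod (a al) * \<rho> ^ mdeg al) has_sum S) UNIV" by (auto simp: summable_on_def)
 then have "(%k. \<Sum>al | mdeg al = k. cmod (a al) * \<rho> ^ mdeg al) sums S" by (rule sums_by_degree)
 moreover have "(\<Sum>al | mdeg al = k. cmod (a al) * \<rho> ^ mdeg al) = hnorm a k * \<rho> ^ k" for k
  by (simp add: hnorm_def sum_distrib_right)
 ultimately have "summable (%k. hnorm a k * \<rho> ^ k)" by (simp add: sums_iff)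
 then show ?thesis using that[OF \<rho> abs] hs s by blast
qed

lemma summable_imp_converges:
 assumes "summable (%k. hnorm a k * R ^ k)" "0 < R"
 shows "converges R a"
 unfolding converges_def
proof clarify
 fix \<rho> :: real assume "0 \<le> \<rho>" "\<rho> < R"
 then show "summable (%k. hnorm a k * \<rho> ^ k)"
  by (intro summable_comparison_test'[OF assms(1)])
    (auto simp: abs_mult hnorm_nonneg intro!: mult_left_mono power_mono)
qed

lemma hcomp_scale: "hcomp a k (t *s u) = t ^ k * hcomp a k u"
 by (simp add: hcomp_def zmon_scale sum_distrib_left mult_ac)

lemma hcomp_zero_imp:
 fixes a :: "(('n::finite) mon) => complex"
 assumes "0 < r" and zero: "!!u. u \<in> ball u0 r ==> hcomp a k u = 0" and "mdeg al = k"
 shows "a al = 0"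
proof -
 define e where "e = r / (real CARD('n) + 1)"
 have e: "0 < e" "real CARD('n) * e < r" using assms(1) by (simp_all add: e_def pos_divide_less_eq algebra_simps)
 define L where "L = (lkp :: ('n mon) => 'n => nat)"
 define b where "b ga = (if ga \<in> L ` {al. mdeg al = k} then a (Abs_poly_mapping ga) else 0)" for ga
 have Labs: "Abs_poly_mapping (L al) = al" for al by (simp add: L_def lookup_inverse)
 have injL: "inj_on L S" for S using Labs by (metis inj_onI)
 have sub: "L ` {al. mdeg al = k} \<subseteq> PiE UNIV (%_. {..k})"
  using lookup_le_monom_degree by (fastforce simp: L_def PiE_iff)
 have fin: "finite (PiE (UNIV :: 'n set) (%_. {..k}))" by (intro finite_PiE) auto
 have "b (L al) = 0"
 proof (rule polynomial_vanishing_on_box[where I = UNIV and T = "%m. ball (u0 $ m) e" and s = k])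
  show "infinite (ball (u0 $ m) e)" for m using e(1) uncountable_ball uncountable_infinite by blast
  show "L al \<in> PiE UNIV (%_. {..k})" using sub assms(3) by blast
  fix v assume v: "!!m. m \<in> UNIV ==> v m \<in> ball (u0 $ m) e"
  define u where "u = (\<chi> m. v m)"
  have "norm (u - u0) \<le> real CARD('n) * e"
   using v by (intro norm_vec_le_card) (auto simp: u_def dist_norm norm_minus_commute less_imp_le)
  then have "hcomp a k u = 0" using e(2) by (intro zero) (simp add: dist_norm norm_minus_commute)
  moreover have "(\<Sum>ga\<in>PiE UNIV (%_. {..k}). b ga * (\<Prod>m\<in>UNIV. v m ^ ga m)) =
    (\<Sum>ga\<in>L ` {al. mdeg al = k}. b ga * (\<Prod>m\<in>UNIV. v m ^ ga m))"
   using fin sub by (intro sum.mono_neutral_right) (auto simp: b_def)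
  moreover have "\<dots> = hcomp a k u"
   unfolding hcomp_def by (subst sum.reindex[OF injL]) (auto simp: b_def Labs L_def zmon_def u_def intro!: sum.cong)
  ultimately show "(\<Sum>ga\<in>PiE UNIV (%_. {..k}). b ga * (\<Prod>m\<in>UNIV. v m ^ ga m)) = 0" by simp
 qed auto
 then show ?thesis using assms(3) Labs by (simp add: b_def)
qed

text \<open>The homogeneous components are recovered one after the other as limits along rays.\<close>

lemma ray_limit:
 fixes f :: "complex^'n::finite => complex"
 assumes "0 < \<rho>" and s: "!!z. (!!m. cmod (z $ m) \<le> \<rho>) ==> (%k. hcomp a k z) sums f z"
  and low: "!!i. i < j ==> hcomp a i u = 0"
 shows "((%t. f (t *s u) / t ^ j) \<longlongrightarrow> hcomp a j u) (at 0)"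
proof -
 define r where "r = \<rho> / (norm u + 1)"
 have r: "0 < r" using assms(1) by (simp add: r_def add_nonneg_pos)
 have "(%n. hcomp a (n + j) u * t ^ n) sums (f (t *s u) / t ^ j)" if t: "t ~= 0" "norm t < r" for t
 proof -
  have "cmod ((t *s u) $ m) \<le> \<rho>" for m
  proof -
   have "cmod ((t *s u) $ m) \<le> r * (norm u + 1)"
    using t(2) component_le_norm[of u m] r by (auto simp: norm_mult intro!: mult_mono)
   also have "\<dots> = \<rho>"
   proof -
    have "norm u + 1 ~= 0" using norm_ge_zero[of u] by linarith
    then show ?thesis by (simp add: r_def)
   qed
   finally show ?thesis .
  qed
  then have "(%k. t ^ k * hcomp a k u) sums f (t *s u)" using s[of "t *s u"] by (simp add: hcomp_scale)
  then have "(%k. t ^ (k + j) * hcomp a (k + j) u) sums (f (t *s u) - (\<Sum>k<j. t ^ k * hcomp a k u))"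
   by (rule sums_split_initial_segment)
  then have "(%k. t ^ (k + j) * hcomp a (k + j) u / t ^ j) sums (f (t *s u) / t ^ j)"
   using low by (intro sums_divide) (simp add: sum.neutral)
  moreover have "t ^ (k + j) * hcomp a (k + j) u / t ^ j = hcomp a (k + j) u * t ^ k" for k
   using t(1) by (simp add: power_add)
  ultimately show ?thesis by simp
 qed
 from powser_limit_0_strong[OF r this] show ?thesis by simp
qed

text \<open>A power series is zero if its sum vanishes on a cone over an open set.\<close>

lemma series_zero_on_cone:
 fixes f :: "complex^'n::finite => complex"
 assumes "0 < \<rho>" and s: "!!z. (!!m. cmod (z $ m) \<le> \<rho>) ==> (%k. hcomp a k z) sums f z"
  and "0 < r" "0 < de" and zero: "!!u t. u \<in> ball u0 r ==> 0 < t ==> t < de ==> f (of_real t *s u) = 0"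
 shows "a al = 0"
proof -
 have "hcomp a k u = 0" if u: "u \<in> ball u0 r" for k u
 proof (induction k rule: less_induct)
  case (less k)
  have "filterlim (complex_of_real) (at 0) (at_right 0)"
  proof (rule filterlim_atI)
   show "(complex_of_real \<longlongrightarrow> 0) (at_right 0)" using tendsto_of_real[OF tendsto_ident_at, of 0 "{0<..}"] by simp
   show "\<forall>\<^sub>F x in at_right 0. complex_of_real x ~= 0" using eventually_at_right_less[of "0::real"] by eventually_elim simp
  qed
  from filterlim_compose[OF ray_limit[OF assms(1) s less] this]
  have "((%t. f (of_real t *s u) / of_real t ^ k) \<longlongrightarrow> hcomp a k u) (at_right 0)" .
  moreover have "\<forall>\<^sub>F t in at_right 0. f (of_real t *s u) / of_real t ^ k = 0"
   by (rule eventually_mono[OF eventually_at_right_real[OF \<open>0 < de\<close>]]) (use zero[OF u] in auto)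
  then have "((%t. f (of_real t *s u) / of_real t ^ k) \<longlongrightarrow> 0) (at_right 0)" by (rule tendsto_eventually)
  ultimately show ?case by (intro tendsto_unique[of "at_right (0 :: real)"]) auto
 qed
 then show ?thesis using hcomp_zero_imp[OF \<open>0 < r\<close>, of u0 a "mdeg al" al] by blast
qed

lemma power_series_unique:
 assumes "power_series_at_0 a f" "power_series_at_0 b f"
 shows "a = b"
proof
 fix al
 have "\<forall>\<^sub>F x in nhds 0. ((%al. (a al - b al) * monom_eval (($) x) al) has_sum 0) UNIV"
  using assms unfolding power_series_at_0_def
 proof eventually_elim
  case (elim x)
  from has_sum_add[OF elim(1) has_sum_cmult_right[OF elim(2), of "-1"]] show ?case by (simp add: left_diff_distrib)
 qed
 then have "power_series_at_0 (%al. a al - b al) (%x. 0)" by (simp add: power_series_at_0_def)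
 then obtain \<rho> where "0 < \<rho>" "!!z. (!!m. cmod (z $ m) \<le> \<rho>) ==> (%k. hcomp (%al. a al - b al) k z) sums 0"
  by (rule power_series_local) blast
 from series_zero_on_cone[OF this zero_less_one zero_less_one] have "a al - b al = 0" by blast
 then show "a al = b al" by simp
qed

text \<open>The Taylor coefficients are unique, so any expansion of the germ computes them.\<close>

lemma taylor_coeff_eq: "power_series_at_0 a f ==> taylor_coeff f = a"
 unfolding taylor_coeff_def by (rule the_equality) (auto intro: power_series_unique)

section \<open>Orders of vanishing\<close>

definition vanishes_to_order :: "nat => (complex^'n::finite => complex) => bool" where
 "vanishes_to_order k f \<longleftrightarrow> (\<exists>C r. 0 \<le> C & 0 < r & (\<forall>x. norm x < r --> cmod (f x) \<le> C * norm x ^ k))"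

text \<open>Orders of vanishing in the sense of estimates are compatible with germs, products and sums, unlike the definition of the powers of the maximal ideal, and determine the order of the power series.\<close>

lemma order_imp_vanishes:
 fixes f :: "complex^'n::finite => complex"
 assumes "power_series_at_0 a f" "order_ge (int k) a"
 shows "vanishes_to_order k f"
proof -
 obtain \<rho> where \<rho>: "0 < \<rho>" "summable (%k. hnorm a k * \<rho> ^ k)"
  "!!z. (!!m. cmod (z $ m) \<le> \<rho>) ==> (%k. hcomp a k z) sums f z"
  by (rule power_series_local[OF assms(1)]) blast
 define C where "C = (suminf (%j. hnorm a j * \<rho> ^ j)) / \<rho> ^ k"
 have C0: "0 \<le> C" unfolding C_def using \<rho>(1,2) by (intro divide_nonneg_nonneg suminf_nonneg mult_nonneg_nonneg hnorm_nonneg zero_le_power) auto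
 have "cmod (f z) \<le> C * norm z ^ k" if z: "norm z < \<rho>" for z
 proof -
  have zm: "cmod (z $ m) \<le> norm z" for m by (rule component_le_norm)
  have s: "(%j. hcomp a j z) sums f z" using \<rho>(3)[of z] zm z by (meson less_imp_le order_trans)
  have le: "cmod (hcomp a j z) \<le> (hnorm a j * \<rho> ^ j) * (norm z ^ k / \<rho> ^ k)" for j
  proof (cases "j < k")
   case True
   then show ?thesis using hcomp_order[OF assms(2), of j] hnorm_nonneg[of a j] \<rho>(1) by simp
  next
   case False
   then obtain i where j: "j = k + i" using le_Suc_ex by (metis not_less)
   have "cmod (hcomp a j z) \<le> hnorm a j * norm z ^ j" using zm by (rule norm_hcomp_le)
   also have "norm z ^ j \<le> norm z ^ k * \<rho> ^ i" unfolding j power_add using z by (intro mult_left_mono power_mono) auto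
   also have "norm z ^ k * \<rho> ^ i = \<rho> ^ j * (norm z ^ k / \<rho> ^ k)" using \<rho>(1) by (simp add: j power_add)
   finally show ?thesis using hnorm_nonneg[of a j] by (simp add: mult_left_mono mult.assoc)
  qed
  have "cmod (suminf (%j. hcomp a j z)) \<le> (suminf (%j. (hnorm a j * \<rho> ^ j) * (norm z ^ k / \<rho> ^ k)))"
   by (rule norm_suminf_le[OF le summable_mult2[OF \<rho>(2)]])
  also have "\<dots> = C * norm z ^ k" using suminf_mult2[OF \<rho>(2), of "norm z ^ k / \<rho> ^ k"] by (simp add: C_def)
  finally show ?thesis using sums_unique[OF s] by simp
 qed
 then show ?thesis unfolding vanishes_to_order_def using C0 \<rho>(1) by blast
qed

lemma vanishes_imp_order:
 fixes f :: "complex^'n::finite => complex"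
 assumes "power_series_at_0 a f" "vanishes_to_order k f"
 shows "order_ge (int k) a"
proof -
 obtain \<rho> where \<rho>: "0 < \<rho>" "!!z. (!!m. cmod (z $ m) \<le> \<rho>) ==> (%k. hcomp a k z) sums f z"
  by (rule power_series_local[OF assms(1)]) blast
 obtain C r where C: "0 \<le> C" "0 < r" "!!x. norm x < r ==> cmod (f x) \<le> C * norm x ^ k"
  using assms(2) unfolding vanishes_to_order_def by blast
 have ntu: "norm (t *s u) \<le> real CARD('n) * (cmod t * norm u)" for t and u :: "complex^'n"
  by (rule norm_vec_le_card) (auto simp: norm_mult intro!: mult_left_mono component_le_norm)
 have "hcomp a j u = 0" if "j < k" for j u
  using that
 proof (induction j rule: less_induct)
  case (less j)
  have lim: "((%t. f (t *s u) / t ^ j) \<longlongrightarrow> hcomp a j u) (at 0)"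
   using less by (intro ray_limit[OF \<rho>]) auto
  define M where "M = real CARD('n) * norm u"
  have M: "0 \<le> M" "norm (t *s u) \<le> M * cmod t" for t using ntu[of t u] by (simp_all add: M_def mult_ac)
  have "((%t. C * M ^ k * cmod t ^ (k - j)) \<longlongrightarrow> C * M ^ k * norm (0 :: complex) ^ (k - j)) (at 0)"
   by (intro tendsto_intros)
  then have lim0: "((%t. C * M ^ k * cmod t ^ (k - j)) \<longlongrightarrow> 0) (at 0)" using less.prems by (simp add: power_0_left)
  have "\<forall>\<^sub>F t in at 0. norm (f (t *s u) / t ^ j) \<le> C * M ^ k * cmod t ^ (k - j)"
  proof (rule eventually_mono[OF eventually_at_ball'[of "r / (M + 1)"]])
   show "0 < r / (M + 1)" using C(2) M(1) by simp
   fix t :: complex assume t: "t \<in> ball 0 (r / (M + 1)) & t ~= 0 & t \<in> UNIV"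
   have "M * cmod t \<le> (M + 1) * cmod t" by (simp add: algebra_simps)
   also have "\<dots> < r" using t M(1) by (simp add: pos_less_divide_eq mult.commute)
   finally have "norm (t *s u) < r" using M(2)[of t] by simp
   then have "cmod (f (t *s u)) \<le> C * norm (t *s u) ^ k" by (rule C(3))
   also have "\<dots> \<le> C * (M * cmod t) ^ k" using C(1) M(2) by (intro mult_left_mono power_mono) auto
   also have "\<dots> = C * M ^ k * cmod t ^ (k - j) * cmod t ^ j"
    using less.prems by (simp add: power_mult_distrib flip: power_add)
   finally show "norm (f (t *s u) / t ^ j) \<le> C * M ^ k * cmod t ^ (k - j)"
    using t by (simp add: norm_divide norm_power pos_divide_le_eq)
  qed
  then have "((%t. f (t *s u) / t ^ j) \<longlongrightarrow> 0) (at 0)" using lim0 by (rule Lim_null_comparison)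
  then show ?case using lim tendsto_unique[of "at (0 :: complex)"] by simp
 qed
 then show ?thesis unfolding order_ge_def using hcomp_zero_imp[OF zero_less_one] by (metis of_nat_less_iff)
qed

lemma vanishes_mult:
 assumes "vanishes_to_order j f" "vanishes_to_order k g"
 shows "vanishes_to_order (j + k) (%x. f x * g x)"
proof -
 obtain C r D s where "0 \<le> C" "0 < r" "!!x. norm x < r ==> cmod (f x) \<le> C * norm x ^ j"
  "0 \<le> D" "0 < s" "!!x. norm x < s ==> cmod (g x) \<le> D * norm x ^ k"
  using assms unfolding vanishes_to_order_def by blast
 then have "cmod (f x * g x) \<le> (C * D) * norm x ^ (j + k)" if "norm x < min r s" for x
  using mult_mono[of "cmod (f x)" "C * norm x ^ j" "cmod (g x)" "D * norm x ^ k"] that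
  by (simp add: norm_mult power_add mult_ac)
 then show ?thesis unfolding vanishes_to_order_def using \<open>0 \<le> C\<close> \<open>0 \<le> D\<close> \<open>0 < r\<close> \<open>0 < s\<close>
  by (intro exI[of _ "C * D"] exI[of _ "min r s"]) auto
qed

lemma vanishes_sum:
 assumes "finite T" "!!t. t \<in> T ==> vanishes_to_order k (f t)"
 shows "vanishes_to_order k (%x. \<Sum>t\<in>T. f t x)"
 using assms
proof (induction T rule: finite_induct)
 case empty
 then show ?case unfolding vanishes_to_order_def by (intro exI[of _ 0] exI[of _ 1]) auto
next
 case (insert t T)
 then obtain C r D s where *: "0 \<le> C" "0 < r" "!!x. norm x < r ==> cmod (f t x) \<le> C * norm x ^ k"
  "0 \<le> D" "0 < s" "!!x. norm x < s ==> cmod (\<Sum>t\<in>T. f t x) \<le> D * norm x ^ k"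
  unfolding vanishes_to_order_def by (metis insertCI)
 have "cmod (\<Sum>t\<in>insert t T. f t x) \<le> (C + D) * norm x ^ k" if "norm x < min r s" for x
  using *(3)[of x] *(6)[of x] that insert.hyps norm_triangle_ineq[of "f t x" "\<Sum>t\<in>T. f t x"]
  by (simp add: distrib_right)
 then show ?case unfolding vanishes_to_order_def using * by (intro exI[of _ "C + D"] exI[of _ "min r s"]) auto
qed

lemma vanishes_eventually_eq:
 assumes "vanishes_to_order k f" "\<forall>\<^sub>F x in nhds 0. g x = f x"
 shows "vanishes_to_order k g"
proof -
 obtain C r where *: "0 \<le> C" "0 < r" "!!x. norm x < r ==> cmod (f x) \<le> C * norm x ^ k"
  using assms(1) unfolding vanishes_to_order_def by blast
 obtain e where "e > 0" "!!x. dist x 0 < e ==> g x = f x" using assms(2) unfolding eventually_nhds_metric by blast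
 then show ?thesis unfolding vanishes_to_order_def using * by (intro exI[of _ C] exI[of _ "min r e"]) auto
qed

lemma max_ideal_power_analytic: "f \<in> max_ideal_power k ==> f \<in> analytic_germs"
 by (cases k) (auto simp: germ_ideal_def)

lemma max_ideal_vanishes: "f \<in> max_ideal ==> vanishes_to_order 1 f"
proof -
 assume f: "f \<in> max_ideal"
 then obtain a where a: "power_series_at_0 a f" and f0: "f 0 = 0" by (auto simp: max_ideal_def analytic_germs_def)
 have "(%k. hcomp a k 0) sums f 0"
  by (rule power_series_local[OF a]) (metis less_imp_le norm_zero zero_index)
 moreover have "hcomp a k 0 = (if k = 0 then a 0 else 0)" for k
 proof (cases "k = 0")
  case True
  then show ?thesis by (simp add: hcomp_def monom_degree_eq_0_iff)
 next
  case False
  have "zmon 0 al = 0" if "mdeg al = k" for al :: "'a mon"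
  proof -
   have "\<exists>m. lkp al m ~= 0"
   proof (rule ccontr)
    assume "\<not> ?thesis"
    then have "mdeg al = 0" by (simp add: monom_degree_def)
    then show False using that False by simp
   qed
   then obtain m where "lkp al m ~= 0" ..
   then show ?thesis unfolding zmon_def by (intro prod_zero) (auto intro!: bexI[of _ m])
  qed
  then show ?thesis using False by (simp add: hcomp_def)
 qed
 ultimately have "(%k. if k = 0 then a 0 else 0) sums 0" using f0 by simp
 moreover have "(%k. if k = 0 then a 0 else 0) sums a 0" using sums_single[of 0 "%_. a 0"] by simp
 ultimately have "a 0 = 0" using sums_unique2 by blast
 then have "order_ge (int 1) a" by (auto simp: order_ge_def monom_degree_eq_0_iff)
 then show ?thesis by (rule order_imp_vanishes[OF a])
qed

lemma analytic_vanishes_0: "f \<in> analytic_germs ==> vanishes_to_order 0 f"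
 unfolding analytic_germs_def using order_imp_vanishes[of _ f 0] by (auto simp: order_ge_def)

lemma max_ideal_power_vanishes: "f \<in> max_ideal_power k ==> vanishes_to_order k f"
proof (induction k arbitrary: f)
 case 0 then show ?case by (simp add: analytic_vanishes_0)
next
 case (Suc k)
 then obtain T h where T: "finite T" "T \<subseteq> {%x. g x * h x |g h. g \<in> max_ideal & h \<in> max_ideal_power k}"
  "\<forall>t\<in>T. h t \<in> analytic_germs" "\<forall>\<^sub>F x in nhds 0. f x = (\<Sum>t\<in>T. h t x * t x)"
  by (auto simp: germ_ideal_def)
 have "vanishes_to_order (Suc k) t" if tT: "t \<in> T" for t
 proof -
  obtain g h' where "t = (%x. g x * h' x)" "g \<in> max_ideal" "h' \<in> max_ideal_power k"
   using subsetD[OF T(2) tT] unfolding mem_Collect_eq by (elim exE conjE) (rule that; assumption)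
  then show ?thesis using vanishes_mult[OF max_ideal_vanishes Suc.IH, of g h'] by simp
 qed
 then have "vanishes_to_order (Suc k) (%x. \<Sum>t\<in>T. h t x * t x)"
  using vanishes_mult[OF analytic_vanishes_0[OF bspec[OF T(3)]]] by (intro vanishes_sum[OF T(1)]) fastforce
 then show ?case using T(4) by (rule vanishes_eventually_eq)
qed

lemma germ_ideal_subset: "S \<subseteq> S' ==> germ_ideal S \<subseteq> germ_ideal S'"
 unfolding germ_ideal_def by blast

lemma max_ideal_power_decreasing: "(max_ideal_power (Suc k) :: (complex^'n::finite => complex) set) \<subseteq> max_ideal_power k"
proof (induction k)
 case 0 then show ?case by (auto simp: germ_ideal_def)
next
 case (Suc k)
 have "germ_ideal {%x. g x * h x |(g :: complex^'n => complex) h. g \<in> max_ideal & h \<in> max_ideal_power (Suc k)} \<subseteq>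
   germ_ideal {%x. g x * h x |g h. g \<in> max_ideal & h \<in> max_ideal_power k}"
 proof (rule germ_ideal_subset, rule subsetI)
  fix f :: "complex^'n => complex" assume "f \<in> {%x. g x * h x |g h. g \<in> max_ideal & h \<in> max_ideal_power (Suc k)}"
  then obtain g h where "f = (%x. g x * h x)" "g \<in> max_ideal" "h \<in> max_ideal_power (Suc k)" by blast
  moreover from this(3) have "h \<in> max_ideal_power k" by (rule subsetD[OF Suc])
  ultimately show "f \<in> {%x. g x * h x |g h. g \<in> max_ideal & h \<in> max_ideal_power k}"
   unfolding mem_Collect_eq by (intro exI[of _ g] exI[of _ h] conjI)
 qed
 then show ?case by (simp only: max_ideal_power.simps(2)[of "Suc k"] max_ideal_power.simps(2)[of k])
qed

lemma max_ideal_power_antimono: "j \<le> k ==> max_ideal_power k \<subseteq> max_ideal_power j"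
 by (rule lift_Suc_antimono_le[of max_ideal_power]) (rule max_ideal_power_decreasing)

lemma multiplicity_unique:
 assumes "has_multiplicity f d" "has_multiplicity f e" shows "d = e"
proof (rule ccontr)
 assume "d ~= e"
 then have "Suc d \<le> e \<or> Suc e \<le> d" by auto
 then show False
  using assms max_ideal_power_antimono[of "Suc d" e] max_ideal_power_antimono[of "Suc e" d]
  unfolding has_multiplicity_def by blast
qed

text \<open>The initial form consists of the Taylor coefficients of lowest degree.\<close>

lemma multiplicity_taylor:
 assumes "has_multiplicity f d"
 shows "power_series_at_0 (taylor_coeff f) f" "order_ge (int d) (taylor_coeff f)"
  "initial_form f = hom_component d f"
proof -
 have f: "f \<in> max_ideal_power d" using assms by (simp add: has_multiplicity_def)
 then obtain a where a: "power_series_at_0 a f" using max_ideal_power_analytic by (auto simp: analytic_germs_def)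
 then show 1: "power_series_at_0 (taylor_coeff f) f" using taylor_coeff_eq by metis
 show "order_ge (int d) (taylor_coeff f)" by (rule vanishes_imp_order[OF 1 max_ideal_power_vanishes[OF f]])
 have "(THE d. has_multiplicity f d) = d" by (rule the_equality, rule assms, rule multiplicity_unique[OF _ assms])
 then show "initial_form f = hom_component d f" by (simp add: initial_form_def)
qed

lemma lookup_hom_component:
 "lkp (hom_component k f) al = (if mdeg al = k then taylor_coeff f al else 0)"
 by (simp add: hom_component_def lookup_sum lookup_single when_def finite_monoms_of_degree)

section \<open>Weighted norms of power series\<close>

definition wmon :: "('n::finite => real) => ('n mon) => real" where
 "wmon w al = (\<Prod>m\<in>UNIV. w m ^ lkp al m)"

definition nsum :: "('n::finite => real) => (('n mon) => complex) => bool" where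
 "nsum w a \<longleftrightarrow> (%al. cmod (a al) * wmon w al) summable_on UNIV"

definition wnorm :: "('n::finite => real) => (('n mon) => complex) => real" where
 "wnorm w a = infsum (%al. cmod (a al) * wmon w al) UNIV"

definition ev :: "((('n::finite) mon) => complex) => complex^'n => complex" where
 "ev a z = infsum (%al. a al * zmon z al) UNIV"

definition in_poly :: "('n::finite => real) => complex^'n => bool" where
 "in_poly w z \<longleftrightarrow> (\<forall>m. cmod (z $ m) \<le> w m)"

context
 fixes w :: "'n::finite => real"
 assumes w: "!!m. 0 < w m"
begin

lemma wmon_pos: "0 < wmon w al"
 unfolding wmon_def using w by (intro prod_pos) auto

lemma wmon_add: "wmon w (al + be) = wmon w al * wmon w be"
 by (simp add: wmon_def lookup_add power_add prod.distrib)

lemma norm_zmon_le_wmon: "in_poly w z ==> cmod (zmon z al) \<le> wmon w al"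
 unfolding zmon_def wmon_def in_poly_def by (simp add: norm_power flip: prod_norm) (intro prod_mono, auto intro: power_mono)

lemma wnorm_nonneg: "0 \<le> wnorm w a"
 unfolding wnorm_def by (rule infsum_nonneg) (simp add: wmon_pos less_imp_le)

lemma ev_abs_summable:
 assumes "nsum w a" "in_poly w z"
 shows "(%al. norm (a al * zmon z al)) summable_on UNIV"
 using assms(1) unfolding nsum_def
 by (rule summable_on_comparison_test) (auto simp: norm_mult intro!: mult_left_mono norm_zmon_le_wmon assms(2))

lemma ev_has_sum:
 assumes "nsum w a" "in_poly w z"
 shows "((%al. a al * zmon z al) has_sum ev a z) UNIV"
 unfolding ev_def by (rule has_sum_infsum[OF abs_summable_summable[OF ev_abs_summable[OF assms]]])

lemma norm_ev_le:
 assumes "nsum w a" "in_poly w z"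
 shows "cmod (ev a z) \<le> wnorm w a"
proof -
 have "cmod (ev a z) \<le> infsum (%al. norm (a al * zmon z al)) UNIV"
  unfolding ev_def by (rule norm_infsum_bound[OF ev_abs_summable[OF assms]])
 also have "\<dots> \<le> wnorm w a"
  unfolding wnorm_def using ev_abs_summable[OF assms] assms(1)
  by (intro infsum_mono) (auto simp: nsum_def norm_mult intro!: mult_left_mono norm_zmon_le_wmon assms(2))
 finally show ?thesis .
qed

lemma ev_power_series:
 assumes "nsum w a" shows "power_series_at_0 a (ev a)"
proof -
 have "finite (range w)" by simp
 define e where "e = Min (range w)"
 have e: "0 < e" "!!m. e \<le> w m" unfolding e_def using w by auto
 have "((%al. a al * monom_eval (($) x) al) has_sum ev a x) UNIV" if "dist x 0 < e" for x
 proof -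
  have "in_poly w x" unfolding in_poly_def
  proof
   fix m
   have "cmod (x $ m) \<le> norm x" by (rule component_le_norm)
   also have "\<dots> \<le> w m" using that e(2)[of m] by simp
   finally show "cmod (x $ m) \<le> w m" .
  qed
  then show ?thesis using ev_has_sum[OF assms] by (simp add: monom_eval_eq_zmon)
 qed
 then show ?thesis unfolding power_series_at_0_def eventually_nhds_metric using e(1) by blast
qed

lemma has_sum_finite_sum:
 assumes "finite J" "!!j. j \<in> J ==> ((f j :: 'a => complex) has_sum s j) A"
 shows "((%x. \<Sum>j\<in>J. f j x) has_sum (\<Sum>j\<in>J. s j)) A"
 using assms by (induction J rule: finite_induct) (auto intro!: has_sum_add has_sum_0)

text \<open>Summation of an absolutely convergent family of series (Fubini).\<close>

lemma family_sum:
 fixes b :: "'j => ('n mon) => complex"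
 assumes b: "!!j. nsum w (b j)" "!!j. wnorm w (b j) \<le> M j" and M: "M summable_on UNIV"
 defines "c \<equiv> %ga. infsum (%j. b j ga) UNIV"
 shows "nsum w c" "wnorm w c \<le> infsum M UNIV"
  "in_poly w z ==> ((%j. ev (b j) z) has_sum ev c z) UNIV"
proof -
 define G where "G = (%(j, ga). cmod (b j ga) * wmon w ga)"
 have G0: "0 \<le> G x" for x by (auto simp: G_def case_prod_beta wmon_pos less_imp_le)
 have hsj: "((%ga. G (j, ga)) has_sum wnorm w (b j)) UNIV" for j
  unfolding G_def wnorm_def using b(1)[of j] by (auto simp: nsum_def intro: has_sum_infsum)
 have Ns: "(%j. wnorm w (b j)) summable_on UNIV"
  using M by (rule summable_on_comparison_test) (use b(2) wnorm_nonneg in auto)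
 have GS: "G summable_on UNIV \<times> UNIV"
  by (rule summable_on_SigmaI[OF hsj Ns]) (rule G0)
 have GS': "(%(ga, j). G (j, ga)) summable_on UNIV \<times> UNIV"
  using GS by (subst (asm) summable_on_swap)
 obtain L where L: "(G has_sum L) (UNIV \<times> UNIV)" using GS by (auto simp: summable_on_def)
 have "((%j. wnorm w (b j)) has_sum L) UNIV" by (rule has_sum_SigmaD[OF L]) (rule hsj)
 then have LM: "L \<le> infsum M UNIV"
  using has_sum_mono[OF _ has_sum_infsum[OF M]] b(2) by blast
 have L': "((%(ga, j). G (j, ga)) has_sum L) (UNIV \<times> UNIV)" using L by (subst (asm) has_sum_swap)
 have sj: "(%j. G (j, ga)) summable_on UNIV" for ga
  using summable_on_SigmaD1[OF GS', of ga] G0 by simp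
 have bj: "(%j. norm (b j ga)) summable_on UNIV" for ga
  using summable_on_cmult_left[OF sj[of ga], of "inverse (wmon w ga)"] wmon_pos[of ga] by (simp add: G_def mult.assoc)
 define h where "h ga = infsum (%j. G (j, ga)) UNIV" for ga
 have hs: "(h has_sum L) UNIV"
  using has_sum_SigmaD[OF L', of h] has_sum_infsum[OF sj] by (simp add: h_def)
 have le: "cmod (c ga) * wmon w ga \<le> h ga" for ga
 proof -
  have "cmod (c ga) \<le> infsum (%j. norm (b j ga)) UNIV" unfolding c_def by (rule norm_infsum_bound[OF bj])
  then have "cmod (c ga) * wmon w ga \<le> infsum (%j. norm (b j ga)) UNIV * wmon w ga"
   using wmon_pos[of ga] by (intro mult_right_mono) auto
  also have "\<dots> = h ga" unfolding h_def G_def by (simp add: infsum_cmult_left[OF bj])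
  finally show ?thesis .
 qed
 show c: "nsum w c"
  unfolding nsum_def using has_sum_imp_summable[OF hs]
  by (rule summable_on_comparison_test) (use le wmon_pos in \<open>auto simp: less_imp_le\<close>)
 have "wnorm w c \<le> L"
  unfolding wnorm_def using has_sum_mono[OF has_sum_infsum[OF c[unfolded nsum_def]] hs] le by blast
 then show "wnorm w c \<le> infsum M UNIV" using LM by simp
 show "((%j. ev (b j) z) has_sum ev c z) UNIV" if z: "in_poly w z"
 proof -
  define E where "E = (%(j, ga). b j ga * zmon z ga)"
  have "(%x. norm (E x)) summable_on UNIV \<times> UNIV"
   using GS by (rule summable_on_comparison_test)
    (auto simp: E_def G_def norm_mult intro!: mult_left_mono norm_zmon_le_wmon z)
  then have ES: "E summable_on UNIV \<times> UNIV" by (rule abs_summable_summable)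
  then obtain K where K: "(E has_sum K) (UNIV \<times> UNIV)" by (auto simp: summable_on_def)
  have 1: "((%j. ev (b j) z) has_sum K) UNIV"
   using has_sum_SigmaD[OF K] ev_has_sum[OF b(1) z] by (auto simp: E_def)
  have K': "((%(ga, j). E (j, ga)) has_sum K) (UNIV \<times> UNIV)" using K by (subst (asm) has_sum_swap)
  have "((%ga. c ga * zmon z ga) has_sum K) UNIV"
  proof (rule has_sum_SigmaD[OF K'])
   fix ga
   have "((%j. b j ga * zmon z ga) has_sum c ga * zmon z ga) UNIV"
    unfolding c_def by (intro has_sum_cmult_left has_sum_infsum abs_summable_summable[OF bj])
   then show "((%y. case (ga, y) of (ga, j) => E (j, ga)) has_sum c ga * zmon z ga) UNIV" by (simp add: E_def)
  qed
  then have "ev c z = K" using ev_has_sum[OF c z] has_sum_unique by blast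
  then show ?thesis using 1 by simp
 qed
qed

lemma nsum_scale:
 assumes "nsum w a" shows "nsum w (%ga. k * a ga)" "wnorm w (%ga. k * a ga) = cmod k * wnorm w a"
  "ev (%ga. k * a ga) z = k * ev a z"
proof -
 show "nsum w (%ga. k * a ga)"
  using summable_on_cmult_right[OF assms[unfolded nsum_def], of "cmod k"] by (simp add: nsum_def norm_mult mult.assoc)
 show "wnorm w (%ga. k * a ga) = cmod k * wnorm w a"
  using infsum_cmult_right[OF assms[unfolded nsum_def], of "cmod k"] by (simp add: wnorm_def norm_mult mult.assoc)
 show "ev (%ga. k * a ga) z = k * ev a z"
  unfolding ev_def by (simp add: mult.assoc infsum_cmult_right')
qed

lemma nsum_add:
 assumes "nsum w a" "nsum w b"
 shows "nsum w (%ga. a ga + b ga)" "wnorm w (%ga. a ga + b ga) \<le> wnorm w a + wnorm w b"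
  "in_poly w z ==> ev (%ga. a ga + b ga) z = ev a z + ev b z"
proof -
 have s: "(%ga. cmod (a ga) * wmon w ga + cmod (b ga) * wmon w ga) summable_on UNIV"
  using assms unfolding nsum_def by (rule summable_on_add)
 have le: "cmod (a ga + b ga) * wmon w ga \<le> cmod (a ga) * wmon w ga + cmod (b ga) * wmon w ga" for ga
  using mult_right_mono[OF norm_triangle_ineq[of "a ga" "b ga"], of "wmon w ga"] wmon_pos[of ga] by (simp add: distrib_right)
 show ab: "nsum w (%ga. a ga + b ga)"
  unfolding nsum_def using s by (rule summable_on_comparison_test) (use le wmon_pos in \<open>auto simp: less_imp_le\<close>)
 have "wnorm w (%ga. a ga + b ga) \<le> infsum (%ga. cmod (a ga) * wmon w ga + cmod (b ga) * wmon w ga) UNIV"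
  unfolding wnorm_def by (rule infsum_mono[OF ab[unfolded nsum_def] s le])
 also have "\<dots> = wnorm w a + wnorm w b"
  unfolding wnorm_def using assms unfolding nsum_def by (rule infsum_add)
 finally show "wnorm w (%ga. a ga + b ga) \<le> wnorm w a + wnorm w b" .
 show "ev (%ga. a ga + b ga) z = ev a z + ev b z" if "in_poly w z"
  using has_sum_unique[OF ev_has_sum[OF ab that]] has_sum_add[OF ev_has_sum[OF assms(1) that] ev_has_sum[OF assms(2) that]]
  by (simp add: distrib_right)
qed

lemma nsum_zero: "nsum w (%_. 0)" "wnorm w (%_. 0) = 0" "ev (%_. 0) z = 0"
 by (simp_all add: nsum_def wnorm_def ev_def)

lemma nsum_sum:
 assumes "finite J" "!!j. j \<in> J ==> nsum w (a j)"
 shows "nsum w (%ga. \<Sum>j\<in>J. a j ga) & wnorm w (%ga. \<Sum>j\<in>J. a j ga) \<le> (\<Sum>j\<in>J. wnorm w (a j)) &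
  (\<forall>z. in_poly w z --> ev (%ga. \<Sum>j\<in>J. a j ga) z = (\<Sum>j\<in>J. ev (a j) z))"
 using assms
proof (induction J rule: finite_induct)
 case empty then show ?case by (simp add: nsum_zero)
next
 case (insert j J)
 then have IH: "nsum w (%ga. \<Sum>j\<in>J. a j ga)" "wnorm w (%ga. \<Sum>j\<in>J. a j ga) \<le> (\<Sum>j\<in>J. wnorm w (a j))"
  "!!z. in_poly w z ==> ev (%ga. \<Sum>j\<in>J. a j ga) z = (\<Sum>j\<in>J. ev (a j) z)" and j: "nsum w (a j)" by auto
 show ?case
  using nsum_add[OF j IH(1)] IH(2,3) insert.hyps by simp
qed

lemma nsum_single:
 shows "nsum w (%de. if de = ga then k else 0)" "wnorm w (%de. if de = ga then k else 0) = cmod k * wmon w ga"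
  "ev (%de. if de = ga then k else 0) z = k * zmon z ga"
proof -
 have "((%de. cmod (if de = ga then k else 0) * wmon w de) has_sum cmod k * wmon w ga) UNIV"
  by (rule has_sum_finite_neutralI[of "{ga}"]) auto
 then show "nsum w (%de. if de = ga then k else 0)" "wnorm w (%de. if de = ga then k else 0) = cmod k * wmon w ga"
  by (auto simp: nsum_def wnorm_def summable_on_def infsumI)
 have "((%de. (if de = ga then k else 0) * zmon z de) has_sum k * zmon z ga) UNIV"
  by (rule has_sum_finite_neutralI[of "{ga}"]) auto
 then show "ev (%de. if de = ga then k else 0) z = k * zmon z ga" unfolding ev_def by (rule infsumI)
qed

lemma nsum_shift:
 fixes al :: "('n::finite) mon"
 assumes "nsum w f"
 defines "s \<equiv> %ga. if ga \<in> range ((+) al) then f (ga - al) else 0"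
 shows "nsum w s" "wnorm w s = wmon w al * wnorm w f" "in_poly w z ==> ev s z = zmon z al * ev f z"
proof -
 have inj: "inj ((+) al)" by (simp add: inj_def)
 have "((%ga. wmon w al * (cmod (f ga) * wmon w ga)) has_sum wmon w al * wnorm w f) UNIV"
  unfolding wnorm_def using assms(1) by (intro has_sum_cmult_right has_sum_infsum) (simp add: nsum_def)
 then have "((%ga. cmod (s ga) * wmon w ga) \<circ> (+) al has_sum wmon w al * wnorm w f) UNIV"
  by (simp add: s_def o_def wmon_add mult_ac)
 then have "((%ga. cmod (s ga) * wmon w ga) has_sum wmon w al * wnorm w f) (range ((+) al))"
  using has_sum_reindex[OF inj] by blast
 then have "((%ga. cmod (s ga) * wmon w ga) has_sum wmon w al * wnorm w f) UNIV"
  by (rule has_sum_cong_neutral[THEN iffD1, rotated -1]) (auto simp: s_def)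
 then show s: "nsum w s" "wnorm w s = wmon w al * wnorm w f"
  by (auto simp: nsum_def wnorm_def summable_on_def infsumI)
 show "ev s z = zmon z al * ev f z" if z: "in_poly w z"
 proof -
  have "((%ga. zmon z al * (f ga * zmon z ga)) has_sum zmon z al * ev f z) UNIV"
   by (intro has_sum_cmult_right ev_has_sum assms(1) z)
  then have "((%ga. s ga * zmon z ga) \<circ> (+) al has_sum zmon z al * ev f z) UNIV"
   by (simp add: s_def o_def zmon_add mult_ac)
  then have "((%ga. s ga * zmon z ga) has_sum zmon z al * ev f z) (range ((+) al))"
   using has_sum_reindex[OF inj] by blast
  then have "((%ga. s ga * zmon z ga) has_sum zmon z al * ev f z) UNIV"
   by (rule has_sum_cong_neutral[THEN iffD1, rotated -1]) (auto simp: s_def)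
  then show ?thesis using has_sum_unique[OF ev_has_sum[OF s(1) z]] by blast
 qed
qed

text \<open>An operator that is given on the monomials, and bounded by a multiple of their weights, extends to all series of finite norm.\<close>

lemma nsum_operator:
 assumes a: "nsum w a" and T: "!!al. nsum w (T al)" "!!al. wnorm w (T al) \<le> K * wmon w al"
 defines "c \<equiv> %ga. infsum (%al. a al * T al ga) UNIV"
 shows "nsum w c" "wnorm w c \<le> K * wnorm w a" "in_poly w z ==> ((%al. a al * ev (T al) z) has_sum ev c z) UNIV"
proof -
 have b: "nsum w (%ga. a al * T al ga)" "wnorm w (%ga. a al * T al ga) \<le> K * (cmod (a al) * wmon w al)" for al
  using nsum_scale[OF T(1), of "a al" al] mult_left_mono[OF T(2), of "cmod (a al)" al] by (simp_all add: mult_ac)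
 have M: "(%al. K * (cmod (a al) * wmon w al)) summable_on UNIV"
  using a unfolding nsum_def by (rule summable_on_cmult_right)
 show "nsum w c" unfolding c_def by (rule family_sum(1)[OF b M])
 have "infsum (%al. K * (cmod (a al) * wmon w al)) UNIV = K * wnorm w a"
  unfolding wnorm_def by (rule infsum_cmult_right) (use a in \<open>simp add: nsum_def\<close>)
 then show "wnorm w c \<le> K * wnorm w a" unfolding c_def using family_sum(2)[OF b M] by simp
 show "((%al. a al * ev (T al) z) has_sum ev c z) UNIV" if "in_poly w z"
  using family_sum(3)[OF b M that] nsum_scale(3)[OF T(1)] unfolding c_def by simp
qed

lemma nsum_mult:
 assumes "nsum w a" "nsum w f"
 obtains p where "nsum w p" "wnorm w p \<le> wnorm w f * wnorm w a" "!!z. in_poly w z ==> ev p z = ev a z * ev f z"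
proof -
 define s where "s al = (%ga. if ga \<in> range ((+) al) then f (ga - al) else 0)" for al :: "'n mon"
 note sh = nsum_shift[OF assms(2), folded s_def]
 have T: "nsum w (s al)" "wnorm w (s al) \<le> wnorm w f * wmon w al" for al using sh by (auto simp: mult.commute)
 have "ev (%ga. infsum (%al. a al * s al ga) UNIV) z = ev a z * ev f z" if z: "in_poly w z" for z
 proof -
  have "((%al. a al * ev (s al) z) has_sum ev (%ga. infsum (%al. a al * s al ga) UNIV) z) UNIV"
   by (rule nsum_operator(3)[OF assms(1) T z])
  moreover have "((%al. a al * zmon z al * ev f z) has_sum ev a z * ev f z) UNIV"
   by (intro has_sum_cmult_left ev_has_sum assms(1) z)
  ultimately show ?thesis by (simp add: sh(3)[OF z] mult.assoc) (rule has_sum_unique)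
 qed
 then show ?thesis using that[OF nsum_operator(1,2)[OF assms(1) T]] by blast
qed

section \<open>Division by several power series\<close>

text \<open>If every monomial can be divided by the \<open>f i\<close> up to an error of at most half its norm, with
 quotients and remainders of bounded relative norm, then every series can be divided exactly: the
 error is divided again, and the resulting series of quotients converges geometrically.\<close>

lemma division_by_approximation:
 fixes f :: "nat => ('n mon) => complex"
 assumes Bs: "finite Bs" and g: "nsum w g"
  and Q: "!!i al. i < p ==> nsum w (Q i al)" "!!i al. i < p ==> wnorm w (Q i al) \<le> K * wmon w al"
  and S: "!!be al. be \<in> Bs ==> nsum w (S be al)" "!!be al. be \<in> Bs ==> wnorm w (S be al) \<le> K * wmon w al"
  and E: "!!al. nsum w (E al)" "!!al. wnorm w (E al) \<le> 1 / 2 * wmon w al"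
  and eq: "!!al z. in_poly w z ==> zmon z al = (\<Sum>i<p. ev (Q i al) z * ev (f i) z) +
    (\<Sum>be\<in>Bs. zmon z be * ev (S be al) z) + ev (E al) z"
 shows "\<exists>H r. (\<forall>i<p. nsum w (H i)) & (\<forall>be\<in>Bs. nsum w (r be)) &
  (\<forall>be\<in>Bs. \<forall>ga. r be ga ~= 0 --> (\<exists>al. S be al ga ~= 0)) &
  (\<forall>z. in_poly w z --> ev g z = (\<Sum>i<p. ev (H i) z * ev (f i) z) + (\<Sum>be\<in>Bs. zmon z be * ev (r be) z))"
proof -
 define op where "op T a = (%ga. infsum (%al. a al * T al ga) UNIV)" for T :: "('n mon) => ('n mon) => complex" and a
 define a where "a k = (op E ^^ k) g" for k
 have a0: "a 0 = g" and aS: "a (Suc k) = op E (a k)" for k by (simp_all add: a_def)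
 have a: "nsum w (a k) & wnorm w (a k) \<le> (1 / 2) ^ k * wnorm w g" for k
 proof (induction k)
  case 0 then show ?case using g by (simp add: a0)
 next
  case (Suc k)
  then have k: "nsum w (a k)" "wnorm w (a k) \<le> (1 / 2) ^ k * wnorm w g" by auto
  have "nsum w (a (Suc k))" "wnorm w (a (Suc k)) \<le> 1 / 2 * wnorm w (a k)"
   unfolding aS op_def by (rule nsum_operator(1,2)[OF k(1) E])+
  then show ?case using k(2) by simp
 qed
 have step: "ev (a k) z = (\<Sum>i<p. ev (op (Q i) (a k)) z * ev (f i) z) + (\<Sum>be\<in>Bs. zmon z be * ev (op (S be) (a k)) z) + ev (a (Suc k)) z"
  if z: "in_poly w z" for k z
 proof -
  have ak: "nsum w (a k)" using a by blast
  have "((%al. (\<Sum>i<p. a k al * ev (Q i al) z * ev (f i) z) + (\<Sum>be\<in>Bs. zmon z be * (a k al * ev (S be al) z)) + a k al * ev (E al) z) has_sum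
    ((\<Sum>i<p. ev (op (Q i) (a k)) z * ev (f i) z) + (\<Sum>be\<in>Bs. zmon z be * ev (op (S be) (a k)) z) + ev (a (Suc k)) z)) UNIV"
  proof (intro has_sum_add has_sum_finite_sum has_sum_cmult_left has_sum_cmult_right finite_lessThan Bs)
   show "((%al. a k al * ev (Q i al) z) has_sum ev (op (Q i) (a k)) z) UNIV" if "i \<in> {..<p}" for i
    unfolding op_def using that by (intro nsum_operator(3)[OF ak Q(1) Q(2) z]) auto
   show "((%al. a k al * ev (S be al) z) has_sum ev (op (S be) (a k)) z) UNIV" if "be \<in> Bs" for be
    unfolding op_def by (rule nsum_operator(3)[OF ak S(1)[OF that] S(2)[OF that] z])
   show "((%al. a k al * ev (E al) z) has_sum ev (a (Suc k)) z) UNIV"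
    unfolding aS op_def by (rule nsum_operator(3)[OF ak E z])
  qed
  moreover have "(\<Sum>i<p. a k al * ev (Q i al) z * ev (f i) z) + (\<Sum>be\<in>Bs. zmon z be * (a k al * ev (S be al) z)) + a k al * ev (E al) z
    = a k al * zmon z al" for al
   unfolding eq[OF z, of al] by (simp add: distrib_left sum_distrib_left mult_ac)
  ultimately have "((%al. a k al * zmon z al) has_sum
    ((\<Sum>i<p. ev (op (Q i) (a k)) z * ev (f i) z) + (\<Sum>be\<in>Bs. zmon z be * ev (op (S be) (a k)) z) + ev (a (Suc k)) z)) UNIV"
   by simp
  then show ?thesis using ev_has_sum[OF ak z] has_sum_unique by blast
 qed
 define Sum where "Sum T = (%ga. infsum (%k. op T (a k) ga) UNIV)" for T
 have geo: "(%k. K * ((1 / 2) ^ k * wnorm w g)) summable_on (UNIV :: nat set)" for K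
 proof -
  have "summable (%k. norm (K * ((1 / 2) ^ k * wnorm w g)))"
  proof -
   have "summable (%k. \<bar>K\<bar> * ((1 / 2) ^ k * \<bar>wnorm w g\<bar>))"
    by (intro summable_mult summable_mult2 summable_geometric) simp
   then show ?thesis by (simp only: real_norm_def abs_mult power_abs abs_divide abs_one abs_numeral)
  qed
  then have "(%k. norm (K * ((1 / 2) ^ k * wnorm w g))) summable_on UNIV" by (intro norm_summable_imp_summable_on) simp
  then show ?thesis by (rule abs_summable_summable)
 qed
 have Sum: "nsum w (Sum T)" "in_poly w z ==> (%k. ev (op T (a k)) z) sums ev (Sum T) z"
  if T: "!!al. nsum w (T al)" "!!al. wnorm w (T al) \<le> K * wmon w al" for T z
 proof -
  have K0: "0 \<le> K"
  proof -
   have "0 \<le> wnorm w (T 0)" by (rule wnorm_nonneg)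
   also have "\<dots> \<le> K * wmon w 0" by (rule T(2))
   finally show ?thesis by (simp add: wmon_def)
  qed
  have b: "nsum w (op T (a k))" "wnorm w (op T (a k)) \<le> K * ((1 / 2) ^ k * wnorm w g)" for k
  proof -
   have ak: "nsum w (a k)" "wnorm w (a k) \<le> (1 / 2) ^ k * wnorm w g" using a by auto
   show "nsum w (op T (a k))" unfolding op_def by (rule nsum_operator(1)[OF ak(1) T])
   have "wnorm w (op T (a k)) \<le> K * wnorm w (a k)" unfolding op_def by (rule nsum_operator(2)[OF ak(1) T])
   also have "\<dots> \<le> K * ((1 / 2) ^ k * wnorm w g)" using ak(2) K0 by (rule mult_left_mono)
   finally show "wnorm w (op T (a k)) \<le> K * ((1 / 2) ^ k * wnorm w g)" .
  qed
  show "nsum w (Sum T)" unfolding Sum_def by (rule family_sum(1)[OF b geo])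
  show "(%k. ev (op T (a k)) z) sums ev (Sum T) z" if "in_poly w z"
   unfolding Sum_def by (rule has_sum_imp_sums[OF family_sum(3)[OF b geo that]])
 qed
 have "ev g z = (\<Sum>i<p. ev (Sum (Q i)) z * ev (f i) z) + (\<Sum>be\<in>Bs. zmon z be * ev (Sum (S be)) z)" if z: "in_poly w z" for z
 proof -
  define t where "t k = (\<Sum>i<p. ev (op (Q i) (a k)) z * ev (f i) z) + (\<Sum>be\<in>Bs. zmon z be * ev (op (S be) (a k)) z)" for k
  have 1: "t sums ((\<Sum>i<p. ev (Sum (Q i)) z * ev (f i) z) + (\<Sum>be\<in>Bs. zmon z be * ev (Sum (S be)) z))"
   unfolding t_def by (intro sums_add sums_sum sums_mult sums_mult2 Sum(2)[OF _ _ z] Q S) auto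
  have "t k = ev (a k) z - ev (a (Suc k)) z" for k using step[OF z, of k] by (simp add: t_def)
  then have ps: "(\<Sum>k<n. t k) = ev g z - ev (a n) z" for n
   using sum_lessThan_telescope'[of "%k. ev (a k) z" n] by (simp add: a0)
  have "(%n. ev (a n) z) \<longlonglongrightarrow> 0"
  proof (rule Lim_null_comparison)
   have "cmod (ev (a n) z) \<le> (1 / 2) ^ n * wnorm w g" for n
    using norm_ev_le[OF _ z, of "a n"] a[of n] by linarith
   then show "\<forall>\<^sub>F n in sequentially. cmod (ev (a n) z) \<le> (1 / 2) ^ n * wnorm w g" by (intro always_eventually) blast
   have "(%n. (1 / 2) ^ n * wnorm w g) \<longlonglongrightarrow> 0 * wnorm w g"
    by (intro tendsto_mult tendsto_const LIMSEQ_realpow_zero) auto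
   then show "(%n. (1 / 2) ^ n * wnorm w g) \<longlonglongrightarrow> 0" by simp
  qed
  then have "(%n. ev g z - ev (a n) z) \<longlonglongrightarrow> ev g z - 0" by (intro tendsto_diff tendsto_const)
  then have "t sums ev g z" by (simp add: sums_def ps)
  then show ?thesis using 1 sums_unique2 by blast
 qed
 moreover have "\<exists>al. S be al ga ~= 0" if "Sum (S be) ga ~= 0" for be ga
 proof (rule ccontr)
  assume "\<not> ?thesis"
  then have "op (S be) (a k) ga = 0" for k by (simp add: op_def)
  then show False using that by (simp add: Sum_def)
 qed
 ultimately show ?thesis
  using Sum(1)[OF Q] Sum(1)[OF S]
  by (intro exI[of _ "%i. Sum (Q i)"] exI[of _ "%be. Sum (S be)"]) auto
qed

end

section \<open>Sets with a conic point\<close>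

lemma straight_sphere:
 fixes x :: "real \<times> 'a::euclidean_space"
 assumes "x \<in> UNIV \<times> sphere 0 1"
 shows "straight (UNIV \<times> sphere 0 1) x (DIM('a) - 1)"
proof -
 define q where "q = (%x :: real \<times> 'a. snd x \<bullet> snd x - 1)"
 have nx: "norm (snd x) = 1" using assms by (auto simp: mem_Times_iff)
 have "Ck_on k UNIV (%x :: real \<times> 'a. snd x \<bullet> snd x + (-1))" for k
  by (intro Ck_on_add Ck_on_const Ck_on_bilinear[OF bounded_bilinear_inner] Ck_on_bounded_linear bounded_linear_snd open_UNIV)
 then have Ck: "Ck_on k UNIV q" for k by (simp add: q_def)
 have der: "(q has_derivative (%h. 2 * (snd x \<bullet> snd h))) (at x)"
  unfolding q_def by (auto intro!: derivative_eq_intros simp: inner_commute)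
 then have D: "FD q (at x) = (%h. 2 * (snd x \<bullet> snd h))" by (rule frechet_derivative_at[symmetric])
 have "range (%v. FD q (at x) (0, v)) = UNIV"
 proof -
  have "surj (%v. 2 * (snd x \<bullet> snd (0 :: real, v)))"
   by (rule surjI[of _ "%s. (s / 2) *\<^sub>R snd x"]) (use nx in \<open>simp add: dot_square_norm\<close>)
  then show ?thesis unfolding D .
 qed
 then have "straight {x. q x = 0} x (DIM('a) - dim (UNIV :: real set))"
  by (intro submersion_straight(1)[OF open_UNIV UNIV_I Ck]) auto
 moreover have "{x. q x = 0} = UNIV \<times> sphere 0 1"
  by (auto simp: q_def dot_square_norm power2_eq_1_iff) (smt (verit) norm_ge_zero)+
 ultimately show ?thesis by simp
qed

text \<open>A chart at a point is a chart at all points of its domain.\<close>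

lemma open_straight: "open {x. straight M x k}"
proof (rule openI)
 fix x assume "x \<in> {x. straight M x k}"
 then obtain V W \<Phi> \<Psi> and K :: "'a set" where *: "x \<in> V" "diffeomorphism V W \<Phi> \<Psi> & (\<forall>y\<in>V. fst (\<Phi> y) = fst y) &
   subspace K & dim K = k & (\<forall>y\<in>V. y \<in> M \<longleftrightarrow> snd (\<Phi> y) \<in> K)"
  unfolding straight_def mem_Collect_eq by (elim exE conjE) (rule that, assumption, intro conjI; assumption)
 have st: "straight M y k" if "y \<in> V" for y
  unfolding straight_def
  by (rule exI[of _ V], rule exI[of _ W], rule exI[of _ \<Phi>], rule exI[of _ \<Psi>], rule exI[of _ K]) (simp add: * that)
 have "open V" using * by (simp add: diffeomorphism_def)
 then obtain e where "e > 0" "ball x e \<subseteq> V" using *(1) open_contains_ball by metis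
 then show "\<exists>e>0. ball x e \<subseteq> {x. straight M x k}" using st by blast
qed

text \<open>\<open>M\<close> is the strict transform of \<open>X\<close> under the blow-up of the origin in polar coordinates.\<close>

locale blown_up =
 fixes M :: "(real \<times> 'a::euclidean_space) set" and X :: "'a set" and \<rho> :: real and k :: nat
 assumes \<rho>: "0 < \<rho>"
  and compact_M: "compact {x \<in> M. 0 \<le> fst x & fst x \<le> \<rho>}"
  and M_sphere: "M \<subseteq> UNIV \<times> sphere 0 1"
  and st0: "!!x. x \<in> M ==> fst x = 0 ==> straight M x k"
  and X_M: "!!t u. 0 < t ==> t \<le> \<rho> ==> norm u = 1 ==> t *\<^sub>R u \<in> X \<longleftrightarrow> (t, u) \<in> M"
  and zero_X: "0 \<in> X"
begin

lemma norm_snd_M: "x \<in> M ==> norm (snd x) = 1"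
 using M_sphere by auto

text \<open>Compactness of the part of \<open>M\<close> with \<open>0 \<le> fst x \<le> \<rho>\<close>.\<close>

lemma cover_near_zero:
 assumes "open G" "!!x. x \<in> M ==> fst x = 0 ==> x \<in> G"
 obtains r where "0 < r" "r \<le> \<rho>" "!!x. x \<in> M ==> 0 \<le> fst x ==> fst x < r ==> x \<in> G"
proof -
 let ?K = "{x \<in> M. 0 \<le> fst x & fst x \<le> \<rho>} - G"
 have K: "compact ?K" by (rule compact_diff[OF compact_M assms(1)])
 show ?thesis
 proof (cases "?K = {}")
  case True
  show ?thesis by (rule that[OF \<rho>]) (use True in auto)
 next
  case False
  obtain y where y: "y \<in> ?K" "\<forall>x\<in>?K. fst y \<le> fst x"
   using continuous_attains_inf[OF K False continuous_on_fst[OF continuous_on_id]] by blast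
  have "0 < fst y" using y(1) assms(2)[of y] by (cases "fst y = 0") auto
  then show ?thesis by (rule that[of "fst y"]) (use y in force)+
 qed
qed

lemma radius_straight:
 obtains r where "0 < r" "r \<le> \<rho>" "\<forall>x\<in>collar M r. straight M x k"
proof -
 have *: "!!x. x \<in> M ==> fst x = 0 ==> x \<in> {x. straight M x k}" using st0 by simp
 obtain r where r: "0 < r" "r \<le> \<rho>" "!!x. x \<in> M ==> 0 \<le> fst x ==> fst x < r ==> x \<in> {x. straight M x k}"
  using cover_near_zero[OF open_straight *] by metis
 show ?thesis by (rule that[OF r(1,2)]) (use r(3) in \<open>auto simp: collar_def\<close>)
qed

lemma curve_from_boundary:
 assumes "x \<in> M" "fst x = 0"
 obtains ga v where "ga 0 = x" "(ga has_vector_derivative v) (at 0 within {0..})" "fst v = 1"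
  "\<exists>de>0. \<forall>s. 0 \<le> s & s < de --> ga s \<in> collar M \<rho>"
proof -
 obtain \<Phi> K where \<Phi>: "subspace K" "slice_chart (collar M \<rho>) x \<Phi> (UNIV \<times> K) (1, 0)"
  "!!v. fst (FD \<Phi> (at x) v) = fst v" "!!w. \<exists>v. FD \<Phi> (at x) v = w"
  by (rule straight_charts[OF st0[OF assms] assms(1), of \<rho>]) (use assms \<rho> in auto)
 obtain v where v: "FD \<Phi> (at x) v = (1, 0)" using \<Phi>(4) by blast
 have "v \<in> tcone (collar M \<rho>) x"
  using v subspace_0[OF \<Phi>(1)] by (intro slice_in_tcone[OF \<Phi>(2)]) (auto simp: inner_prod_def)
 moreover have "fst v = 1" using \<Phi>(3)[of v] v by simp
 ultimately show ?thesis using that unfolding tcone_def by blast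
qed

lemma curve_fst_pos:
 assumes "ga 0 = x" "(ga has_vector_derivative v) (at 0 within {0..})" "fst v = 1" "fst x = (0 :: real)"
 shows "\<forall>\<^sub>F s in at_right 0. 0 < fst (ga s)"
proof -
 have "((%s. fst ((1 / s) *\<^sub>R (ga s - x))) \<longlongrightarrow> fst v) (at_right 0)"
  by (intro tendsto_fst tcone_limit assms)
 then have "\<forall>\<^sub>F s in at_right 0. 0 < fst ((1 / s) *\<^sub>R (ga s - x))"
  by (rule order_tendstoD) (simp add: assms(3))
 then show ?thesis
  using eventually_at_right_less[of "0 :: real"]
  by eventually_elim (simp add: assms(4) zero_less_divide_iff)
qed

lemma closed_M: "closed {x \<in> M. 0 \<le> fst x & fst x \<le> \<rho>}"
 by (rule compact_imp_closed[OF compact_M])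

text \<open>Near the boundary of the blow-up, every point of \<open>M\<close> with first coordinate zero is a limit of points with positive first coordinate, so the closure adds exactly the boundary.\<close>

lemma conic_point_X:
 assumes closedin: "\<exists>\<rho>>0. closedin (top_of_set (ball 0 \<rho>)) (X \<inter> ball 0 \<rho>)"
 shows "conic_point X"
proof -
 obtain r where r: "0 < r" "r \<le> \<rho>" and st0: "\<forall>x\<in>collar M r. straight M x k" by (rule radius_straight)
 then have st: "!!x. x \<in> collar M r ==> straight M x k" by blast
 let ?S = "UNIV \<times> sphere 0 1 :: (real \<times> 'a) set"
 let ?P = "{0..<r} \<times> sphere 0 1 :: (real \<times> 'a) set"
 let ?A = "bl0 -` (X \<inter> {x. 0 < norm x & norm x < r}) \<inter> {0..} \<times> sphere 0 1"
 have P: "?P = collar ?S r" by (auto simp: collar_def)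
 have A: "?A = {x \<in> M. 0 < fst x & fst x < r}"
 proof (intro subset_antisym subsetI)
  fix x assume x: "x \<in> ?A"
  then obtain t u where tu: "x = (t, u)" "0 \<le> t" "norm u = 1" by auto
  then have "0 < t" "t < r" "t *\<^sub>R u \<in> X" using x by (auto simp: bl0_def)
  then show "x \<in> {x \<in> M. 0 < fst x & fst x < r}" using X_M[of t u] tu r by auto
 next
  fix x assume x: "x \<in> {x \<in> M. 0 < fst x & fst x < r}"
  then obtain t u where tu: "x = (t, u)" "0 < t" "t < r" "(t, u) \<in> M" by (cases x) auto
  then show "x \<in> ?A" using X_M[of t u] norm_snd_M[of x] r by (auto simp: bl0_def)
 qed
 have cl: "top_of_set ?P closure_of ?A = ?P \<inter> closure ?A"
 proof -
  have "?P \<inter> ?A = ?A" unfolding A using M_sphere by (auto simp: mem_Times_iff)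
  then show ?thesis unfolding closure_of_subtopology euclidean_closure_of by (simp only:)
 qed
 have "?P \<inter> closure ?A = collar M r"
 proof (intro subset_antisym subsetI)
  fix x assume x: "x \<in> ?P \<inter> closure ?A"
  have "closure ?A \<subseteq> {x \<in> M. 0 \<le> fst x & fst x \<le> \<rho>}"
   unfolding A by (rule closure_minimal[OF _ closed_M]) (use r in auto)
  then show "x \<in> collar M r" using x by (auto simp: collar_def)
 next
  fix x assume x: "x \<in> collar M r"
  have "x \<in> closure ?A"
  proof (cases "fst x = 0")
   case False
   then have "x \<in> ?A" unfolding A using x by (auto simp: collar_def)
   then show ?thesis by (rule subsetD[OF closure_subset])
  next
   case True
   have xM: "x \<in> M" using x by (simp add: collar_def)
   obtain ga v where ga: "ga 0 = x" "(ga has_vector_derivative v) (at 0 within {0..})" "fst v = 1"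
    "\<exists>de>0. \<forall>s. 0 \<le> s & s < de --> ga s \<in> collar M \<rho>" by (rule curve_from_boundary[OF xM True])
   obtain de where de: "de > 0" "!!s. 0 \<le> s ==> s < de ==> ga s \<in> collar M \<rho>" using ga(4) by blast
   have "(ga \<longlongrightarrow> ga 0) (at 0 within {0..})"
    using has_vector_derivative_continuous[OF ga(2)] by (simp add: continuous_within)
   then have lim: "(ga \<longlongrightarrow> x) (at_right 0)" unfolding ga(1) by (rule tendsto_within_subset) auto
   have "((%s. fst (ga s)) \<longlongrightarrow> fst x) (at_right 0)" by (rule tendsto_fst[OF lim])
   then have "\<forall>\<^sub>F s in at_right 0. fst (ga s) < r" by (rule order_tendstoD) (simp add: True r)
   moreover have "\<forall>\<^sub>F s in at_right 0. s < de" using de(1) by (rule eventually_at_right_real[THEN eventually_mono]) auto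
   moreover note curve_fst_pos[OF ga(1-3) True] eventually_at_right_less[of "0 :: real"]
   ultimately have "\<forall>\<^sub>F s in at_right 0. ga s \<in> ?A"
   proof eventually_elim
    case (elim s)
    then have "ga s \<in> collar M \<rho>" using de(2)[of s] by simp
    then show ?case unfolding A using elim by (auto simp: collar_def)
   qed
   then have "\<forall>\<^sub>F s in at_right 0. ga s \<in> closure ?A" by (rule eventually_mono) (rule subsetD[OF closure_subset])
   then show ?thesis by (rule Lim_in_closed_set[OF closed_closure _ _ lim]) simp
  qed
  then show "x \<in> ?P \<inter> closure ?A" using x M_sphere by (auto simp: collar_def)
 qed
 moreover have "p_submanifold (collar ?S r) (collar M r)"
  by (rule collar_p_submanifold[OF st _ r(1) M_sphere]) (auto intro!: straight_sphere simp: collar_def)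
 ultimately have "p_submanifold ?P (top_of_set ?P closure_of ?A)" using cl P by simp
 moreover have "0 \<in> closure X" using zero_X closure_subset by blast
 ultimately show ?thesis unfolding conic_point_def using closedin r(1) by blast
qed

subsection \<open>The tangent cone at the origin\<close>

lemma tcone_X_subset:
 assumes "v \<in> tcone X 0" "v ~= 0"
 shows "(0, (1 / norm v) *\<^sub>R v) \<in> M"
proof -
 obtain ga de where ga: "ga 0 = 0" "(ga has_vector_derivative v) (at 0 within {0..})"
  and de: "de > 0" "!!s. 0 \<le> s ==> s < de ==> ga s \<in> X"
  using assms(1) unfolding tcone_def by blast
 let ?q = "%s. (1 / s) *\<^sub>R ga s"
 have lim: "(?q \<longlongrightarrow> v) (at_right 0)" using tcone_limit[OF ga] by simp
 have "(ga \<longlongrightarrow> ga 0) (at 0 within {0..})"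
  using has_vector_derivative_continuous[OF ga(2)] by (simp add: continuous_within)
 then have lim0: "(ga \<longlongrightarrow> 0) (at_right 0)" unfolding ga(1) by (rule tendsto_within_subset) auto
 have nz: "\<forall>\<^sub>F s in at_right 0. ?q s ~= 0" using lim assms(2) by (rule tendsto_imp_eventually_ne)
 have "\<forall>\<^sub>F s in at_right 0. norm (ga s) < \<rho>"
  using tendsto_norm[OF lim0] by (rule order_tendstoD) (simp add: \<rho>)
 moreover have "\<forall>\<^sub>F s in at_right 0. s < de" using de(1) by (rule eventually_at_right_real[THEN eventually_mono]) auto
 ultimately have ev: "\<forall>\<^sub>F s in at_right 0. (norm (ga s), (1 / norm (?q s)) *\<^sub>R ?q s) \<in> {x \<in> M. 0 \<le> fst x & fst x \<le> \<rho>}"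
  using nz eventually_at_right_less[of "0 :: real"]
 proof eventually_elim
  case (elim s)
  have g: "ga s ~= 0" "0 < s" using elim by auto
  then have e: "(1 / norm (?q s)) *\<^sub>R ?q s = (1 / norm (ga s)) *\<^sub>R ga s" by simp
  have "norm (ga s) *\<^sub>R ((1 / norm (ga s)) *\<^sub>R ga s) \<in> X" using de(2)[of s] elim g by simp
  then show ?case unfolding e using X_M[of "norm (ga s)" "(1 / norm (ga s)) *\<^sub>R ga s"] g elim by simp
 qed
 have "((%s. (norm (ga s), (1 / norm (?q s)) *\<^sub>R ?q s)) \<longlongrightarrow> (norm (0 :: 'a), (1 / norm v) *\<^sub>R v)) (at_right 0)"
  using assms(2) by (intro tendsto_Pair tendsto_norm lim0 tendsto_scaleR tendsto_divide tendsto_const lim) auto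
 then have "(norm (0 :: 'a), (1 / norm v) *\<^sub>R v) \<in> {x \<in> M. 0 \<le> fst x & fst x \<le> \<rho>}"
  by (rule Lim_in_closed_set[OF closed_M ev, rotated]) simp
 then show ?thesis by simp
qed

lemma boundary_in_tcone_X:
 assumes "(0, u) \<in> M"
 shows "u \<in> tcone X 0"
proof -
 have f0: "fst (0 :: real, u) = 0" by simp
 obtain ga v where ga: "ga 0 = (0, u)" "(ga has_vector_derivative v) (at 0 within {0..})" "fst v = 1"
  "\<exists>de>0. \<forall>s. 0 \<le> s & s < de --> ga s \<in> collar M \<rho>" by (rule curve_from_boundary[OF assms f0])
 obtain de where de: "de > 0" "!!s. 0 \<le> s ==> s < de ==> ga s \<in> collar M \<rho>" using ga(4) by blast
 define k where "k s = fst (ga s) *\<^sub>R snd (ga s)" for s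
 have "((%s. fst (ga s)) has_vector_derivative fst v) (at 0 within {0..})"
  "((%s. snd (ga s)) has_vector_derivative snd v) (at 0 within {0..})"
  using bounded_linear.has_vector_derivative[OF bounded_linear_fst ga(2)]
   bounded_linear.has_vector_derivative[OF bounded_linear_snd ga(2)] .
 then have "(k has_vector_derivative (fst (ga 0) *\<^sub>R snd v + fst v *\<^sub>R snd (ga 0))) (at 0 within {0..})"
  unfolding k_def by (rule bounded_bilinear.has_vector_derivative[OF bounded_bilinear_scaleR])
 then have "(k has_vector_derivative u) (at 0 within {0..})" using ga by simp
 moreover have "k s \<in> X" if s: "0 \<le> s" "s < de" for s
 proof (cases "fst (ga s) = 0")
  case True then show ?thesis using zero_X by (simp add: k_def)
 next
  case False
  have "ga s \<in> M" "0 < fst (ga s)" "fst (ga s) \<le> \<rho>" using de(2)[OF s] False by (auto simp: collar_def)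
  then show ?thesis using X_M[of "fst (ga s)" "snd (ga s)"] norm_snd_M by (simp add: k_def)
 qed
 ultimately show ?thesis unfolding tcone_def using de(1) ga(1)
  by (intro CollectI exI[of _ k]) (auto simp: k_def)
qed

text \<open>The tangent cone of a smooth germ is its tangent space.\<close>

lemma nonsingular_imp_subspace:
 assumes "\<not> singular_point X 0"
 shows "subspace (tcone X 0)"
proof -
 obtain V where V: "open V" "0 \<in> V" "submanifold_with_boundary (X \<inter> V)" "manifold_boundary (X \<inter> V) = {}"
  using assms zero_X unfolding singular_point_def by blast
 obtain \<Phi> L e where c: "slice_chart (X \<inter> V) 0 \<Phi> L e"
  using V(2,3) zero_X unfolding submanifold_with_boundary_def by blast
 have "e = 0 \<or> e \<bullet> \<Phi> 0 > 0"
 proof -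
  have "0 \<le> e \<bullet> \<Phi> 0"
   by (rule slice_chart_unfold[OF c]) auto
  moreover have "e ~= 0 ==> e \<bullet> \<Phi> 0 ~= 0" using V(4) c unfolding manifold_boundary_def by blast
  ultimately show ?thesis by fastforce
 qed
 then have sub: "subspace (tcone (X \<inter> V) 0)" by (rule tcone_interior_subspace[OF c])
 have "tcone X 0 \<subseteq> tcone (X \<inter> V) 0"
 proof
  fix v assume "v \<in> tcone X 0"
  then obtain ga de where ga: "ga 0 = 0" "(ga has_vector_derivative v) (at 0 within {0..})"
   and de: "de > 0" "!!s. 0 \<le> s ==> s < de ==> ga s \<in> X"
   unfolding tcone_def by blast
  have "(ga \<longlongrightarrow> ga 0) (at 0 within {0..})"
   using has_vector_derivative_continuous[OF ga(2)] by (simp add: continuous_within)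
  then have "\<forall>\<^sub>F s in at 0 within {0..}. ga s \<in> V" using topological_tendstoD V ga(1) by metis
  then obtain de' where de': "de' > 0" "!!s. 0 \<le> s ==> s ~= 0 ==> s < de' ==> ga s \<in> V"
   unfolding eventually_at by (auto simp: dist_real_def)
  then have "ga s \<in> X \<inter> V" if "0 \<le> s" "s < min de de'" for s
   using that de(2)[of s] V(2) ga(1) by (cases "s = 0") auto
  then show "v \<in> tcone (X \<inter> V) 0"
   unfolding tcone_def using ga de(1) de'(1) by (intro CollectI exI[of _ ga]) (auto intro!: exI[of _ "min de de'"])
 qed
 then have "tcone X 0 = tcone (X \<inter> V) 0" using tcone_mono[of "X \<inter> V" X 0] by auto
 then show ?thesis using sub by simp
qed

end

section \<open>Lipschitz paths\<close>

definition lip_joined :: "'a::metric_space set => real => 'a => 'a => bool" where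
 "lip_joined S L x y \<longleftrightarrow> (\<exists>ga. ga 0 = x & ga 1 = y & (\<forall>s\<in>{0..1}. ga s \<in> S) &
   (\<forall>s\<in>{0..1::real}. \<forall>t\<in>{0..1}. dist (ga s) (ga t) \<le> L * \<bar>s - t\<bar>))"

text \<open>The length of a Lipschitz path is at most its Lipschitz constant.\<close>

lemma inner_dist_le_lip:
 assumes "lip_joined S L x y" "0 \<le> L"
 shows "inner_dist S x y \<le> ennreal L"
proof -
 obtain ga where ga: "ga 0 = x" "ga 1 = y" "!!s. s \<in> {0..1} ==> ga s \<in> S"
  and lip: "!!s t. s \<in> {0..1} ==> t \<in> {0..1} ==> dist (ga s) (ga t) \<le> L * \<bar>s - t\<bar>"
  using assms(1) unfolding lip_joined_def by blast
 have "L-lipschitz_on {0..1} ga"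
  by (rule lipschitz_onI) (use lip assms(2) in \<open>auto simp: dist_real_def\<close>)
 then have path: "path ga" unfolding path_def by (rule lipschitz_on_continuous_on)
 have len: "path_length ga \<le> ennreal L"
  unfolding path_length_def
 proof (rule SUP_least, clarify)
  fix k :: nat and t :: "nat => real" assume t: "mono t" "range t \<subseteq> {0..1}"
  have "(\<Sum>i<k. ennreal (dist (ga (t i)) (ga (t (Suc i))))) \<le> (\<Sum>i<k. ennreal (L * (t (Suc i) - t i)))"
  proof (intro sum_mono ennreal_leI)
   fix i
   have "t i \<le> t (Suc i)" using t(1) by (simp add: mono_def)
   then show "dist (ga (t i)) (ga (t (Suc i))) \<le> L * (t (Suc i) - t i)"
   proof -
    have "\<bar>t i - t (Suc i)\<bar> = t (Suc i) - t i" using \<open>t i \<le> t (Suc i)\<close> by simp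
    moreover have "t i \<in> {0..1}" "t (Suc i) \<in> {0..1}" using t(2) by blast+
    ultimately show ?thesis using lip[of "t i" "t (Suc i)"] by simp
   qed
  qed
  also have "\<dots> = ennreal (\<Sum>i<k. L * (t (Suc i) - t i))"
   using t(1) assms(2) by (intro sum_ennreal) (auto simp: mono_def)
  also have "(\<Sum>i<k. L * (t (Suc i) - t i)) = L * (t k - t 0)"
   by (simp add: sum_distrib_left[symmetric] sum_lessThan_telescope)
  also have "\<dots> \<le> L * 1"
   using t(2) assms(2) by (intro mult_left_mono) (auto simp: image_subset_iff; smt (verit))
  finally show "(\<Sum>i<k. ennreal (dist (ga (t i)) (ga (t (Suc i))))) \<le> ennreal L" by (simp add: ennreal_leI order_trans)
 qed
 then have "path_length ga < \<infinity>" by (simp add: le_less_trans)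
 then have "inner_dist S x y \<le> path_length ga"
  unfolding inner_dist_def using path ga
  by (intro INF_lower) (auto simp: path_image_def pathstart_def pathfinish_def)
 then show ?thesis using len by (rule order_trans)
qed

lemma lip_joined_refl: "x \<in> S ==> lip_joined S 0 x x"
 unfolding lip_joined_def by (intro exI[of _ "%_. x"]) auto

lemma lip_joined_mono:
 assumes "lip_joined S L x y" "L \<le> L'" shows "lip_joined S L' x y"
proof -
 have "L * \<bar>s - t\<bar> \<le> L' * \<bar>s - t\<bar>" for s t :: real using assms(2) by (intro mult_right_mono) auto
 moreover obtain ga where ga: "ga 0 = x" "ga 1 = y" "\<forall>s\<in>{0..1}. ga s \<in> S"
  and "\<forall>s\<in>{0..1}. \<forall>t\<in>{0..1}. dist (ga s) (ga t) \<le> L * \<bar>s - t\<bar>"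
  using assms(1) unfolding lip_joined_def by blast
 ultimately have "\<forall>s\<in>{0..1}. \<forall>t\<in>{0..1}. dist (ga s) (ga t) \<le> L' * \<bar>s - t\<bar>"
  using order_trans by blast
 then show ?thesis using ga unfolding lip_joined_def by blast
qed

lemma lip_joined_sym:
 assumes "lip_joined S L x y" shows "lip_joined S L y x"
proof -
 obtain ga where ga: "ga 0 = x" "ga 1 = y" "!!s. s \<in> {0..1} ==> ga s \<in> S"
  and lip: "!!s t. s \<in> {0..1} ==> t \<in> {0..1} ==> dist (ga s) (ga t) \<le> L * \<bar>s - t\<bar>"
  using assms(1) unfolding lip_joined_def by blast
 have "dist (ga (1 - s)) (ga (1 - t)) \<le> L * \<bar>s - t\<bar>" if "s \<in> {0..1}" "t \<in> {0..1}" for s t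
  using lip[of "1 - s" "1 - t"] that by (simp add: abs_minus_commute)
 then show ?thesis unfolding lip_joined_def using ga by (intro exI[of _ "%s. ga (1 - s)"]) auto
qed

lemma lip_joined_trans:
 assumes "lip_joined S a x y" "lip_joined S b y z" "0 \<le> a" "0 \<le> b"
 shows "lip_joined S (2 * (a + b)) x z"
proof -
 obtain ga where ga: "ga 0 = x" "ga 1 = y" "!!s. s \<in> {0..1} ==> ga s \<in> S"
  and lip: "!!s t. s \<in> {0..1} ==> t \<in> {0..1} ==> dist (ga s) (ga t) \<le> a * \<bar>s - t\<bar>"
  using assms(1) unfolding lip_joined_def by blast
 obtain \<eta> where \<eta>: "\<eta> 0 = y" "\<eta> 1 = z" "!!s. s \<in> {0..1} ==> \<eta> s \<in> S"
  and lip': "!!s t. s \<in> {0..1} ==> t \<in> {0..1} ==> dist (\<eta> s) (\<eta> t) \<le> b * \<bar>s - t\<bar>"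
  using assms(2) unfolding lip_joined_def by blast
 define k where "k s = (if s \<le> 1 / 2 then ga (2 * s) else \<eta> (2 * s - 1))" for s :: real
 have k1: "k s = ga (2 * s)" if "s \<le> 1 / 2" for s using that by (simp add: k_def)
 have k2: "k s = \<eta> (2 * s - 1)" if "1 / 2 \<le> s" for s
 proof (cases "s = 1 / 2")
  case True
  have "k (1 / 2) = y" "\<eta> (2 * (1 / 2) - 1) = y" using ga(2) \<eta>(1) by (simp_all add: k_def)
  then show ?thesis unfolding True by simp
 next
  case False then show ?thesis using that by (simp add: k_def)
 qed
 have A: "dist (k s) (k t) \<le> 2 * a * (t - s)" if "0 \<le> s" "s \<le> t" "t \<le> 1 / 2" for s t
 proof -
  have "\<bar>2 * s - 2 * t\<bar> = 2 * (t - s)" using that by simp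
  then show ?thesis using lip[of "2 * s" "2 * t"] that k1[of s] k1[of t] by (simp add: mult_ac)
 qed
 have B: "dist (k s) (k t) \<le> 2 * b * (t - s)" if "1 / 2 \<le> s" "s \<le> t" "t \<le> 1" for s t
 proof -
  have "\<bar>(2 * s - 1) - (2 * t - 1)\<bar> = 2 * (t - s)" using that by simp
  then show ?thesis using lip'[of "2 * s - 1" "2 * t - 1"] that k2[of s] k2[of t] by (simp add: mult_ac)
 qed
 have W: "dist (k s) (k t) \<le> 2 * (a + b) * (t - s)" if st: "0 \<le> s" "s \<le> t" "t \<le> 1" for s t
 proof -
  have m: "2 * a * (t - s) \<le> 2 * (a + b) * (t - s)" "2 * b * (t - s) \<le> 2 * (a + b) * (t - s)"
   using assms(3,4) st by (auto intro!: mult_right_mono)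
  consider "t \<le> 1 / 2" | "1 / 2 \<le> s" | "s \<le> 1 / 2" "1 / 2 \<le> t" by linarith
  then show ?thesis
  proof cases
   case 3
   have "dist (k s) (k t) \<le> dist (k s) (k (1 / 2)) + dist (k (1 / 2)) (k t)" by (rule dist_triangle)
   also have "\<dots> \<le> 2 * a * (1 / 2 - s) + 2 * b * (t - 1 / 2)"
    using A[of s "1 / 2"] B[of "1 / 2" t] st 3 by (intro add_mono) auto
   also have "\<dots> \<le> 2 * a * (t - s) + 2 * b * (t - s)"
    using 3 assms(3,4) by (intro add_mono mult_left_mono) auto
   finally show ?thesis by (simp add: algebra_simps)
  qed (use A B st m order_trans in blast)+
 qed
 have "dist (k s) (k t) \<le> 2 * (a + b) * \<bar>s - t\<bar>" if "s \<in> {0..1}" "t \<in> {0..1}" for s t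
  using W[of s t] W[of t s] that by (cases "s \<le> t") (auto simp: dist_commute abs_if)
 moreover have "k s \<in> S" if "s \<in> {0..1}" for s using that ga(3) \<eta>(3) by (auto simp: k_def)
 moreover have "k 0 = x" "k 1 = z" using ga \<eta> by (auto simp: k_def)
 ultimately show ?thesis unfolding lip_joined_def by (intro exI[of _ k]) blast
qed

lemma Ck_locally_lipschitz:
 fixes f :: "'a::euclidean_space => 'b::euclidean_space"
 assumes Ck: "Ck_on (Suc 0) V f" and "open V" "x \<in> V"
 obtains de C where "0 < de" "0 \<le> C" "ball x de \<subseteq> V"
  "!!y z. y \<in> ball x de ==> z \<in> ball x de ==> norm (f y - f z) \<le> C * norm (y - z)"
proof -
 let ?D = "%y. FD f (at y)"
 obtain de where de: "0 < de" "cball x de \<subseteq> V" using assms(2,3) open_contains_cball by blast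
 have "continuous_on V (%y. ?D y b)" for b using Ck by simp
 then have cD: "continuous_on (cball x de) (%y. ?D y b)" for b using de(2) continuous_on_subset by blast
 have "continuous_on (cball x de) (%y. \<Sum>b\<in>Basis. norm (?D y b))"
  by (rule continuous_on_sum[OF continuous_on_norm[OF cD]])
 then have "bounded ((%y. \<Sum>b\<in>Basis. norm (?D y b)) ` cball x de)"
  by (intro compact_imp_bounded compact_continuous_image) auto
 then obtain C where C: "!!y. y \<in> cball x de ==> norm (\<Sum>b\<in>Basis. norm (?D y b)) \<le> C"
  unfolding bounded_iff by blast
 have C0: "0 \<le> C" using C[of x] de(1) norm_ge_zero order_trans by (metis centre_in_cball less_imp_le)
 have on: "onorm (?D y) \<le> C" if y: "y \<in> ball x de" for y
 proof (rule onorm_le)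
  fix h
  have yV: "y \<in> V" using y de(2) ball_subset_cball by blast
  have "?D y h = (\<Sum>b\<in>Basis. (h \<bullet> b) *\<^sub>R ?D y b)"
   by (rule derivative_basis_expansion[OF Ck_on_has_derivative[OF Ck assms(2) yV]])
  also have "norm \<dots> \<le> (\<Sum>b\<in>Basis. norm h * norm (?D y b))"
   by (intro sum_norm_le) (auto intro!: mult_right_mono Basis_le_norm)
  also have "\<dots> = (\<Sum>b\<in>Basis. norm (?D y b)) * norm h" by (simp add: sum_distrib_left mult.commute)
  also have "\<dots> \<le> C * norm h"
   using C[of y] y by (intro mult_right_mono) (auto simp: less_imp_le)
  finally show "norm (?D y h) \<le> C * norm h" .
 qed
 have "norm (f y - f z) \<le> C * norm (y - z)" if "y \<in> ball x de" "z \<in> ball x de" for y z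
 proof (rule differentiable_bound[OF convex_ball _ on])
  show "(f has_derivative ?D y) (at y within ball x de)" if "y \<in> ball x de" for y
  proof -
   have "y \<in> V" using that de(2) ball_subset_cball by blast
   then show ?thesis by (rule has_derivative_at_withinI[OF Ck_on_has_derivative[OF Ck assms(2)]])
  qed
 qed (use that in auto)
 then show ?thesis using that[of de C] de C0 ball_subset_cball by blast
qed

text \<open>Segments in the chart give paths in \<open>M\<close> along which the first coordinate is affine.\<close>

lemma straight_local_paths:
 fixes M :: "(real \<times> 'a::euclidean_space) set"
 assumes st: "straight M x0 k" and "fst x0 = 0"
 shows "\<exists>V C. open V & x0 \<in> V & 0 \<le> C &
  (\<forall>x\<in>V \<inter> M. \<forall>y\<in>V \<inter> M. dist x y \<le> 2 & (\<exists>g. g 0 = x & g 1 = y &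
   (\<forall>s\<in>{0..1}. g s \<in> M & fst (g s) = (1 - s) * fst x + s * fst y) &
   (\<forall>s\<in>{0..1}. \<forall>t\<in>{0..1::real}. norm (snd (g s) - snd (g t)) \<le> C * dist x y * \<bar>s - t\<bar>))) &
  (\<forall>x\<in>V \<inter> M. \<exists>y\<in>V \<inter> M. fst y = 0)"
proof -
 obtain V' W' \<Phi> \<Psi> and K :: "'a set" where *: "x0 \<in> V' & diffeomorphism V' W' \<Phi> \<Psi> & (\<forall>y\<in>V'. fst (\<Phi> y) = fst y) &
   subspace K & dim K = k & (\<forall>y\<in>V'. y \<in> M \<longleftrightarrow> snd (\<Phi> y) \<in> K)"
  using st unfolding straight_def by (elim exE) (rule that, assumption)
 from * have x0: "x0 \<in> V'" and d: "diffeomorphism V' W' \<Phi> \<Psi>" and K: "subspace K" by simp_all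
 from * have fst': "!!y. y \<in> V' ==> fst (\<Phi> y) = fst y" and M': "!!y. y \<in> V' ==> y \<in> M \<longleftrightarrow> snd (\<Phi> y) \<in> K" by simp_all
 have op: "open V'" "open W'" and hom: "homeomorphism V' W' \<Phi> \<Psi>"
  and Ck: "Ck_on (Suc 0) V' \<Phi>" "Ck_on (Suc 0) W' \<Psi>" using d unfolding diffeomorphism_def by blast+
 have h: "!!y. y \<in> V' ==> \<Psi> (\<Phi> y) = y" "!!z. z \<in> W' ==> \<Phi> (\<Psi> z) = z" "!!y. y \<in> V' ==> \<Phi> y \<in> W'" "!!z. z \<in> W' ==> \<Psi> z \<in> V'"
  using hom by (auto simp: homeomorphism_def)
 obtain de1 C1 where de1: "0 < de1" "0 \<le> C1" "ball x0 de1 \<subseteq> V'"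
  and C1: "!!y z. y \<in> ball x0 de1 ==> z \<in> ball x0 de1 ==> norm (\<Phi> y - \<Phi> z) \<le> C1 * norm (y - z)"
  using Ck_locally_lipschitz[OF Ck(1) op(1) x0] by blast
 obtain de2 C2 where de2: "0 < de2" "0 \<le> C2" "ball (\<Phi> x0) de2 \<subseteq> W'"
  and C2: "!!y z. y \<in> ball (\<Phi> x0) de2 ==> z \<in> ball (\<Phi> x0) de2 ==> norm (\<Psi> y - \<Psi> z) \<le> C2 * norm (y - z)"
  using Ck_locally_lipschitz[OF Ck(2) op(2) h(3)[OF x0]] by blast
 define de where "de = min de2 (min de1 1 / (C2 + 1))"
 have de: "0 < de" "de \<le> de2" "C2 * de < min de1 1"
 proof -
  show "0 < de" "de \<le> de2" using de1(1) de2(1,2) by (auto simp: de_def)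
  have "C2 * de < (C2 + 1) * de" using \<open>0 < de\<close> by (simp add: algebra_simps)
  also have "\<dots> \<le> (C2 + 1) * (min de1 1 / (C2 + 1))" using de2(2) by (intro mult_left_mono) (auto simp: de_def)
  also have "\<dots> = min de1 1" using de2(2) by simp
  finally show "C2 * de < min de1 1" .
 qed
 let ?B = "ball (\<Phi> x0) de"
 have BW: "?B \<subseteq> W'" "?B \<subseteq> ball (\<Phi> x0) de2" using de de2(3) by auto
 have \<Psi>B: "\<Psi> z \<in> ball x0 (min de1 1)" if z: "z \<in> ?B" for z
 proof -
  have "norm (\<Psi> (\<Phi> x0) - \<Psi> z) \<le> C2 * norm (\<Phi> x0 - z)" using z BW de2(1) by (intro C2) auto
  also have "\<dots> \<le> C2 * de" using z de2(2) by (intro mult_left_mono) (auto simp: dist_norm)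
  finally show ?thesis using de(3) h(1)[OF x0] by (simp add: dist_norm)
 qed
 define V where "V = {x \<in> V'. \<Phi> x \<in> ?B}"
 have "open V"
 proof -
  have "continuous_on V' \<Phi>" using hom by (simp add: homeomorphism_def)
  then have "open (V' \<inter> \<Phi> -` ?B)" using op(1) by (intro continuous_open_preimage) auto
  moreover have "V' \<inter> \<Phi> -` ?B = V" by (auto simp: V_def)
  ultimately show ?thesis by simp
 qed
 have V\<Psi>: "\<Psi> z \<in> V" if "z \<in> ?B" for z
 proof -
  have "z \<in> W'" using that BW(1) by blast
  then show ?thesis using h(4)[of z] h(2)[of z] that by (simp add: V_def)
 qed
 have Vball: "x \<in> ball x0 (min de1 1)" if "x \<in> V" for x
  using \<Psi>B[of "\<Phi> x"] that h(1)[of x] by (auto simp: V_def)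
 have main: "\<exists>g. g 0 = x & g 1 = y &
   (\<forall>s\<in>{0..1}. g s \<in> M & fst (g s) = (1 - s) * fst x + s * fst y) &
   (\<forall>s\<in>{0..1}. \<forall>t\<in>{0..1::real}. norm (snd (g s) - snd (g t)) \<le> (C2 * C1) * dist x y * \<bar>s - t\<bar>)"
  if x: "x \<in> V \<inter> M" and y: "y \<in> V \<inter> M" for x y
 proof -
  define l where "l s = (1 - s) *\<^sub>R \<Phi> x + s *\<^sub>R \<Phi> y" for s :: real
  have xy: "\<Phi> x \<in> ?B" "\<Phi> y \<in> ?B" "x \<in> V'" "y \<in> V'" using x y by (auto simp: V_def)
  have lB: "l s \<in> ?B" if "s \<in> {0..1}" for s
   unfolding l_def using that xy by (intro convexD[OF convex_ball]) auto
  have fl: "fst (\<Psi> (l s)) = (1 - s) * fst x + s * fst y" if "s \<in> {0..1}" for s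
  proof -
   have "fst (\<Psi> (l s)) = fst (\<Phi> (\<Psi> (l s)))" using fst' h(4) lB[OF that] BW by (metis subsetD)
   also have "\<dots> = fst (l s)" using h(2) lB[OF that] BW by (metis subsetD)
   finally show ?thesis using fst'[OF xy(3)] fst'[OF xy(4)] by (simp add: l_def)
  qed
  have gM: "\<Psi> (l s) \<in> M" if "s \<in> {0..1}" for s
  proof -
   have W: "l s \<in> W'" using lB[OF that] BW by blast
   have "snd (\<Phi> x) \<in> K" "snd (\<Phi> y) \<in> K" using M' x y xy by auto
   then have "snd (l s) \<in> K" using K by (simp add: l_def subspace_add subspace_scale)
   then show ?thesis using M'[OF h(4)[OF W]] h(2)[OF W] by simp
  qed
  have lip: "norm (snd (\<Psi> (l s)) - snd (\<Psi> (l t))) \<le> (C2 * C1) * dist x y * \<bar>s - t\<bar>"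
   if st: "s \<in> {0..1}" "t \<in> {0..1}" for s t
  proof -
   have "norm (snd (\<Psi> (l s)) - snd (\<Psi> (l t))) \<le> norm (\<Psi> (l s) - \<Psi> (l t))"
    by (metis norm_snd_le prod.collapse snd_diff)
   also have "\<dots> \<le> C2 * norm (l s - l t)" by (intro C2 subsetD[OF BW(2)] lB st)
   also have "l s - l t = (t - s) *\<^sub>R (\<Phi> x - \<Phi> y)" by (simp add: l_def algebra_simps)
   also have "C2 * norm \<dots> = C2 * (\<bar>s - t\<bar> * norm (\<Phi> x - \<Phi> y))" by (simp add: abs_minus_commute)
   also have "\<dots> \<le> C2 * (\<bar>s - t\<bar> * (C1 * norm (x - y)))"
    using C1[of x y] Vball x y de2(2) by (intro mult_left_mono) auto
   finally show ?thesis by (simp add: dist_norm mult_ac)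
  qed
  have "\<Psi> (l 0) = x" "\<Psi> (l 1) = y" using h(1) xy by (auto simp: l_def)
  then show ?thesis using fl gM lip by (intro exI[of _ "%s. \<Psi> (l s)"]) auto
 qed
 have diam: "dist x y \<le> 2" if "x \<in> V" "y \<in> V" for x y
  using Vball[OF that(1)] Vball[OF that(2)] dist_triangle[of x y x0] by (auto simp: dist_commute)
 have "\<exists>y\<in>V \<inter> M. fst y = 0" if x: "x \<in> V \<inter> M" for x
 proof -
  let ?z = "(0, snd (\<Phi> x))"
  have f0: "fst (\<Phi> x0) = 0" using fst'[OF x0] assms(2) by simp
  have "dist (\<Phi> x0) ?z \<le> dist (\<Phi> x0) (\<Phi> x)"
   using f0 by (simp add: dist_prod_def)
  then have zB: "?z \<in> ?B" using x by (auto simp: V_def)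
  then have zW: "?z \<in> W'" using BW by blast
  have "snd (\<Phi> x) \<in> K" using M'[of x] x unfolding V_def by blast
  then have "\<Psi> ?z \<in> M" using M'[OF h(4)[OF zW]] h(2)[OF zW] by simp
  moreover have "fst (\<Psi> ?z) = 0" using fst'[OF h(4)[OF zW]] h(2)[OF zW] by simp
  ultimately show ?thesis using V\<Psi>[OF zB] by blast
 qed
 moreover have "x0 \<in> V" using x0 de(1) by (simp add: V_def)
 moreover have "0 \<le> C2 * C1" using de1 de2 by simp
 ultimately show ?thesis
  using main diam \<open>open V\<close> by - (rule exI[of _ V], rule exI[of _ "C2 * C1"], intro conjI ballI, simp_all)
qed

section \<open>Conic sets are Lipschitz normally embedded\<close>

context blown_up
begin

lemma polar_distance:
 assumes "norm u = 1" "norm v = 1" "0 \<le> t" "0 \<le> s"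
 shows "\<bar>t - s\<bar> \<le> norm (t *\<^sub>R u - s *\<^sub>R v)" "max t s * norm (u - v) \<le> 2 * norm (t *\<^sub>R u - s *\<^sub>R (v :: 'a))"
proof -
 show 1: "\<bar>t - s\<bar> \<le> norm (t *\<^sub>R u - s *\<^sub>R v)"
  using norm_triangle_ineq3[of "t *\<^sub>R u" "s *\<^sub>R v"] assms by simp
 have A: "a * norm (x - y) \<le> 2 * norm (a *\<^sub>R x - b *\<^sub>R y)" if "0 \<le> b" "b \<le> a" "norm x = 1" "norm y = 1" for a b and x y :: 'a
 proof -
  have "(a *\<^sub>R x - b *\<^sub>R y) + (b - a) *\<^sub>R y = a *\<^sub>R (x - y)"
   by (simp add: scaleR_left_diff_distrib scaleR_right_diff_distrib)
  then have "a * norm (x - y) = norm ((a *\<^sub>R x - b *\<^sub>R y) + (b - a) *\<^sub>R y)" using that by simp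
  also have "\<dots> \<le> norm (a *\<^sub>R x - b *\<^sub>R y) + \<bar>b - a\<bar>" by (rule norm_triangle_le) (simp add: that)
  also have "\<bar>b - a\<bar> \<le> norm (a *\<^sub>R x - b *\<^sub>R y)"
   using norm_triangle_ineq3[of "a *\<^sub>R x" "b *\<^sub>R y"] that by simp
  finally show ?thesis by simp
 qed
 show "max t s * norm (u - v) \<le> 2 * norm (t *\<^sub>R u - s *\<^sub>R v)"
  using A[of s t u v] A[of t s v u] assms by (cases "s \<le> t") (auto simp: norm_minus_commute max_def)
qed

text \<open>A path on \<open>M\<close> is blown down to a path of controlled length.\<close>

lemma polar_path:
 assumes x: "0 \<le> fst x" "fst x \<le> r" and y: "0 \<le> fst y" "fst y \<le> r" and "r \<le> \<rho>" "0 \<le> C"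
  and g: "g 0 = x" "g 1 = y" "!!s. s \<in> {0..1} ==> g s \<in> M & fst (g s) = (1 - s) * fst x + s * fst y"
   "!!s t. s \<in> {0..1} ==> t \<in> {0..1} ==> norm (snd (g s) - snd (g t)) \<le> C * \<bar>s - t\<bar>"
 shows "lip_joined (X \<inter> {x. norm x \<le> r}) (\<bar>fst x - fst y\<bar> + max (fst x) (fst y) * C) (fst x *\<^sub>R snd x) (fst y *\<^sub>R snd y)"
 unfolding lip_joined_def
proof (intro exI[of _ "%s. fst (g s) *\<^sub>R snd (g s)"] conjI ballI)
 have fst_g: "0 \<le> fst (g s)" "fst (g s) \<le> max (fst x) (fst y)" if s: "s \<in> {0..1}" for s
 proof -
  show "0 \<le> fst (g s)" using g(3)[OF s] x y s by auto
  have "(1 - s) * fst x + s * fst y \<le> (1 - s) * max (fst x) (fst y) + s * max (fst x) (fst y)"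
   using s by (intro add_mono mult_left_mono) auto
  then show "fst (g s) \<le> max (fst x) (fst y)" using g(3)[OF s] by (simp add: algebra_simps)
 qed
 show "fst (g s) *\<^sub>R snd (g s) \<in> X \<inter> {x. norm x \<le> r}" if s: "s \<in> {0..1}" for s
 proof -
  have M: "g s \<in> M" using g(3)[OF s] by simp
  have "norm (fst (g s) *\<^sub>R snd (g s)) \<le> r" using fst_g[OF s] norm_snd_M[OF M] x y by simp
  moreover have "fst (g s) *\<^sub>R snd (g s) \<in> X"
  proof (cases "fst (g s) = 0")
   case True then show ?thesis using zero_X by simp
  next
   case False
   then show ?thesis using X_M[of "fst (g s)" "snd (g s)"] norm_snd_M[OF M] M fst_g[OF s] x y \<open>r \<le> \<rho>\<close> by simp
  qed
  ultimately show ?thesis by simp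
 qed
 fix s t :: real assume s: "s \<in> {0..1}" and t: "t \<in> {0..1}"
 have "fst (g s) *\<^sub>R snd (g s) - fst (g t) *\<^sub>R snd (g t) =
   (fst (g s) - fst (g t)) *\<^sub>R snd (g s) + fst (g t) *\<^sub>R (snd (g s) - snd (g t))" by (simp add: algebra_simps)
 also have "norm \<dots> \<le> \<bar>fst (g s) - fst (g t)\<bar> + fst (g t) * norm (snd (g s) - snd (g t))"
  by (rule norm_triangle_le) (use norm_snd_M[of "g s"] g(3)[OF s] fst_g(1)[OF t] in simp)
 also have "fst (g s) - fst (g t) = (s - t) * (fst y - fst x)" using g(3)[OF s] g(3)[OF t] by (simp add: algebra_simps)
 also have "\<bar>(s - t) * (fst y - fst x)\<bar> = \<bar>fst x - fst y\<bar> * \<bar>s - t\<bar>" by (simp add: abs_mult abs_minus_commute mult.commute)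
 also have "fst (g t) * norm (snd (g s) - snd (g t)) \<le> max (fst x) (fst y) * (C * \<bar>s - t\<bar>)"
  using fst_g[OF t] g(4)[OF s t] by (intro mult_mono) auto
 finally show "dist (fst (g s) *\<^sub>R snd (g s)) (fst (g t) *\<^sub>R snd (g t)) \<le> (\<bar>fst x - fst y\<bar> + max (fst x) (fst y) * C) * \<bar>s - t\<bar>"
  by (simp add: dist_norm algebra_simps)
qed (use g in auto)

text \<open>Points of the link that are close to each other are joined within one chart; for the others, the
 path through the origin is short enough.\<close>

lemma LNE_X: "\<exists>r0>0. \<forall>r. 0 < r & r \<le> r0 --> LNE (X \<inter> {x. norm x \<le> r})"
proof -
 let ?M0 = "{x \<in> M. fst x = 0}"
 define Q where "Q V C \<longleftrightarrow> open V & 0 \<le> C &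
  (\<forall>x\<in>V \<inter> M. \<forall>y\<in>V \<inter> M. dist x y \<le> 2 & (\<exists>g. g 0 = x & g 1 = y &
   (\<forall>s\<in>{0..1}. g s \<in> M & fst (g s) = (1 - s) * fst x + s * fst y) &
   (\<forall>s\<in>{0..1}. \<forall>t\<in>{0..1::real}. norm (snd (g s) - snd (g t)) \<le> C * dist x y * \<bar>s - t\<bar>))) &
  (\<forall>x\<in>V \<inter> M. \<exists>y\<in>V \<inter> M. fst y = 0)" for V C
 have "\<forall>x0\<in>?M0. \<exists>P. x0 \<in> fst P & Q (fst P) (snd P)"
 proof
  fix x0 assume "x0 \<in> ?M0"
  then have x0: "x0 \<in> M" "fst x0 = 0" by auto
  obtain V C where "x0 \<in> V" "Q V C"
   using straight_local_paths[OF st0[OF x0] x0(2)] unfolding Q_def by blast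
  then show "\<exists>P. x0 \<in> fst P & Q (fst P) (snd P)" by (intro exI[of _ "(V, C)"]) simp
 qed
 from bchoice[OF this] obtain f where f: "\<forall>x0\<in>?M0. x0 \<in> fst (f x0) & Q (fst (f x0)) (snd (f x0))" by blast
 define Vf Cf where "Vf x0 = fst (f x0)" and "Cf x0 = snd (f x0)" for x0
 have VC: "!!x0. x0 \<in> ?M0 ==> x0 \<in> Vf x0" "!!x0. x0 \<in> ?M0 ==> Q (Vf x0) (Cf x0)"
  using f unfolding Vf_def Cf_def by blast+
 have opV: "open (Vf x0)" if "x0 \<in> ?M0" for x0 using VC(2)[OF that] by (simp add: Q_def)
 have "open (\<Union>x0\<in>?M0. Vf x0)" using opV by blast
 then obtain r1 where r1: "0 < r1" "r1 \<le> \<rho>" "!!x. x \<in> M ==> 0 \<le> fst x ==> fst x < r1 ==> x \<in> (\<Union>x0\<in>?M0. Vf x0)"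
  by (rule cover_near_zero) (use VC(1) in auto)
 define r2 where "r2 = r1 / 2"
 have r2: "0 < r2" "r2 \<le> \<rho>" "r2 < r1" using r1 by (auto simp: r2_def)
 define K where "K = {x \<in> M. 0 \<le> fst x & fst x \<le> r2}"
 have "K = {x \<in> M. 0 \<le> fst x & fst x \<le> \<rho>} \<inter> {x. fst x \<le> r2}" using r2 by (auto simp: K_def)
 moreover have "closed {x :: real \<times> 'a. fst x \<le> r2}" by (intro closed_Collect_le continuous_intros)
 ultimately have K: "compact K" using compact_M by (simp add: compact_Int_closed)
 have Kcov: "K \<subseteq> (\<Union>x0\<in>?M0. Vf x0)" using r1(3) r2 by (auto simp: K_def)
 obtain F where F: "F \<subseteq> ?M0" "finite F" "K \<subseteq> (\<Union>x0\<in>F. Vf x0)"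
  by (rule compactE_image[OF K opV Kcov])
 show ?thesis
 proof (cases "F = {}")
  case True
  then have K0: "K = {}" using F by auto
  have "X \<inter> {x. norm x \<le> r} = {0}" if r: "0 < r" "r \<le> r2" for r
  proof -
   have "p = 0" if p: "p \<in> X" "norm p \<le> r" for p
   proof (rule ccontr)
    assume "p ~= 0"
    then have "(norm p, (1 / norm p) *\<^sub>R p) \<in> K" using X_M[of "norm p" "(1 / norm p) *\<^sub>R p"] p r r2 by (simp add: K_def)
    then show False using K0 by simp
   qed
   then show ?thesis using zero_X r by auto
  qed
  moreover have "LNE {0 :: 'a}"
   unfolding LNE_def using inner_dist_le_lip[OF lip_joined_refl[of "0 :: 'a" "{0}"]]
   by (intro exI[of _ 1]) auto
  ultimately show ?thesis using r2(1) by (intro exI[of _ r2]) auto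
 next
  case False
  define C where "C = (\<Sum>x0\<in>F. Cf x0)"
  have Cge: "Cf x0 \<le> C" "0 \<le> Cf x0" if "x0 \<in> F" for x0
  proof -
   have nn: "0 \<le> Cf x" if "x \<in> F" for x using VC(2)[OF subsetD[OF F(1) that]] unfolding Q_def by blast
   then show "0 \<le> Cf x0" using that by simp
   show "Cf x0 \<le> C" unfolding C_def by (rule member_le_sum[OF that _ F(2)]) (use nn in auto)
  qed
  have C0: "0 \<le> C" using False Cge by (metis all_not_in_conv order_trans)
  obtain de where de: "0 < de" "!!T. T \<subseteq> K ==> diameter T < de ==> \<exists>B\<in>Vf ` F. T \<subseteq> B"
  proof (rule Lebesgue_number_lemma[OF K, of "Vf ` F"])
   show "Vf ` F ~= {}" using False by simp
   show "K \<subseteq> \<Union> (Vf ` F)" using F(3) by simp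
   show "open B" if "B \<in> Vf ` F" for B using that opV F(1) by auto
  qed blast
  define L where "L = (1 + \<rho> * C + 2 * C) + 4 * (1 + 2 * C) * (\<rho> + 2) / de + (1 + 2 * C)"
  have parts: "0 \<le> 1 + \<rho> * C + 2 * C" "0 \<le> 4 * (1 + 2 * C) * (\<rho> + 2) / de" "0 \<le> 1 + 2 * C"
   using C0 \<rho> de(1) by auto
  have L0: "0 < L" using parts C0 unfolding L_def by linarith
  have "LNE (X \<inter> {x. norm x \<le> r})" if r: "0 < r" "r \<le> r2" for r
  proof -
   let ?S = "X \<inter> {x. norm x \<le> r}"
   have r\<rho>: "r \<le> \<rho>" using r r2 by simp
   have inK: "x \<in> K" if "x \<in> M" "0 \<le> fst x" "fst x \<le> r" for x using that r by (simp add: K_def)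
   have near: "lip_joined ?S (\<bar>fst x - fst y\<bar> + max (fst x) (fst y) * (C * dist x y)) (fst x *\<^sub>R snd x) (fst y *\<^sub>R snd y)"
    if x: "x \<in> M" "0 \<le> fst x" "fst x \<le> r" and y: "y \<in> M" "0 \<le> fst y" "fst y \<le> r"
     and V: "x0 \<in> F" "x \<in> Vf x0" "y \<in> Vf x0" for x y x0
   proof -
    have "Q (Vf x0) (Cf x0)" using VC(2) V(1) F(1) by blast
    then obtain g where g: "g 0 = x" "g 1 = y" "!!s. s \<in> {0..1} ==> g s \<in> M & fst (g s) = (1 - s) * fst x + s * fst y"
     "!!s t. s \<in> {0..1} ==> t \<in> {0..1} ==> norm (snd (g s) - snd (g t)) \<le> Cf x0 * dist x y * \<bar>s - t\<bar>"
     using x y V unfolding Q_def by blast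
    have "lip_joined ?S (\<bar>fst x - fst y\<bar> + max (fst x) (fst y) * (Cf x0 * dist x y)) (fst x *\<^sub>R snd x) (fst y *\<^sub>R snd y)"
     by (rule polar_path[OF x(2,3) y(2,3) r\<rho> _ g]) (use Cge V in auto)
    moreover have "max (fst x) (fst y) * (Cf x0 * dist x y) \<le> max (fst x) (fst y) * (C * dist x y)"
     using Cge[OF V(1)] x y by (intro mult_left_mono mult_right_mono) auto
    ultimately show ?thesis using lip_joined_mono by (metis add_left_mono)
   qed
   have radial: "lip_joined ?S ((1 + 2 * C) * fst x) (fst x *\<^sub>R snd x) 0"
    if x: "x \<in> M" "0 \<le> fst x" "fst x \<le> r" for x
   proof -
    obtain x0 where x0: "x0 \<in> F" "x \<in> Vf x0" using inK[OF x] F(3) by blast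
    have Q: "Q (Vf x0) (Cf x0)" using VC(2) x0(1) F(1) by blast
    obtain y where y: "y \<in> Vf x0" "y \<in> M" "fst y = 0" using Q x x0 unfolding Q_def by blast
    have "dist x y \<le> 2" using Q x x0 y unfolding Q_def by blast
    then have "fst x + fst x * (C * dist x y) \<le> (1 + 2 * C) * fst x"
     using mult_left_mono[of "C * dist x y" "C * 2" "fst x"] mult_left_mono[of "dist x y" 2 C] C0 x(2) by (simp add: algebra_simps)
    moreover have "lip_joined ?S (fst x + fst x * (C * dist x y)) (fst x *\<^sub>R snd x) 0"
     using near[OF x y(2) _ _ x0 y(1)] y(3) x r by (simp add: max_def)
    ultimately show ?thesis using lip_joined_mono by blast
   qed
   have "lip_joined ?S (L * dist p q) p q" if p: "p \<in> ?S" and q: "q \<in> ?S" for p q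
   proof -
    have pol: "(norm z, (1 / norm z) *\<^sub>R z) \<in> M" if "z \<in> ?S" "z ~= 0" for z
     using that X_M[of "norm z" "(1 / norm z) *\<^sub>R z"] r\<rho> by simp
    have rad: "lip_joined ?S ((1 + 2 * C) * norm z) z 0" if z: "z \<in> ?S" for z
    proof (cases "z = 0")
     case True then show ?thesis using lip_joined_refl[of 0 ?S] z by simp
    next
     case False
     show ?thesis using radial[OF pol[OF z False]] z False by simp
    qed
    have rad_L: "(1 + 2 * C) * norm z \<le> L * norm z" for z :: 'a
     using parts unfolding L_def by (intro mult_right_mono norm_ge_zero zero_le_dist) linarith
    consider "p = 0" | "q = 0" | "p ~= 0" "q ~= 0" by blast
    then show ?thesis
    proof cases
     case 1
     then show ?thesis using lip_joined_mono[OF lip_joined_sym[OF rad[OF q]] rad_L] by (simp add: dist_norm)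
    next
     case 2
     then show ?thesis using lip_joined_mono[OF rad[OF p] rad_L] by (simp add: dist_norm)
    next
     case 3
     define x where "x = (norm p, (1 / norm p) *\<^sub>R p)"
     define y where "y = (norm q, (1 / norm q) *\<^sub>R q)"
     have xM: "x \<in> M" "0 \<le> fst x" "fst x \<le> r" "fst x *\<^sub>R snd x = p" "norm (snd x) = 1"
      using pol[OF p 3(1)] p 3 by (auto simp: x_def)
     have yM: "y \<in> M" "0 \<le> fst y" "fst y \<le> r" "fst y *\<^sub>R snd y = q" "norm (snd y) = 1"
      using pol[OF q 3(2)] q 3 by (auto simp: y_def)
     have pd: "\<bar>fst x - fst y\<bar> \<le> dist p q" "max (fst x) (fst y) * norm (snd x - snd y) \<le> 2 * dist p q"
      using polar_distance[OF xM(5) yM(5) xM(2) yM(2)] xM(4) yM(4) by (simp_all add: dist_norm)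
     have dxy: "dist x y \<le> \<bar>fst x - fst y\<bar> + norm (snd x - snd y)"
      using norm_Pair_le[of "fst x - fst y" "snd x - snd y"] by (simp add: dist_norm minus_prod_def)
     have mx: "max (fst x) (fst y) * dist x y \<le> (\<rho> + 2) * dist p q"
     proof -
      have "max (fst x) (fst y) * dist x y \<le> max (fst x) (fst y) * (\<bar>fst x - fst y\<bar> + norm (snd x - snd y))"
       using dxy xM(2) by (intro mult_left_mono) auto
      also have "\<dots> = max (fst x) (fst y) * \<bar>fst x - fst y\<bar> + max (fst x) (fst y) * norm (snd x - snd y)"
       by (simp add: distrib_left)
      also have "\<dots> \<le> \<rho> * dist p q + 2 * dist p q"
       by (rule add_mono[OF mult_mono pd(2)]) (use pd(1) xM yM r\<rho> \<rho> in auto)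
      finally show ?thesis by (simp add: distrib_right)
     qed
     show ?thesis
     proof (cases "dist x y < de")
      case True
      have "diameter {x, y} \<le> dist x y"
      proof (rule diameter_le)
       fix a b assume "a \<in> {x, y}" "b \<in> {x, y}"
       then have "dist a b \<le> dist x y" by (elim insertE emptyE) (simp_all add: dist_commute)
       then show "norm (a - b) \<le> dist x y" by (simp add: dist_norm)
      qed simp
      then obtain x0 where x0: "x0 \<in> F" "x \<in> Vf x0" "y \<in> Vf x0"
       using de(2)[of "{x, y}"] True inK xM yM by auto
      have "\<bar>fst x - fst y\<bar> + max (fst x) (fst y) * (C * dist x y) \<le> dist p q + C * ((\<rho> + 2) * dist p q)"
       using pd(1) mult_left_mono[OF mx C0] by (simp add: mult_ac)
      also have "\<dots> = (1 + \<rho> * C + 2 * C) * dist p q" by (simp add: algebra_simps)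
      also have "\<dots> \<le> L * dist p q" using parts unfolding L_def by (intro mult_right_mono norm_ge_zero zero_le_dist) linarith
      finally show ?thesis using lip_joined_mono[OF near[OF xM(1-3) yM(1-3) x0]] xM(4) yM(4) by simp
     next
      case False
      have "de * max (fst x) (fst y) \<le> (\<rho> + 2) * dist p q"
      proof -
       have "0 \<le> max (fst x) (fst y)" using xM(2) by (simp add: le_max_iff_disj)
       then show ?thesis
        using mult_left_mono[of de "dist x y" "max (fst x) (fst y)"] False mx by (simp add: mult.commute)
      qed
      then have m: "max (fst x) (fst y) \<le> (\<rho> + 2) * dist p q / de"
       unfolding pos_le_divide_eq[OF de(1)] by (simp only: mult.commute)
      have "2 * ((1 + 2 * C) * norm p + (1 + 2 * C) * norm q) = 2 * (1 + 2 * C) * (fst x + fst y)"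
       by (simp add: x_def y_def algebra_simps)
      also have "\<dots> \<le> 2 * (1 + 2 * C) * (2 * ((\<rho> + 2) * dist p q / de))"
       using m parts(3) by (intro mult_left_mono) auto
      also have "\<dots> = 4 * (1 + 2 * C) * (\<rho> + 2) / de * dist p q" by simp
      also have "\<dots> \<le> L * dist p q" using parts unfolding L_def by (intro mult_right_mono norm_ge_zero zero_le_dist) linarith
      finally show ?thesis
       using lip_joined_mono[OF lip_joined_trans[OF rad[OF p] lip_joined_sym[OF rad[OF q]]]] parts(3) by simp
     qed
    qed
   qed
   then have "inner_dist ?S p q \<le> ennreal (L * dist p q)" if "p \<in> ?S" "q \<in> ?S" for p q
    using that L0 by (intro inner_dist_le_lip) auto
   then show ?thesis unfolding LNE_def using L0 by blast
  qed
  then show ?thesis using r2(1) by blast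
 qed
qed

end

section \<open>Systems of linear forms\<close>

text \<open>A vector that is orthogonal to the range, for the real inner product, gives a complex linear
 dependence between the rows.\<close>

lemma independent_rows_surj:
 fixes A :: "'n::finite => 'n => complex"
 assumes ind: "!!l. (!!m. (\<Sum>r\<in>S. l r * A r m) = 0) ==> \<forall>r\<in>S. l r = 0"
 shows "range (%v :: complex^'n. \<chi> r. if r \<in> S then \<Sum>m\<in>UNIV. v $ m * A r m else 0) = {w. \<forall>r. r \<notin> S --> w $ r = 0}"
  (is "range ?T = ?R")
proof -
 have lin: "linear ?T"
 proof (rule linearI)
  show "?T (x + y) = ?T x + ?T y" for x y by (simp add: vec_eq_iff algebra_simps sum.distrib)
  show "?T (k *\<^sub>R x) = k *\<^sub>R ?T x" for k x by (simp add: vec_eq_iff scaleR_sum_right)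
 qed
 have subT: "subspace (range ?T)" by (rule linear_subspace_image[OF lin subspace_UNIV])
 have subR: "subspace ?R" by (auto simp: subspace_def)
 have TR: "range ?T \<subseteq> ?R" by auto
 have "?R \<subseteq> range ?T"
 proof (rule ccontr)
  assume "\<not> ?thesis"
  then have "span (range ?T) \<subset> span ?R" using TR subT subR by (simp add: span_eq_iff[THEN iffD2] psubset_eq)
  then obtain w where w: "w ~= 0" "w \<in> span ?R" "!!y. y \<in> span (range ?T) ==> orthogonal w y"
   by (rule orthogonal_to_subspace_exists_gen) blast
  have wR: "!!r. r \<notin> S ==> w $ r = 0" using w(2) subR by (simp add: span_eq_iff[THEN iffD2])
  have ort: "(\<Sum>r\<in>S. w $ r \<bullet> (k * A r m)) = 0" for k m
  proof -
   have "w \<bullet> ?T (axis m k) = 0" using w(3)[of "?T (axis m k)"] span_base[of "?T (axis m k)" "range ?T"] by (simp add: orthogonal_def)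
   moreover have ax: "(\<Sum>m'\<in>UNIV. axis m k $ m' * A r m') = k * A r m" for r
    by (subst sum.remove[of _ m]) (auto simp: axis_def intro!: sum.neutral)
   then have "?T (axis m k) = (\<chi> r. if r \<in> S then k * A r m else 0)" by (simp only:)
   ultimately have "(\<Sum>r\<in>UNIV. w $ r \<bullet> (if r \<in> S then k * A r m else 0)) = 0" by (simp add: inner_vec_def)
   moreover have "(\<Sum>r\<in>UNIV. w $ r \<bullet> (if r \<in> S then k * A r m else 0)) = (\<Sum>r\<in>S. w $ r \<bullet> (k * A r m))"
    by (intro sum.mono_neutral_cong_right) auto
   ultimately show ?thesis by simp
  qed
  have "(\<Sum>r\<in>S. cnj (w $ r) * A r m) = 0" for m
  proof -
   define z where "z = (\<Sum>r\<in>S. cnj (w $ r) * A r m)"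
   have "Re (k * z) = (\<Sum>r\<in>S. w $ r \<bullet> (k * A r m))" for k
    by (simp add: z_def sum_distrib_left inner_complex_def algebra_simps)
   then have "Re (k * z) = 0" for k using ort by simp
   from this[of "cnj z"] have "(Re z)\<^sup>2 + (Im z)\<^sup>2 = 0" by (simp add: power2_eq_square)
   then show ?thesis unfolding z_def[symmetric] by (simp add: complex_eq_iff sum_power2_eq_zero_iff)
  qed
  then have "\<forall>r\<in>S. cnj (w $ r) = 0" by (intro ind)
  then have "w = 0" using wR by (simp add: vec_eq_iff) (metis)
  then show False using w(1) by simp
 qed
 then show ?thesis using TR by blast
qed

lemma vec_eq_sum_axis: "(\<chi> r. g r) = (\<Sum>r\<in>UNIV. axis r (g r :: complex))"
proof -
 have "(\<Sum>r\<in>UNIV. axis r (g r)) $ s = g s" for s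
 proof -
  have "(\<Sum>r\<in>UNIV. axis r (g r)) $ s = (\<Sum>r\<in>UNIV. axis r (g r) $ s)" by (rule sum_component)
  also have "\<dots> = (\<Sum>r\<in>{s}. axis r (g r) $ s)" by (rule sum.mono_neutral_right) (auto simp: axis_def)
  finally show ?thesis by simp
 qed
 then show ?thesis by (subst vec_eq_iff) (simp only: vec_lambda_beta simp_thms)
qed

lemma bounded_linear_axis: "bounded_linear (axis r :: complex => complex^'n::finite)"
 unfolding linear_conv_bounded_linear[symmetric] by (rule linearI) (simp_all add: vec_eq_iff axis_def)

lemma Ck_on_vec:
 fixes f :: "'n::finite => 'a::euclidean_space => complex"
 assumes "open U" "!!r. Ck_on k U (f r)"
 shows "Ck_on k U (%x. \<chi> r. f r x)"
proof -
 show ?thesis unfolding vec_eq_sum_axis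
  by (intro Ck_on_sum[OF assms(1)] Ck_on_linear_compose[OF bounded_linear_axis assms(1) assms(2)])
qed

lemma Ck_on_mult:
 fixes f g :: "'a::euclidean_space => complex"
 shows "open U ==> Ck_on k U f ==> Ck_on k U g ==> Ck_on k U (%x. f x * g x)"
 by (rule Ck_on_bilinear[OF bounded_bilinear_mult])

lemma Ck_on_zmon:
 assumes "open U" "Ck_on k U f"
 shows "Ck_on k U (%x. zmon (f x) al)"
proof -
 have nth: "Ck_on k U (%x. f x $ m)" for m by (rule Ck_on_linear_compose[OF bounded_linear_vec_nth assms])
 have pow: "Ck_on k U (%x. f x $ m ^ j)" for m j
  by (induction j) (auto intro: Ck_on_const[OF assms(1)] Ck_on_mult[OF assms(1) nth])
 have "Ck_on k U (%x. \<Prod>m\<in>S. f x $ m ^ lkp al m)" for S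
  by (induction S rule: infinite_finite_induct) (auto intro: Ck_on_const[OF assms(1)] Ck_on_mult[OF assms(1) pow])
 then show ?thesis unfolding zmon_def .
qed

text \<open>The chain rule for the inclusion of a slice.\<close>

lemma partial_derivative:
 assumes "(F has_derivative D) (at (s, z))"
 shows "((%z. F (s, z)) has_derivative (%v. D (0, v))) (at z)"
proof -
 have "((%z. (s, z)) has_derivative (%v. (0, v))) (at z)" by (intro has_derivative_Pair has_derivative_const has_derivative_ident)
 from has_derivative_compose[OF this, of F D] show ?thesis using assms by simp
qed

lemma hform_eq_hcomp: "hform c i k = hcomp (%al. c (i, al)) k"
 by (simp add: hform_def hcomp_def fun_eq_iff)

lemma dform_eq_dcomp: "dform c i k = dcomp (%al. c (i, al)) k"
 by (simp add: dform_def dcomp_def fun_eq_iff)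

lemma hform_has_derivative:
 "(hform c i k has_derivative (%v. \<Sum>m\<in>UNIV. v $ m * dform c i k m z)) (at z)"
 unfolding hform_eq_hcomp dform_eq_dcomp by (rule hcomp_has_derivative)

lemma has_derivative_vec:
 fixes f :: "'n::finite => 'a::real_normed_vector => complex"
 assumes "!!r. (f r has_derivative f' r) F"
 shows "((%x. \<chi> r. f r x) has_derivative (%h. \<chi> r. f' r h)) F"
proof -
 show ?thesis unfolding vec_eq_sum_axis
  by (intro has_derivative_sum bounded_linear.has_derivative[OF bounded_linear_axis] assms)
qed

section \<open>The number of points in a simple fibre\<close>

text \<open>A family of equations over an interval whose solutions stay in a compact set and are all
 nondegenerate: the solutions can be followed along the interval, so their number is constant.\<close>

lemma fibre_card_constant:
 fixes h :: "real \<times> 'a::euclidean_space => 'a"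
 assumes comp: "compact {x. fst x \<in> {0..1} & h x = y0}"
  and loc: "!!x. fst x \<in> {0..1} ==> h x = y0 ==>
   \<exists>V W g. x \<in> V & open V & open W & homeomorphism V W (%x. (fst x, h x)) g"
 shows "finite {z. h (1, z) = y0}" "card {z. h (1, z) = y0} = card {z. h (0, z) = y0}"
proof -
 let ?T = "{x. fst x \<in> {0..1} & h x = y0}"
 define Z where "Z s = {z. h (s, z) = y0}" for s
 have fin: "finite (Z s)" if s: "s \<in> {0..1}" for s
 proof (rule ccontr)
  assume inf: "infinite (Z s)"
  have "Z s \<subseteq> snd ` ?T" using s by (force simp: Z_def image_iff)
  moreover have "compact (snd ` ?T)" by (intro compact_continuous_image comp continuous_on_snd continuous_on_id)
  ultimately obtain z where z: "z islimpt Z s" "z \<in> snd ` ?T"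
   using inf compact_eq_Bolzano_Weierstrass[of "snd ` ?T"] islimpt_subset[of _ "Z s"] by blast
  have "compact (?T \<inter> {s} \<times> UNIV)" by (intro compact_Int_closed comp closed_Times closed_singleton closed_UNIV)
  then have "compact (snd ` (?T \<inter> {s} \<times> UNIV))" by (intro compact_continuous_image continuous_on_snd continuous_on_id)
  moreover have "?T \<inter> {s} \<times> UNIV = Pair s ` Z s" using s by (auto simp: Z_def)
  then have "snd ` (?T \<inter> {s} \<times> UNIV) = Z s" by (simp add: image_image)
  ultimately have zZ: "z \<in> Z s" using z(1) by (metis closed_limpt compact_imp_closed)
  obtain V W g where V: "(s, z) \<in> V" "open V" "homeomorphism V W (%x. (fst x, h x)) g"
   using loc[of "(s, z)"] zZ s by (auto simp: Z_def)
  have "open ((%w. (s, w)) -` V)" using V(2) by (intro open_vimage continuous_intros)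
  then obtain w where "w \<in> Z s" "(s, w) \<in> V" "w ~= z"
   using islimptE[OF z(1), of "(%w. (s, w)) -` V"] V(1) by blast
  moreover have "inj_on (%x. (fst x, h x)) V" by (rule inj_on_inverseI[of V g]) (use V(3) in \<open>simp add: homeomorphism_def\<close>)
  ultimately show False using zZ V(1) unfolding inj_on_def Z_def by fastforce
 qed
 have loccard: "\<exists>e>0. \<forall>t\<in>{0..1}. \<bar>t - s\<bar> < e --> card (Z t) = card (Z s)" if s: "s \<in> {0..1}" for s
 proof -
  define R where "R z V g \<longleftrightarrow> (s, z) \<in> V & open V & (\<exists>W. open W & homeomorphism V W (%x. (fst x, h x)) g)" for z V g
  have "\<exists>V g. R z V g" if "z \<in> Z s" for z
   using loc[of "(s, z)"] that s unfolding R_def Z_def by fastforce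
  then obtain Vf gf where Vg: "!!z. z \<in> Z s ==> R z (Vf z) (gf z)" by metis
  obtain \<eta> where \<eta>: "\<eta> > 0" "!!z w. z \<in> Z s ==> w \<in> Z s ==> z ~= w ==> \<eta> \<le> dist z w"
  proof (cases "\<exists>z\<in>Z s. \<exists>w\<in>Z s. z ~= w")
   case True
   let ?D = "(%(z, w). dist z w) ` {(z, w). z \<in> Z s & w \<in> Z s & z ~= w}"
   have "{(z, w). z \<in> Z s & w \<in> Z s & z ~= w} \<subseteq> Z s \<times> Z s" by auto
   then have f: "finite ?D" using fin[OF s] by (meson finite_SigmaI finite_imageI finite_subset)
   have ne: "?D ~= {}" using True by auto
   have "0 < Min ?D" using f ne by (subst Min_gr_iff) auto
   moreover have "Min ?D \<le> dist z w" if "z \<in> Z s" "w \<in> Z s" "z ~= w" for z w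
    using f that by (intro Min_le) (auto intro!: image_eqI[of _ _ "(z, w)"])
   ultimately show ?thesis using that by blast
  next
   case False
   then show ?thesis using that[of 1] by auto
  qed
  define V' where "V' z = Vf z \<inter> {x. dist z (snd x) < \<eta> / 2}" for z
  have opV': "open (V' z)" if "z \<in> Z s" for z
   unfolding V'_def using Vg[OF that] by (intro open_Int open_Collect_less continuous_intros) (auto simp: R_def)
  have imV': "open ((%x. (fst x, h x)) ` V' z)" if z: "z \<in> Z s" for z
  proof -
   obtain W where W: "open W" "homeomorphism (Vf z) W (%x. (fst x, h x)) (gf z)" using Vg[OF z] by (auto simp: R_def)
   have "openin (top_of_set W) ((%x. (fst x, h x)) ` V' z)"
    using Vg[OF z] opV'[OF z]
    by (intro homeomorphism_imp_open_map[OF W(2)]) (auto simp: openin_open_eq R_def V'_def)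
   then show ?thesis using W(1) by (simp add: openin_open_eq)
  qed
  have injV': "x = y" if m: "z \<in> Z s" "x \<in> V' z" "y \<in> V' z" "fst x = fst y" "h x = h y" for z x y
  proof -
   obtain W where W: "homeomorphism (Vf z) W (%x. (fst x, h x)) (gf z)" using Vg[OF m(1)] by (auto simp: R_def)
   have "gf z (fst x, h x) = x" "gf z (fst y, h y) = y"
    using W m(2,3) unfolding homeomorphism_def V'_def by auto
   then show ?thesis using m(4,5) by metis
  qed
  have disj: "z = w" if "z \<in> Z s" "w \<in> Z s" "x \<in> V' z" "x \<in> V' w" for z w x
  proof (rule ccontr)
   assume "z ~= w"
   then have "\<eta> \<le> dist z w" using \<eta>(2) that by blast
   also have "\<dots> \<le> dist z (snd x) + dist w (snd x)" by (rule dist_triangle2)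
   also have "\<dots> < \<eta>" using that(3,4) by (simp add: V'_def)
   finally show False by simp
  qed
  have base: "(s, z) \<in> V' z" if "z \<in> Z s" for z using Vg[OF that] \<eta>(1) by (simp add: V'_def R_def)
  have "\<forall>z\<in>Z s. \<exists>e>0. ball (s, y0) e \<subseteq> (%x. (fst x, h x)) ` V' z"
  proof
   fix z assume z: "z \<in> Z s"
   have "(s, y0) \<in> (%x. (fst x, h x)) ` V' z" using base[OF z] z by (auto simp: Z_def intro!: image_eqI[of _ _ "(s, z)"])
   then show "\<exists>e>0. ball (s, y0) e \<subseteq> (%x. (fst x, h x)) ` V' z" using imV'[OF z] open_contains_ball by blast
  qed
  then obtain ef where ef: "!!z. z \<in> Z s ==> ef z > 0 & ball (s, y0) (ef z) \<subseteq> (%x. (fst x, h x)) ` V' z" by metis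
  let ?K = "?T - (\<Union>z\<in>Z s. V' z)"
  have "compact ?K" using opV' by (intro compact_diff comp) blast
  then have cK: "compact (fst ` ?K)" by (intro compact_continuous_image continuous_on_fst continuous_on_id)
  have nK: "s \<notin> fst ` ?K"
  proof
   assume "s \<in> fst ` ?K"
   then obtain z where "(s, z) \<in> ?K" by force
   then show False using base[of z] by (auto simp: Z_def)
  qed
  have sK: "s \<in> - (fst ` ?K)" unfolding Compl_iff by (rule nK)
  from openE[OF open_Compl[OF compact_imp_closed[OF cK]] sK] obtain e0 where e0': "e0 > 0" "ball s e0 \<subseteq> - (fst ` ?K)" by blast
  have e0: "e0 > 0" "ball s e0 \<inter> fst ` ?K = {}" using e0' by (simp_all only: disjoint_eq_subset_Compl)
  define e where "e = Min (insert e0 (ef ` Z s))"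
  have e: "e > 0" "e \<le> e0" "!!z. z \<in> Z s ==> e \<le> ef z"
   unfolding e_def using fin[OF s] e0(1) ef by auto
  have "card (Z t) = card (Z s)" if t: "t \<in> {0..1}" "\<bar>t - s\<bar> < e" for t
  proof -
   have ex: "\<exists>w. (t, w) \<in> V' z & h (t, w) = y0" if z: "z \<in> Z s" for z
   proof -
    have "(t, y0) \<in> ball (s, y0) (ef z)" using t(2) e(3)[OF z] by (simp add: dist_prod_def dist_real_def abs_minus_commute)
    then have "(t, y0) \<in> (%x. (fst x, h x)) ` V' z" using ef[OF z] by blast
    then obtain x where "x \<in> V' z" "fst x = t" "h x = y0" by auto
    then show ?thesis by (metis prod.collapse)
   qed
   then obtain f where f: "!!z. z \<in> Z s ==> (t, f z) \<in> V' z" "!!z. z \<in> Z s ==> h (t, f z) = y0" by metis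
   have "inj_on f (Z s)" using disj f(1) by (metis inj_onI)
   moreover have "f ` Z s = Z t"
   proof (intro subset_antisym subsetI)
    fix w assume w: "w \<in> Z t"
    have "t \<in> ball s e0" using t(2) e(2) by (simp add: dist_real_def abs_minus_commute)
    have "(t, w) \<notin> ?K"
    proof
     assume "(t, w) \<in> ?K"
     then have "t \<in> fst ` ?K" by (rule image_eqI[rotated]) simp
     with \<open>t \<in> ball s e0\<close> have "t \<in> ball s e0 \<inter> fst ` ?K" by (rule IntI)
     then show False unfolding e0(2) by simp
    qed
    then obtain z where z: "z \<in> Z s" "(t, w) \<in> V' z" using w t(1) by (auto simp: Z_def)
    have "(t, w) = (t, f z)" using w f z by (intro injV'[OF z(1)]) (auto simp: Z_def)
    then show "w \<in> f ` Z s" using z(1) by simp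
   qed (use f(2) in \<open>auto simp: Z_def\<close>)
   ultimately show ?thesis using card_image by metis
  qed
  then show ?thesis using e(1) by blast
 qed
 have "card (Z 1) = card (Z 0)"
 proof (rule connected_induction_simple[of "{0..1::real}" 0 1 "%s. card (Z s) = card (Z 0)"])
  fix s :: real assume s: "s \<in> {0..1}"
  obtain e where e: "e > 0" "!!t. t \<in> {0..1} ==> \<bar>t - s\<bar> < e ==> card (Z t) = card (Z s)" using loccard[OF s] by blast
  show "\<exists>T. openin (top_of_set {0..1}) T & s \<in> T & (\<forall>x\<in>T. \<forall>y\<in>T. card (Z x) = card (Z 0) --> card (Z y) = card (Z 0))"
  proof (intro exI[of _ "{0..1} \<inter> ball s e"] conjI ballI impI)
   show "openin (top_of_set {0..1}) ({0..1} \<inter> ball s e)" by (rule openin_open_Int[OF open_ball])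
   show "s \<in> {0..1} \<inter> ball s e" using s e(1) by simp
   fix x y assume "x \<in> {0..1} \<inter> ball s e" "y \<in> {0..1} \<inter> ball s e" and x: "card (Z x) = card (Z 0)"
   then have "card (Z x) = card (Z s)" "card (Z y) = card (Z s)"
    using e(2)[of x] e(2)[of y] by (simp_all add: dist_real_def abs_minus_commute)
   then show "card (Z y) = card (Z 0)" using x by simp
  qed
 qed auto
 then show "card {z. h (1, z) = y0} = card {z. h (0, z) = y0}" by (simp add: Z_def)
 show "finite {z. h (1, z) = y0}" using fin[of 1] by (simp add: Z_def)
qed

section \<open>Generic fibres of the projection to the y-variables\<close>

context elimination
begin

definition fib :: "(nat \<times> ('n mon) => complex) => (complex^'n) set" where
 "fib c = {z. (\<forall>m. m \<notin> X --> z $ m = (if m = j0 then 1 else 0)) & (\<forall>i<length d. hform c i (d ! i) z = 0)}"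

definition no_zero_at_infinity :: "(nat \<times> ('n mon) => complex) => bool" where
 "no_zero_at_infinity c \<longleftrightarrow>
   (\<forall>x. (\<forall>m. m \<notin> X --> x $ m = 0) & (\<forall>i<length d. hform c i (d ! i) x = 0) --> x = 0)"

definition simple_fibre :: "(nat \<times> ('n mon) => complex) => bool" where
 "simple_fibre c \<longleftrightarrow> (\<forall>z\<in>fib c. \<forall>l. (\<forall>m\<in>X. (\<Sum>i<length d. l i * dform c i (d ! i) m z) = 0) --> (\<forall>i<length d. l i = 0))"

definition pos :: "'n => nat" where "pos = the_inv_into {..<length d} \<iota>"

lemma pos_\<iota> [simp]: "i < length d ==> pos (\<iota> i) = i"
 unfolding pos_def by (rule the_inv_into_f_f[OF inj_\<iota>]) simp

lemma pos_X: "r \<in> X ==> pos r < length d" "r \<in> X ==> \<iota> (pos r) = r"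
 by (auto simp: X_def)

lemma j0_X: "j0 \<notin> X"
 using j0 by (simp add: X_def)

lemma sum_X: "(\<Sum>r\<in>X. f (pos r)) = (\<Sum>i<length d. f i)"
 unfolding X_def by (simp add: sum.reindex[OF inj_\<iota>])

text \<open>Completing independent equations by the remaining coordinates gives local coordinates.\<close>

lemma partial_chart:
 fixes h :: "real \<times> (complex^'n) => complex^'n" and B :: "nat => 'n => complex"
 assumes U: "open U" "(s, z) \<in> U" and Ckh: "!!k. Ck_on k U h"
  and der: "((%z. h (s, z)) has_derivative
   (%v. \<chi> r. if r \<in> X then \<Sum>m\<in>UNIV. v $ m * B (pos r) m else v $ r)) (at z)"
  and ind: "!!l. \<forall>m\<in>X. (\<Sum>i<length d. l i * B i m) = 0 ==> \<forall>i<length d. l i = 0"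
 shows "\<exists>V W g. V \<subseteq> U & (s, z) \<in> V & diffeomorphism V W (%x. (fst x, h x)) g"
proof -
 let ?x = "(s, z)"
 let ?\<Theta> = "%x. (fst x, h x)"
 have "Ck_on k U (%x. (fst x, 0) + (0, h x))" for k
  by (intro Ck_on_add[OF U(1)] Ck_on_bounded_linear[OF _ U(1)] Ck_on_linear_compose[OF _ U(1) Ckh, of "%w. (0, w)"]
    bounded_linear_Pair bounded_linear_fst bounded_linear_zero bounded_linear_ident)
 then have Ck\<Theta>: "Ck_on k U ?\<Theta>" for k by simp
 have derh: "(h has_derivative FD h (at ?x)) (at ?x)" by (rule Ck_on_has_derivative[OF Ckh U])
 have der\<Theta>: "(?\<Theta> has_derivative (%v. (fst v, FD h (at ?x) v))) (at ?x)"
  by (intro has_derivative_Pair derh has_derivative_fst has_derivative_ident)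
 define A where "A r m = (if r \<in> X then B (pos r) m else if m = r then 1 else 0)" for r m
 have Aid: "(\<Sum>m\<in>UNIV. v $ m * A r m) = v $ r" if "r \<notin> X" for r and v :: "complex^'n"
 proof -
  have "(\<Sum>m\<in>UNIV. v $ m * A r m) = (\<Sum>m\<in>{r}. v $ m * A r m)"
   by (rule sum.mono_neutral_right) (use that in \<open>auto simp: A_def\<close>)
  then show ?thesis using that by (simp add: A_def)
 qed
 have "((%z. h (s, z)) has_derivative (%v. FD h (at ?x) (0, v))) (at z)"
  by (rule partial_derivative[OF derh])
 from has_derivative_unique[OF this der]
 have Dh: "(%v. FD h (at ?x) (0, v)) = (%v. \<chi> r. \<Sum>m\<in>UNIV. v $ m * A r m)"
  by (simp add: fun_eq_iff vec_eq_iff Aid) (simp add: A_def)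
 have surj: "range (%v :: complex^'n. \<chi> r. if r \<in> UNIV then \<Sum>m\<in>UNIV. v $ m * A r m else 0) = {w. \<forall>r. r \<notin> UNIV --> w $ r = 0}"
 proof (rule independent_rows_surj)
  fix l assume l: "!!m. (\<Sum>r\<in>UNIV. l r * A r m) = 0"
  have split: "(\<Sum>r\<in>UNIV. l r * A r m) = (\<Sum>i<length d. l (\<iota> i) * B i m) + (if m \<in> X then 0 else l m)" for m
  proof -
   have "(\<Sum>r\<in>UNIV. l r * A r m) = (\<Sum>r\<in>X. l r * A r m) + (\<Sum>r\<in>-X. l r * A r m)"
    by (subst sum.union_disjoint[symmetric]) (auto simp: Compl_partition)
   also have "(\<Sum>r\<in>X. l r * A r m) = (\<Sum>r\<in>X. (%i. l (\<iota> i) * B i m) (pos r))"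
    by (intro sum.cong) (auto simp: A_def pos_X)
   also have "\<dots> = (\<Sum>i<length d. l (\<iota> i) * B i m)" by (rule sum_X)
   also have "(\<Sum>r\<in>-X. l r * A r m) = (\<Sum>r\<in>-X. if r = m then l m else 0)"
    by (intro sum.cong) (auto simp: A_def)
   also have "\<dots> = (if m \<in> X then 0 else l m)" by (simp add: sum.delta)
   finally show ?thesis .
  qed
  have "\<forall>m\<in>X. (\<Sum>i<length d. l (\<iota> i) * B i m) = 0"
  proof
   fix m assume "m \<in> X"
   then show "(\<Sum>i<length d. l (\<iota> i) * B i m) = 0" using split[of m] l[of m] by simp
  qed
  then have li: "\<forall>i<length d. l (\<iota> i) = 0" by (rule ind)
  have "l r = 0" for r
  proof (cases "r \<in> X")
   case True then show ?thesis using li pos_X[of r] by metis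
  next
   case False then show ?thesis using l[of r] split[of r] li by simp
  qed
  then show "\<forall>r\<in>UNIV. l r = 0" by blast
 qed
 let ?D = "%v. FD h (at ?x) (0, v)"
 have "surj ?D" unfolding Dh using surj by simp
 moreover have linD: "linear ?D"
 proof -
  have "linear (%v :: complex^'n. (0 :: real, v))" by (simp add: linear_iff)
  from linear_compose[OF this has_derivative_linear[OF derh]] show ?thesis by (simp add: o_def)
 qed
 ultimately have inj: "inj ?D" by (intro linear_surjective_imp_injective refl)
 have "v = 0" if "FD ?\<Theta> (at ?x) v = 0" for v
 proof -
  have v: "fst v = 0" "FD h (at ?x) v = 0"
   using that frechet_derivative_at[OF der\<Theta>] by (auto simp: zero_prod_def dest: sym)
  then have "?D (snd v) = 0" by (metis prod.collapse)
  then have "snd v = 0" using inj linD by (simp add: linear_injective_0)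
  then show ?thesis using v(1) by (simp add: prod_eq_iff)
 qed
 then obtain V W g where "V \<subseteq> U" "?x \<in> V" "diffeomorphism V W ?\<Theta> g"
  using smooth_inverse_function[OF U Ck\<Theta>] by blast
 then show ?thesis by blast
qed

lemma fib_card_eq:
 fixes c0 c :: "nat \<times> ('n mon) => complex" and ga :: "real => complex"
 defines "cs \<equiv> %s a. c0 a + ga s * (c a - c0 a)"
 assumes ga: "!!k. Ck_on k UNIV ga" "ga 0 = 0" "ga 1 = 1"
  and N1: "!!s. s \<in> {0..1} ==> no_zero_at_infinity (cs s)" and N2: "!!s. s \<in> {0..1} ==> simple_fibre (cs s)"
 shows "finite (fib c)" "card (fib c) = card (fib c0)"
proof -
 define H where "H r = (%(s, z :: complex^'n). if r \<in> X then hform (cs s) (pos r) (d ! pos r) z else z $ r)" for r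
 define h where "h x = (\<chi> r. H r x)" for x
 define y0 :: "complex^'n" where "y0 = axis j0 1"
 have y0: "y0 $ r = (if r = j0 then 1 else 0)" for r by (simp add: y0_def axis_def)
 have fib: "{z. h (s, z) = y0} = fib (cs s)" for s
 proof (intro set_eqI iffI)
  fix z assume "z \<in> {z. h (s, z) = y0}"
  then have *: "H r (s, z) = (if r = j0 then 1 else 0)" for r by (auto simp: h_def vec_eq_iff y0)
  have "hform (cs s) i (d ! i) z = 0" if "i < length d" for i
   using *[of "\<iota> i"] that \<iota>_in_X[OF that] j0_X by (auto simp: H_def)
  moreover have "z $ m = (if m = j0 then 1 else 0)" if "m \<notin> X" for m using *[of m] that by (simp add: H_def)
  ultimately show "z \<in> fib (cs s)" by (simp add: fib_def)
 next
  fix z assume "z \<in> fib (cs s)"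
  then show "z \<in> {z. h (s, z) = y0}"
   using j0_X pos_X by (auto simp: h_def vec_eq_iff y0 H_def fib_def)
 qed
 have CkH: "Ck_on k UNIV (H r)" for k r
 proof (cases "r \<in> X")
  case False
  then have "H r = (%x. snd x $ r)" by (auto simp: H_def)
  then show ?thesis
   by (simp add: Ck_on_bounded_linear bounded_linear_compose[OF bounded_linear_vec_nth bounded_linear_snd])
 next
  case True
  have g: "Ck_on k UNIV (%x :: real \<times> (complex^'n). ga (fst x))"
   by (rule Ck_on_compose[OF open_UNIV open_UNIV _ ga(1)]) (auto intro: Ck_on_bounded_linear bounded_linear_fst)
  have "Ck_on k UNIV (%x :: real \<times> (complex^'n). \<Sum>al | mdeg al = d ! pos r.
    (c0 (pos r, al) + ga (fst x) * (c (pos r, al) - c0 (pos r, al))) * zmon (snd x) al)"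
   by (intro Ck_on_sum Ck_on_mult Ck_on_add Ck_on_const Ck_on_zmon g open_UNIV Ck_on_bounded_linear bounded_linear_snd)
  then show ?thesis using True by (simp add: H_def hform_def cs_def case_prod_beta')
 qed
 have Ckh: "Ck_on k UNIV h" for k
  unfolding h_def[abs_def] by (rule Ck_on_vec[OF open_UNIV CkH])
 have conth: "continuous_on UNIV h" using Ckh[of 0] by simp
 let ?T = "{x. fst x \<in> {0..1} & h x = y0}"
 have closedT: "closed ?T"
 proof -
  have eq: "?T = fst -` {0..1} \<inter> h -` {y0}" by auto
  have c1: "closed (fst -` {0..1} :: (real \<times> (complex^'n)) set)"
   by (intro closed_vimage closed_atLeastAtMost continuous_on_fst continuous_on_id)
  have c2: "closed (h -` {y0})" by (intro closed_vimage closed_singleton conth)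
  show ?thesis unfolding eq by (rule closed_Int[OF c1 c2])
 qed
 have "bounded ?T"
 proof -
  let ?K = "{x. fst x \<in> {0..1} & norm (snd x) = 1 & (\<forall>m. m \<notin> insert j0 X --> snd x $ m = 0) & (\<forall>r\<in>X. H r x = 0)}"
  have clK: "closed ?K"
  proof -
   have "?K = fst -` {0..1} \<inter> (%x. norm (snd x)) -` {1} \<inter> (\<Inter>m\<in>- insert j0 X. (%x. snd x $ m) -` {0}) \<inter> (\<Inter>r\<in>X. H r -` {0})"
    by auto
   moreover have "continuous_on UNIV (H r)" for r using CkH[of 0 r] by simp
   ultimately show ?thesis by (auto intro!: closed_Int closed_INT closed_vimage continuous_intros)
  qed
  have "compact (({0..1} \<times> sphere 0 1) \<inter> ?K)" by (intro compact_Int_closed compact_Times compact_Icc compact_sphere clK)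
  moreover have "({0..1} \<times> sphere 0 1) \<inter> ?K = ?K" by (auto simp: mem_Times_iff)
  ultimately have K: "compact ?K" by (simp only:)
  have pos: "snd x $ j0 ~= 0" if x: "x \<in> ?K" for x
  proof
   assume "snd x $ j0 = 0"
   then have "\<forall>m. m \<notin> X --> snd x $ m = 0" using x by (metis (mono_tags, lifting) insert_iff mem_Collect_eq)
   moreover have "\<forall>i<length d. hform (cs (fst x)) i (d ! i) (snd x) = 0"
   proof (intro allI impI)
    fix i assume "i < length d"
    then show "hform (cs (fst x)) i (d ! i) (snd x) = 0" using x \<iota>_in_X[of i] by (force simp: H_def case_prod_beta)
   qed
   ultimately have "snd x = 0" using N1[of "fst x"] x unfolding no_zero_at_infinity_def by blast
   then show False using x by simp
  qed
  obtain \<eta> where \<eta>: "\<eta> > 0" "!!x. x \<in> ?K ==> \<eta> \<le> cmod (snd x $ j0)"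
  proof (cases "?K = {}")
   case True show ?thesis by (rule that[of 1], simp, simp only: True empty_iff)
  next
   case False
   have "continuous_on ?K (%x. cmod (snd x $ j0))" by (intro continuous_intros)
   from continuous_attains_inf[OF K False this] obtain x
    where x: "x \<in> ?K" "\<forall>y\<in>?K. cmod (snd x $ j0) \<le> cmod (snd y $ j0)" by (rule bexE)
   show ?thesis by (rule that[of "cmod (snd x $ j0)"], use pos[OF x(1)] in simp, rule bspec[OF x(2)])
  qed
  have "norm x \<le> 1 + 1 / \<eta>" if x: "x \<in> ?T" for x
  proof -
   obtain s z where sz: "x = (s, z)" by (cases x)
   have z: "z \<in> fib (cs s)" "s \<in> {0..1}" using x fib[of s] sz by auto
   have zj: "z $ j0 = 1" using z j0_X by (simp add: fib_def)
   then have nz: "norm z ~= 0" by (metis norm_eq_zero zero_index zero_neq_one)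
   let ?w = "(1 / norm z) *\<^sub>R z"
   have "hform (cs s) i (d ! i) ?w = 0" if "i < length d" for i
    using z that unfolding scaleR_eq_scalar_mult hform_scale by (simp add: fib_def)
   then have "(s, ?w) \<in> ?K" using z nz pos_X by (auto simp: fib_def H_def)
   then have "\<eta> \<le> cmod (?w $ j0)" using \<eta>(2)[of "(s, ?w)"] by simp
   then have "\<eta> \<le> 1 / norm z" using zj by simp
   then have "norm z \<le> 1 / \<eta>" using \<eta>(1) nz by (simp add: field_simps)
   moreover have "norm x \<le> norm s + norm z" unfolding sz by (rule norm_Pair_le)
   ultimately show ?thesis using z(2) by simp
  qed
  then show ?thesis unfolding bounded_iff by blast
 qed
 then have comp: "compact ?T" using closedT compact_eq_bounded_closed by blast
 have loc: "\<exists>V W g. x \<in> V & open V & open W & homeomorphism V W (%x. (fst x, h x)) g"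
  if x: "fst x \<in> {0..1}" "h x = y0" for x
 proof -
  obtain s z where sz: "x = (s, z)" by (cases x)
  have z: "z \<in> fib (cs s)" "s \<in> {0..1}" using x fib[of s] sz by auto
  have Hder: "((%z. H r (s, z)) has_derivative
    (%v. if r \<in> X then \<Sum>m\<in>UNIV. v $ m * dform (cs s) (pos r) (d ! pos r) m z else v $ r)) (at z)" for r
  proof (cases "r \<in> X")
   case True then show ?thesis using hform_has_derivative by (simp add: H_def)
  next
   case False
   have "((%z. z $ r) has_derivative (%v :: complex^'n. v $ r)) (at z)"
    by (rule bounded_linear_imp_has_derivative[OF bounded_linear_vec_nth])
   then show ?thesis using False by (simp add: H_def)
  qed
  have "((%z. h (s, z)) has_derivative
    (%v. \<chi> r. if r \<in> X then \<Sum>m\<in>UNIV. v $ m * dform (cs s) (pos r) (d ! pos r) m z else v $ r)) (at z)"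
   unfolding h_def by (rule has_derivative_vec[OF Hder])
  from partial_chart[OF open_UNIV UNIV_I Ckh this]
  obtain V W g where "(s, z) \<in> V" "diffeomorphism V W (%x. (fst x, h x)) g"
   using N2[OF z(2), unfolded simple_fibre_def, THEN bspec, OF z(1)] by blast
  then show ?thesis unfolding sz diffeomorphism_def by blast
 qed
 have c1: "cs 1 = c" "cs 0 = c0" using ga by (auto simp: cs_def)
 show "finite (fib c)" "card (fib c) = card (fib c0)"
  using fibre_card_constant[OF comp loc] fib[of 1] fib[of 0] c1 by simp_all
qed

definition pure_coeffs :: "nat \<times> ('n mon) => complex" where
 "pure_coeffs = (%(i, al). if al = sgl (\<iota> i) (d ! i) then 1
   else if al = sgl j0 (d ! i) then - 1 else 0)"

lemma single_neq:
 assumes "i < length d"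
 shows "sgl j0 (d ! i) ~= sgl (\<iota> i) (d ! i)"
proof
 assume "sgl j0 (d ! i) = sgl (\<iota> i) (d ! i)"
 then have "lkp (sgl j0 (d ! i)) j0 = lkp (sgl (\<iota> i) (d ! i)) j0" by simp
 then show False using d_pos[OF assms] \<iota>_in_X[OF assms] j0_X by (auto simp: lookup_single when_def split: if_splits)
qed

text \<open>The fibre of these forms consists of vectors of roots of unity, which can be counted.\<close>

lemma hform_pure:
 assumes "i < length d" shows "hform pure_coeffs i (d ! i) z = z $ \<iota> i ^ (d ! i) - z $ j0 ^ (d ! i)"
proof -
 let ?a = "sgl (\<iota> i) (d ! i)" and ?b = "sgl j0 (d ! i)"
 have "hform pure_coeffs i (d ! i) z = (\<Sum>al\<in>{?a, ?b}. pure_coeffs (i, al) * zmon z al)"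
  unfolding hform_def using finite_monoms_of_degree by (intro sum.mono_neutral_right) (auto simp: pure_coeffs_def)
 then show ?thesis using single_neq[OF assms] by (simp add: pure_coeffs_def)
qed

lemma dform_pure:
 assumes "i < length d" "m \<in> X"
 shows "dform pure_coeffs i (d ! i) m z = (if m = \<iota> i then of_nat (d ! i) * z $ \<iota> i ^ (d ! i - 1) else 0)"
proof -
 let ?a = "sgl (\<iota> i) (d ! i)" and ?b = "sgl j0 (d ! i)"
 have "dform pure_coeffs i (d ! i) m z = (\<Sum>al\<in>{?a, ?b}. pure_coeffs (i, al) * dmono m z al)"
  unfolding dform_def using finite_monoms_of_degree by (intro sum.mono_neutral_right) (auto simp: pure_coeffs_def)
 moreover have "dmono m z ?b = 0" using assms(2) j0_X by (auto simp: dmono_def lookup_single when_def)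
 moreover have "dmono m z ?a = (if m = \<iota> i then of_nat (d ! i) * z $ \<iota> i ^ (d ! i - 1) else 0)"
  by (auto simp: dmono_def lookup_single when_def simp flip: single_diff)
 ultimately show ?thesis using single_neq[OF assms(1)] by (simp add: pure_coeffs_def)
qed

lemma pure_no_zero: "no_zero_at_infinity pure_coeffs"
 unfolding no_zero_at_infinity_def
proof (intro allI impI)
 fix x :: "complex^'n"
 assume x: "(\<forall>m. m \<notin> X --> x $ m = 0) & (\<forall>i<length d. hform pure_coeffs i (d ! i) x = 0)"
 have "x $ m = 0" for m
 proof (cases "m \<in> X")
  case True
  have "x $ \<iota> (pos m) ^ (d ! pos m) - x $ j0 ^ (d ! pos m) = 0"
   using x hform_pure[of "pos m" x] pos_X[OF True] by auto
  then show ?thesis using x j0_X d_pos[of "pos m"] pos_X[OF True] by (auto simp: power_0_left split: if_splits)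
 qed (use x in blast)
 then show "x = 0" by (simp add: vec_eq_iff)
qed

lemma pure_simple: "simple_fibre pure_coeffs"
 unfolding simple_fibre_def
proof (intro ballI allI impI)
 fix z and l :: "nat => complex" and i
 assume z: "z \<in> fib pure_coeffs" and l: "\<forall>m\<in>X. (\<Sum>i<length d. l i * dform pure_coeffs i (d ! i) m z) = 0" and i: "i < length d"
 have "z $ j0 = 1" "hform pure_coeffs i (d ! i) z = 0" using z i j0_X by (auto simp: fib_def)
 then have "z $ \<iota> i ^ (d ! i) = 1" using hform_pure[OF i, of z] by simp
 then have nz: "z $ \<iota> i ~= 0" using d_pos[OF i] by (auto simp: power_0_left)
 have "(\<Sum>i'<length d. l i' * dform pure_coeffs i' (d ! i') (\<iota> i) z) = (\<Sum>i'<length d. if i' = i then l i * (of_nat (d ! i) * z $ \<iota> i ^ (d ! i - 1)) else 0)"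
 proof (intro sum.cong refl, goal_cases)
  case (1 i')
  then have "\<iota> i = \<iota> i' \<longleftrightarrow> i = i'" using inj_\<iota> i by (auto simp: inj_on_def)
  then show ?case using 1 dform_pure[OF _ \<iota>_in_X[OF i], of i' z] by auto
 qed
 then have "l i * (of_nat (d ! i) * z $ \<iota> i ^ (d ! i - 1)) = 0" using l \<iota>_in_X[OF i] i by simp
 then show "l i = 0" using nz d_pos[OF i] by auto
qed

lemma card_fib_pure: "(\<Prod>i<length d. d ! i) \<le> card (fib pure_coeffs)" if "finite (fib pure_coeffs)"
proof -
 let ?R = "%i. {w :: complex. w ^ (d ! i) = 1}"
 let ?e = "%f. \<chi> m. if m \<in> X then f (pos m) else if m = j0 then 1 else (0 :: complex)"
 have cardR: "card (?R i) = d ! i" if "i < length d" for i using card_roots_unity_eq[of "d ! i"] d_pos[OF that] by simp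
 have inj: "inj_on ?e (PiE {..<length d} ?R)"
 proof (rule inj_onI)
  fix f g assume f: "f \<in> PiE {..<length d} ?R" "g \<in> PiE {..<length d} ?R" and e: "?e f = ?e g"
  show "f = g"
  proof (rule PiE_ext[OF f])
   fix i assume "i \<in> {..<length d}"
   then show "f i = g i" using arg_cong[OF e, of "%v. v $ \<iota> i"] \<iota>_in_X by auto
  qed
 qed
 have "?e ` PiE {..<length d} ?R \<subseteq> fib pure_coeffs"
  using hform_pure \<iota>_in_X j0_X by (auto simp: fib_def PiE_iff)
 then have "card (?e ` PiE {..<length d} ?R) \<le> card (fib pure_coeffs)" using that by (intro card_mono)
 moreover have "card (?e ` PiE {..<length d} ?R) = (\<Prod>i<length d. d ! i)"
  using cardR by (simp add: card_image[OF inj] card_PiE)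
 ultimately show ?thesis by simp
qed

text \<open>The two coefficient tuples are joined in the complex line through them by one of the arcs
 \<open>s + \<i> \<theta> s (1 - s)\<close>, which are disjoint except for their end points, so that almost all of them
 avoid the finitely many points of the line at which the polynomial \<open>\<phi>\<close> vanishes.\<close>

lemma many_points_in_fibre:
 assumes \<phi>: "polyon J \<phi>" "\<phi> c ~= 0"
  and N1: "!!c. \<phi> c ~= 0 ==> no_zero_at_infinity c" and N2: "!!c. \<phi> c ~= 0 ==> simple_fibre c"
 shows "finite (fib c)" "(\<Prod>i<length d. d ! i) \<le> card (fib c)"
proof -
 obtain q where q: "!!s. \<phi> (%a. pure_coeffs a + s * (c a - pure_coeffs a)) = poly q s"
  using polyon_line[OF \<phi>(1), of pure_coeffs "%a. c a - pure_coeffs a"] by blast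
 have "poly q 1 ~= 0" using q[of 1] \<phi>(2) by simp
 then have "q ~= 0" by auto
 then have fin: "finite {s. poly q s = 0}" by (rule poly_roots_finite)
 define arc where "arc \<theta> s = complex_of_real s + \<i> * of_real (\<theta> * (s * (1 - s)))" for \<theta> s :: real
 define bad where "bad w = Im w / (Re w * (1 - Re w))" for w
 have "finite (bad ` {s. poly q s = 0})" using fin by simp
 then obtain \<theta> where \<theta>: "\<theta> \<notin> bad ` {s. poly q s = 0}" using ex_new_if_finite[OF infinite_UNIV_char_0] by blast
 have nz: "poly q (arc \<theta> s) ~= 0" if s: "s \<in> {0<..1}" for s
 proof (cases "s = 1")
  case True then show ?thesis using \<open>poly q 1 ~= 0\<close> by (simp add: arc_def)
 next
  case False
  have "Re (arc \<theta> s) = s" "Im (arc \<theta> s) = \<theta> * (s * (1 - s))" by (simp_all add: arc_def)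
  then have "bad (arc \<theta> s) = \<theta>" using s False by (simp add: bad_def)
  then show ?thesis using \<theta> imageI[of "arc \<theta> s" "{s. poly q s = 0}" bad] by auto
 qed
 have fibs: "finite (fib c)" "card (fib c) = card (fib pure_coeffs)"
  if "!!s. s \<in> {0..1} ==> no_zero_at_infinity (%a. pure_coeffs a + arc \<theta> s * (c a - pure_coeffs a))"
   "!!s. s \<in> {0..1} ==> simple_fibre (%a. pure_coeffs a + arc \<theta> s * (c a - pure_coeffs a))"
  using fib_card_eq[of "arc \<theta>" pure_coeffs c, OF _ _ _ that]
 proof -
  have of_re: "Ck_on k UNIV (%s :: real. complex_of_real s)" for k by (rule Ck_on_bounded_linear[OF bounded_linear_of_real open_UNIV])
  have "arc \<theta> = (%s. of_real s + \<i> * of_real \<theta> * (of_real s * (1 + (-1) * of_real s)))" by (simp add: arc_def fun_eq_iff)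
  moreover have "Ck_on k UNIV (%s :: real. complex_of_real s + \<i> * of_real \<theta> * (of_real s * (1 + (-1) * of_real s)))" for k
   by (intro Ck_on_add Ck_on_mult Ck_on_const of_re open_UNIV)
  ultimately have "Ck_on k UNIV (arc \<theta>)" for k by simp
  then show "finite (fib c)" "card (fib c) = card (fib pure_coeffs)"
   using fib_card_eq[of "arc \<theta>" pure_coeffs c, OF _ _ _ that] by (auto simp: arc_def)
 qed
 have good: "no_zero_at_infinity (%a. pure_coeffs a + arc \<theta> s * (c a - pure_coeffs a)) &
   simple_fibre (%a. pure_coeffs a + arc \<theta> s * (c a - pure_coeffs a))" if s: "s \<in> {0..1}" for s
 proof (cases "s = 0")
  case True then show ?thesis using pure_no_zero pure_simple by (simp add: arc_def)
 next
  case False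
  then have "\<phi> (%a. pure_coeffs a + arc \<theta> s * (c a - pure_coeffs a)) ~= 0" using q nz[of s] s by auto
  then show ?thesis using N1 N2 by blast
 qed
 show "finite (fib c)" using fibs(1) good by blast
 have eq: "card (fib c) = card (fib pure_coeffs)" using fibs(2) good by blast
 have "finite (fib pure_coeffs)"
 proof (rule fib_card_eq(1)[of "%s. of_real s" pure_coeffs pure_coeffs])
  show "Ck_on k UNIV (%s :: real. complex_of_real s)" for k by (rule Ck_on_bounded_linear[OF bounded_linear_of_real open_UNIV])
 qed (simp_all add: pure_no_zero pure_simple)
 then show "(\<Prod>i<length d. d ! i) \<le> card (fib c)" using card_fib_pure eq by simp
qed

end

section \<open>Interpolation in the fibre\<close>

text \<open>If the evaluation matrix of finitely many functions at at least as many points is right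
 invertible, then so is every nearby matrix, by diagonal dominance, and it is then injective for
 reasons of dimension.\<close>

lemma perturbed_interpolation:
 fixes V :: "'k => 'b => complex"
 assumes T: "finite T" and B: "finite B" and card: "card B \<le> card T"
  and \<Lambda>: "!!z k. z \<in> T ==> k \<in> T ==> (\<Sum>be\<in>B. V z be * \<Lambda> be k) = (if z = k then 1 else 0)"
 obtains ep where "0 < ep"
  "\<forall>V' \<xi>. (\<forall>k\<in>T. \<forall>be\<in>B. cmod (V' k be - V k be) < ep) & (\<forall>k\<in>T. (\<Sum>be\<in>B. V' k be * \<xi> be) = 0) --> (\<forall>be\<in>B. \<xi> be = 0)"
proof -
 define M where "M = 1 + (\<Sum>k\<in>T. \<Sum>be\<in>B. cmod (\<Lambda> be k))"
 have "0 \<le> (\<Sum>k\<in>T. \<Sum>be\<in>B. cmod (\<Lambda> be k))" by (intro sum_nonneg) auto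
 then have M: "0 < M" by (simp add: M_def)
 have Mk: "(\<Sum>be\<in>B. cmod (\<Lambda> be k)) \<le> M" if "k \<in> T" for k
 proof -
  have "(\<Sum>be\<in>B. cmod (\<Lambda> be k)) \<le> (\<Sum>k\<in>T. \<Sum>be\<in>B. cmod (\<Lambda> be k))"
   by (rule member_le_sum[OF that _ T]) (auto intro: sum_nonneg)
  then show ?thesis by (simp add: M_def)
 qed
 define ep where "ep = 1 / (2 * (card T + 1) * M)"
 have ep: "0 < ep" using M by (simp add: ep_def)
 have "ep * M = 1 / (2 * (card T + 1))" using M by (simp add: ep_def)
 then have half: "card T * (ep * M) \<le> 1 / 2" by (simp only:) (simp add: divide_le_eq)
 have "\<xi> be0 = 0" if V': "!!k be. k \<in> T ==> be \<in> B ==> cmod (V' k be - V k be) < ep"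
  and \<xi>: "!!k. k \<in> T ==> (\<Sum>be\<in>B. V' k be * \<xi> be) = 0" and be0: "be0 \<in> B" for V' \<xi> be0
 proof (rule ccontr)
  assume nz: "\<xi> be0 ~= 0"
  define a where "a be v = (case v of None => \<xi> be | Some k => \<Lambda> be k)" for be v
  have cV: "card B < card (insert None (Some ` T))"
   using card T by (simp add: card_image)
  obtain x where x: "\<exists>v\<in>insert None (Some ` T). x v ~= 0"
    "!!be. be \<in> B ==> (\<Sum>v\<in>insert None (Some ` T). a be v * x v) = 0"
   using underdetermined_system[OF B _ cV, of a] T by auto
  define \<eta> where "\<eta> k = x (Some k)" for k
  have lin: "\<xi> be * x None + (\<Sum>k\<in>T. \<Lambda> be k * \<eta> k) = 0" if "be \<in> B" for be
   using x(2)[OF that] T by (simp add: sum.reindex a_def \<eta>_def)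
  have eq: "\<eta> z = - (\<Sum>k\<in>T. (\<Sum>be\<in>B. (V' z be - V z be) * \<Lambda> be k) * \<eta> k)" if z: "z \<in> T" for z
  proof -
   have "(\<Sum>be\<in>B. V' z be * (\<xi> be * x None + (\<Sum>k\<in>T. \<Lambda> be k * \<eta> k))) = 0"
    using lin by (simp add: sum.neutral)
   moreover have "(\<Sum>be\<in>B. V' z be * (\<xi> be * x None + (\<Sum>k\<in>T. \<Lambda> be k * \<eta> k)))
     = (\<Sum>be\<in>B. V' z be * \<xi> be) * x None + (\<Sum>k\<in>T. (\<Sum>be\<in>B. V' z be * \<Lambda> be k) * \<eta> k)"
    by (subst sum.swap[symmetric, of _ B T] | simp add: distrib_left sum.distrib sum_distrib_left sum_distrib_right mult.assoc sum.swap[of _ B T])+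
   ultimately have "(\<Sum>k\<in>T. (\<Sum>be\<in>B. V' z be * \<Lambda> be k) * \<eta> k) = 0" using \<xi>[OF z] by simp
   moreover have "(\<Sum>be\<in>B. V' z be * \<Lambda> be k) = (\<Sum>be\<in>B. (V' z be - V z be) * \<Lambda> be k) + (if z = k then 1 else 0)"
    if "k \<in> T" for k
    using \<Lambda>[OF z that] by (simp add: left_diff_distrib sum_subtractf)
   ultimately have "(\<Sum>k\<in>T. (\<Sum>be\<in>B. (V' z be - V z be) * \<Lambda> be k) * \<eta> k) + (\<Sum>k\<in>T. (if z = k then 1 else 0) * \<eta> k) = 0"
    by (simp add: sum.distrib[symmetric] distrib_right[symmetric])
   moreover have "(\<Sum>k\<in>T. (if z = k then 1 else 0) * \<eta> k) = \<eta> z"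
   proof -
    have "(\<Sum>k\<in>T. (if z = k then 1 else 0) * \<eta> k) = (\<Sum>k\<in>{z}. (if z = k then 1 else 0) * \<eta> k)"
     by (rule sum.mono_neutral_right) (use T z in auto)
    then show ?thesis by simp
   qed
   ultimately show ?thesis by (simp add: eq_neg_iff_add_eq_0 add.commute)
  qed
  define S where "S = (\<Sum>k\<in>T. cmod (\<eta> k))"
  have S0: "0 \<le> S" unfolding S_def by (intro sum_nonneg) auto
  have "cmod (\<eta> z) \<le> (ep * M) * S" if z: "z \<in> T" for z
  proof -
   have "cmod (\<eta> z) \<le> (\<Sum>k\<in>T. cmod ((\<Sum>be\<in>B. (V' z be - V z be) * \<Lambda> be k) * \<eta> k))"
    unfolding eq[OF z] norm_minus_cancel by (rule norm_sum)
   also have "\<dots> \<le> (\<Sum>k\<in>T. (ep * M) * cmod (\<eta> k))"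
   proof (rule sum_mono)
    fix k assume k: "k \<in> T"
    have "cmod (\<Sum>be\<in>B. (V' z be - V z be) * \<Lambda> be k) \<le> (\<Sum>be\<in>B. cmod ((V' z be - V z be) * \<Lambda> be k))" by (rule norm_sum)
    also have "\<dots> \<le> (\<Sum>be\<in>B. ep * cmod (\<Lambda> be k))"
     unfolding norm_mult by (intro sum_mono mult_right_mono) (use V'[OF z] in \<open>auto simp: less_imp_le\<close>)
    also have "\<dots> \<le> ep * M" unfolding sum_distrib_left[symmetric] using Mk[OF k] ep by (intro mult_left_mono) auto
    finally show "cmod ((\<Sum>be\<in>B. (V' z be - V z be) * \<Lambda> be k) * \<eta> k) \<le> (ep * M) * cmod (\<eta> k)"
     unfolding norm_mult by (rule mult_right_mono) simp
   qed
   finally show ?thesis by (simp add: S_def sum_distrib_left)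
  qed
  then have "S \<le> (\<Sum>z\<in>T. (ep * M) * S)" unfolding S_def[of ] by (intro sum_mono) (simp add: S_def)
  also have "\<dots> = (card T * (ep * M)) * S" by simp
  also have "\<dots> \<le> 1 / 2 * S" using half S0 by (rule mult_right_mono)
  finally have "S = 0" using S0 by simp
  then have \<eta>0: "\<forall>k\<in>T. \<eta> k = 0" unfolding S_def using T by (simp add: sum_nonneg_eq_0_iff)
  then have "x None = 0" using lin[OF be0] nz by simp
  then show False using x(1) \<eta>0 by (auto simp: \<eta>_def)
 qed
 then show ?thesis by (intro that[OF ep]) blast
qed

context elimination
begin

lemma zmon_off_X:
 assumes "!!m. m \<notin> X ==> z $ m = 0" "\<not> xmon al"
 shows "zmon z al = 0"
proof -
 obtain m where "m \<in> Poly_Mapping.keys al" "m \<notin> X" using assms(2) by (auto simp: xmon_def)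
 then have "z $ m ^ lkp al m = 0" using assms(1)[of m] by (simp add: in_keys_iff)
 then show ?thesis unfolding zmon_def by (intro prod_zero) (auto intro!: bexI[of _ m])
qed

lemma hform_split:
 "hform c i (d ! i) z = F0 c i z + (\<Sum>al | mdeg al = d ! i & \<not> xmon al. c (i, al) * zmon z al)"
proof -
 have *: "{al. mdeg al = d ! i} = {al. mdeg al = d ! i & xmon al} \<union> {al. mdeg al = d ! i & \<not> xmon al}" by auto
 show ?thesis unfolding hform_def F0_def *
  by (rule sum.union_disjoint[OF finite_xmons finite_subset[OF _ finite_monoms_of_degree[of "d ! i"]]]) auto
qed

text \<open>The conclusion of the generic reduction, for given coefficients.\<close>

definition reducible :: "(nat \<times> ('n mon) => complex) => bool" where
 "reducible c \<longleftrightarrow> (\<forall>al. xmon al & mdeg al \<le> topdeg -->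
   (\<exists>n. \<forall>x. zmon x al = (\<Sum>al' | mdeg al' = mdeg al & xmon al'. n al' * bas c al' x)))"

text \<open>If all \<open>F0\<close> vanish at a point then so do all monomials of degree \<open>topdeg\<close>.\<close>

lemma reducible_no_zero:
 assumes "reducible c" shows "no_zero_at_infinity c"
 unfolding no_zero_at_infinity_def
proof (intro allI impI, elim conjE)
 fix x assume off: "\<forall>m. m \<notin> X --> x $ m = 0" and zero: "\<forall>i<length d. hform c i (d ! i) x = 0"
 have F: "F0 c i x = 0" if "i < length d" for i
 proof -
  have "(\<Sum>al | mdeg al = d ! i & \<not> xmon al. c (i, al) * zmon x al) = 0"
   by (rule sum.neutral) (use zmon_off_X off in auto)
  then show ?thesis using zero that hform_split[of c i x] by simp
 qed
 have "x $ m = 0" for m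
 proof (cases "m \<in> X")
  case True
  let ?al = "sgl m topdeg"
  obtain n where n: "!!x. zmon x ?al = (\<Sum>al' | mdeg al' = topdeg & xmon al'. n al' * bas c al' x)"
   using assms xmon_single[OF True, of topdeg] unfolding reducible_def by fastforce
  have "bas c al' x = 0" if "mdeg al' = topdeg & xmon al'" for al'
  proof -
   have "red al'" using that by (intro red_if_large) auto
   then show ?thesis using F rix(1) by (simp add: bas_def)
  qed
  then have "zmon x ?al = 0" unfolding n by (intro sum.neutral) auto
  then show ?thesis by simp
 next
  case False then show ?thesis using off by simp
 qed
 then show "x = 0" by (simp add: vec_eq_iff)
qed

definition xpart :: "('n mon) => ('n mon)" where
 "xpart al = (\<Sum>m\<in>X. sgl m (lkp al m))"

lemma lookup_xpart: "lkp (xpart al) m = (if m \<in> X then lkp al m else 0)"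
proof -
 have "lkp (xpart al) m = (\<Sum>m'\<in>X. if m' = m then lkp al m else 0)"
  unfolding xpart_def lookup_sum by (intro sum.cong) (auto simp: lookup_single when_def)
 then show ?thesis by (simp add: sum.delta')
qed

lemma xmon_xpart: "xmon (xpart al)"
 by (auto simp: xmon_def in_keys_iff lookup_xpart split: if_splits)

lemma xpart_split: "al - xpart al + xpart al = al"
 by (rule monom_diff_add) (simp add: lookup_xpart)

lemma degree_xpart_less:
 assumes "\<not> xmon al" shows "mdeg (xpart al) < mdeg al"
proof -
 have "al - xpart al ~= 0" using assms xmon_xpart[of al] xpart_split[of al] by force
 then have "0 < mdeg (al - xpart al)" using monom_degree_eq_0_iff by blast
 then show ?thesis using monom_degree_add[of "al - xpart al" "xpart al"] by (simp add: xpart_split)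
qed

text \<open>The value of the other variables is fixed on the fibre.\<close>

lemma zmon_fib:
 assumes "z \<in> fib c"
 shows "zmon z al = zmon (axis j0 1) (al - xpart al) * zmon z (xpart al)"
proof -
 have "zmon z (al - xpart al) = zmon (axis j0 1) (al - xpart al)"
  unfolding zmon_def
 proof (rule prod.cong)
  fix m
  show "z $ m ^ lkp (al - xpart al) m = axis j0 1 $ m ^ lkp (al - xpart al) m"
   using assms by (cases "m \<in> X") (auto simp: lookup_minus lookup_xpart fib_def axis_def)
 qed simp
 then show ?thesis using zmon_add[of z "al - xpart al" "xpart al"] by (simp add: xpart_split)
qed

definition basis :: "('n mon) set" where "basis = {be. xmon be & \<not> red be}"

lemma basis_inj: "inj_on (%be. \<lambda>i\<in>{..<length d}. lkp be (\<iota> i)) basis"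
proof (rule inj_onI)
 fix be ga assume b: "be \<in> basis" "ga \<in> basis"
  and eq: "(\<lambda>i\<in>{..<length d}. lkp be (\<iota> i)) = (\<lambda>i\<in>{..<length d}. lkp ga (\<iota> i))"
 have "lkp be m = lkp ga m" for m
 proof (cases "m \<in> X")
  case True
  then obtain i where "i < length d" "m = \<iota> i" by (auto simp: X_def)
  then show ?thesis using fun_cong[OF eq, of i] by simp
 next
  case False
  then have "m \<notin> Poly_Mapping.keys be" "m \<notin> Poly_Mapping.keys ga" using b by (auto simp: basis_def xmon_def)
  then show ?thesis by (simp add: in_keys_iff)
 qed
 then show "be = ga" by (rule poly_mapping_eqI)
qed

lemma basis_bound: "(%be. \<lambda>i\<in>{..<length d}. lkp be (\<iota> i)) ` basis \<subseteq> (\<Pi>\<^sub>E i\<in>{..<length d}. {..<d ! i})"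
 by (intro image_subsetI PiE_I) (auto simp: basis_def red_def not_le)

lemma finite_basis: "finite basis"
 by (rule finite_imageD[OF finite_subset[OF basis_bound] basis_inj]) (auto intro: finite_PiE)

lemma card_basis_le: "card basis \<le> (\<Prod>i<length d. d ! i)"
proof -
 have "card basis \<le> card (\<Pi>\<^sub>E i\<in>{..<length d}. {..<d ! i})"
  by (rule card_inj_on_le[OF basis_inj basis_bound]) (auto intro: finite_PiE)
 then show ?thesis by (simp add: card_PiE)
qed

lemma zero_in_basis: "0 \<in> basis"
 using d_pos by (auto simp: basis_def xmon_def red_def Suc_le_eq)

text \<open>Restrictions to the fibre of linear combinations of the monomials in \<open>basis\<close>.\<close>

definition spanned :: "(nat \<times> ('n mon) => complex) => (complex^'n => complex) => bool" where
 "spanned c g \<longleftrightarrow> (\<exists>l. \<forall>z\<in>fib c. g z = (\<Sum>be\<in>basis. zmon z be * l be))"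

lemma spanned_cong: "spanned c g ==> (!!z. z \<in> fib c ==> g z = h z) ==> spanned c h"
 unfolding spanned_def by metis

lemma spanned_zero: "spanned c (%z. 0)"
 unfolding spanned_def by (intro exI[of _ "%_. 0"]) simp

lemma spanned_add:
 assumes "spanned c g" "spanned c h" shows "spanned c (%z. g z + h z)"
proof -
 obtain l l' where "\<forall>z\<in>fib c. g z = (\<Sum>be\<in>basis. zmon z be * l be)" "\<forall>z\<in>fib c. h z = (\<Sum>be\<in>basis. zmon z be * l' be)"
  using assms unfolding spanned_def by blast
 then show ?thesis unfolding spanned_def
  by (intro exI[of _ "%be. l be + l' be"]) (simp add: distrib_left sum.distrib)
qed

lemma spanned_cmult:
 assumes "spanned c g" shows "spanned c (%z. k * g z)"
proof -
 obtain l where "\<forall>z\<in>fib c. g z = (\<Sum>be\<in>basis. zmon z be * l be)" using assms unfolding spanned_def by blast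
 then show ?thesis unfolding spanned_def
  by (intro exI[of _ "%be. k * l be"]) (simp add: sum_distrib_left mult_ac)
qed

lemma spanned_sum: "(!!a. a \<in> A ==> spanned c (g a)) ==> spanned c (%z. \<Sum>a\<in>A. g a z)"
 by (induction A rule: infinite_finite_induct) (auto intro: spanned_zero spanned_add)

lemma spanned_basis:
 assumes "be \<in> basis" shows "spanned c (%z. zmon z be)"
 unfolding spanned_def
proof (intro exI ballI)
 fix z
 have "(\<Sum>be'\<in>basis. zmon z be' * (if be' = be then 1 else 0)) = (\<Sum>be'\<in>{be}. zmon z be' * (if be' = be then 1 else 0))"
  by (rule sum.mono_neutral_right) (use finite_basis assms in auto)
 then show "zmon z be = (\<Sum>be'\<in>basis. zmon z be' * (if be' = be then 1 else 0))" by simp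
qed

lemma monom_split_degree:
 fixes al :: "'n mon"
 assumes "k \<le> mdeg al"
 shows "\<exists>al0 al1. al = al0 + al1 & mdeg al0 = k"
 using assms
proof (induction k)
 case 0 show ?case by (intro exI[of _ 0] exI[of _ al]) simp
next
 case (Suc k)
 then obtain al0 al1 where a: "al = al0 + al1" "mdeg al0 = k" by auto
 then have "mdeg al1 ~= 0" using Suc.prems monom_degree_add[of al0 al1] by simp
 then have "al1 ~= 0" by auto
 then obtain m where m: "m \<in> Poly_Mapping.keys al1" by fastforce
 then have "1 \<le> lkp al1 m" by (simp add: in_keys_iff)
 then have "al1 - sgl m 1 + sgl m 1 = al1" by (rule monom_diff_single_add)
 then have "al = (al0 + sgl m 1) + (al1 - sgl m 1)" by (metis a(1) add.assoc add.commute)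
 then show ?case using a(2) by (intro exI[of _ "al0 + sgl m 1"] exI[of _ "al1 - sgl m 1"])
   (simp add: monom_degree_add)
qed

text \<open>The part of a monomial to which the reduction is applied, and the part that is left over.\<close>

lemma monom_cut:
 assumes "xmon al"
 obtains al0 al1 where "al = al0 + al1" "xmon al0" "xmon al1" "mdeg al0 \<le> topdeg"
  "al1 ~= 0 ==> mdeg al0 = topdeg"
proof (cases "mdeg al \<le> topdeg")
 case True
 then show ?thesis using that[of al 0] assms by (simp add: xmon_def)
next
 case False
 then obtain al0 al1 where "al = al0 + al1" "mdeg al0 = topdeg" using monom_split_degree[of topdeg al] by auto
 then show ?thesis using that[of al0 al1] assms by (simp add: xmon_add)
qed

text \<open>On the fibre, \<open>F0 c i\<close> is equal to minus the rest of the \<open>i\<close>-th form, which has lower degree in the variables of \<open>X\<close>; the reduction thus lowers the degree.\<close>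

lemma spanned_xmon:
 assumes red: "reducible c" and "xmon al"
 shows "spanned c (%z. zmon z al)"
 using assms(2)
proof (induction "mdeg al" arbitrary: al rule: less_induct)
 case less
 obtain al0 al1 where cut: "al = al0 + al1" "xmon al0" "xmon al1" "mdeg al0 \<le> topdeg"
  "al1 ~= 0 ==> mdeg al0 = topdeg" using monom_cut[OF less.prems] by blast
 obtain n where n: "!!x. zmon x al0 = (\<Sum>al' | mdeg al' = mdeg al0 & xmon al'. n al' * bas c al' x)"
  using red cut(2,4) unfolding reducible_def by blast
 have "spanned c (%z. zmon z al1 * bas c al' z)" if "mdeg al' = mdeg al0" "xmon al'" for al'
 proof (cases "red al'")
  case True
  let ?i = "rix al'"
  let ?D = "{de. mdeg de = d ! ?i & \<not> xmon de}"
  have "spanned c (%z. \<Sum>de\<in>?D. (- (c (?i, de) * zmon (axis j0 1) (de - xpart de))) * zmon z (al1 + rest al' + xpart de))"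
  proof (rule spanned_sum, rule spanned_cmult, rule less.hyps)
   fix de assume de: "de \<in> ?D"
   then have "mdeg (xpart de) < d ! ?i" using degree_xpart_less[of de] by simp
   then show "mdeg (al1 + rest al' + xpart de) < mdeg al"
    using degree_rest[OF True] that(1) by (simp add: monom_degree_add cut(1))
   show "xmon (al1 + rest al' + xpart de)" using cut(3) xmon_rest[OF that(2) True] xmon_xpart by (simp add: xmon_add)
  qed
  then show ?thesis
  proof (rule spanned_cong)
   fix z assume z: "z \<in> fib c"
   have "F0 c ?i z = - (\<Sum>de\<in>?D. c (?i, de) * zmon z de)"
    using hform_split[of c ?i z] z rix(1)[OF True] by (simp add: fib_def eq_neg_iff_add_eq_0)
   also have "\<dots> = (\<Sum>de\<in>?D. - (c (?i, de) * zmon (axis j0 1) (de - xpart de)) * zmon z (xpart de))"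
    unfolding sum_negf[symmetric] by (intro sum.cong refl, subst zmon_fib[OF z]) simp
   finally show "(\<Sum>de\<in>?D. (- (c (?i, de) * zmon (axis j0 1) (de - xpart de))) * zmon z (al1 + rest al' + xpart de)) =
     zmon z al1 * bas c al' z"
    using True by (simp add: bas_def zmon_add sum_distrib_left mult_ac)
  qed
 next
  case False
  then have "\<not> topdeg \<le> mdeg al'" using red_if_large[OF that(2)] by blast
  then have "al1 = 0" using cut(5) that(1) by force
  moreover have "al' \<in> basis" using False that by (simp add: basis_def)
  ultimately show ?thesis using spanned_basis False by (simp add: bas_def)
 qed
 then have "spanned c (%z. \<Sum>al' | mdeg al' = mdeg al0 & xmon al'. n al' * (zmon z al1 * bas c al' z))"
  by (intro spanned_sum spanned_cmult) auto
 then show ?case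
  by (rule spanned_cong) (simp add: cut(1) zmon_add n sum_distrib_left sum_distrib_right mult_ac)
qed

lemma spanned_mult_coord:
 assumes red: "reducible c" and "spanned c g" "m \<in> X"
 shows "spanned c (%z. (z $ m + k) * g z)"
proof -
 obtain l where l: "\<forall>z\<in>fib c. g z = (\<Sum>be\<in>basis. zmon z be * l be)" using assms(2) unfolding spanned_def by blast
 have "spanned c (%z. \<Sum>be\<in>basis. l be * zmon z (sgl m 1 + be))"
  by (intro spanned_sum spanned_cmult spanned_xmon[OF red]) (use xmon_single[OF assms(3)] in \<open>auto simp: xmon_add basis_def\<close>)
 then have "spanned c (%z. z $ m * g z)"
  by (rule spanned_cong) (simp add: l zmon_add sum_distrib_left mult_ac)
 then have "spanned c (%z. z $ m * g z + k * g z)" by (rule spanned_add) (rule spanned_cmult[OF assms(2)])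
 then show ?thesis by (simp add: distrib_right)
qed

lemma fib_eqI:
 assumes "z \<in> fib c" "w \<in> fib c" "!!m. m \<in> X ==> z $ m = w $ m"
 shows "z = w"
proof -
 have "z $ m = w $ m" for m using assms by (cases "m \<in> X") (auto simp: fib_def)
 then show ?thesis by (simp add: vec_eq_iff)
qed

text \<open>A product of coordinate differences separates one point from the others.\<close>

lemma interpolation:
 assumes red: "reducible c" and "finite S" "S \<subseteq> fib c" "k \<in> fib c" "k \<notin> S"
 shows "\<exists>g. spanned c g & g k = 1 & (\<forall>z\<in>S. g z = 0)"
 using assms(2,3,5)
proof (induction S rule: finite_induct)
 case empty
 show ?case by (intro exI[of _ "%z. 1"]) (use spanned_basis[OF zero_in_basis, of c] in auto)
next
 case (insert w S)
 then obtain g where g: "spanned c g" "g k = 1" "\<forall>z\<in>S. g z = 0" by auto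
 obtain m where m: "m \<in> X" "k $ m ~= w $ m" using fib_eqI[of k c w] assms(4) insert.prems by auto
 let ?h = "%z. (1 / (k $ m - w $ m)) * ((z $ m + (- w $ m)) * g z)"
 have "spanned c ?h" by (intro spanned_cmult spanned_mult_coord[OF red g(1) m(1)])
 then show ?case using g m(2) by (intro exI[of _ ?h]) auto
qed

lemma interpolation_matrix:
 assumes red: "reducible c" and "finite (fib c)"
 obtains \<Lambda> where "!!z k. z \<in> fib c ==> k \<in> fib c ==> (\<Sum>be\<in>basis. zmon z be * \<Lambda> be k) = (if z = k then 1 else 0)"
proof -
 have "\<forall>k\<in>fib c. \<exists>l. \<forall>z\<in>fib c. (\<Sum>be\<in>basis. zmon z be * l be) = (if z = k then 1 else 0)"
 proof
  fix k assume k: "k \<in> fib c"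
  obtain g where g: "spanned c g" "g k = 1" "\<forall>z\<in>fib c - {k}. g z = 0"
   using interpolation[OF red, of "fib c - {k}" k] assms(2) k by auto
  obtain l where "\<forall>z\<in>fib c. g z = (\<Sum>be\<in>basis. zmon z be * l be)" using g(1) unfolding spanned_def by blast
  then show "\<exists>l. \<forall>z\<in>fib c. (\<Sum>be\<in>basis. zmon z be * l be) = (if z = k then 1 else 0)"
   using g by (intro exI[of _ l]) auto
 qed
 then obtain L where "\<forall>k\<in>fib c. \<forall>z\<in>fib c. (\<Sum>be\<in>basis. zmon z be * L k be) = (if z = k then 1 else 0)"
  by (rule bchoice[THEN exE])
 then show ?thesis using that[of "%be k. L k be"] by blast
qed

end

section \<open>The division theorem\<close>

lemma wmon_zmon: "of_real (wmon w al) = zmon (\<chi> m. of_real (w m)) al"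
 by (simp add: wmon_def zmon_def)

lemma wmon_single: "wmon w (sgl m k) = w m ^ k"
proof -
 have "complex_of_real (wmon w (sgl m k)) = of_real (w m ^ k)" unfolding wmon_zmon by simp
 then show ?thesis by (simp only: of_real_eq_iff)
qed

lemma wmon_plus: "wmon w (al + be) = wmon w al * wmon w be"
proof -
 have "complex_of_real (wmon w (al + be)) = of_real (wmon w al * wmon w be)" unfolding of_real_mult wmon_zmon by (rule zmon_add)
 then show ?thesis by (simp only: of_real_eq_iff)
qed

lemma wmon_le:
 assumes "!!m. 0 < w m" "!!m. w m \<le> r"
 shows "wmon w al \<le> r ^ mdeg al"
 unfolding wmon_def monom_degree_def power_sum
 using assms by (intro prod_mono) (auto intro!: power_mono simp: less_imp_le)

lemma nsum_ball:
 assumes w: "!!m. 0 < w m" "!!m. w m \<le> r" and "(%al. cmod (g al) * r ^ mdeg al) summable_on UNIV"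
 shows "nsum w g"
 unfolding nsum_def using assms(3)
proof (rule summable_on_comparison_test)
 fix al
 show "cmod (g al) * wmon w al \<le> cmod (g al) * r ^ mdeg al" by (intro mult_left_mono wmon_le w) auto
 show "0 \<le> cmod (g al) * wmon w al" using wmon_pos[of w] w(1) by (simp add: less_imp_le)
qed

context elimination
begin

lemma xmon_lookup: "xmon al ==> m \<notin> X ==> lkp al m = 0"
 unfolding xmon_def by (metis in_keys_iff subsetD)

text \<open>The other variables get a weight that is smaller by one more factor \<open>\<tau>\<close>: then all terms of
 the equations, except those of their initial forms in the variables of \<open>X\<close> alone, are small.\<close>

definition weights :: "real => real => 'n => real" where
 "weights \<rho> \<tau> m = (if m \<in> X then \<tau> * \<rho> else \<tau> * (\<tau> * \<rho>))"

lemma weights: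
 assumes "0 < \<rho>" "0 < \<tau>" "\<tau> \<le> 1"
 shows "0 < weights \<rho> \<tau> m" "weights \<rho> \<tau> m \<le> \<tau> * \<rho>" "weights \<rho> \<tau> m \<le> \<rho>"
proof -
 show "0 < weights \<rho> \<tau> m" using assms by (simp add: weights_def)
 have "\<tau> * (\<tau> * \<rho>) \<le> 1 * (\<tau> * \<rho>)" using assms by (intro mult_right_mono) auto
 then show le: "weights \<rho> \<tau> m \<le> \<tau> * \<rho>" by (simp add: weights_def)
 have "\<tau> * \<rho> \<le> 1 * \<rho>" using assms by (intro mult_right_mono) auto
 then show "weights \<rho> \<tau> m \<le> \<rho>" using le by simp
qed

lemma wmon_xmon:
 assumes "xmon al" shows "wmon (weights \<rho> \<tau>) al = (\<tau> * \<rho>) ^ mdeg al"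
 unfolding wmon_def monom_degree_def power_sum
 by (intro prod.cong refl) (use xmon_lookup[OF assms] in \<open>auto simp: weights_def\<close>)

lemma wmon_not_xmon:
 assumes "0 < \<rho>" "0 < \<tau>" "\<tau> \<le> 1" "\<not> xmon al"
 shows "wmon (weights \<rho> \<tau>) al \<le> \<tau> * (\<tau> * \<rho>) ^ mdeg al"
proof -
 note w = weights[OF assms(1-3)]
 obtain m where m: "m \<in> Poly_Mapping.keys al" "m \<notin> X" using assms(4) by (auto simp: xmon_def)
 then have l: "1 \<le> lkp al m" by (simp add: in_keys_iff)
 let ?be = "al - sgl m 1"
 have "wmon (weights \<rho> \<tau>) al = wmon (weights \<rho> \<tau>) ?be * (\<tau> * (\<tau> * \<rho>))"
  by (subst monom_diff_single_add[OF l, symmetric], subst wmon_plus, subst wmon_single) (simp add: weights_def m)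
 also have "\<dots> \<le> (\<tau> * \<rho>) ^ mdeg ?be * (\<tau> * (\<tau> * \<rho>))"
  using assms by (intro mult_right_mono wmon_le w) auto
 also have "\<dots> = \<tau> * (\<tau> * \<rho>) ^ (mdeg ?be + 1)" by simp
 finally show ?thesis unfolding monom_degree_diff_single[OF l] .
qed

text \<open>The quotients of a monomial come from the reduction of its part in the variables of \<open>X\<close>. The error consists of these quotients multiplied by the differences between the equations and the \<open>F0 c i\<close>.\<close>

lemma division:
 fixes a :: "nat => ('n mon) => complex"
 assumes red: "reducible c" and \<rho>: "0 < \<rho>"
  and a: "!!i. i < length d ==> (%al. cmod (a i al) * \<rho> ^ mdeg al) summable_on UNIV"
  and low: "!!i. i < length d ==> order_ge (int (d ! i)) (a i)"
  and lead: "!!i al. i < length d ==> mdeg al = d ! i ==> a i al = c (i, al)"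
 shows "\<exists>w. (\<forall>m. 0 < w m & w m \<le> \<rho>) & (\<forall>g. nsum w g -->
  (\<exists>H r. (\<forall>i<length d. nsum w (H i)) & (\<forall>be\<in>basis. nsum w (r be)) &
   (\<forall>be\<in>basis. \<forall>ga. r be ga ~= 0 --> (\<forall>m\<in>X. lkp ga m = 0)) &
   (\<forall>z. in_poly w z -->
     ev g z = (\<Sum>i<length d. ev (H i) z * ev (a i) z) + (\<Sum>be\<in>basis. zmon z be * ev (r be) z))))"
proof -
 define P where "P k = {al. mdeg al = k & xmon al}" for k
 have finP: "finite (P k)" for k unfolding P_def by (rule finite_xmons)
 have "\<exists>q. xpart al = fst q + snd q & xmon (fst q) & xmon (snd q) & mdeg (fst q) \<le> topdeg &
   (snd q ~= 0 --> mdeg (fst q) = topdeg)" for al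
  using monom_cut[OF xmon_xpart[of al]] by (metis fst_conv snd_conv)
 then obtain cut where cut: "!!al. xpart al = fst (cut al) + snd (cut al) & xmon (fst (cut al)) & xmon (snd (cut al)) &
   mdeg (fst (cut al)) \<le> topdeg & (snd (cut al) ~= 0 --> mdeg (fst (cut al)) = topdeg)"
  using choice[of "%al q. xpart al = fst q + snd q & xmon (fst q) & xmon (snd q) & mdeg (fst q) \<le> topdeg &
   (snd q ~= 0 --> mdeg (fst q) = topdeg)"] by blast
 define c0 where "c0 al = fst (cut al)" for al
 define c1 where "c1 al = snd (cut al)" for al
 define rem where "rem al = al - xpart al" for al
 define L where "L al = mdeg (c0 al)" for al
 have c0: "xmon (c0 al)" "L al \<le> topdeg" and c1: "xmon (c1 al)" "c1 al ~= 0 ==> L al = topdeg" for al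
  using cut[of al] by (auto simp: c0_def c1_def L_def)
 have split: "al = rem al + (c0 al + c1 al)" for al
  using xpart_split[of al] cut[of al] by (simp add: rem_def c0_def c1_def)
 have "\<forall>be. \<exists>n. xmon be & mdeg be \<le> topdeg --> (\<forall>x. zmon x be = (\<Sum>al'\<in>P (mdeg be). n al' * bas c al' x))"
  using red unfolding reducible_def P_def by blast
 then obtain n where "\<forall>be. xmon be & mdeg be \<le> topdeg --> (\<forall>x. zmon x be = (\<Sum>al'\<in>P (mdeg be). n be al' * bas c al' x))"
  by (rule choice[THEN exE])
 then have n: "zmon x (c0 al) = (\<Sum>al'\<in>P (L al). n (c0 al) al' * bas c al' x)" for al x
  using c0 by (simp add: L_def)
 define A where "A = (\<Union>k\<le>topdeg. P k)"
 have finA: "finite A" by (simp add: A_def finP)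
 define N where "N = 1 + (\<Sum>be\<in>A. \<Sum>al'\<in>A. cmod (n be al'))"
 have N: "(\<Sum>al'\<in>B. cmod (n (c0 al) al')) \<le> N" if "B \<subseteq> P (L al)" for al B
 proof -
  have "B \<subseteq> A" using that c0(2)[of al] by (auto simp: A_def)
  then have "(\<Sum>al'\<in>B. cmod (n (c0 al) al')) \<le> (\<Sum>al'\<in>A. cmod (n (c0 al) al'))" by (intro sum_mono2 finA) auto
  also have "\<dots> \<le> (\<Sum>be\<in>A. \<Sum>al'\<in>A. cmod (n be al'))"
   by (rule member_le_sum[OF _ _ finA]) (use c0[of al] in \<open>auto simp: A_def P_def L_def intro: sum_nonneg\<close>)
  finally show ?thesis by (simp add: N_def)
 qed
 have N0: "0 < N" unfolding N_def by (intro add_pos_nonneg sum_nonneg) auto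
 define e where "e i = (%al. if al \<in> P (d ! i) then 0 else a i al)" for i
 define S where "S i = infsum (%al. cmod (a i al) * \<rho> ^ mdeg al) UNIV" for i
 have S0: "0 \<le> S i" for i unfolding S_def by (intro infsum_nonneg) (use \<rho> in auto)
 define C where "C = (\<Sum>i<length d. N * S i / \<rho> ^ (d ! i))"
 have C0: "0 \<le> C" unfolding C_def using N0 S0 \<rho> by (intro sum_nonneg divide_nonneg_nonneg mult_nonneg_nonneg) auto
 define \<tau> where "\<tau> = 1 / (2 * (1 + C))"
 have \<tau>: "0 < \<tau>" "\<tau> \<le> 1" "\<tau> * C \<le> 1 / 2" using C0 by (auto simp: \<tau>_def divide_le_eq)
 define w where "w = weights \<rho> \<tau>"
 note wp = weights[OF \<rho> \<tau>(1,2), folded w_def]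
 have w: "!!m. 0 < w m" by (rule wp(1))
 have \<tau>\<rho>: "0 < \<tau> * \<rho>" using \<tau> \<rho> by simp
 have na: "nsum w (a i)" if "i < length d" for i by (rule nsum_ball[OF wp(1,3) a[OF that]])
 have e: "nsum w (e i)" "wnorm w (e i) \<le> \<tau> ^ (d ! i + 1) * S i" if i: "i < length d" for i
 proof -
  have le: "cmod (e i al) * wmon w al \<le> \<tau> ^ (d ! i + 1) * (cmod (a i al) * \<rho> ^ mdeg al)" for al
  proof (cases "e i al = 0")
   case False
   then have np: "al \<notin> P (d ! i)" and ea: "e i al = a i al" by (auto simp: e_def split: if_splits)
   have ge: "d ! i \<le> mdeg al" using low[OF i] False ea by (force simp: order_ge_def)
   have "wmon w al \<le> \<tau> ^ (d ! i + 1) * \<rho> ^ mdeg al"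
   proof (cases "mdeg al = d ! i")
    case True
    then have "\<not> xmon al" using np by (simp add: P_def)
    from wmon_not_xmon[OF \<rho> \<tau>(1,2) this] show ?thesis by (simp add: w_def True power_mult_distrib mult_ac)
   next
    case False
    have "wmon w al \<le> (\<tau> * \<rho>) ^ mdeg al" by (rule wmon_le[OF wp(1,2)])
    also have "\<dots> = \<tau> ^ mdeg al * \<rho> ^ mdeg al" by (rule power_mult_distrib)
    also have "\<dots> \<le> \<tau> ^ (d ! i + 1) * \<rho> ^ mdeg al"
     using ge False \<tau> \<rho> by (intro mult_right_mono power_decreasing) auto
    finally show ?thesis .
   qed
   then have "cmod (a i al) * wmon w al \<le> cmod (a i al) * (\<tau> ^ (d ! i + 1) * \<rho> ^ mdeg al)"
    by (rule mult_left_mono) simp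
   then show ?thesis unfolding ea by (simp only: mult_ac)
  qed (use \<tau> \<rho> in simp)
  have s: "(%al. \<tau> ^ (d ! i + 1) * (cmod (a i al) * \<rho> ^ mdeg al)) summable_on UNIV"
   by (rule summable_on_cmult_right[OF a[OF i]])
  show ns: "nsum w (e i)" unfolding nsum_def
   by (rule summable_on_comparison_test[OF s le]) (intro mult_nonneg_nonneg norm_ge_zero less_imp_le wmon_pos w)
  have "wnorm w (e i) \<le> infsum (%al. \<tau> ^ (d ! i + 1) * (cmod (a i al) * \<rho> ^ mdeg al)) UNIV"
   unfolding wnorm_def by (rule infsum_mono[OF ns[unfolded nsum_def] s le])
  also have "\<dots> = \<tau> ^ (d ! i + 1) * S i" unfolding S_def by (rule infsum_cmult_right[OF a[OF i]])
  finally show "wnorm w (e i) \<le> \<tau> ^ (d ! i + 1) * S i" .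
 qed
 have ev_a: "ev (a i) z = F0 c i z + ev (e i) z" if i: "i < length d" and z: "in_poly w z" for i z
 proof -
  have "((%al. (if al \<in> P (d ! i) then a i al else 0) * zmon z al) has_sum F0 c i z) UNIV"
   unfolding F0_def P_def[symmetric]
   by (rule has_sum_finite_neutralI[OF finP]) (auto simp: P_def lead[OF i] intro!: sum.cong)
  from has_sum_add[OF this ev_has_sum[where w = w, OF w e(1)[OF i] z]]
  have "((%al. a i al * zmon z al) has_sum F0 c i z + ev (e i) z) UNIV"
   by (rule has_sum_cong[THEN iffD1, rotated]) (auto simp: e_def)
  then show ?thesis using has_sum_unique ev_has_sum[where w = w, OF w na[OF i] z] by blast
 qed
 define J where "J i al = {al' \<in> {al' \<in> P (L al). red al'}. rix al' = i}" for i al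
 have J: "finite (J i al)" "J i al \<subseteq> P (L al)" for i al using finP[of "L al"] by (auto simp: J_def)
 define mon where "mon al al' = rem al + c1 al + rest al'" for al al'
 define Q where "Q i al = (%ga. \<Sum>al'\<in>J i al. if ga = mon al al' then n (c0 al) al' else 0)" for i al
 define R where "R be al = (%ga. if ga = rem al then (if be \<in> P (L al) & c1 al = 0 then n (c0 al) be else 0) else 0)" for be al
 have wc0: "wmon w al = wmon w (rem al + c1 al) * (\<tau> * \<rho>) ^ L al" for al
  by (subst split[of al]) (simp add: wmon_plus wmon_xmon[OF c0(1)] w_def L_def)
 have wmon_mon: "wmon w (mon al al') = wmon w al / (\<tau> * \<rho>) ^ (d ! i)" if al': "al' \<in> J i al" for al al' i
 proof -
  have p: "red al'" "rix al' = i" "xmon al'" "mdeg al' = L al" using al' by (auto simp: J_def P_def)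
  have "(\<tau> * \<rho>) ^ L al = wmon w (rest al') * (\<tau> * \<rho>) ^ (d ! i)"
   using degree_rest[OF p(1)] p(2,4) by (simp add: w_def wmon_xmon[OF xmon_rest[OF p(3,1)]] flip: power_add)
  then have eq: "wmon w al = wmon w (mon al al') * (\<tau> * \<rho>) ^ (d ! i)" unfolding wc0[of al] mon_def by (simp add: wmon_plus)
  have "(\<tau> * \<rho>) ^ (d ! i) ~= 0" using zero_less_power[OF \<tau>\<rho>, of "d ! i"] by linarith
  then show ?thesis unfolding eq by (simp only: nonzero_mult_div_cancel_right not_False_eq_True)
 qed
 have Q: "nsum w (Q i al)" "wnorm w (Q i al) \<le> N / (\<tau> * \<rho>) ^ (d ! i) * wmon w al"
  "in_poly w z ==> ev (Q i al) z = (\<Sum>al'\<in>J i al. n (c0 al) al' * zmon z (mon al al'))" for i al z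
 proof -
  have q: "nsum w (Q i al) & wnorm w (Q i al) \<le> (\<Sum>al'\<in>J i al. wnorm w (%ga. if ga = mon al al' then n (c0 al) al' else 0)) &
   (\<forall>z. in_poly w z --> ev (Q i al) z = (\<Sum>al'\<in>J i al. ev (%ga. if ga = mon al al' then n (c0 al) al' else 0) z))"
   unfolding Q_def by (rule nsum_sum[where w = w, OF w J(1) nsum_single(1)[where w = w, OF w]])
  show "nsum w (Q i al)" using q by blast
  have "wnorm w (Q i al) \<le> (\<Sum>al'\<in>J i al. cmod (n (c0 al) al') * wmon w (mon al al'))"
   using q by (simp only: nsum_single(2)[where w = w, OF w])
  also have "\<dots> = (\<Sum>al'\<in>J i al. cmod (n (c0 al) al')) * (wmon w al / (\<tau> * \<rho>) ^ (d ! i))"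
   unfolding sum_distrib_right by (intro sum.cong refl) (simp add: wmon_mon)
  also have "\<dots> \<le> N * (wmon w al / (\<tau> * \<rho>) ^ (d ! i))"
   using N[OF J(2)] wmon_pos[where w = w, OF w, of al] \<tau>\<rho> by (intro mult_right_mono) (auto simp: less_imp_le)
  finally show "wnorm w (Q i al) \<le> N / (\<tau> * \<rho>) ^ (d ! i) * wmon w al" by simp
  show "ev (Q i al) z = (\<Sum>al'\<in>J i al. n (c0 al) al' * zmon z (mon al al'))" if "in_poly w z"
   using q that by (simp only: nsum_single(3)[where w = w, OF w])
 qed
 have R: "nsum w (R be al)" "wnorm w (R be al) \<le> N / (\<tau> * \<rho>) ^ mdeg be * wmon w al"
  "ev (R be al) z = (if be \<in> P (L al) & c1 al = 0 then n (c0 al) be else 0) * zmon z (rem al)" for be al z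
 proof -
  show "nsum w (R be al)" unfolding R_def by (rule nsum_single(1)[where w = w, OF w])
  show "ev (R be al) z = (if be \<in> P (L al) & c1 al = 0 then n (c0 al) be else 0) * zmon z (rem al)"
   unfolding R_def by (rule nsum_single(3)[where w = w, OF w])
  have eq: "wnorm w (R be al) = cmod (if be \<in> P (L al) & c1 al = 0 then n (c0 al) be else 0) * wmon w (rem al)"
   unfolding R_def by (rule nsum_single(2)[where w = w, OF w])
  show "wnorm w (R be al) \<le> N / (\<tau> * \<rho>) ^ mdeg be * wmon w al"
  proof (cases "be \<in> P (L al) & c1 al = 0")
   case True
   then have "L al = mdeg be" by (simp add: P_def)
   then have eq': "wmon w al = wmon w (rem al) * (\<tau> * \<rho>) ^ mdeg be" using wc0[of al] True by simp
   have "(\<tau> * \<rho>) ^ mdeg be ~= 0" using zero_less_power[OF \<tau>\<rho>, of "mdeg be"] by linarith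
   then have "wmon w (rem al) = wmon w al / (\<tau> * \<rho>) ^ mdeg be"
    unfolding eq' by (simp only: nonzero_mult_div_cancel_right not_False_eq_True)
   moreover have "cmod (n (c0 al) be) \<le> N" using N[of "{be}" al] True by simp
   ultimately have "wnorm w (R be al) \<le> N * (wmon w al / (\<tau> * \<rho>) ^ mdeg be)"
    unfolding eq using True wmon_pos[where w = w, OF w, of al] \<tau>\<rho> by (simp only: simp_thms if_True) (intro mult_right_mono, auto simp: less_imp_le)
   then show ?thesis by simp
  next
   case False
   then have "wnorm w (R be al) = 0" unfolding eq by (simp only: if_False) simp
   then show ?thesis using N0 \<tau>\<rho> wmon_pos[where w = w, OF w, of al] by simp
  qed
 qed
 have "\<exists>q. i < length d --> nsum w q & wnorm w q \<le> wnorm w (e i) * wnorm w (Q i al) & (\<forall>z. in_poly w z --> ev q z = ev (Q i al) z * ev (e i) z)" for i al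
 proof (cases "i < length d")
  case True
  obtain q where "nsum w q" "wnorm w q \<le> wnorm w (e i) * wnorm w (Q i al)" "\<forall>z. in_poly w z --> ev q z = ev (Q i al) z * ev (e i) z"
   using nsum_mult[where w = w, OF w Q(1)[of i al] e(1)[OF True]] by blast
  then show ?thesis by blast
 qed blast
 then obtain qe where qe: "!!i al. i < length d ==> nsum w (qe i al) & wnorm w (qe i al) \<le> wnorm w (e i) * wnorm w (Q i al) &
   (\<forall>z. in_poly w z --> ev (qe i al) z = ev (Q i al) z * ev (e i) z)" by metis
 define E where "E al = (%ga. \<Sum>i<length d. (- 1) * qe i al ga)" for al
 have ns: "nsum w (%ga. (- 1) * qe i al ga)" if "i \<in> {..<length d}" for i al
  using nsum_scale(1)[where w = w, OF w, of "qe i al" "- 1"] qe that by blast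
 have Es: "nsum w (E al) & wnorm w (E al) \<le> (\<Sum>i<length d. wnorm w (%ga. (- 1) * qe i al ga)) &
   (\<forall>z. in_poly w z --> ev (E al) z = (\<Sum>i<length d. ev (%ga. (- 1) * qe i al ga) z))" for al
  unfolding E_def by (rule nsum_sum[where w = w, OF w finite_lessThan ns])
 have E: "nsum w (E al)" "wnorm w (E al) \<le> 1 / 2 * wmon w al" for al
 proof -
  show "nsum w (E al)" using Es by blast
  have "wnorm w (E al) \<le> (\<Sum>i<length d. wnorm w (%ga. (- 1) * qe i al ga))" using Es by blast
  also have "\<dots> \<le> (\<Sum>i<length d. \<tau> * (N * S i / \<rho> ^ (d ! i)) * wmon w al)"
  proof (rule sum_mono)
   fix i assume "i \<in> {..<length d}"
   then have i: "i < length d" by simp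
   have "wnorm w (%ga. (- 1) * qe i al ga) = wnorm w (qe i al)" using nsum_scale(2)[where w = w, OF w, of "qe i al" "- 1"] qe[OF i] by simp
   also have "\<dots> \<le> wnorm w (e i) * wnorm w (Q i al)" using qe[OF i] by blast
   also have "\<dots> \<le> (\<tau> ^ (d ! i + 1) * S i) * (N / (\<tau> * \<rho>) ^ (d ! i) * wmon w al)"
    using \<tau>(1) S0[of i] by (intro mult_mono e(2)[OF i] Q(2) wnorm_nonneg[where w = w, OF w]) auto
   also have "\<dots> = \<tau> * (N * S i / \<rho> ^ (d ! i)) * wmon w al" using \<tau>(1) \<rho> by (simp add: power_mult_distrib)
   finally show "wnorm w (%ga. (- 1) * qe i al ga) \<le> \<tau> * (N * S i / \<rho> ^ (d ! i)) * wmon w al" .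
  qed
  also have "\<dots> = (\<tau> * C) * wmon w al" unfolding C_def sum_distrib_left sum_distrib_right ..
  also have "\<dots> \<le> 1 / 2 * wmon w al" using \<tau>(3) wmon_pos[where w = w, OF w, of al] by (intro mult_right_mono) auto
  finally show "wnorm w (E al) \<le> 1 / 2 * wmon w al" .
 qed
 have eq: "zmon z al = (\<Sum>i<length d. ev (Q i al) z * ev (a i) z) + (\<Sum>be\<in>basis. zmon z be * ev (R be al) z) + ev (E al) z"
  if z: "in_poly w z" for z al
 proof -
  have evE: "ev (E al) z = (\<Sum>i<length d. - (ev (Q i al) z * ev (e i) z))"
  proof -
   have "ev (E al) z = (\<Sum>i<length d. ev (%ga. (- 1) * qe i al ga) z)" using Es z by blast
   also have "\<dots> = (\<Sum>i<length d. - (ev (Q i al) z * ev (e i) z))"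
    using nsum_scale(3)[where w = w, OF w, of "qe _ al" "- 1"] qe z by (intro sum.cong refl) simp
   finally show ?thesis .
  qed
  have A: "(\<Sum>i<length d. ev (Q i al) z * ev (a i) z) + ev (E al) z = (\<Sum>i<length d. ev (Q i al) z * F0 c i z)"
   unfolding evE sum.distrib[symmetric] by (intro sum.cong refl) (simp add: ev_a[OF _ z] distrib_left)
  define \<mu> where "\<mu> = zmon z (rem al + c1 al)"
  define G where "G al' = \<mu> * (n (c0 al) al' * bas c al' z)" for al'
  have "(\<Sum>i<length d. ev (Q i al) z * F0 c i z) = (\<Sum>i<length d. \<Sum>al'\<in>J i al. G al')"
   unfolding Q(3)[OF z] sum_distrib_right
   by (intro sum.cong refl) (auto simp: G_def \<mu>_def J_def bas_def mon_def zmon_add)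
  also have "\<dots> = (\<Sum>al'\<in>{al' \<in> P (L al). red al'}. G al')"
   unfolding J_def by (rule sum.group) (use finP rix(1) in auto)
  finally have B: "(\<Sum>i<length d. ev (Q i al) z * F0 c i z) = (\<Sum>al'\<in>{al' \<in> P (L al). red al'}. G al')" .
  have "(\<Sum>be\<in>basis. zmon z be * ev (R be al) z) = (\<Sum>be\<in>{al' \<in> P (L al). \<not> red al'}. zmon z be * ev (R be al) z)"
   by (rule sum.mono_neutral_right[OF finite_basis]) (auto simp: basis_def P_def R(3))
  also have "\<dots> = (\<Sum>be\<in>{al' \<in> P (L al). \<not> red al'}. G be)"
  proof (intro sum.cong refl)
   fix be assume b: "be \<in> {al' \<in> P (L al). \<not> red al'}"
   then have "L al ~= topdeg" using red_if_large[of be] by (auto simp: P_def)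
   then have "c1 al = 0" using c1(2) by blast
   then show "zmon z be * ev (R be al) z = G be" using b by (simp add: R(3) G_def bas_def \<mu>_def)
  qed
  finally have D: "(\<Sum>be\<in>basis. zmon z be * ev (R be al) z) = (\<Sum>be\<in>{al' \<in> P (L al). \<not> red al'}. G be)" .
  have "zmon z al = (\<Sum>al'\<in>P (L al). G al')"
   by (subst split[of al]) (simp add: zmon_add n G_def \<mu>_def sum_distrib_left mult_ac)
  also have "P (L al) = {al' \<in> P (L al). red al'} \<union> {al' \<in> P (L al). \<not> red al'}" by blast
  also have "(\<Sum>al'\<in>\<dots>. G al') = (\<Sum>al'\<in>{al' \<in> P (L al). red al'}. G al') + (\<Sum>al'\<in>{al' \<in> P (L al). \<not> red al'}. G al')"
   by (rule sum.union_disjoint) (use finP in auto)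
  finally show ?thesis using A B D by (simp add: add_ac)
 qed
 define K where "K = (\<Sum>i<length d. N / (\<tau> * \<rho>) ^ (d ! i)) + (\<Sum>be\<in>basis. N / (\<tau> * \<rho>) ^ mdeg be)"
 have pos: "0 \<le> N / (\<tau> * \<rho>) ^ k" for k using N0 \<tau>\<rho> by simp
 have K1: "wnorm w (Q i al) \<le> K * wmon w al" if "i < length d" for i al
 proof -
  have "N / (\<tau> * \<rho>) ^ (d ! i) \<le> (\<Sum>i<length d. N / (\<tau> * \<rho>) ^ (d ! i))"
   by (rule member_le_sum[of i]) (use that pos in auto)
  also have "\<dots> \<le> K" unfolding K_def by (simp add: sum_nonneg pos)
  finally show ?thesis using Q(2)[of i al] mult_right_mono[of _ K "wmon w al"] wmon_pos[where w = w, OF w, of al]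
   by (meson less_imp_le order_trans)
 qed
 have K2: "wnorm w (R be al) \<le> K * wmon w al" if "be \<in> basis" for be al
 proof -
  have "N / (\<tau> * \<rho>) ^ mdeg be \<le> (\<Sum>be\<in>basis. N / (\<tau> * \<rho>) ^ mdeg be)"
   by (rule member_le_sum[OF that _ finite_basis]) (use pos in auto)
  also have "\<dots> \<le> K" unfolding K_def by (simp add: sum_nonneg pos)
  finally show ?thesis using R(2)[of be al] mult_right_mono[of _ K "wmon w al"] wmon_pos[where w = w, OF w, of al]
   by (meson less_imp_le order_trans)
 qed
 show ?thesis
 proof (rule exI[of _ w], intro conjI allI impI)
  show "0 < w m" "w m \<le> \<rho>" for m using wp by auto
  fix g assume g: "nsum w g"
  from division_by_approximation[where w = w, OF w finite_basis g Q(1) K1 R(1) K2 E eq]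
  obtain H r where Hr: "\<forall>i<length d. nsum w (H i)" "\<forall>be\<in>basis. nsum w (r be)"
   "\<forall>be\<in>basis. \<forall>ga. r be ga ~= 0 --> (\<exists>al. R be al ga ~= 0)"
   "\<forall>z. in_poly w z --> ev g z = (\<Sum>i<length d. ev (H i) z * ev (a i) z) + (\<Sum>be\<in>basis. zmon z be * ev (r be) z)"
   by blast
  have "\<forall>m\<in>X. lkp ga m = 0" if "R be al ga ~= 0" for be al ga
   using that by (auto simp: R_def rem_def lookup_minus lookup_xpart split: if_splits)
  then have "\<forall>be\<in>basis. \<forall>ga. r be ga ~= 0 --> (\<forall>m\<in>X. lkp ga m = 0)" using Hr(3) by metis
  then show "\<exists>H r. (\<forall>i<length d. nsum w (H i)) & (\<forall>be\<in>basis. nsum w (r be)) &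
   (\<forall>be\<in>basis. \<forall>ga. r be ga ~= 0 --> (\<forall>m\<in>X. lkp ga m = 0)) &
   (\<forall>z. in_poly w z -->
     ev g z = (\<Sum>i<length d. ev (H i) z * ev (a i) z) + (\<Sum>be\<in>basis. zmon z be * ev (r be) z))"
   using Hr by blast
 qed
qed

end

section \<open>Equations with generic initial forms\<close>

lemma isCont_zmon: "isCont (%u. zmon u al) u"
 by (rule has_derivative_continuous[OF zmon_has_derivative])

lemma power_series_radius:
 fixes f :: "complex^'n::finite => complex"
 assumes "power_series_at_0 a f"
 shows "\<exists>\<rho>>0. (%al. cmod (a al) * \<rho> ^ mdeg al) summable_on UNIV &
  (\<forall>z. (\<forall>m. cmod (z $ m) \<le> \<rho>) --> ((%al. a al * zmon z al) has_sum f z) UNIV)"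
proof (rule power_series_local[OF assms])
 fix \<rho> :: real
 assume "0 < \<rho>" "(%al. cmod (a al) * \<rho> ^ mdeg al) summable_on UNIV"
  and "!!z. (!!m. cmod (z $ m) \<le> \<rho>) ==> ((%al. a al * zmon z al) has_sum f z) UNIV"
 then show ?thesis by (intro exI[of _ \<rho>]) simp
qed

lemma analytic_germs_sum:
 assumes "finite A" "!!i. i \<in> A ==> H i \<in> analytic_germs"
 shows "(%x. \<Sum>i\<in>A. H i x) \<in> analytic_germs"
 using assms
proof (induction A rule: finite_induct)
 case empty
 have "power_series_at_0 (%_. 0) (%x :: complex^'n. 0)" by (simp add: power_series_at_0_def)
 then show ?case by (auto simp: analytic_germs_def)
next
 case (insert i A)
 obtain a where a: "power_series_at_0 a (H i)" using insert.prems[of i] by (auto simp: analytic_germs_def)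
 have "(%x. \<Sum>i\<in>A. H i x) \<in> analytic_germs" using insert.IH insert.prems by simp
 then obtain b where b: "power_series_at_0 b (%x. \<Sum>i\<in>A. H i x)" by (auto simp: analytic_germs_def)
 from a b have "power_series_at_0 (%al. a al + b al) (%x. H i x + (\<Sum>i\<in>A. H i x))"
  unfolding power_series_at_0_def
 proof eventually_elim
  case (elim x)
  from has_sum_add[OF this] show ?case by (simp add: distrib_right)
 qed
 then show ?case using insert.hyps by (auto simp: analytic_germs_def)
qed

text \<open>On dual vectors only the identity contributes to the alternating sum.\<close>

lemma wedge_dual_nonzero:
 assumes dual: "!!i j. i < length \<phi> ==> j < length \<phi> ==> (\<phi> ! i) (v j) = (if i = j then \<kappa> i else 0)"
  and \<kappa>: "!!i. i < length \<phi> ==> \<kappa> i ~= 0"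
 shows "wedge \<phi> v ~= 0"
proof -
 let ?t = "%\<sigma>. of_int (sign \<sigma>) * (\<Prod>i<length \<phi>. (\<phi> ! i) (v (\<sigma> i)))"
 have "wedge \<phi> v = (\<Sum>\<sigma>\<in>{id}. ?t \<sigma>)"
  unfolding wedge_def
 proof (rule sum.mono_neutral_right)
  show "finite {\<sigma>. \<sigma> permutes {..<length \<phi>}}" by (simp add: finite_permutations)
  show "{id} \<subseteq> {\<sigma>. \<sigma> permutes {..<length \<phi>}}" by (simp add: permutes_id)
  show "\<forall>\<sigma>\<in>{\<sigma>. \<sigma> permutes {..<length \<phi>}} - {id}. ?t \<sigma> = 0"
  proof
   fix \<sigma> assume s: "\<sigma> \<in> {\<sigma>. \<sigma> permutes {..<length \<phi>}} - {id}"
   then obtain i where i: "\<sigma> i ~= i" by (auto simp: fun_eq_iff)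
   then have "i < length \<phi>" using s by (metis DiffD1 lessThan_iff mem_Collect_eq permutes_def)
   moreover have "\<sigma> i < length \<phi>" using s permutes_in_image[of \<sigma> "{..<length \<phi>}" i] calculation by simp
   ultimately have "(\<phi> ! i) (v (\<sigma> i)) = 0" using dual i by simp
   then have "(\<Prod>i<length \<phi>. (\<phi> ! i) (v (\<sigma> i))) = 0" using \<open>i < length \<phi>\<close> by (intro prod_zero) auto
   then show "?t \<sigma> = 0" by simp
  qed
 qed
 also have "\<dots> = (\<Prod>i<length \<phi>. \<kappa> i)" using dual by (simp add: sign_id)
 also have "\<dots> ~= 0" using \<kappa> by simp
 finally show ?thesis .
qed

locale generic_equations = elimination d \<iota> j0
 for d :: "nat list" and \<iota> :: "nat => 'n::finite" and j0 :: 'n +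
 fixes a :: "nat => ('n mon) => complex" and c :: "nat \<times> ('n mon) => complex"
  and f :: "nat => complex^'n => complex" and R :: real
 assumes R: "0 < R"
  and a_sum: "!!i. i < length d ==> (%al. cmod (a i al) * R ^ mdeg al) summable_on UNIV"
  and order_a: "!!i. i < length d ==> order_ge (int (d ! i)) (a i)"
  and f_sum: "!!i z. i < length d ==> (!!m. cmod (z $ m) \<le> R) ==> ((%al. a i al * zmon z al) has_sum f i z) UNIV"
  and lead: "!!i al. i < length d ==> mdeg al = d ! i ==> a i al = c (i, al)"
  and red: "reducible c" and fin: "finite (fib c)" and many: "(\<Prod>i<length d. d ! i) \<le> card (fib c)"
  and simple: "simple_fibre c"
  and indep: "!!x l. x ~= 0 ==> \<forall>i<length d. hform c i (d ! i) x = 0 ==>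
   \<forall>m. (\<Sum>i<length d. l i * dform c i (d ! i) m x) = 0 ==> \<forall>i<length d. l i = 0"
begin

abbreviation "ep \<equiv> R / 2"

definition G :: "nat => real \<times> (complex^'n) => complex" where "G i = blowup (int (d ! i)) (a i)"

definition Z :: "(complex^'n) set" where "Z = {x. \<forall>i<length d. f i x = 0}"

lemma a_converges:
 assumes "i < length d" shows "converges R (a i)"
proof (rule summable_imp_converges[OF _ R])
 obtain S where "((%al. cmod (a i al) * R ^ mdeg al) has_sum S) UNIV" using a_sum[OF assms] by (auto simp: summable_on_def)
 from sums_by_degree[OF this]
 have "summable (%k. \<Sum>al | mdeg al = k. cmod (a i al) * R ^ mdeg al)" by (rule sums_summable)
 then show "summable (%k. hnorm (a i) k * R ^ k)" by (simp add: hnorm_def sum_distrib_right)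
qed

lemma hcomp_a: "i < length d ==> hcomp (a i) (d ! i) = hform c i (d ! i)"
 by (rule ext) (simp add: hcomp_def hform_def lead)

lemma Ck_G: "i < length d ==> Ck_on k (box2 ep) (G i)"
 unfolding G_def by (rule Ck_on_blowup[OF a_converges order_a]) auto

lemma G_zero: "i < length d ==> G i (0, u) = hform c i (d ! i) u"
 unfolding G_def by (simp add: blowup_zero[OF order_a] hcomp_a)

text \<open>The blow-up is the quotient by a power of the radius.\<close>

lemma f_blowup:
 assumes i: "i < length d" and e: "order_ge (int e) (a i)" and tu: "(t, u) \<in> box2 ep"
 shows "f i (t *\<^sub>R u) = of_real t ^ e * blowup (int e) (a i) (t, u)"
proof -
 have "cmod ((t *\<^sub>R u) $ m) \<le> R" for m
 proof -
  have "\<bar>t\<bar> * cmod (u $ m) \<le> ep * 2" using tu by (intro mult_mono) (auto simp: box2_def less_imp_le)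
  then show ?thesis by simp
 qed
 from sums_by_degree[OF f_sum[OF i this]]
 have 1: "(%k. of_real t ^ k * hcomp (a i) k u) sums f i (t *\<^sub>R u)"
  by (simp add: hcomp_def[symmetric] scaleR_eq_scalar_mult hcomp_scale)
 have "(%k. of_real t ^ nat (int k - int e) * hcomp (a i) k u) sums blowup (int e) (a i) (t, u)"
  unfolding blowup_def case_prod_conv by (rule summable_sums[OF blowup_summable[OF a_converges[OF i] e _ tu]]) simp
 then have "(%k. of_real t ^ e * (of_real t ^ nat (int k - int e) * hcomp (a i) k u)) sums (of_real t ^ e * blowup (int e) (a i) (t, u))"
  by (rule sums_mult)
 moreover have "of_real t ^ e * (of_real t ^ nat (int k - int e) * hcomp (a i) k u) = of_real t ^ k * hcomp (a i) k u" for k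
 proof (cases "e \<le> k")
  case True
  then have "nat (int k - int e) = k - e" by simp
  then show ?thesis using True by (simp flip: power_add mult.assoc)
 next
  case False then show ?thesis using hcomp_order[OF e, of k u] by simp
 qed
 ultimately show ?thesis using 1 sums_unique2 by simp
qed

lemma f_G: "i < length d ==> (t, u) \<in> box2 ep ==> f i (t *\<^sub>R u) = of_real t ^ (d ! i) * G i (t, u)"
 unfolding G_def by (rule f_blowup[OF _ order_a])

lemma Z_G: "t ~= 0 ==> (t, u) \<in> box2 ep ==> t *\<^sub>R u \<in> Z \<longleftrightarrow> (\<forall>i<length d. G i (t, u) = 0)"
 by (auto simp: Z_def f_G)

lemma sphere_box: "\<bar>t\<bar> < ep ==> norm u < 2 ==> (t, u) \<in> box2 ep"
 using component_le_norm[of u] by (auto simp: box2_def intro: le_less_trans)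

lemma DG_zero:
 assumes i: "i < length d" and u: "(0, u) \<in> box2 ep"
 shows "FD (G i) (at (0, u)) (0, v) = (\<Sum>m\<in>UNIV. v $ m * dform c i (d ! i) m u)"
proof -
 have "((%u. G i (0, u)) has_derivative (%v. FD (G i) (at (0, u)) (0, v))) (at u)"
  by (rule partial_derivative[OF Ck_on_has_derivative[OF Ck_G[OF i] open_box2 u]])
 moreover have "(%u. G i (0, u)) = hform c i (d ! i)" by (rule ext) (rule G_zero[OF i])
 ultimately have "(hform c i (d ! i) has_derivative (%v. FD (G i) (at (0, u)) (0, v))) (at u)" by simp
 from fun_cong[OF has_derivative_unique[OF this hform_has_derivative]] show ?thesis .
qed

section \<open>The ideal of the zero set\<close>

text \<open>The points of the fibre can be followed along the zero set, over the directions close to that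
 of \<open>j0\<close>. The factor \<open>\<kappa>\<close> moves the fibre into the domain of the blow-up.\<close>

lemma zero_curves:
 assumes z: "z \<in> fib c" and \<kappa>: "0 < \<kappa>" "\<kappa> * norm z < 1" and "0 < e0"
 shows "\<exists>de>0. \<forall>s y. \<bar>s\<bar> < de & norm (y - \<kappa> *\<^sub>R axis j0 1) < de -->
  (\<exists>u. norm (u - \<kappa> *\<^sub>R z) < e0 & (s, u) \<in> box2 ep & (\<forall>m. m \<notin> X --> u $ m = y $ m) & (\<forall>i<length d. G i (s, u) = 0))"
proof -
 define h where "h x = (\<chi> r. if r \<in> X then G (pos r) x else snd x $ r)" for x
 let ?z = "\<kappa> *\<^sub>R z" and ?y = "\<kappa> *\<^sub>R axis j0 1 :: complex^'n"
 have zb: "(0, ?z) \<in> box2 ep" by (rule sphere_box) (use R \<kappa> in auto)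
 have Ckh: "Ck_on k (box2 ep) h" for k
  unfolding h_def
 proof (rule Ck_on_vec[OF open_box2])
  fix r
  show "Ck_on k (box2 ep) (%x. if r \<in> X then G (pos r) x else snd x $ r)"
  proof (cases "r \<in> X")
   case True then show ?thesis using Ck_G[OF pos_X(1)] by simp
  next
   case False
   have "Ck_on k (box2 ep) (%x. snd x $ r)"
    by (intro Ck_on_linear_compose[OF bounded_linear_vec_nth open_box2] Ck_on_bounded_linear bounded_linear_snd open_box2)
   then show ?thesis using False by simp
  qed
 qed
 have der: "((%u. h (0, u)) has_derivative
   (%v. \<chi> r. if r \<in> X then \<Sum>m\<in>UNIV. v $ m * dform c (pos r) (d ! pos r) m ?z else v $ r)) (at ?z)"
  unfolding h_def
 proof (rule has_derivative_vec)
  fix r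
  show "((%u. if r \<in> X then G (pos r) (0, u) else snd (0 :: real, u) $ r) has_derivative
    (%v. if r \<in> X then \<Sum>m\<in>UNIV. v $ m * dform c (pos r) (d ! pos r) m ?z else v $ r)) (at ?z)"
  proof (cases "r \<in> X")
   case True then show ?thesis using hform_has_derivative pos_X(1) by (simp add: G_zero)
  next
   case False
   have "((%z. z $ r) has_derivative (%v :: complex^'n. v $ r)) (at ?z)"
    by (rule bounded_linear_imp_has_derivative[OF bounded_linear_vec_nth])
   then show ?thesis using False by simp
  qed
 qed
 have ind: "\<forall>i<length d. l i = 0" if l: "\<forall>m\<in>X. (\<Sum>i<length d. l i * dform c i (d ! i) m ?z) = 0" for l
 proof -
  have "\<forall>m\<in>X. (\<Sum>i<length d. (l i * of_real \<kappa> ^ (d ! i - 1)) * dform c i (d ! i) m z) = 0"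
   using l by (simp add: scaleR_eq_scalar_mult dform_scale mult_ac)
  from simple[unfolded simple_fibre_def, THEN bspec, OF z, THEN spec, THEN mp, OF this] show ?thesis using \<kappa>(1) by simp
 qed
 from partial_chart[OF open_box2 zb Ckh der ind]
 obtain V W g where V: "V \<subseteq> box2 ep" "(0, ?z) \<in> V" and dif: "diffeomorphism V W (%x. (fst x, h x)) g" by blast
 have W: "open W" "continuous_on W g" "g ` W = V" "!!x. x \<in> V ==> g (fst x, h x) = x" "!!w. w \<in> W ==> (fst (g w), h (g w)) = w"
  "!!x. x \<in> V ==> (fst x, h x) \<in> W"
  using dif unfolding diffeomorphism_def homeomorphism_def by auto
 have "hform c i (d ! i) ?z = 0" if "i < length d" for i
  using z that by (simp add: scaleR_eq_scalar_mult hform_scale fib_def)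
 then have hz: "h (0, ?z) = ?y"
  using z j0_X pos_X(1) by (auto simp: h_def vec_eq_iff G_zero fib_def axis_def)
 have yW: "(0, ?y) \<in> W" and gy: "g (0, ?y) = (0, ?z)" using W(6)[OF V(2)] W(4)[OF V(2)] hz by simp_all
 have "isCont g (0, ?y)" using W(1,2) yW by (simp add: continuous_on_eq_continuous_at)
 then obtain de1 where de1: "de1 > 0" "!!w. dist w (0, ?y) < de1 ==> dist (g w) (0, ?z) < e0"
  using assms(4) gy unfolding continuous_at_eps_delta by metis
 obtain de2 where de2: "de2 > 0" "ball (0, ?y) de2 \<subseteq> W" using W(1) yW open_contains_ball by blast
 define de where "de = min de1 de2 / 2"
 have de: "0 < de" using de1 de2 by (simp add: de_def)
 have "\<exists>u. norm (u - ?z) < e0 & (s, u) \<in> box2 ep & (\<forall>m. m \<notin> X --> u $ m = y $ m) & (\<forall>i<length d. G i (s, u) = 0)"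
  if sy: "\<bar>s\<bar> < de" "norm (y - ?y) < de" for s y
 proof -
  define y' where "y' = (\<chi> r. if r \<in> X then 0 else y $ r)"
  have "norm (y' - ?y) \<le> norm (y - ?y)"
   by (rule norm_le_componentwise_cart) (use j0_X in \<open>auto simp: y'_def axis_def\<close>)
  then have "dist (s, y') (0, ?y) < 2 * de"
   using sy norm_Pair_le[of s "y' - ?y"] by (simp add: dist_norm)
  then have n: "dist (s, y') (0, ?y) < de1" "dist (s, y') (0, ?y) < de2" by (auto simp: de_def)
  have wW: "(s, y') \<in> W" using n(2) de2(2) by (auto simp: dist_commute)
  define u where "u = snd (g (s, y'))"
  have g1: "g (s, y') = (s, u)" using W(5)[OF wW] by (auto simp: u_def prod_eq_iff)
  have "h (s, u) = y'" using W(5)[OF wW] unfolding g1 by simp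
  note gu = g1 this
  have "norm (u - ?z) \<le> norm ((s, u) - (0, ?z))" using norm_snd_le[of "u - ?z" s] by simp
  also have "\<dots> < e0" using de1(2)[OF n(1)] by (simp add: gu(1) dist_norm)
  finally have "norm (u - ?z) < e0" .
  moreover have "(s, u) \<in> box2 ep" using W(3) wW gu(1) V(1) by (metis imageI subsetD)
  moreover have "u $ m = y $ m" if "m \<notin> X" for m
   using arg_cong[OF gu(2), of "%w. w $ m"] that by (simp add: h_def y'_def)
  moreover have "G i (s, u) = 0" if "i < length d" for i
   using arg_cong[OF gu(2), of "%w. w $ \<iota> i"] that \<iota>_in_X[of i] by (simp add: h_def y'_def)
  ultimately show ?thesis by blast
 qed
 then show ?thesis using de by blast
qed

lemma ev_cong_off_X:
 assumes "\<forall>ga. r ga ~= 0 --> (\<forall>m\<in>X. lkp ga m = 0)" "!!m. m \<notin> X ==> z $ m = z' $ m"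
 shows "ev r z = ev r z'"
 unfolding ev_def
proof (rule infsum_cong)
 fix ga
 show "r ga * zmon z ga = r ga * zmon z' ga"
 proof (cases "r ga = 0")
  case False
  have "zmon z ga = zmon z' ga" unfolding zmon_def
  proof (rule prod.cong)
   fix m
   show "z $ m ^ lkp ga m = z' $ m ^ lkp ga m"
    using assms False by (cases "m \<in> X") auto
  qed simp
  then show ?thesis by simp
 qed simp
qed

text \<open>Over each such direction the zero set has at least as many points as there are monomials in
 \<open>basis\<close>, in general position: the remainder of a division vanishes if it does so on the zero set.\<close>

lemma remainder_zero:
 assumes w: "!!m. 0 < w m" and r: "!!be. be \<in> basis ==> nsum w (r be)"
  and sup: "!!be. be \<in> basis ==> \<forall>ga. r be ga ~= 0 --> (\<forall>m\<in>X. lkp ga m = 0)"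
  and \<eta>: "0 < \<eta>" and zero: "!!s u. 0 < s ==> s < \<eta> ==> (s, u) \<in> box2 ep ==> \<forall>i<length d. G i (s, u) = 0 ==>
   (\<Sum>be\<in>basis. zmon (s *\<^sub>R u) be * ev (r be) (s *\<^sub>R u)) = 0"
  and be0: "be0 \<in> basis"
 shows "r be0 al = 0"
proof -
 define \<kappa> where "\<kappa> = 1 / (1 + (\<Sum>z\<in>fib c. norm z))"
 have s0: "0 \<le> (\<Sum>z\<in>fib c. norm z)" by (intro sum_nonneg) auto
 have \<kappa>: "0 < \<kappa>" "!!z. z \<in> fib c ==> \<kappa> * norm z < 1"
 proof -
  show "0 < \<kappa>" using s0 by (simp add: \<kappa>_def)
  fix z assume "z \<in> fib c"
  then have "norm z \<le> (\<Sum>z\<in>fib c. norm z)" by (intro member_le_sum fin) auto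
  then show "\<kappa> * norm z < 1" using s0 by (simp add: \<kappa>_def divide_less_eq)
 qed
 obtain \<Lambda> where \<Lambda>: "!!z k. z \<in> fib c ==> k \<in> fib c ==> (\<Sum>be\<in>basis. zmon z be * \<Lambda> be k) = (if z = k then 1 else 0)"
  using interpolation_matrix[OF red fin] by blast
 define V where "V z be = zmon (\<kappa> *\<^sub>R z) be" for z :: "complex^'n" and be
 have "(\<Sum>be\<in>basis. V z be * (\<Lambda> be k / of_real \<kappa> ^ mdeg be)) = (if z = k then 1 else 0)"
  if "z \<in> fib c" "k \<in> fib c" for z k
  using \<Lambda>[OF that] \<kappa>(1) by (simp add: V_def scaleR_eq_scalar_mult zmon_scale)
 from perturbed_interpolation[OF fin finite_basis order_trans[OF card_basis_le many] this]
 obtain ep1 where ep1: "0 < ep1"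
  "\<forall>V' \<xi>. (\<forall>k\<in>fib c. \<forall>be\<in>basis. cmod (V' k be - V k be) < ep1) & (\<forall>k\<in>fib c. (\<Sum>be\<in>basis. V' k be * \<xi> be) = 0) --> (\<forall>be\<in>basis. \<xi> be = 0)"
  by blast
 have "\<forall>z\<in>fib c. \<exists>de>0. \<forall>s y. \<bar>s\<bar> < de & norm (y - \<kappa> *\<^sub>R axis j0 1) < de -->
  (\<exists>u. (\<forall>be\<in>basis. cmod (zmon u be - V z be) < ep1) & (s, u) \<in> box2 ep & (\<forall>m. m \<notin> X --> u $ m = y $ m) & (\<forall>i<length d. G i (s, u) = 0))"
 proof
  fix z assume z: "z \<in> fib c"
  have "\<forall>\<^sub>F u in nhds (\<kappa> *\<^sub>R z). \<forall>be\<in>basis. dist (zmon u be) (V z be) < ep1"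
  proof (rule eventually_ball_finite[OF finite_basis], rule ballI)
   fix be
   have "((%u. zmon u be) \<longlongrightarrow> V z be) (nhds (\<kappa> *\<^sub>R z))"
    using isCont_zmon[of "\<kappa> *\<^sub>R z" be] unfolding V_def isCont_def
    by (rule tendsto_at_iff_tendsto_nhds[of "%u. zmon u be" "\<kappa> *\<^sub>R z", THEN iffD1])
   then show "\<forall>\<^sub>F u in nhds (\<kappa> *\<^sub>R z). dist (zmon u be) (V z be) < ep1" by (rule tendstoD[OF _ ep1(1)])
  qed
  then obtain e where e: "e > 0" "!!u. norm (u - \<kappa> *\<^sub>R z) < e ==> \<forall>be\<in>basis. cmod (zmon u be - V z be) < ep1"
   unfolding eventually_nhds_metric dist_norm by blast
  from zero_curves[OF z \<kappa>(1) \<kappa>(2)[OF z] e(1)] obtain de where de: "de > 0"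
   "!!s y. \<bar>s\<bar> < de & norm (y - \<kappa> *\<^sub>R axis j0 1) < de ==>
     \<exists>u. norm (u - \<kappa> *\<^sub>R z) < e & (s, u) \<in> box2 ep & (\<forall>m. m \<notin> X --> u $ m = y $ m) & (\<forall>i<length d. G i (s, u) = 0)"
   by metis
  show "\<exists>de>0. \<forall>s y. \<bar>s\<bar> < de & norm (y - \<kappa> *\<^sub>R axis j0 1) < de -->
   (\<exists>u. (\<forall>be\<in>basis. cmod (zmon u be - V z be) < ep1) & (s, u) \<in> box2 ep & (\<forall>m. m \<notin> X --> u $ m = y $ m) & (\<forall>i<length d. G i (s, u) = 0))"
   using de e(2) by (intro exI[of _ de]) metis
 qed
 then obtain def where def: "\<forall>z\<in>fib c. def z > 0 & (\<forall>s y. \<bar>s\<bar> < def z & norm (y - \<kappa> *\<^sub>R axis j0 1) < def z -->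
  (\<exists>u. (\<forall>be\<in>basis. cmod (zmon u be - V z be) < ep1) & (s, u) \<in> box2 ep & (\<forall>m. m \<notin> X --> u $ m = y $ m) & (\<forall>i<length d. G i (s, u) = 0)))"
  by (rule bchoice[THEN exE])
 define de where "de = Min (insert \<eta> (def ` fib c))"
 have de: "0 < de" "de \<le> \<eta>" "!!z. z \<in> fib c ==> de \<le> def z"
  unfolding de_def using fin \<eta> def by auto
 have ev0: "ev (r be0) (of_real s *s y) = 0" if y: "y \<in> ball (\<kappa> *\<^sub>R axis j0 1) de" and s: "0 < s" "s < de" for y s
 proof -
  have yn: "norm (y - \<kappa> *\<^sub>R axis j0 1) < de" using y by (simp add: dist_norm norm_minus_commute)
  have "\<forall>z\<in>fib c. \<exists>u. (\<forall>be\<in>basis. cmod (zmon u be - V z be) < ep1) & (s, u) \<in> box2 ep & (\<forall>m. m \<notin> X --> u $ m = y $ m) & (\<forall>i<length d. G i (s, u) = 0)"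
  proof
   fix z assume z: "z \<in> fib c"
   have "\<bar>s\<bar> < def z & norm (y - \<kappa> *\<^sub>R axis j0 1) < def z" using s yn de(3)[OF z] by simp
   then show "\<exists>u. (\<forall>be\<in>basis. cmod (zmon u be - V z be) < ep1) & (s, u) \<in> box2 ep & (\<forall>m. m \<notin> X --> u $ m = y $ m) & (\<forall>i<length d. G i (s, u) = 0)"
    using def z by blast
  qed
  then obtain u where u: "\<forall>z\<in>fib c. (\<forall>be\<in>basis. cmod (zmon (u z) be - V z be) < ep1) & (s, u z) \<in> box2 ep & (\<forall>m. m \<notin> X --> u z $ m = y $ m) & (\<forall>i<length d. G i (s, u z) = 0)"
   by (rule bchoice[THEN exE])
  define \<xi> where "\<xi> be = of_real s ^ mdeg be * ev (r be) (s *\<^sub>R y)" for be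
  have "(\<Sum>be\<in>basis. zmon (u z) be * \<xi> be) = 0" if z: "z \<in> fib c" for z
  proof -
   have "(\<Sum>be\<in>basis. zmon (s *\<^sub>R u z) be * ev (r be) (s *\<^sub>R u z)) = 0"
    using u z s de(2) by (intro zero) auto
   moreover have "zmon (s *\<^sub>R u z) be * ev (r be) (s *\<^sub>R u z) = zmon (u z) be * \<xi> be" if "be \<in> basis" for be
   proof -
    have "ev (r be) (s *\<^sub>R u z) = ev (r be) (s *\<^sub>R y)" by (rule ev_cong_off_X[OF sup[OF that]]) (use u z in simp)
    then show ?thesis by (simp add: \<xi>_def scaleR_eq_scalar_mult zmon_scale mult_ac)
   qed
   ultimately show ?thesis by simp
  qed
  then have "\<forall>be\<in>basis. \<xi> be = 0" using u by (intro ep1(2)[THEN spec, THEN spec, THEN mp, of "%z be. zmon (u z) be"]) blast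
  then have "\<xi> be0 = 0" using be0 by blast
  then show ?thesis using s(1) by (simp add: \<xi>_def scaleR_eq_scalar_mult)
 qed
 show ?thesis
 proof (rule power_series_local[OF ev_power_series[where w = w, OF w r[OF be0]]])
  fix \<rho> :: real
  assume "0 < \<rho>" and "!!z. (!!m. cmod (z $ m) \<le> \<rho>) ==> (%k. hcomp (r be0) k z) sums ev (r be0) z"
  from series_zero_on_cone[OF this de(1) de(1) ev0] show ?thesis .
 qed
qed

text \<open>The remainder of the division by the \<open>f i\<close> vanishes.\<close>

lemma vanishing_division:
 assumes b: "power_series_at_0 b g" and van: "\<forall>\<^sub>F x in nhds 0. x \<in> Z --> g x = 0"
 shows "\<exists>H. (\<forall>i<length d. H i \<in> analytic_germs) & (\<forall>\<^sub>F x in nhds 0. g x = (\<Sum>i<length d. H i x * f i x))"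
proof -
 obtain \<rho>1 where \<rho>1: "0 < \<rho>1" "(%al. cmod (b al) * \<rho>1 ^ mdeg al) summable_on UNIV"
  "\<forall>z. (\<forall>m. cmod (z $ m) \<le> \<rho>1) --> ((%al. b al * zmon z al) has_sum g z) UNIV"
  using power_series_radius[OF b] by (elim exE conjE) (rule that; assumption)
 define \<rho> where "\<rho> = min R \<rho>1"
 have \<rho>: "0 < \<rho>" "\<rho> \<le> R" "\<rho> \<le> \<rho>1" using R \<rho>1 by (auto simp: \<rho>_def)
 have a\<rho>: "(%al. cmod (a i al) * \<rho> ^ mdeg al) summable_on UNIV" if "i < length d" for i
  using a_sum[OF that] by (rule summable_on_comparison_test) (use \<rho> in \<open>auto intro!: mult_left_mono power_mono\<close>)
 obtain w where w0: "\<forall>m. 0 < w m & w m \<le> \<rho>" and div0: "\<forall>g. nsum w g -->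
  (\<exists>H r. (\<forall>i<length d. nsum w (H i)) & (\<forall>be\<in>basis. nsum w (r be)) &
   (\<forall>be\<in>basis. \<forall>ga. r be ga ~= 0 --> (\<forall>m\<in>X. lkp ga m = 0)) &
   (\<forall>z. in_poly w z -->
     ev g z = (\<Sum>i<length d. ev (H i) z * ev (a i) z) + (\<Sum>be\<in>basis. zmon z be * ev (r be) z)))"
  by (rule division[OF red \<rho>(1) a\<rho> order_a lead, THEN exE],
    assumption, assumption, assumption, assumption, elim conjE, (rule that; assumption))
 note div = div0[THEN spec, THEN mp]
 have w: "!!m. 0 < w m" "!!m. w m \<le> \<rho>" using w0 by auto
 have wR: "w m \<le> R" "w m \<le> \<rho>1" for m using w(2)[of m] \<rho> by auto
 have nb: "nsum w b" by (rule nsum_ball[where w = w, OF w(1) wR(2) \<rho>1(2)])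
 have na: "nsum w (a i)" if "i < length d" for i by (rule nsum_ball[where w = w, OF w(1) wR(1) a_sum[OF that]])
 obtain H r where H: "\<forall>i<length d. nsum w (H i)" and r: "\<forall>be\<in>basis. nsum w (r be)"
  and sup: "\<forall>be\<in>basis. \<forall>ga. r be ga ~= 0 --> (\<forall>m\<in>X. lkp ga m = 0)"
  and eq0: "\<forall>z. in_poly w z --> ev b z = (\<Sum>i<length d. ev (H i) z * ev (a i) z) + (\<Sum>be\<in>basis. zmon z be * ev (r be) z)"
  using div[OF nb] by (elim exE conjE) (rule that; assumption)
 note eq = eq0[THEN spec, THEN mp]
 have evb: "ev b z = g z" if z: "in_poly w z" for z
  using \<rho>1(3)[THEN spec, of z] z wR(2) ev_has_sum[where w = w, OF w(1) nb z] has_sum_unique unfolding in_poly_def by (meson order_trans)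
 have eva: "ev (a i) z = f i z" if z: "in_poly w z" and i: "i < length d" for z i
  using f_sum[OF i, of z] z wR(1) ev_has_sum[where w = w, OF w(1) na[OF i] z] has_sum_unique unfolding in_poly_def by (meson order_trans)
 obtain \<eta>1 where \<eta>1: "\<eta>1 > 0" "!!x. norm x < \<eta>1 ==> x \<in> Z ==> g x = 0"
  using van unfolding eventually_nhds_metric dist_norm by auto
 define \<omega> where "\<omega> = Min (range w)"
 have \<omega>: "0 < \<omega>" "!!m. \<omega> \<le> w m" unfolding \<omega>_def using w(1) by auto
 define C where "C = real CARD('n) * 2"
 have C: "0 < C" by (simp add: C_def)
 have small: "norm (s *\<^sub>R u) \<le> s * C" if "(s, u) \<in> box2 ep" "0 < s" for s and u :: "complex^'n"
  using norm_vec_le_card[of u 2] that by (auto simp: box2_def C_def less_imp_le intro!: mult_left_mono)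
 have ball: "in_poly w x" if "norm x < \<omega>" for x
  unfolding in_poly_def using component_le_norm[of x] \<omega>(2) that by (meson less_imp_le order_trans)
 have r0: "r be al = 0" if "be \<in> basis" for be al
 proof (rule remainder_zero[of w r "min \<eta>1 \<omega> / C", OF w(1) bspec[OF r] bspec[OF sup] _ _ that])
  show "0 < min \<eta>1 \<omega> / C" using \<eta>1 \<omega> C by simp
  fix s u assume s: "0 < s" "s < min \<eta>1 \<omega> / C" and su: "(s, u) \<in> box2 ep" and G: "\<forall>i<length d. G i (s, u) = 0"
  have "s * C < min \<eta>1 \<omega>" using s(2) C by (simp add: pos_less_divide_eq)
  then have n: "norm (s *\<^sub>R u) < \<eta>1" "norm (s *\<^sub>R u) < \<omega>" using small[OF su s(1)] by auto
  have sZ: "s *\<^sub>R u \<in> Z" using Z_G[of s u] s su G by simp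
  have ip: "in_poly w (s *\<^sub>R u)" by (rule ball[OF n(2)])
  have "(\<Sum>i<length d. ev (H i) (s *\<^sub>R u) * ev (a i) (s *\<^sub>R u)) = 0"
   using sZ by (intro sum.neutral) (simp add: eva[OF ip] Z_def)
  then show "(\<Sum>be\<in>basis. zmon (s *\<^sub>R u) be * ev (r be) (s *\<^sub>R u)) = 0"
   using eq[OF ip] evb[OF ip] \<eta>1(2)[OF n(1) sZ] by simp
 qed (use that in auto)
 have "g x = (\<Sum>i<length d. ev (H i) x * f i x)" if "norm x < \<omega>" for x
 proof -
  have "ev (r be) x = 0" if "be \<in> basis" for be using r0[OF that] by (simp add: ev_def)
  then show ?thesis using eq[OF ball[OF that]] evb[OF ball[OF that]] eva[OF ball[OF that]] by simp
 qed
 then have "\<forall>\<^sub>F x in nhds 0. g x = (\<Sum>i<length d. ev (H i) x * f i x)"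
  unfolding eventually_nhds_metric dist_norm using \<omega>(1) by auto
 moreover have "ev (H i) \<in> analytic_germs" if "i < length d" for i
  using ev_power_series[where w = w, OF w(1) H[THEN spec, THEN mp, OF that]] by (auto simp: analytic_germs_def)
 ultimately show ?thesis by (intro exI[of _ "%i. ev (H i)"]) blast
qed

text \<open>Several indices may have the same \<open>f i\<close>; their quotients are added up.\<close>

lemma ideal_of_zero_set: "vanishing_ideal Z = germ_ideal (f ` {..<length d})"
proof (intro subset_antisym subsetI)
 fix g assume "g \<in> vanishing_ideal Z"
 then obtain b where g: "g \<in> analytic_germs" "power_series_at_0 b g" "\<forall>\<^sub>F x in nhds 0. x \<in> Z --> g x = 0"
  by (auto simp: vanishing_ideal_def analytic_germs_def)
 obtain H where H: "!!i. i < length d ==> H i \<in> analytic_germs" "\<forall>\<^sub>F x in nhds 0. g x = (\<Sum>i<length d. H i x * f i x)"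
  using vanishing_division[OF g(2,3)] by blast
 define h where "h t = (%x. \<Sum>i\<in>{i \<in> {..<length d}. f i = t}. H i x)" for t
 have "(\<Sum>i<length d. H i x * f i x) = (\<Sum>t\<in>f ` {..<length d}. h t x * t x)" for x
 proof -
  have "(\<Sum>t\<in>f ` {..<length d}. h t x * t x) = (\<Sum>t\<in>f ` {..<length d}. \<Sum>i\<in>{i \<in> {..<length d}. f i = t}. H i x * f i x)"
   unfolding h_def sum_distrib_right by (intro sum.cong refl) auto
  also have "\<dots> = (\<Sum>i<length d. H i x * f i x)" by (rule sum.group) auto
  finally show ?thesis ..
 qed
 then have "\<forall>\<^sub>F x in nhds 0. g x = (\<Sum>t\<in>f ` {..<length d}. h t x * t x)" using H(2) by simp
 moreover have "h t \<in> analytic_germs" for t unfolding h_def by (rule analytic_germs_sum) (use H(1) in auto)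
 ultimately show "g \<in> germ_ideal (f ` {..<length d})"
  unfolding germ_ideal_def using g(1) by (intro CollectI conjI exI[of _ "f ` {..<length d}"] exI[of _ h]) auto
next
 fix g assume "g \<in> germ_ideal (f ` {..<length d})"
 then obtain T h where g: "g \<in> analytic_germs" and T: "T \<subseteq> f ` {..<length d}"
  and ev: "\<forall>\<^sub>F x in nhds 0. g x = (\<Sum>t\<in>T. h t x * t x)" by (auto simp: germ_ideal_def)
 have "\<forall>\<^sub>F x in nhds 0. x \<in> Z --> g x = 0" using ev
 proof eventually_elim
  case (elim x)
  show ?case
  proof
   assume "x \<in> Z"
   show "g x = 0" unfolding elim
   proof (rule sum.neutral, rule ballI)
    fix t assume "t \<in> T"
    then have "t x = 0" using T \<open>x \<in> Z\<close> by (auto simp: Z_def)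
    then show "h t x * t x = 0" by simp
   qed
  qed
 qed
 then show "g \<in> vanishing_ideal Z" using g by (simp add: vanishing_ideal_def)
qed

end

section \<open>The blow-up of the zero set\<close>

context generic_equations
begin

text \<open>The components of \<open>q\<close> outside \<open>X\<close> are zero; off the domain of the blow-up, \<open>q\<close> is nonzero.\<close>

definition q :: "real \<times> (complex^'n) => (complex^'n) \<times> real" where
 "q x = (if x \<in> box2 ep then (\<chi> r. if r \<in> X then G (pos r) x else 0, snd x \<bullet> snd x - 1) else (0, 1))"

definition Q :: "((complex^'n) \<times> real) set" where "Q = {w. \<forall>r. r \<notin> X --> w $ r = 0} \<times> UNIV"

definition M :: "(real \<times> (complex^'n)) set" where "M = {x. q x = 0}"

lemma q_in_Q: "q x \<in> Q"
 by (simp add: q_def Q_def)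

lemma M_iff: "(t, u) \<in> M \<longleftrightarrow> (t, u) \<in> box2 ep & (\<forall>i<length d. G i (t, u) = 0) & norm u = 1"
proof -
 have "(\<forall>r. (if r \<in> X then G (pos r) (t, u) else 0) = 0) \<longleftrightarrow> (\<forall>i<length d. G i (t, u) = 0)"
  using \<iota>_in_X pos_X(1) by (metis pos_\<iota>)
 moreover have "u \<bullet> u - 1 = 0 \<longleftrightarrow> norm u = 1" using norm_eq_1[of u] by auto
 ultimately show ?thesis by (auto simp: M_def q_def zero_prod_def vec_eq_iff)
qed

lemma Ck_q: "Ck_on k (box2 ep) q"
proof -
 have G: "Ck_on k (box2 ep) (%x. if r \<in> X then G (pos r) x else 0)" for r
  using Ck_G[OF pos_X(1), of r] by (cases "r \<in> X") (simp_all add: Ck_on_const open_box2)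
 have "Ck_on k (box2 ep) (%x :: real \<times> (complex^'n). snd x \<bullet> snd x + (- 1))"
  by (intro Ck_on_add Ck_on_const Ck_on_bilinear[OF bounded_bilinear_inner] Ck_on_bounded_linear bounded_linear_snd open_box2)
 note s = Ck_on_linear_compose[OF _ open_box2 this, of "%s. (0 :: complex^'n, s)"]
 have "Ck_on k (box2 ep) (%x. (\<chi> r. if r \<in> X then G (pos r) x else 0, 0) + (0, snd x \<bullet> snd x + (- 1)))"
  by (intro Ck_on_add[OF open_box2] s Ck_on_linear_compose[OF _ open_box2 Ck_on_vec[OF open_box2 G], of "%w. (w, 0)"]
    bounded_linear_Pair bounded_linear_zero bounded_linear_ident)
 then show ?thesis by (rule Ck_on_cong[OF open_box2, rotated]) (simp add: q_def)
qed

lemma q_derivative: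
 assumes x: "x \<in> box2 ep"
 shows "FD q (at x) h =
  (\<chi> r. if r \<in> X then FD (G (pos r)) (at x) h else 0, 2 * (snd x \<bullet> snd h))"
proof -
 have "((%x. if r \<in> X then G (pos r) x else 0) has_derivative
   (%h. if r \<in> X then FD (G (pos r)) (at x) h else 0)) (at x)" for r
  using Ck_on_has_derivative[OF Ck_G[OF pos_X(1)] open_box2 x, of r] by (cases "r \<in> X") simp_all
 note D1 = has_derivative_vec[OF this]
 have D2: "((%x :: real \<times> (complex^'n). snd x \<bullet> snd x - 1) has_derivative (%h. 2 * (snd x \<bullet> snd h))) (at x)"
  by (auto intro!: derivative_eq_intros simp: inner_commute)
 have "(q has_derivative (%h. (\<chi> r. if r \<in> X then FD (G (pos r)) (at x) h else 0, 2 * (snd x \<bullet> snd h)))) (at x)"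
  by (rule has_derivative_transform_within_open[OF has_derivative_Pair[OF D1 D2] open_box2 x]) (simp add: q_def)
 from fun_cong[OF frechet_derivative_at[OF this], of h] show ?thesis by (rule sym)
qed

text \<open>The equations are independent at the points of the cone; by homogeneity the radial direction
 takes care of the equation of the sphere.\<close>

lemma q_surj:
 assumes "(0, u) \<in> M"
 shows "range (%v. FD q (at (0, u)) (0, v)) = Q"
proof -
 have u: "(0, u) \<in> box2 ep" "norm u = 1" and zero: "\<forall>i<length d. hform c i (d ! i) u = 0"
  using assms G_zero by (auto simp: M_iff)
 define T where "T v = (\<chi> r. if r \<in> X then \<Sum>m\<in>UNIV. v $ m * dform c (pos r) (d ! pos r) m u else 0)" for v
 have D: "FD q (at (0, u)) (0, v) = (T v, 2 * (u \<bullet> v))" for v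
  unfolding q_derivative[OF u(1)] T_def by (simp add: vec_eq_iff DG_zero[OF pos_X(1) u(1)])
 have "range T = {w. \<forall>r. r \<notin> X --> w $ r = 0}"
  unfolding T_def
 proof (rule independent_rows_surj)
  fix l assume l: "!!m. (\<Sum>r\<in>X. l r * dform c (pos r) (d ! pos r) m u) = 0"
  have "(\<Sum>i<length d. l (\<iota> i) * dform c i (d ! i) m u) = 0" for m
   using l[of m] sum_X[of "%i. l (\<iota> i) * dform c i (d ! i) m u"] by (simp add: pos_X cong: sum.cong)
  then have "\<forall>i<length d. l (\<iota> i) = 0" using indep[of u "%i. l (\<iota> i)"] zero u(2) by fastforce
  then show "\<forall>r\<in>X. l r = 0" using pos_X by metis
 qed
 note TQ = this
 show ?thesis
 proof (intro subset_antisym subsetI)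
  fix y assume "y \<in> range (%v. FD q (at (0, u)) (0, v))"
  then show "y \<in> Q" by (auto simp: D Q_def T_def)
 next
  fix y assume "y \<in> Q"
  then obtain w s where y: "y = (w, s)" "w \<in> range T" unfolding TQ by (auto simp: Q_def)
  then obtain v where v: "w = T v" by blast
  define v' where "v' = v + ((s / 2 - u \<bullet> v) *\<^sub>R u)"
  have "T v' = T v"
   unfolding T_def vec_eq_iff
  proof (intro allI)
   fix r
   have "(\<Sum>m\<in>UNIV. v' $ m * dform c (pos r) (d ! pos r) m u) = (\<Sum>m\<in>UNIV. v $ m * dform c (pos r) (d ! pos r) m u)
     + of_real (s / 2 - u \<bullet> v) * (\<Sum>m\<in>UNIV. u $ m * dform c (pos r) (d ! pos r) m u)"
    unfolding v'_def vector_add_component vector_scaleR_component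
    by (simp add: scaleR_conv_of_real distrib_right sum.distrib sum_distrib_left mult.assoc)
   then show "(\<chi> r. if r \<in> X then \<Sum>m\<in>UNIV. v' $ m * dform c (pos r) (d ! pos r) m u else 0) $ r
     = (\<chi> r. if r \<in> X then \<Sum>m\<in>UNIV. v $ m * dform c (pos r) (d ! pos r) m u else 0) $ r"
    using zero pos_X(1)[of r] by (simp add: euler_hform)
  qed
  moreover have "2 * (u \<bullet> v') = s" using u(2) by (simp add: v'_def inner_add_right dot_square_norm algebra_simps)
  ultimately have "FD q (at (0, u)) (0, v') = y" by (simp add: D y v)
  then show "y \<in> range (%v. FD q (at (0, u)) (0, v))" by blast
 qed
qed

lemma compact_sphere_part: "compact {x \<in> M. 0 \<le> fst x & fst x \<le> R / 4}"
proof -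
 define K where "K = ({0..R / 4} \<times> sphere 0 1 :: (real \<times> (complex^'n)) set)"
 have cK: "compact K" unfolding K_def by (rule compact_Times[OF compact_Icc compact_sphere])
 have "K \<subseteq> box2 ep"
 proof
  fix x assume "x \<in> K"
  then obtain t u where "x = (t, u)" "0 \<le> t" "t \<le> R / 4" "norm u = 1" by (cases x) (simp add: K_def)
  then show "x \<in> box2 ep" using R by (simp add: sphere_box)
 qed
 then have "continuous_on K q" using Ck_q[of 0, unfolded Ck_on.simps] by (rule continuous_on_subset[rotated])
 then have cl: "closed (K \<inter> q -` {0})" by (rule continuous_closed_preimage[OF _ compact_imp_closed[OF cK] closed_singleton])
 have "{x \<in> M. 0 \<le> fst x & fst x \<le> R / 4} = K \<inter> (K \<inter> q -` {0})"
 proof (rule set_eqI)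
  fix x :: "real \<times> (complex^'n)"
  obtain t u where x: "x = (t, u)" by (cases x)
  have "(t, u) \<in> M \<longleftrightarrow> q (t, u) = 0" by (simp only: M_def mem_Collect_eq)
  moreover have "(t, u) \<in> M ==> norm u = 1" using M_iff by blast
  ultimately show "x \<in> {x \<in> M. 0 \<le> fst x & fst x \<le> R / 4} \<longleftrightarrow> x \<in> K \<inter> (K \<inter> q -` {0})"
   unfolding x K_def by auto
 qed
 then show ?thesis using compact_Int_closed[OF cK cl] by (simp only:)
qed

lemma zero_in_Z: "0 \<in> Z"
proof -
 have "f i 0 = 0" if i: "i < length d" for i
 proof -
  have "f i (0 *\<^sub>R 0) = of_real 0 ^ (d ! i) * G i (0, 0)" by (rule f_G[OF i sphere_box]) (use R in auto)
  then show ?thesis using d_pos[OF i] by (simp add: power_0_left)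
 qed
 then show ?thesis by (simp add: Z_def)
qed

lemma polar_Z:
 assumes "0 < t" "t \<le> R / 4" "norm u = 1" shows "t *\<^sub>R u \<in> Z \<longleftrightarrow> (t, u) \<in> M"
proof -
 have "(t, u) \<in> box2 ep" using assms R by (intro sphere_box) auto
 then show ?thesis using assms Z_G[of t u] by (simp add: M_iff)
qed

sublocale blown_up M Z "R / 4" "DIM(complex^'n) - dim Q"
proof
 show "0 < R / 4" using R by simp
 show "compact {x \<in> M. 0 \<le> fst x & fst x \<le> R / 4}" by (rule compact_sphere_part)
 show "M \<subseteq> UNIV \<times> sphere 0 1"
 proof
  fix x assume "x \<in> M"
  then show "x \<in> UNIV \<times> sphere 0 1" by (cases x) (simp add: M_iff)
 qed
 show "straight M x (DIM(complex^'n) - dim Q)" if x: "x \<in> M" "fst x = 0" for x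
 proof -
  obtain u where u: "x = (0, u)" using x(2) by (cases x) auto
  have xM: "(0, u) \<in> M" using x(1) unfolding u .
  then have b: "(0, u) \<in> box2 ep" using M_iff[of 0 u] by simp
  have "straight {x. q x = 0} (0, u) (DIM(complex^'n) - dim Q)"
  proof (rule submersion_straight(1)[OF open_box2 b])
   show "Ck_on k (box2 ep) q" for k by (rule Ck_q)
   show "q x \<in> Q" for x by (rule q_in_Q)
   show "range (%v. FD q (at (0, u)) (0, v)) = Q" by (rule q_surj[OF xM])
  qed
  then show ?thesis by (simp only: u M_def)
 qed
 show "t *\<^sub>R u \<in> Z \<longleftrightarrow> (t, u) \<in> M" if "0 < t" "t \<le> R / 4" "norm u = 1" for t u by (rule polar_Z[OF that])
 show "0 \<in> Z" by (rule zero_in_Z)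
qed

lemma Ck_f:
 assumes i: "i < length d"
 shows "Ck_on k (ball 0 ep) (f i)"
proof -
 define g where "g z = (ep / 2, (2 / ep) *\<^sub>R z)" for z :: "complex^'n"
 define b where "b = blowup (int 0) (a i)"
 have e0: "order_ge (int 0) (a i)" by (simp add: order_ge_def)
 have box: "g z \<in> box2 ep" if "z \<in> ball 0 ep" for z
  unfolding g_def
 proof (rule sphere_box)
  have "norm z < ep" using that by simp
  then show "norm ((2 / ep) *\<^sub>R z) < 2" using R by (simp add: pos_divide_less_eq)
 qed (use R in simp)
 have bl: "bounded_linear (%z :: complex^'n. (0 :: real, (2 / ep) *\<^sub>R z))"
  by (rule bounded_linear_Pair[OF bounded_linear_zero bounded_linear_scaleR_right])
 have "Ck_on k (ball 0 ep) (%z :: complex^'n. (ep / 2, 0) + (0, (2 / ep) *\<^sub>R z))"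
  by (rule Ck_on_add[OF open_ball Ck_on_const[OF open_ball] Ck_on_bounded_linear[OF bl open_ball]])
 then have Cg: "Ck_on k (ball 0 ep) g" by (rule Ck_on_cong[OF open_ball, rotated]) (simp add: g_def)
 have Cb: "Ck_on k (box2 ep) b" unfolding b_def by (rule Ck_on_blowup[OF a_converges[OF i] e0]) simp
 have "g ` ball 0 ep \<subseteq> box2 ep" using box by blast
 from Ck_on_compose[OF open_ball open_box2 this Cb Cg] have "Ck_on k (ball 0 ep) (%z. b (g z))" .
 then show ?thesis
 proof (rule Ck_on_cong[OF open_ball, rotated])
  fix z :: "complex^'n" assume "z \<in> ball 0 ep"
  from f_blowup[OF i e0 box[OF this, unfolded g_def]] show "b (g z) = f i z" using R by (simp add: b_def g_def)
 qed
qed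

lemma conic_Z: "conic_point Z"
proof (rule conic_point_X, intro exI[of _ ep] conjI)
 show "0 < ep" using R by simp
 have "closedin (top_of_set (ball 0 ep)) (ball 0 ep \<inter> f i -` {0})" if "i < length d" for i
  using Ck_f[OF that, of 0] by (intro continuous_closedin_preimage) auto
 then have "closedin (top_of_set (ball 0 ep)) (\<Inter>i\<in>{..<length d}. ball 0 ep \<inter> f i -` {0})" if "{..<length d} ~= {}"
  using that by (intro closedin_INT) auto
 moreover have "Z \<inter> ball 0 ep = (\<Inter>i\<in>{..<length d}. ball 0 ep \<inter> f i -` {0})" if "{..<length d} ~= {}"
  using that by (auto simp: Z_def)
 moreover have "Z \<inter> ball 0 ep = ball 0 ep" if "{..<length d} = {}" using that by (auto simp: Z_def)
 ultimately show "closedin (top_of_set (ball 0 ep)) (Z \<inter> ball 0 ep)"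
  by (cases "{..<length d} = {}") (simp_all only: simp_thms closedin_subtopology_refl topspace_euclidean subset_UNIV)
qed

text \<open>Two points of the fibre are in the tangent cone, and their difference would be a common zero of
 the initial forms on which the variables outside \<open>X\<close> vanish.\<close>

lemma singular_Z:
 assumes "i0 < length d" "2 \<le> d ! i0"
 shows "singular_point Z 0"
proof (rule ccontr)
 assume "\<not> singular_point Z 0"
 then have sub: "subspace (tcone Z 0)" by (rule nonsingular_imp_subspace)
 have "2 \<le> (\<Prod>i<length d. d ! i)"
 proof -
  have "d ! i0 dvd (\<Prod>i<length d. d ! i)" using assms(1) by (intro dvd_prodI) auto
  moreover have "0 < (\<Prod>i<length d. d ! i)" using d_pos by (intro prod_pos) (auto simp: Suc_le_eq)
  ultimately show ?thesis using assms(2) dvd_imp_le order_trans by blast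
 qed
 then have "\<not> card (fib c) \<le> Suc 0" using many by linarith
 then obtain z1 z2 where z: "z1 \<in> fib c" "z2 \<in> fib c" "z1 ~= z2" using card_le_Suc0_iff_eq[OF fin] by blast
 have cone: "z \<in> tcone Z 0" if z: "z \<in> fib c" for z
 proof -
  have "z $ j0 = 1" using z j0_X by (simp add: fib_def)
  then have nz: "z ~= 0" by auto
  let ?u = "(1 / norm z) *\<^sub>R z"
  have nu: "norm ?u = 1" using nz by simp
  have b: "(0, ?u) \<in> box2 ep" using R nu by (intro sphere_box) auto
  have "hform c i (d ! i) ?u = 0" if "i < length d" for i
   using z that unfolding scaleR_eq_scalar_mult hform_scale by (simp add: fib_def)
  then have "(0, ?u) \<in> M" using b nu by (simp add: M_iff G_zero)
  from subspace_scale[OF sub boundary_in_tcone_X[OF this], of "norm z"] show ?thesis using nz by simp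
 qed
 define y where "y = z1 - z2"
 have y: "y ~= 0" "y \<in> tcone Z 0" using z(3) subspace_diff[OF sub cone[OF z(1)] cone[OF z(2)]] by (auto simp: y_def)
 have off: "\<forall>m. m \<notin> X --> y $ m = 0" using z by (auto simp: y_def fib_def)
 have yM: "(0, (1 / norm y) *\<^sub>R y) \<in> M" by (rule tcone_X_subset[OF y(2,1)])
 have "hform c i (d ! i) y = 0" if i: "i < length d" for i
 proof -
  have "hform c i (d ! i) ((1 / norm y) *\<^sub>R y) = 0" using yM i by (simp add: M_iff G_zero)
  then show ?thesis using y(1) unfolding scaleR_eq_scalar_mult hform_scale by simp
 qed
 then have "y = 0" using reducible_no_zero[OF red] off unfolding no_zero_at_infinity_def by blast
 then show False using y(1) by simp
qed

text \<open>The independence at the boundary of the blow-up persists nearby, and passes to the \<open>f i\<close>.\<close>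

lemma wedge_nonzero:
 assumes fs: "length fs = length d" "!!i. i < length d ==> fs ! i = f i"
 shows "\<forall>\<^sub>F x in at 0 within Z. wedge (map (%g. FD g (at x)) fs) ~= (%v. 0)"
proof -
 define good where "good x \<longleftrightarrow> x \<in> box2 ep & (\<forall>w\<in>Q. \<exists>v. FD q (at x) (0, v) = w)" for x
 have "\<exists>V. open V & x \<in> V & (\<forall>y\<in>V. good y)" if x: "x \<in> M" "fst x = 0" for x
 proof -
  obtain u where u: "x = (0, u)" using x(2) by (cases x) auto
  have b: "(0, u) \<in> box2 ep" using x(1) M_iff unfolding u by blast
  have xM: "(0, u) \<in> M" using x(1) unfolding u .
  have "\<exists>V. open V & (0, u) \<in> V & V \<subseteq> box2 ep & (\<forall>x\<in>V. \<forall>w\<in>Q. \<exists>v. FD q (at x) (0, v) = w)"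
  proof (rule submersion_straight(2)[OF open_box2 b])
   show "Ck_on k (box2 ep) q" for k by (rule Ck_q)
   show "q x \<in> Q" for x by (rule q_in_Q)
   show "range (%v. FD q (at (0, u)) (0, v)) = Q" by (rule q_surj[OF xM])
  qed
  then obtain V where V: "open V" "(0, u) \<in> V" "V \<subseteq> box2 ep" "\<forall>x\<in>V. \<forall>w\<in>Q. \<exists>v. FD q (at x) (0, v) = w"
   by (elim exE conjE) (rule that; assumption)
  have "\<forall>y\<in>V. good y"
  proof
   fix y assume y: "y \<in> V"
   show "good y" unfolding good_def using subsetD[OF V(3) y] bspec[OF V(4) y] by simp
  qed
  then show ?thesis using V(1,2) unfolding u by (intro exI[of _ V] conjI)
 qed
 note nb = this
 define N where "N = \<Union>{V. open V & (\<forall>y\<in>V. good y)}"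
 have cov: "x \<in> N" if "x \<in> M" "fst x = 0" for x using nb[OF that] unfolding N_def by blast
 have op: "open N" unfolding N_def by (rule open_Union) simp
 obtain r where r: "0 < r" "r \<le> R / 4" "!!x. x \<in> M ==> 0 \<le> fst x ==> fst x < r ==> x \<in> N"
  using cover_near_zero[OF op cov] by metis
 have "wedge (map (%g. FD g (at x)) fs) ~= (%v. 0)" if x: "x \<in> Z" "x ~= 0" "norm x < r" for x
 proof -
  define t where "t = norm x"
  define u where "u = (1 / t) *\<^sub>R x"
  have t: "0 < t" "t < r" "t < ep" and u: "norm u = 1" and xtu: "x = t *\<^sub>R u" using x r(2) R by (auto simp: t_def u_def)
  have tuM: "(t, u) \<in> M" using polar_Z[of t u] t u x(1) xtu r(2) by simp
  then have good: "good (t, u)" using r(3)[of "(t, u)"] t by (auto simp: N_def)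
  then have b: "(t, u) \<in> box2 ep" by (simp add: good_def)
  have "\<exists>v. FD q (at (t, u)) (0, v) = (axis (\<iota> j) 1, 0)" if "j < length d" for j
  proof -
   have "(axis (\<iota> j) 1, 0) \<in> Q" using \<iota>_in_X[OF that] by (auto simp: Q_def axis_def)
   then show ?thesis using good by (simp add: good_def)
  qed
  then obtain v where v: "!!j. j < length d ==> FD q (at (t, u)) (0, v j) = (axis (\<iota> j) 1, 0)" by metis
  have DG: "FD (G i) (at (t, u)) (0, v j) = (if i = j then 1 else 0)" if ij: "i < length d" "j < length d" for i j
  proof -
   have "(\<chi> r. if r \<in> X then FD (G (pos r)) (at (t, u)) (0, v j) else 0) = axis (\<iota> j) 1"
    using v[OF ij(2)] unfolding q_derivative[OF b] by simp
   from arg_cong[OF this, of "%w. w $ \<iota> i"] show ?thesis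
    using ij \<iota>_in_X[OF ij(1)] inj_onD[OF inj_\<iota>, of i j] by (auto simp: axis_def)
  qed
  have Df: "FD (f i) (at x) (t *\<^sub>R h) = of_real t ^ (d ! i) * FD (G i) (at (t, u)) (0, h)"
   if i: "i < length d" for i h
  proof -
   have "x \<in> ball 0 ep" using t by (simp add: t_def)
   from Ck_on_has_derivative[OF Ck_f[OF i] open_ball this]
   have "(f i has_derivative FD (f i) (at x)) (at (t *\<^sub>R u))" by (simp only: xtu)
   moreover have "((%u. t *\<^sub>R u) has_derivative (%h. t *\<^sub>R h)) (at u)"
    by (rule bounded_linear_imp_has_derivative[OF bounded_linear_scaleR_right])
   ultimately have D1: "((%u. f i (t *\<^sub>R u)) has_derivative (%h. FD (f i) (at x) (t *\<^sub>R h))) (at u)"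
    using has_derivative_compose by blast
   have "((%u. G i (t, u)) has_derivative (%h. FD (G i) (at (t, u)) (0, h))) (at u)"
    by (rule partial_derivative[OF Ck_on_has_derivative[OF Ck_G[OF i] open_box2 b]])
   then have "((%u. of_real t ^ (d ! i) * G i (t, u)) has_derivative
     (%h. of_real t ^ (d ! i) * FD (G i) (at (t, u)) (0, h))) (at u)"
    by (rule has_derivative_mult_right)
   moreover have "open {u. (t, u) \<in> (box2 ep :: (real \<times> (complex^'n)) set)}"
    using open_vimage[OF open_box2, of "%u. (t, u)"] by (simp add: vimage_def continuous_intros)
   ultimately have "((%u. f i (t *\<^sub>R u)) has_derivative
     (%h. of_real t ^ (d ! i) * FD (G i) (at (t, u)) (0, h))) (at u)"
    by (rule has_derivative_transform_within_open) (use b in \<open>auto simp: f_G[OF i]\<close>)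
   from has_derivative_unique[OF D1 this] show ?thesis by (rule fun_cong)
  qed
  have "wedge (map (%g. FD g (at x)) fs) (%j. t *\<^sub>R v j) ~= 0"
  proof (rule wedge_dual_nonzero)
   fix i j assume "i < length (map (%g. FD g (at x)) fs)" "j < length (map (%g. FD g (at x)) fs)"
   then have ij: "i < length d" "j < length d" using fs(1) by auto
   show "(map (%g. FD g (at x)) fs ! i) (t *\<^sub>R v j) = (if i = j then of_real t ^ (d ! i) else 0)"
    using ij fs by (simp add: Df DG)
  qed (use t in simp)
  then show ?thesis by auto
 qed
 then show ?thesis unfolding eventually_at using r(1) by (intro exI[of _ r]) (auto simp: dist_norm)
qed

lemma icis_Z:
 assumes fs: "length fs = length d" "!!i. i < length d ==> fs ! i = f i"
 shows "icis_germ (length d) Z"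
 unfolding icis_germ_def
proof (intro exI[of _ fs] conjI)
 show "length fs = length d" by (rule fs(1))
 have set: "set fs = f ` {..<length d}" using fs by (auto simp: set_conv_nth image_iff) metis
 have "power_series_at_0 (a i) (f i)" if i: "i < length d" for i
  unfolding power_series_at_0_def eventually_nhds_metric
 proof (intro exI[of _ R] conjI allI impI R)
  fix z :: "complex^'n" assume "dist z 0 < R"
  then have "cmod (z $ m) \<le> R" for m using component_le_norm[of z m] by simp
  from f_sum[OF i this] show "((%al. a i al * monom_eval (($) z) al) has_sum f i z) UNIV" by (simp add: monom_eval_eq_zmon)
 qed
 then show "set fs \<subseteq> max_ideal" using zero_in_Z unfolding set by (auto simp: max_ideal_def analytic_germs_def Z_def)
 show "vanishing_ideal Z = germ_ideal (set fs)" unfolding set by (rule ideal_of_zero_set)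
 show "\<forall>\<^sub>F x in at 0 within Z. wedge (map (%g. FD g (at x)) fs) ~= (%v. 0)"
  by (rule wedge_nonzero[OF fs])
qed

end

section \<open>Generic complete intersection germs\<close>

context elimination
begin

text \<open>The three generic conditions together.\<close>

lemma generic_coefficients:
 "\<exists>\<phi>. polyon (idx d) \<phi> & (\<exists>v. \<phi> v ~= 0) & (\<forall>c. \<phi> c ~= 0 -->
  reducible c & finite (fib c) & (\<Prod>i<length d. d ! i) \<le> card (fib c) & simple_fibre c &
  (\<forall>x l. x ~= 0 & (\<forall>i<length d. hform c i (d ! i) x = 0) &
   (\<forall>m. (\<Sum>i<length d. l i * dform c i (d ! i) m x) = 0) --> (\<forall>i<length d. l i = 0)))"
proof -
 obtain \<phi>1 where 1: "polyon (idx d) \<phi>1" "\<exists>v. \<phi>1 v ~= 0" "!!c. \<phi>1 c ~= 0 ==> reducible c"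
  using generic_reduction unfolding reducible_def by blast
 obtain \<phi>2 where 2: "polyon (idx d) \<phi>2" "\<exists>v. \<phi>2 v ~= 0" and 22: "\<forall>c x l. \<phi>2 c ~= 0 & x $ j0 = 1 & (\<forall>m. m \<notin> insert j0 X --> x $ m = 0) &
   (\<forall>i<length d. hform c i (d ! i) x = 0) & (\<forall>m\<in>insert j0 X - {j0}. (\<Sum>i<length d. l i * dform c i (d ! i) m x) = 0) --> (\<forall>i<length d. l i = 0)"
  using generic_independent_at[of j0 "insert j0 X" d] d_pos by auto
 have simple: "simple_fibre c" if nz: "\<phi>2 c ~= 0" for c
  unfolding simple_fibre_def
 proof (intro ballI allI impI)
  fix z l i assume z: "z \<in> fib c" and l: "\<forall>m\<in>X. (\<Sum>i<length d. l i * dform c i (d ! i) m z) = 0" and i: "i < length d"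
  have "z $ j0 = 1 & (\<forall>m. m \<notin> insert j0 X --> z $ m = 0) & (\<forall>i<length d. hform c i (d ! i) z = 0)"
   using z j0_X by (simp add: fib_def)
  moreover note spec[OF spec[OF spec[OF 22, where x = c], where x = z], where x = l]
  ultimately have "\<forall>i<length d. l i = 0" using nz l by simp
  then show "l i = 0" using i by blast
 qed
 obtain \<phi>3 where 3: "polyon (idx d) \<phi>3" "\<exists>v. \<phi>3 v ~= 0" "\<forall>c (x :: complex^'n) l. \<phi>3 c ~= 0 & x ~= 0 & (\<forall>i<length d. hform c i (d ! i) x = 0) &
    (\<forall>m. (\<Sum>i<length d. l i * dform c i (d ! i) m x) = 0) --> (\<forall>i<length d. l i = 0)"
  using generic_independent[of d] d_pos by auto
 define \<phi> where "\<phi> v = \<phi>1 v * (\<phi>2 v * \<phi>3 v)" for v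
 have p23: "polyon (idx d) (%v. \<phi>2 v * \<phi>3 v)" by (rule polyon_mult[OF 2(1) 3(1)])
 have "polyon (idx d) (%v. \<phi>1 v * (\<phi>2 v * \<phi>3 v))" by (rule polyon_mult[OF 1(1) p23])
 then have pol: "polyon (idx d) \<phi>" by (simp only: \<phi>_def[abs_def])
 from 1(2) 2(2) 3(2) obtain v1 v2 v3 where v: "\<phi>1 v1 ~= 0" "\<phi>2 v2 ~= 0" "\<phi>3 v3 ~= 0" by (elim exE)
 obtain u where "\<phi>2 u ~= 0" "\<phi>3 u ~= 0" by (rule polyon_common_nonzero[where \<phi> = \<phi>2 and \<psi> = \<phi>3 and v = v2 and w = v3, OF 2(1) 3(1) v(2,3)])
 then have u: "\<phi>2 u * \<phi>3 u ~= 0" by simp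
 obtain t where "\<phi>1 t ~= 0" "\<phi>2 t * \<phi>3 t ~= 0" by (rule polyon_common_nonzero[where \<phi> = \<phi>1 and \<psi> = "%v. \<phi>2 v * \<phi>3 v" and v = v1 and w = u, OF 1(1) p23 v(1) u])
 then have t: "\<phi> t ~= 0" by (simp add: \<phi>_def)
 have nz: "\<phi>1 c ~= 0" "\<phi>2 c ~= 0" "\<phi>3 c ~= 0" if "\<phi> c ~= 0" for c using that by (simp_all add: \<phi>_def)
 have n1: "no_zero_at_infinity c" and n2: "simple_fibre c" if "\<phi> c ~= 0" for c
  by (rule reducible_no_zero[OF 1(3)[OF nz(1)[OF that]]], rule simple[OF nz(2)[OF that]])
 have all: "reducible c & finite (fib c) & (\<Prod>i<length d. d ! i) \<le> card (fib c) & simple_fibre c &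
  (\<forall>x l. x ~= 0 & (\<forall>i<length d. hform c i (d ! i) x = 0) &
   (\<forall>m. (\<Sum>i<length d. l i * dform c i (d ! i) m x) = 0) --> (\<forall>i<length d. l i = 0))" if c: "\<phi> c ~= 0" for c
 proof (rule conjI[OF 1(3)[OF nz(1)[OF c]]], rule conjI[OF many_points_in_fibre(1)[OF pol c n1 n2]],
   assumption, assumption, rule conjI[OF many_points_in_fibre(2)[OF pol c n1 n2]], assumption, assumption, rule conjI[OF n2[OF c]])
  show "\<forall>x l. x ~= 0 & (\<forall>i<length d. hform c i (d ! i) x = 0) &
   (\<forall>m. (\<Sum>i<length d. l i * dform c i (d ! i) m x) = 0) --> (\<forall>i<length d. l i = 0)"
   using 3(3)[THEN spec, of c] by (simp only: nz(3)[OF c] simp_thms)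
 qed
 show ?thesis by (rule exI[of _ \<phi>], rule conjI[OF pol], rule conjI, rule exI, rule t, rule allI, rule impI, rule all)
qed

lemma generic_complete_intersection:
 assumes cond: "reducible c" "finite (fib c)" "(\<Prod>i<length d. d ! i) \<le> card (fib c)" "simple_fibre c"
   "\<forall>x l. x ~= 0 & (\<forall>i<length d. hform c i (d ! i) x = 0) &
    (\<forall>m. (\<Sum>i<length d. l i * dform c i (d ! i) m x) = 0) --> (\<forall>i<length d. l i = 0)"
  and fs: "length fs = length d" and mult: "!!i. i < length d ==> has_multiplicity (fs ! i) (d ! i)"
  and c: "!!i al. i < length d ==> mdeg al = d ! i ==> taylor_coeff (fs ! i) al = c (i, al)"
 shows "icis_germ (length d) (zero_locus fs)" "conic_point (zero_locus fs)"
  "\<exists>i<length d. 2 \<le> d ! i ==> conic_singular_point (zero_locus fs)"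
  "\<exists>r0>0. \<forall>r. 0 < r & r \<le> r0 --> LNE (zero_locus fs \<inter> {x. norm x \<le> r})"
proof -
 define a where "a i = taylor_coeff (fs ! i)" for i
 have "\<forall>i\<in>{..<length d}. \<exists>\<rho>>0. (%al. cmod (a i al) * \<rho> ^ mdeg al) summable_on UNIV &
   (\<forall>z. (\<forall>m. cmod (z $ m) \<le> \<rho>) --> ((%al. a i al * zmon z al) has_sum (fs ! i) z) UNIV)"
 proof
  fix i assume "i \<in> {..<length d}"
  then have "power_series_at_0 (a i) (fs ! i)" using multiplicity_taylor(1)[OF mult] by (simp add: a_def)
  then show "\<exists>\<rho>>0. (%al. cmod (a i al) * \<rho> ^ mdeg al) summable_on UNIV &
   (\<forall>z. (\<forall>m. cmod (z $ m) \<le> \<rho>) --> ((%al. a i al * zmon z al) has_sum (fs ! i) z) UNIV)"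
   by (rule power_series_radius)
 qed
 then obtain \<rho> where \<rho>: "\<forall>i\<in>{..<length d}. \<rho> i > 0 & (%al. cmod (a i al) * \<rho> i ^ mdeg al) summable_on UNIV &
   (\<forall>z. (\<forall>m. cmod (z $ m) \<le> \<rho> i) --> ((%al. a i al * zmon z al) has_sum (fs ! i) z) UNIV)"
  by (rule bchoice[THEN exE])
 define R where "R = Min (insert 1 (\<rho> ` {..<length d}))"
 have R: "0 < R" "!!i. i < length d ==> R \<le> \<rho> i" unfolding R_def using \<rho> by auto
 interpret generic_equations d \<iota> j0 a c "(!) fs" R
 proof
  show "0 < R" by (rule R(1))
  fix i assume i: "i < length d"
  have s: "(%al. cmod (a i al) * \<rho> i ^ mdeg al) summable_on UNIV" using \<rho> i by blast
  show "(%al. cmod (a i al) * R ^ mdeg al) summable_on UNIV"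
   using s by (rule summable_on_comparison_test) (use R(1) R(2)[OF i] in \<open>auto intro!: mult_left_mono power_mono\<close>)
  show "order_ge (int (d ! i)) (a i)" using multiplicity_taylor(2)[OF mult[OF i]] by (simp add: a_def)
  show "((%al. a i al * zmon z al) has_sum (fs ! i) z) UNIV" if "!!m. cmod (z $ m) \<le> R" for z
  proof -
   have "\<forall>m. cmod (z $ m) \<le> \<rho> i" using that R(2)[OF i] by (meson order_trans)
   then show ?thesis using \<rho> i by simp
  qed
  show "a i al = c (i, al)" if "mdeg al = d ! i" for al using c[OF i that] by (simp add: a_def)
 next
  show "reducible c" "finite (fib c)" "(\<Prod>i<length d. d ! i) \<le> card (fib c)" "simple_fibre c" by (rule cond)+
  show "\<forall>i<length d. l i = 0" if "x ~= 0" "\<forall>i<length d. hform c i (d ! i) x = 0"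
   "\<forall>m. (\<Sum>i<length d. l i * dform c i (d ! i) m x) = 0" for x l
   using cond(5) that by blast
 qed
 have Z: "zero_locus fs = Z" by (simp add: zero_locus_def Z_def all_set_conv_all_nth fs)
 show "icis_germ (length d) (zero_locus fs)" unfolding Z by (rule icis_Z[OF fs refl])
 show "conic_point (zero_locus fs)" unfolding Z by (rule conic_Z)
 show "conic_singular_point (zero_locus fs)" if "\<exists>i<length d. 2 \<le> d ! i"
  unfolding Z conic_singular_point_def using that conic_Z singular_Z by blast
 show "\<exists>r0>0. \<forall>r. 0 < r & r \<le> r0 --> LNE (zero_locus fs \<inter> {x. norm x \<le> r})" unfolding Z by (rule LNE_X)
qed

end

theorem proposition7p1:
  fixes p :: nat and d :: "nat list"
  assumes "1 \<le> p" and "p < CARD('n::finite)"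
    and "length d = p" and "sorted_wrt (\<ge>) d" and "\<forall>k\<in>set d. 1 \<le> k"
  shows "\<exists>U :: ('n, complex) mpoly list set.
    openin (zariski_topology d) U \<and> zariski_topology d closure_of U = hom_tuples d \<and>
    (\<forall>f :: (complex^'n \<Rightarrow> complex) list.
       f \<in> max_ideal_tuples d \<and> (\<forall>i<p. has_multiplicity (f ! i) (d ! i)) \<and>
       map initial_form f \<in> U \<longrightarrow>
         icis_germ p (zero_locus f) \<and>
         conic_point (zero_locus f) \<and>
         ((\<exists>i<p. 2 \<le> d ! i) \<longrightarrow> conic_singular_point (zero_locus f)) \<and>
         (\<exists>r\<^sub>f>0. \<forall>r. 0 < r \<and> r \<le> r\<^sub>f \<longrightarrow> LNE (zero_locus f \<inter> {x. norm x \<le> r})))"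
proof -
 obtain \<iota> where \<iota>: "bij_betw \<iota> {0..<CARD('n)} (UNIV :: 'n set)" using ex_bij_betw_nat_finite[of "UNIV :: 'n set"] by auto
 then have inj: "inj_on \<iota> {0..<CARD('n)}" by (rule bij_betw_imp_inj_on)
 interpret elimination d \<iota> "\<iota> p"
 proof
  show "inj_on \<iota> {..<length d}" using inj by (rule inj_on_subset) (use assms(2,3) in auto)
  show "\<iota> p \<notin> \<iota> ` {..<length d}"
  proof
   assume "\<iota> p \<in> \<iota> ` {..<length d}"
   then obtain i where "i < p" "\<iota> p = \<iota> i" using assms(3) by auto
   then show False using inj_onD[OF inj, of p i] assms(2) by auto
  qed
  show "1 \<le> d ! i" if "i < length d" for i using assms(5) that by auto
 qed
 obtain \<phi> where \<phi>: "polyon (idx d :: (nat \<times> ('n mon)) set) \<phi>" "\<exists>v. \<phi> v ~= 0"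
  and gen: "!!c. \<phi> c ~= 0 ==> reducible c & finite (fib c) & (\<Prod>i<length d. d ! i) \<le> card (fib c) & simple_fibre c &
  (\<forall>x l. x ~= 0 & (\<forall>i<length d. hform c i (d ! i) x = 0) &
   (\<forall>m. (\<Sum>i<length d. l i * dform c i (d ! i) m x) = 0) --> (\<forall>i<length d. l i = 0))"
  using generic_coefficients by blast
 obtain v where v: "\<phi> v ~= 0" using \<phi>(2) by blast
 define U where "U = {F \<in> hom_tuples d. \<phi> (coeff_coords F) ~= 0}"
 note U = zariski_open_dense[OF \<phi>(1) v, folded U_def]
 have main: "icis_germ p (zero_locus f) & conic_point (zero_locus f) &
     ((\<exists>i<p. 2 \<le> d ! i) --> conic_singular_point (zero_locus f)) &
     (\<exists>r\<^sub>f>0. \<forall>r. 0 < r & r \<le> r\<^sub>f --> LNE (zero_locus f \<inter> {x. norm x \<le> r}))"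
  if f: "f \<in> max_ideal_tuples d" "\<forall>i<p. has_multiplicity (f ! i) (d ! i)" "map initial_form f \<in> U" for f
 proof -
  define c where "c = coeff_coords (map initial_form f)"
  have len: "length f = length d" using f(1) by (simp add: max_ideal_tuples_def)
  have mult: "has_multiplicity (f ! i) (d ! i)" if "i < length d" for i using f(2) that assms(3) by simp
  have c: "taylor_coeff (f ! i) al = c (i, al)" if "i < length d" "mdeg al = d ! i" for i al
   using that len by (simp add: c_def coeff_coords_def multiplicity_taylor(3)[OF mult] lookup_hom_component)
  have "\<phi> c ~= 0" using f(3) by (simp add: U_def c_def)
  from gen[OF this] have cond: "reducible c" "finite (fib c)" "(\<Prod>i<length d. d ! i) \<le> card (fib c)" "simple_fibre c"
   "\<forall>x l. x ~= 0 & (\<forall>i<length d. hform c i (d ! i) x = 0) &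
    (\<forall>m. (\<Sum>i<length d. l i * dform c i (d ! i) m x) = 0) --> (\<forall>i<length d. l i = 0)" by blast+
  show ?thesis using generic_complete_intersection[OF cond len mult c] assms(3) by blast
 qed
 show ?thesis using U main by (intro exI[of _ U]) blast
qed

end
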